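(* For every prime $p$ and every $1\le n\leq 5$ one has $\Upsilon_n(\hat{G}_* )\cong\mathbb{Z}_p^{l_2(n)}$. Moreover: (1) If $p\neq 2$, then $\Upsilon_6(\hat{G}_* )\cong\mathbb{Z}_p^{6}$, and in general, for $n\geq 2$, $\Upsilon_n(\hat{G}_* )\cong\mathbb{Z}_p^{m(n)}$, where $m(n)=n(n+2)/8$ if $n$ is even and $m(n)=(n-1)(n+1)/4$ if $n$ is odd. (2) If $p=2$, then $\Upsilon_6(\hat{G}_* )$ is an abelian pro-$2$ group whose minimal number of (topological) generators is at least $l_2(6)=9$.
   Context: Let $p$ be a prime and let $\Pi_*=\mathbb{Z}_p[[x_{i,j},y_{i,j}\mid 1\le i,j\le 2]]$ be the ring of formal power series in $8$ commuting variables over the $p$-adic integers $\mathbb{Z}_p$. Let $Q_{*n}$ be the ideal of power series having no nonzero homogeneous terms of degree less than $n$. The ideals $Q_{*n}+p^m\Pi_*$ are a basis of neighborhoods of zero of the profinite topology of $\Pi_*$, and $M_2(\Pi_* )$ has the induced profinite topology. Write $M_2(\Pi_*,Q_{*1})=\ker(M_2(\Pi_* )\to M_2(\Pi_*/Q_{*1}))$; then $1+M_2(\Pi_*,Q_{*1})$ is a pro-$p$ group. Let $x_*=(x_{i,j})_{i,j=1}^2$ and $y_*=(y_{i,j})_{i,j=1}^2$ be the generic matrices, and let $\hat{G}_*$ be the closure in $1+M_2(\Pi_*,Q_{*1})$ of the subgroup generated by $1+x_*$ and $1+y_*$. For a pro-$p$ group $\hat{H}$, let $\hat{H}=\hat{H}_1,\hat{H}_2,\hat{H}_3,\dots$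 be its (closed) lower central series and $\Upsilon_n(\hat{H})=\hat{H}_n/\hat{H}_{n+1}$. Finally $l_2(n)=\frac1n\sum_{m\mid n}\mu(m)\,2^{n/m}$, where $\mu$ is the Möbius function. *)

theory Defs
  imports
    "HOL-Analysis.Analysis"
    "HOL-Algebra.QuotRing"
    "HOL-Algebra.Generated_Groups"
    "HOL-Algebra.Product_Groups"
    "HOL-Computational_Algebra.Squarefree"
    "HOL-Library.Multiset"
    "HOL-Library.Numeral_Type"
    "HOL-Library.Extended_Nat"
begin

section \<open>Topological groups and pro-p groups\<close>

text \<open>
  A topological group is given by a group \<open>G\<close> together with a topology \<open>T\<close> on \<open>carrier G\<close>.
\<close>

definition topological_group :: "('a, 'm) monoid_scheme \<Rightarrow> 'a topology \<Rightarrow> bool" where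
  "topological_group G T \<longleftrightarrow>
     group G \<and> topspace T = carrier G \<and>
     continuous_map (prod_topology T T) T (\<lambda>(x, y). x \<otimes>\<^bsub>G\<^esub> y) \<and>
     continuous_map T T (\<lambda>x. inv\<^bsub>G\<^esub> x)"

definition profinite_group :: "('a, 'm) monoid_scheme \<Rightarrow> 'a topology \<Rightarrow> bool" where
  "profinite_group G T \<longleftrightarrow>
     topological_group G T \<and> compact_space T \<and> Hausdorff_space T \<and>
     (\<forall>U. openin T U \<and> \<one>\<^bsub>G\<^esub> \<in> U \<longrightarrow> (\<exists>H. subgroup H G \<and> openin T H \<and> H \<subseteq> U))"

definition pro_p_group :: "nat \<Rightarrow> ('a, 'm) monoid_scheme \<Rightarrow> 'a topology \<Rightarrow> bool" where
  "pro_p_group p G T \<longleftrightarrow>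
     profinite_group G T \<and>
     (\<forall>N. N \<lhd> G \<and> openin T N \<longrightarrow> (\<exists>k. card (rcosets\<^bsub>G\<^esub> N) = p ^ k))"

definition top_group_iso ::
  "('a, 'm) monoid_scheme \<Rightarrow> 'a topology \<Rightarrow> ('b, 'n) monoid_scheme \<Rightarrow> 'b topology \<Rightarrow> bool" where
  "top_group_iso G T H S \<longleftrightarrow> (\<exists>f \<in> iso G H. homeomorphic_map T S f)"

definition topologically_generates ::
  "('a, 'm) monoid_scheme \<Rightarrow> 'a topology \<Rightarrow> 'a set \<Rightarrow> bool" where
  "topologically_generates G T S \<longleftrightarrow>
     S \<subseteq> carrier G \<and> T closure_of (generate G S) = carrier G"

text \<open>
  The minimal number of topological generators; it is \<open>\<infinity>\<close> if there is no finite
  topologically generating set.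
\<close>

definition min_generators :: "('a, 'm) monoid_scheme \<Rightarrow> 'a topology \<Rightarrow> enat" where
  "min_generators G T = (INF S \<in> {S. finite S \<and> topologically_generates G T S}. enat (card S))"

definition commutator_subgroup ::
  "('a, 'm) monoid_scheme \<Rightarrow> 'a set \<Rightarrow> 'a set \<Rightarrow> 'a set" where
  "commutator_subgroup G H K =
     generate G {h \<otimes>\<^bsub>G\<^esub> k \<otimes>\<^bsub>G\<^esub> inv\<^bsub>G\<^esub> h \<otimes>\<^bsub>G\<^esub> inv\<^bsub>G\<^esub> k | h k. h \<in> H \<and> k \<in> K}"

text \<open>
  The closed lower central series, indexed from 1; the value at 0 is a dummy.
\<close>

fun closed_lcs :: "('a, 'm) monoid_scheme \<Rightarrow> 'a topology \<Rightarrow> nat \<Rightarrow> 'a set" where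
  "closed_lcs G T 0 = carrier G"
| "closed_lcs G T (Suc 0) = carrier G"
| "closed_lcs G T (Suc (Suc n)) =
     T closure_of (commutator_subgroup G (closed_lcs G T (Suc n)) (carrier G))"

definition quotient_topology :: "'a topology \<Rightarrow> ('a \<Rightarrow> 'b) \<Rightarrow> 'b topology" where
  "quotient_topology T f =
     topology (\<lambda>U. U \<subseteq> f ` topspace T \<and> openin T {x \<in> topspace T. f x \<in> U})"

lemma openin_quotient_topology:
  "openin (quotient_topology T f) U \<longleftrightarrow>
     U \<subseteq> f ` topspace T \<and> openin T {x \<in> topspace T. f x \<in> U}"
proof -
  have "istopology (\<lambda>U. U \<subseteq> f ` topspace T \<and> openin T {x \<in> topspace T. f x \<in> U})"
    unfolding istopology_def
  proof (intro conjI allI impI)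
    fix S U
    assume S: "S \<subseteq> f ` topspace T \<and> openin T {x \<in> topspace T. f x \<in> S}"
      and U: "U \<subseteq> f ` topspace T \<and> openin T {x \<in> topspace T. f x \<in> U}"
    have "{x \<in> topspace T. f x \<in> S \<inter> U} =
        {x \<in> topspace T. f x \<in> S} \<inter> {x \<in> topspace T. f x \<in> U}" by auto
    with S U show "openin T {x \<in> topspace T. f x \<in> S \<inter> U}" by (simp add: openin_Int)
    from S show "S \<inter> U \<subseteq> f ` topspace T" by auto
  next
    fix K
    assume K: "\<forall>S\<in>K. S \<subseteq> f ` topspace T \<and> openin T {x \<in> topspace T. f x \<in> S}"
    have "{x \<in> topspace T. f x \<in> \<Union>K} = (\<Union>S\<in>K. {x \<in> topspace T. f x \<in> S})" by auto
    with K show "openin T {x \<in> topspace T. f x \<in> \<Union>K}" by auto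
    from K show "\<Union>K \<subseteq> f ` topspace T" by blast
  qed
  then show ?thesis by (simp add: quotient_topology_def)
qed

definition Upsilon :: "('a, 'm) monoid_scheme \<Rightarrow> 'a topology \<Rightarrow> nat \<Rightarrow> 'a set monoid" where
  "Upsilon G T n = (G\<lparr>carrier := closed_lcs G T n\<rparr>) Mod (closed_lcs G T (Suc n))"

definition Upsilon_top :: "('a, 'm) monoid_scheme \<Rightarrow> 'a topology \<Rightarrow> nat \<Rightarrow> 'a set topology" where
  "Upsilon_top G T n =
     quotient_topology (subtopology T (closed_lcs G T n)) (\<lambda>x. closed_lcs G T (Suc n) #>\<^bsub>G\<^esub> x)"

text \<open>
  The topology on an additive group for which the family \<open>B\<close> of subgroups, directed downwards,
  is a basis of neighbourhoods of zero.
\<close>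

definition subgroup_topology :: "('a, 'm) ring_scheme \<Rightarrow> 'a set set \<Rightarrow> 'a topology" where
  "subgroup_topology R B = topology_generated_by (\<Union>N\<in>B. a_rcosets\<^bsub>R\<^esub> N)"

definition multiples :: "('a, 'm) ring_scheme \<Rightarrow> nat \<Rightarrow> 'a set" where
  "multiples R k = (\<lambda>a. [k] \<cdot>\<^bsub>R\<^esub> a) ` carrier R"


section \<open>The p-adic integers\<close>

text \<open>
  The inverse limit of the rings \<open>\<int>/p\<^sup>n\<int>\<close>: the \<open>n\<close>-th component of an element is its residue
  modulo \<open>p\<^sup>n\<close>, represented in \<open>{0..<p\<^sup>n}\<close>.
\<close>

definition padic_int :: "nat \<Rightarrow> (nat \<Rightarrow> int) ring" where
  "padic_int p =
     \<lparr>carrier = {a. \<forall>n. a n \<in> {0..<int p ^ n} \<and> a (Suc n) mod int p ^ n = a n},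
      mult = (\<lambda>a b n. (a n * b n) mod int p ^ n),
      one = (\<lambda>n. 1 mod int p ^ n),
      zero = (\<lambda>n. 0),
      add = (\<lambda>a b n. (a n + b n) mod int p ^ n)\<rparr>"

definition padic_top :: "nat \<Rightarrow> (nat \<Rightarrow> int) topology" where
  "padic_top p = subgroup_topology (padic_int p) (range (\<lambda>m. multiples (padic_int p) (p ^ m)))"

lemma padic_int_cring:
  assumes "p > 0"
  shows "cring (padic_int p)"
proof -
  have mm: "x mod int p ^ Suc n mod int p ^ n = x mod int p ^ n" for x :: int and n
    by (simp add: mod_mod_cancel)
  have pos: "int p ^ n > 0" for n using assms by simp
  show ?thesis
  proof (intro cringI abelian_groupI comm_monoidI)
    fix x y assume x: "x \<in> carrier (padic_int p)" and y: "y \<in> carrier (padic_int p)"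
    have *: "x (Suc n) mod int p ^ n = x n" "y (Suc n) mod int p ^ n = y n" for n
      using x y by (auto simp: padic_int_def)
    have "(x (Suc n) + y (Suc n)) mod int p ^ Suc n mod int p ^ n = (x n + y n) mod int p ^ n" for n
      unfolding mm by (metis * mod_add_eq)
    then show "x \<oplus>\<^bsub>padic_int p\<^esub> y \<in> carrier (padic_int p)"
      using pos by (auto simp: padic_int_def)
    have "(x (Suc n) * y (Suc n)) mod int p ^ Suc n mod int p ^ n = (x n * y n) mod int p ^ n" for n
      unfolding mm by (metis * mod_mult_eq)
    then show "x \<otimes>\<^bsub>padic_int p\<^esub> y \<in> carrier (padic_int p)"
      using pos by (auto simp: padic_int_def)
    let ?z = "\<lambda>n. (- x n) mod int p ^ n"
    have "(- x (Suc n)) mod int p ^ Suc n mod int p ^ n = (- x n) mod int p ^ n" for n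
      unfolding mm by (metis * mod_minus_eq)
    then have "?z \<in> carrier (padic_int p)" using pos by (auto simp: padic_int_def)
    moreover have "?z \<oplus>\<^bsub>padic_int p\<^esub> x = \<zero>\<^bsub>padic_int p\<^esub>"
      by (auto simp: padic_int_def mod_add_left_eq)
    ultimately show "\<exists>z\<in>carrier (padic_int p). z \<oplus>\<^bsub>padic_int p\<^esub> x = \<zero>\<^bsub>padic_int p\<^esub>" by blast
  next
    show "\<one>\<^bsub>padic_int p\<^esub> \<in> carrier (padic_int p)"
      using pos by (auto simp: padic_int_def mm[simplified])
  qed (use assms in \<open>auto simp: padic_int_def mod_add_left_eq mod_add_right_eq mod_mult_left_eq
        mod_mult_right_eq algebra_simps mod_add_eq fun_eq_iff\<close>)
qed

definition padic_power :: "nat \<Rightarrow> nat \<Rightarrow> (nat \<Rightarrow> nat \<Rightarrow> int) monoid" where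
  "padic_power p d = product_group {..<d} (\<lambda>_. add_monoid (padic_int p))"

definition padic_power_top :: "nat \<Rightarrow> nat \<Rightarrow> (nat \<Rightarrow> nat \<Rightarrow> int) topology" where
  "padic_power_top p d = product_topology (\<lambda>_. padic_top p) {..<d}"


section \<open>Power series and matrices over a ring\<close>

text \<open>
  Formal power series over \<open>R\<close> in commuting variables indexed by the type \<open>'v\<close>: monomials are
  finite multisets of variables, and a power series is the function giving its coefficients.
\<close>

definition power_series_ring :: "('a, 'm) ring_scheme \<Rightarrow> ('v multiset \<Rightarrow> 'a) ring" where
  "power_series_ring R =
     \<lparr>carrier = {f. \<forall>m. f m \<in> carrier R},
      mult = (\<lambda>f g m. finsum R (\<lambda>k. f k \<otimes>\<^bsub>R\<^esub> g (m - k)) {k. k \<subseteq># m}),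
      one = (\<lambda>m. if m = {#} then \<one>\<^bsub>R\<^esub> else \<zero>\<^bsub>R\<^esub>),
      zero = (\<lambda>m. \<zero>\<^bsub>R\<^esub>),
      add = (\<lambda>f g m. f m \<oplus>\<^bsub>R\<^esub> g m)\<rparr>"

definition series_var :: "('a, 'm) ring_scheme \<Rightarrow> 'v \<Rightarrow> 'v multiset \<Rightarrow> 'a" where
  "series_var R v = (\<lambda>m. if m = {#v#} then \<one>\<^bsub>R\<^esub> else \<zero>\<^bsub>R\<^esub>)"

definition matrix_ring :: "('a, 'm) ring_scheme \<Rightarrow> ('n::finite \<Rightarrow> 'n \<Rightarrow> 'a) ring" where
  "matrix_ring R =
     \<lparr>carrier = {A. \<forall>i j. A i j \<in> carrier R},
      mult = (\<lambda>A B i j. finsum R (\<lambda>k. A i k \<otimes>\<^bsub>R\<^esub> B k j) UNIV),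
      one = (\<lambda>i j. if i = j then \<one>\<^bsub>R\<^esub> else \<zero>\<^bsub>R\<^esub>),
      zero = (\<lambda>i j. \<zero>\<^bsub>R\<^esub>),
      add = (\<lambda>A B i j. A i j \<oplus>\<^bsub>R\<^esub> B i j)\<rparr>"


section \<open>The pro-p group generated by two generic matrices\<close>

datatype letter = gen_x | gen_y

text \<open>The variables \<open>x\<^sub>i\<^sub>,\<^sub>j\<close> and \<open>y\<^sub>i\<^sub>,\<^sub>j\<close>; the index type \<open>2\<close> has exactly two elements.\<close>

type_synonym var = "letter \<times> 2 \<times> 2"
type_synonym series = "var multiset \<Rightarrow> nat \<Rightarrow> int"
type_synonym series_matrix = "2 \<Rightarrow> 2 \<Rightarrow> series"

definition Pi_star :: "nat \<Rightarrow> series ring" where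
  "Pi_star p = power_series_ring (padic_int p)"

definition Q_star :: "nat \<Rightarrow> nat \<Rightarrow> series set" where
  "Q_star p n = {f \<in> carrier (Pi_star p). \<forall>m. size m < n \<longrightarrow> f m = \<zero>\<^bsub>padic_int p\<^esub>}"

definition M2 :: "nat \<Rightarrow> series_matrix ring" where
  "M2 p = matrix_ring (Pi_star p)"

definition M2_top :: "nat \<Rightarrow> series_matrix topology" where
  "M2_top p = subgroup_topology (M2 p)
     {{A. \<forall>i j. A i j \<in> Q_star p n <+>\<^bsub>Pi_star p\<^esub> multiples (Pi_star p) (p ^ m)} | n m. True}"

text \<open>\<open>M\<^sub>2(\<Pi>\<^sub>*, Q\<^sub>*\<^sub>1)\<close>, the kernel of \<open>M\<^sub>2(\<Pi>\<^sub>*) \<rightarrow> M\<^sub>2(\<Pi>\<^sub>*/Q\<^sub>*\<^sub>1)\<close>.\<close>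

definition M2_ker :: "nat \<Rightarrow> series_matrix set" where
  "M2_ker p = a_kernel (M2 p) (matrix_ring (Pi_star p Quot Q_star p 1))
     (\<lambda>A i j. Q_star p 1 +>\<^bsub>Pi_star p\<^esub> A i j)"

definition congruence_group :: "nat \<Rightarrow> series_matrix monoid" where
  "congruence_group p =
     \<lparr>carrier = (\<lambda>A. \<one>\<^bsub>M2 p\<^esub> \<oplus>\<^bsub>M2 p\<^esub> A) ` M2_ker p, mult = mult (M2 p), one = \<one>\<^bsub>M2 p\<^esub>\<rparr>"

definition congruence_top :: "nat \<Rightarrow> series_matrix topology" where
  "congruence_top p = subtopology (M2_top p) (carrier (congruence_group p))"

definition generic_matrix :: "nat \<Rightarrow> letter \<Rightarrow> series_matrix" where
  "generic_matrix p c = (\<lambda>i j. series_var (padic_int p) (c, i, j))"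

definition G_hat :: "nat \<Rightarrow> series_matrix monoid" where
  "G_hat p = (congruence_group p)\<lparr>carrier := congruence_top p closure_of
     generate (congruence_group p)
       {\<one>\<^bsub>M2 p\<^esub> \<oplus>\<^bsub>M2 p\<^esub> generic_matrix p gen_x, \<one>\<^bsub>M2 p\<^esub> \<oplus>\<^bsub>M2 p\<^esub> generic_matrix p gen_y}\<rparr>"

definition G_hat_top :: "nat \<Rightarrow> series_matrix topology" where
  "G_hat_top p = subtopology (congruence_top p) (carrier (G_hat p))"


section \<open>The ranks\<close>

definition moebius :: "nat \<Rightarrow> int" where
  "moebius n = (if squarefree n then (-1) ^ card (prime_factors n) else 0)"

text \<open>In the next two definitions the divisions are exact (for \<open>n \<ge> 1\<close>).\<close>

definition l2 :: "nat \<Rightarrow> nat" where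
  "l2 n = nat ((\<Sum>m | m dvd n. moebius m * 2 ^ (n div m)) div int n)"

definition m_rank :: "nat \<Rightarrow> nat" where
  "m_rank n = (if even n then n * (n + 2) div 8 else (n - 1) * (n + 1) div 4)"

end

theory Submission
  imports Defs "HOL-Algebra.Sylow" "HOL-Algebra.Multiplicative_Group"
begin

text \<open>
  With \<open>z = [1 + x, 1 + y]\<close> and the operators \<open>A = ad x ad x\<close>, \<open>B = ad x ad y\<close>, \<open>C = ad y ad y\<close>
  (group commutators with the generators), the even lower central quotients of the discrete group
  generated by \<open>1 + x\<close> and \<open>1 + y\<close> are spanned by the elements \<open>A\<^sup>i B\<^sup>j C\<^sup>l z\<close>, and the odd ones by
  their commutators with the generators. The leading term of \<open>A\<^sup>i B\<^sup>j C\<^sup>l z\<close> is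
  \<open>a\<^sup>i b\<^sup>j c\<^sup>l (x y - y x)\<close>, where \<open>a\<close>, \<open>c\<close> are the discriminants of \<open>x\<close>, \<open>y\<close> and \<open>b\<close> is their
  polarization; these monomials are independent up to a power of 4.
  That \<open>A\<close>, \<open>B\<close>, \<open>C\<close> commute modulo higher terms is, for odd \<open>p\<close>, a consequence of the fact that
  conjugation by \<open>x y - y x\<close> inverts the generators up to determinants, so that even terms
  corrected to be anti-invariant commute with each other. For \<open>p = 2\<close> commutativity fails in degree
  6, where the three elements \<open>[z, A z]\<close>, \<open>[z, B z]\<close>, \<open>[z, C z]\<close> join the six monomials and the
  nine elements are independent modulo squares. All this is done modulo \<open>p\<^sup>k\<close> and modulo degree
  \<open>k\<close> for every \<open>k\<close>, because the quotients of the closed lower central series are the completions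
  of the discrete ones for this filtration.
\<close>

subsection \<open>Power series with integer coefficients\<close>

text \<open>Degrees do not determine weights: elements of \<open>lcs n\<close> have degree at least
  n, but an element of high degree need not lie deep in the series, which is what happens for p = 2
  in weight 6. Relations between A, B, C are therefore derived inside the group by Jacobi
  identities; matrices enter only through conjugation by z and through leading terms, which bound
  the coefficients of a relation. All these matrices have integer coefficients, since p-adic ones
  can be approximated by integral ones to any precision. So one discrete group serves all p, and p
  enters through the normal subgroups \<open>adicV p k\<close>. The factors 2 and 4 lost in the
  independence statements do no harm to the isomorphisms, even for p = 2: a coefficient that is to
  be known modulo p^m is computed at a larger level k. Only the count of generators for p = 2 is a
  question of parity, and there the exact power of 2 matters.\<close>

typedef 'v mps = "UNIV :: ('v multiset \<Rightarrow> int) set" morphisms mcoef Mps by simp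

lemma mcoef_Mps [simp]: "mcoef (Mps f) = f"
  by (simp add: Mps_inverse)

lemma mps_eqI: "(\<And>m. mcoef f m = mcoef g m) \<Longrightarrow> f = g"
  by (metis mcoef_inject ext)

lemma finite_submultisets [simp]: "finite {k. k \<subseteq># m}"
proof (induction m)
  case (add x m)
  have "{k. k \<subseteq># add_mset x m} \<subseteq> {k. k \<subseteq># m} \<union> add_mset x ` {k. k \<subseteq># m}"
  proof
    fix k assume k: "k \<in> {k. k \<subseteq># add_mset x m}"
    show "k \<in> {k. k \<subseteq># m} \<union> add_mset x ` {k. k \<subseteq># m}"
    proof (cases "x \<in># k")
      case True
      then obtain k' where "k = add_mset x k'" by (metis multi_member_split)
      with k show ?thesis by auto
    next
      case False
      with k have "k \<subseteq># m"
        by (metis add_mset_add_single diff_single_trivial mem_Collect_eq subset_eq_diff_conv)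
      then show ?thesis by simp
    qed
  qed
  with add show ?case by (meson finite_UnI finite_imageI finite_subset)
qed simp

instantiation mps :: (type) comm_ring_1
begin

definition "0 = Mps (\<lambda>m. 0)"
definition "1 = Mps (\<lambda>m. if m = {#} then 1 else 0)"
definition "f + g = Mps (\<lambda>m. mcoef f m + mcoef g m)"
definition "- f = Mps (\<lambda>m. - mcoef f m)"
definition "f - g = Mps (\<lambda>m. mcoef f m - mcoef g m)"
definition "f * g = Mps (\<lambda>m. \<Sum>k | k \<subseteq># m. mcoef f k * mcoef g (m - k))"

instance
proof
  fix f g h :: "'a mps"
  show "f * g = g * f"
  proof (rule mps_eqI)
    fix m
    have "(\<Sum>k | k \<subseteq># m. mcoef f k * mcoef g (m - k)) = (\<Sum>k | k \<subseteq># m. mcoef f (m - k) * mcoef g k)"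
      by (rule sum.reindex_bij_witness[of _ "\<lambda>k. m - k" "\<lambda>k. m - k"])
         (auto simp: subset_mset.diff_diff_right)
    then show "mcoef (f * g) m = mcoef (g * f) m"
      by (simp add: times_mps_def mult.commute)
  qed
  show "f * g * h = f * (g * h)"
  proof (rule mps_eqI)
    fix m
    have "mcoef (f * g * h) m =
        (\<Sum>k | k \<subseteq># m. \<Sum>l | l \<subseteq># k. mcoef f l * mcoef g (k - l) * mcoef h (m - k))"
      by (simp add: times_mps_def sum_distrib_right)
    also have "\<dots> = (\<Sum>(k,l)\<in>Sigma {k. k \<subseteq># m} (\<lambda>k. {l. l \<subseteq># k}). mcoef f l * mcoef g (k - l) * mcoef h (m - k))"
      by (rule sum.Sigma) auto
    also have "\<dots> = (\<Sum>(l,k)\<in>Sigma {l. l \<subseteq># m} (\<lambda>l. {k. k \<subseteq># m - l}). mcoef f l * (mcoef g k * mcoef h (m - l - k)))"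
    proof (rule sum.reindex_bij_witness[of _ "\<lambda>(l,k). (l + k, l)" "\<lambda>(k,l). (l, k - l)"])
      fix x assume "x \<in> (SIGMA k:{k. k \<subseteq># m}. {l. l \<subseteq># k})"
      then obtain k l where x: "x = (k, l)" "k \<subseteq># m" "l \<subseteq># k" by auto
      then show "(case case x of (k, l) \<Rightarrow> (l, k - l) of (l, k) \<Rightarrow> (l + k, l)) = x" by simp
      have "l \<subseteq># m" using x by (meson subset_mset.order_trans)
      moreover have "k - l \<subseteq># m - l" using x by (simp add: subseteq_mset_def diff_le_mono)
      ultimately show "(case x of (k, l) \<Rightarrow> (l, k - l)) \<in> (SIGMA l:{l. l \<subseteq># m}. {k. k \<subseteq># m - l})"
        using x by simp
      have "m - l - (k - l) = m - k" using x by simp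
      then show "(case case x of (k, l) \<Rightarrow> (l, k - l) of (l, k) \<Rightarrow>
            mcoef f l * (mcoef g k * mcoef h (m - l - k))) =
          (case x of (k, l) \<Rightarrow> mcoef f l * mcoef g (k - l) * mcoef h (m - k))"
        using x by (simp add: mult.assoc)
    next
      fix y assume "y \<in> (SIGMA l:{l. l \<subseteq># m}. {k. k \<subseteq># m - l})"
      then obtain k l where y: "y = (l, k)" "l \<subseteq># m" "k \<subseteq># m - l" by auto
      then show "(case case y of (l, k) \<Rightarrow> (l + k, l) of (k, l) \<Rightarrow> (l, k - l)) = y" by simp
      have "l + k \<subseteq># m" using y by (metis subset_mset.le_diff_conv2 union_commute)
      then show "(case y of (l, k) \<Rightarrow> (l + k, l)) \<in> (SIGMA k:{k. k \<subseteq># m}. {l. l \<subseteq># k})"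
        using y by simp
    qed
    also have "\<dots> = (\<Sum>l | l \<subseteq># m. \<Sum>k | k \<subseteq># m - l. mcoef f l * (mcoef g k * mcoef h (m - l - k)))"
      by (rule sum.Sigma[symmetric]) auto
    also have "\<dots> = mcoef (f * (g * h)) m"
      by (simp add: times_mps_def sum_distrib_left)
    finally show "mcoef (f * g * h) m = mcoef (f * (g * h)) m" .
  qed
  show "1 * f = f"
  proof (rule mps_eqI)
    fix m
    have "(\<Sum>k | k \<subseteq># m. (if k = {#} then 1 else 0) * mcoef f (m - k)) = (\<Sum>k\<in>{{#}}. (if k = {#} then 1 else 0) * mcoef f (m - k))"
      by (rule sum.mono_neutral_right) auto
    then show "mcoef (1 * f) m = mcoef f m"
      by (simp add: times_mps_def one_mps_def)
  qed
  show "(f + g) * h = f * h + g * h"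
    by (rule mps_eqI) (simp add: times_mps_def plus_mps_def distrib_right sum.distrib)
  have "mcoef (0 :: 'a mps) {#} \<noteq> mcoef 1 {#}"
    by (simp add: one_mps_def zero_mps_def)
  then show "(0 :: 'a mps) \<noteq> 1" by metis
qed (auto intro!: mps_eqI simp: plus_mps_def zero_mps_def uminus_mps_def minus_mps_def)

end

lemma mcoef_0 [simp]: "mcoef 0 m = 0"
  by (simp add: zero_mps_def)

lemma mcoef_1: "mcoef 1 m = (if m = {#} then 1 else 0)"
  by (simp add: one_mps_def)

lemma mcoef_add [simp]: "mcoef (f + g) m = mcoef f m + mcoef g m"
  by (simp add: plus_mps_def)

lemma mcoef_minus [simp]: "mcoef (- f) m = - mcoef f m"
  by (simp add: uminus_mps_def)

lemma mcoef_diff [simp]: "mcoef (f - g) m = mcoef f m - mcoef g m"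
  by (simp add: minus_mps_def)

lemma mcoef_mult: "mcoef (f * g) m = (\<Sum>k | k \<subseteq># m. mcoef f k * mcoef g (m - k))"
  by (simp add: times_mps_def)

lemma mcoef_sum [simp]: "mcoef (sum f A) m = (\<Sum>x\<in>A. mcoef (f x) m)"
  by (induction A rule: infinite_finite_induct) auto

lemma mcoef_of_nat: "mcoef (of_nat n) m = (if m = {#} then int n else 0)"
  by (induction n) (auto simp: mcoef_1)

lemma mcoef_of_int: "mcoef (of_int n) m = (if m = {#} then n else 0)"
  by (cases n) (auto simp: mcoef_of_nat mcoef_1)

lemma mcoef_of_int_mult [simp]: "mcoef (of_int n * f) m = n * mcoef f m"
proof -
  have "mcoef (of_int n * f) m = (\<Sum>k\<in>{{#}}. mcoef (of_int n) k * mcoef f (m - k))"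
    unfolding mcoef_mult by (rule sum.mono_neutral_right) (auto simp: mcoef_of_int)
  then show ?thesis by (simp add: mcoef_of_int)
qed

lemma mcoef_numeral_mult [simp]: "mcoef (numeral n * f) m = numeral n * mcoef f m"
  by (metis mcoef_of_int_mult of_int_numeral)

definition mmono :: "'v multiset \<Rightarrow> 'v mps" where
  "mmono m = Mps (\<lambda>k. if k = m then 1 else 0)"

lemma mcoef_mmono: "mcoef (mmono m) k = (if k = m then 1 else 0)"
  by (simp add: mmono_def)

lemma mcoef_mult_mmono: "mcoef (f * mmono m) k = (if m \<subseteq># k then mcoef f (k - m) else 0)"
proof (cases "m \<subseteq># k")
  case True
  have "mcoef (mmono m * f) k = (\<Sum>l\<in>{m}. mcoef (mmono m) l * mcoef f (k - l))"
    unfolding mcoef_mult using True by (intro sum.mono_neutral_right) (auto simp: mcoef_mmono)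
  with True show ?thesis by (simp add: mcoef_mmono mult.commute)
next
  case False
  have "mcoef (mmono m * f) k = 0"
    unfolding mcoef_mult using False by (intro sum.neutral) (auto simp: mcoef_mmono)
  with False show ?thesis by (simp add: mult.commute)
qed

lemma mmono_mult_mmono: "mmono m * mmono k = mmono (m + k)"
  by (rule mps_eqI) (auto simp: mcoef_mult_mmono mcoef_mmono subset_mset.add_diff_inverse)

lemma mmono_0 [simp]: "mmono {#} = 1"
  by (simp add: mmono_def one_mps_def)

text \<open>For \<open>P = 0\<close> these are the power series without terms of degree less than \<open>n\<close>.\<close>

definition fil :: "int \<Rightarrow> nat \<Rightarrow> 'v mps set" where
  "fil P n = {f. \<forall>m. size m < n \<longrightarrow> P dvd mcoef f m}"

lemma fil_0_level [simp]: "f \<in> fil P 0"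
  by (simp add: fil_def)

lemma fil_zero [simp]: "0 \<in> fil P n"
  by (simp add: fil_def)

lemma fil_add: "f \<in> fil P n \<Longrightarrow> g \<in> fil P n \<Longrightarrow> f + g \<in> fil P n"
  by (simp add: fil_def)

lemma fil_minus: "f \<in> fil P n \<Longrightarrow> - f \<in> fil P n"
  by (simp add: fil_def)

lemma fil_diff: "f \<in> fil P n \<Longrightarrow> g \<in> fil P n \<Longrightarrow> f - g \<in> fil P n"
  by (simp add: fil_def)

lemma fil_mult:
  assumes "f \<in> fil P a" "g \<in> fil P b"
  shows "f * g \<in> fil P (a + b)"
proof -
  have "P dvd mcoef f k * mcoef g (m - k)" if "size m < a + b" "k \<subseteq># m" for m k
  proof -
    have "size k + size (m - k) = size m" using that(2)
      by (simp add: size_Diff_submset size_mset_mono)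
    then have "size k < a \<or> size (m - k) < b" using that(1) by linarith
    then show ?thesis using assms by (auto simp: fil_def)
  qed
  then show ?thesis by (auto simp: fil_def mcoef_mult intro: dvd_sum)
qed

lemma fil_antimono: "f \<in> fil P a \<Longrightarrow> P' dvd P \<Longrightarrow> b \<le> a \<Longrightarrow> f \<in> fil P' b"
  unfolding fil_def by (auto intro: dvd_trans)

lemma fil_mult_left: "g \<in> fil P n \<Longrightarrow> f * g \<in> fil P n"
  using fil_mult[of f P 0 g n] by simp

lemma fil_mult_right: "f \<in> fil P n \<Longrightarrow> f * g \<in> fil P n"
  using fil_mult[of f P n g 0] by simp

lemma fil_mmono: "mmono m \<in> fil P (size m)"
  by (auto simp: fil_def mcoef_mmono)

lemma fil_of_int_mult: "of_int P * f \<in> fil P n"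
  by (simp add: fil_def)

text \<open>The geometric series in \<open>1 - f\<close>. When \<open>f\<close> has constant term 1,
  powers beyond \<open>size m\<close> have no coefficient at \<open>m\<close>, so that the
  truncation is exact.\<close>

definition mps_inv :: "'v mps \<Rightarrow> 'v mps" where
  "mps_inv f = Mps (\<lambda>m. mcoef (\<Sum>n\<le>size m. (1 - f) ^ n) m)"

lemma mps_inv_right:
  fixes f :: "'v mps"
  assumes "1 - f \<in> fil 0 1"
  shows "f * mps_inv f = 1"
proof (rule mps_eqI)
  fix m :: "'v multiset"
  define N where "N = size m"
  define h where "h = 1 - f"
  have pw: "h ^ n \<in> fil 0 n" for n
  proof (induction n)
    case (Suc n)
    then show ?case using fil_mult[of h 0 1 "h ^ n" n] assms by (simp add: h_def)
  qed simp
  have "mps_inv f - (\<Sum>n\<le>N. h ^ n) \<in> fil 0 (N + 1)"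
    unfolding fil_def
  proof (clarsimp simp: mps_inv_def simp flip: h_def)
    fix k :: "'v multiset" assume k: "size k < Suc N"
    have "(\<Sum>n\<le>N. mcoef (h ^ n) k) = (\<Sum>n\<le>size k. mcoef (h ^ n) k)"
      using k pw by (intro sum.mono_neutral_right) (auto simp: fil_def)
    then show "(\<Sum>n\<le>size k. mcoef (h ^ n) k) = (\<Sum>n\<le>N. mcoef (h ^ n) k)" by simp
  qed
  then have 1: "f * mps_inv f - f * (\<Sum>n\<le>N. h ^ n) \<in> fil 0 (N + 1)"
    by (metis fil_mult_left right_diff_distrib)
  have "f * (\<Sum>n\<le>N. h ^ n) = 1 - h ^ Suc N"
    using one_diff_power_eq[of h "Suc N"] by (simp add: h_def lessThan_Suc_atMost)
  with 1 have "mcoef (f * mps_inv f - 1 + h ^ Suc N) m = 0"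
    unfolding fil_def N_def by (simp add: algebra_simps)
  moreover have "mcoef (h ^ Suc N) m = 0"
    using pw[of "Suc N"] by (auto simp: fil_def N_def)
  ultimately show "mcoef (f * mps_inv f) m = mcoef 1 m" by simp
qed

subsection \<open>Two by two matrices\<close>

text \<open>With named entries a matrix identity becomes four polynomial identities for
  \<open>algebra_simps\<close>; unlike the record \<open>matrix_ring\<close>, this type can be an
  instance of \<open>ring_1\<close>.\<close>

datatype 'a mat2 = Mat2 (e11: 'a) (e12: 'a) (e21: 'a) (e22: 'a)

lemma mat2_eq_iff: "A = B \<longleftrightarrow> e11 A = e11 B \<and> e12 A = e12 B \<and> e21 A = e21 B \<and> e22 A = e22 B"
  by (cases A; cases B) auto

instantiation mat2 :: (comm_ring_1) ring_1
begin

definition "0 = Mat2 0 0 0 0"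
definition "1 = Mat2 1 0 0 1"
definition "A + B = Mat2 (e11 A + e11 B) (e12 A + e12 B) (e21 A + e21 B) (e22 A + e22 B)"
definition "- A = Mat2 (- e11 A) (- e12 A) (- e21 A) (- e22 A)"
definition "A - B = Mat2 (e11 A - e11 B) (e12 A - e12 B) (e21 A - e21 B) (e22 A - e22 B)"
definition "A * B = Mat2 (e11 A * e11 B + e12 A * e21 B) (e11 A * e12 B + e12 A * e22 B)
  (e21 A * e11 B + e22 A * e21 B) (e21 A * e12 B + e22 A * e22 B)"

instance
  by standard
     (simp_all add: zero_mat2_def one_mat2_def plus_mat2_def uminus_mat2_def minus_mat2_def
       times_mat2_def mat2_eq_iff algebra_simps)

end

lemma mat2_sel [simp]:
  "e11 0 = 0" "e12 0 = 0" "e21 0 = 0" "e22 0 = 0"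
  "e11 1 = 1" "e12 1 = 0" "e21 1 = 0" "e22 1 = 1"
  "e11 (A + B) = e11 A + e11 B" "e12 (A + B) = e12 A + e12 B"
  "e21 (A + B) = e21 A + e21 B" "e22 (A + B) = e22 A + e22 B"
  "e11 (- A) = - e11 A" "e12 (- A) = - e12 A" "e21 (- A) = - e21 A" "e22 (- A) = - e22 A"
  "e11 (A - B) = e11 A - e11 B" "e12 (A - B) = e12 A - e12 B"
  "e21 (A - B) = e21 A - e21 B" "e22 (A - B) = e22 A - e22 B"
  "e11 (A * B) = e11 A * e11 B + e12 A * e21 B" "e12 (A * B) = e11 A * e12 B + e12 A * e22 B"
  "e21 (A * B) = e21 A * e11 B + e22 A * e21 B" "e22 (A * B) = e21 A * e12 B + e22 A * e22 B"
  by (simp_all add: zero_mat2_def one_mat2_def plus_mat2_def uminus_mat2_def minus_mat2_def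
       times_mat2_def)

lemma mat2_sel_sum [simp]:
  "e11 (sum f S) = (\<Sum>x\<in>S. e11 (f x))" "e12 (sum f S) = (\<Sum>x\<in>S. e12 (f x))"
  "e21 (sum f S) = (\<Sum>x\<in>S. e21 (f x))" "e22 (sum f S) = (\<Sum>x\<in>S. e22 (f x))"
  by (induction S rule: infinite_finite_induct; simp)+

definition scal :: "'a::comm_ring_1 \<Rightarrow> 'a mat2" where
  "scal a = Mat2 a 0 0 a"

lemma scal_sel [simp]: "e11 (scal a) = a" "e12 (scal a) = 0" "e21 (scal a) = 0" "e22 (scal a) = a"
  by (simp_all add: scal_def)

lemma scal_hom: "scal (a + b) = scal a + scal b" "scal (a * b) = scal a * scal b"
    "scal (a - b) = scal a - scal b" "scal (- a) = - scal a" "scal 1 = 1" "scal 0 = 0"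
  by (simp_all add: mat2_eq_iff)

lemma scal_commute: "A * scal a = scal a * A"
  by (simp add: mat2_eq_iff algebra_simps)

lemma scal_commute_left: "A * (scal a * B) = scal a * (A * B)"
  by (simp add: mat2_eq_iff algebra_simps)

lemma of_int_eq_scal: "of_int n = scal (of_int n)"
proof -
  have "of_nat k = scal (of_nat k :: 'a)" for k by (induction k) (auto simp: scal_hom)
  then show ?thesis by (cases n) (auto simp: scal_hom)
qed

definition det2 :: "'a::comm_ring_1 mat2 \<Rightarrow> 'a" where
  "det2 A = e11 A * e22 A - e12 A * e21 A"

definition adj2 :: "'a::comm_ring_1 mat2 \<Rightarrow> 'a mat2" where
  "adj2 A = Mat2 (e22 A) (- e12 A) (- e21 A) (e11 A)"

lemma det2_mult: "det2 (A * B) = det2 A * det2 B"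
  by (simp add: det2_def algebra_simps)

lemma det2_1 [simp]: "det2 1 = 1"
  by (simp add: det2_def)

lemma mult_adj2: "A * adj2 A = scal (det2 A)" "adj2 A * A = scal (det2 A)"
  by (simp_all add: adj2_def det2_def mat2_eq_iff algebra_simps)

section \<open>Matrices filtered by degree and divisibility\<close>

definition mfil :: "int \<Rightarrow> nat \<Rightarrow> 'v mps mat2 set" where
  "mfil P n = {A. e11 A \<in> fil P n \<and> e12 A \<in> fil P n \<and> e21 A \<in> fil P n \<and> e22 A \<in> fil P n}"

lemma mfil_0_level [simp]: "A \<in> mfil P 0"
  by (simp add: mfil_def)

lemma mfil_zero [simp]: "0 \<in> mfil P n"
  by (simp add: mfil_def)

lemma mfil_add: "A \<in> mfil P n \<Longrightarrow> B \<in> mfil P n \<Longrightarrow> A + B \<in> mfil P n"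
  by (simp add: mfil_def fil_add)

lemma mfil_minus: "A \<in> mfil P n \<Longrightarrow> - A \<in> mfil P n"
  by (simp add: mfil_def fil_minus)

lemma mfil_diff: "A \<in> mfil P n \<Longrightarrow> B \<in> mfil P n \<Longrightarrow> A - B \<in> mfil P n"
  by (simp add: mfil_def fil_diff)

lemma mfil_mult: "A \<in> mfil P a \<Longrightarrow> B \<in> mfil P b \<Longrightarrow> A * B \<in> mfil P (a + b)"
  by (auto simp: mfil_def intro!: fil_add fil_mult)

lemma mfil_mult_left: "B \<in> mfil P n \<Longrightarrow> A * B \<in> mfil P n"
  using mfil_mult[of A P 0 B n] by simp

lemma mfil_mult_right: "A \<in> mfil P n \<Longrightarrow> A * B \<in> mfil P n"
  using mfil_mult[of A P n B 0] by simp

lemma mfil_antimono: "A \<in> mfil P a \<Longrightarrow> P' dvd P \<Longrightarrow> b \<le> a \<Longrightarrow> A \<in> mfil P' b"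
  unfolding mfil_def by (auto intro: fil_antimono)

lemma mfil_0_mono: "A \<in> mfil 0 a \<Longrightarrow> b \<le> a \<Longrightarrow> A \<in> mfil P b"
  by (erule mfil_antimono) auto

lemma mfil_mult3: "A \<in> mfil P a \<Longrightarrow> B \<in> mfil P b \<Longrightarrow> c \<le> a + b \<Longrightarrow> A * B \<in> mfil P c"
  by (meson mfil_antimono mfil_mult dvd_refl)

lemma mfil_of_int_mult: "of_int P * A \<in> mfil P n"
  by (simp add: mfil_def of_int_eq_scal fil_of_int_mult)

subsection \<open>Commutator calculus\<close>

text \<open>Groups are written additively, so that the class of not necessarily commutative groups of
  the library applies.\<close>

lemmas group_norm = diff_conv_add_uminus minus_add add.assoc

definition subgrp :: "'g::group_add set \<Rightarrow> bool" where
  "subgrp H \<longleftrightarrow> 0 \<in> H \<and> (\<forall>a\<in>H. \<forall>b\<in>H. a + b \<in> H) \<and> (\<forall>a\<in>H. - a \<in> H)"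

definition nsubgrp :: "'g::group_add set \<Rightarrow> bool" where
  "nsubgrp N \<longleftrightarrow> subgrp N \<and> (\<forall>g. \<forall>a\<in>N. g + a - g \<in> N)"

inductive_set gen :: "'g::group_add set \<Rightarrow> 'g set" for S where
  gen_zero: "0 \<in> gen S"
| gen_base: "a \<in> S \<Longrightarrow> a \<in> gen S"
| gen_add: "a \<in> gen S \<Longrightarrow> b \<in> gen S \<Longrightarrow> a + b \<in> gen S"
| gen_minus: "a \<in> gen S \<Longrightarrow> - a \<in> gen S"

definition comm :: "'g::group_add \<Rightarrow> 'g \<Rightarrow> 'g" where
  "comm a b = a + b - a - b"

text \<open>Indexed like \<open>closed_lcs\<close>: the whole group is term 1, and term 0 is a
  dummy.\<close>

fun lcs :: "nat \<Rightarrow> 'g::group_add set" where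
  "lcs 0 = UNIV"
| "lcs (Suc 0) = UNIV"
| "lcs (Suc (Suc n)) = gen {comm h k | h k. h \<in> lcs (Suc n)}"

lemma subgrpD:
  assumes "subgrp H"
  shows "0 \<in> H" "a \<in> H \<Longrightarrow> b \<in> H \<Longrightarrow> a + b \<in> H" "a \<in> H \<Longrightarrow> - a \<in> H"
    "a \<in> H \<Longrightarrow> b \<in> H \<Longrightarrow> a - b \<in> H"
  using assms unfolding subgrp_def by (auto simp: diff_conv_add_uminus simp del: add_uminus_conv_diff)

lemma subgrp_gen [simp]: "subgrp (gen S)"
  by (simp add: subgrp_def gen.intros)

lemma gen_least: "subgrp H \<Longrightarrow> S \<subseteq> H \<Longrightarrow> gen S \<subseteq> H"
proof
  fix x assume "subgrp H" "S \<subseteq> H" "x \<in> gen S"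
  from this(3) show "x \<in> H"
    by induction (use \<open>subgrp H\<close> \<open>S \<subseteq> H\<close> in \<open>auto dest: subgrpD\<close>)
qed

lemma gen_mono: "S \<subseteq> T \<Longrightarrow> gen S \<subseteq> gen T"
  by (meson gen_least gen_base subgrp_gen subsetD subsetI)

lemma nsubgrpD:
  assumes "nsubgrp N"
  shows "subgrp N" "a \<in> N \<Longrightarrow> g + a - g \<in> N" "a \<in> N \<Longrightarrow> - g + a + g \<in> N"
  using assms unfolding nsubgrp_def by (auto dest: spec[where x="- g"])

lemmas nsubgrp_mem = subgrpD[OF nsubgrpD(1)]

lemma comm_0 [simp]: "comm a 0 = 0" "comm 0 a = 0" "comm a a = 0"
  by (simp_all add: comm_def)

lemma minus_comm: "- comm a b = comm b a"
  by (simp add: comm_def group_norm del: add_uminus_conv_diff)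

lemma comm_add_left_eq: "comm (a + a') b = a + comm a' b - a + comm a b"
  by (simp add: comm_def group_norm del: add_uminus_conv_diff)

lemma comm_minus_left_eq: "comm (- a) b = - (- a + comm a b + a)"
  by (simp add: comm_def group_norm del: add_uminus_conv_diff)

lemma conj_eq_comm: "a + c - a = comm a c + c"
  by (simp add: comm_def group_norm del: add_uminus_conv_diff)

lemma add_commute_comm: "a + b = comm a b + (b + a)"
  by (simp add: comm_def group_norm del: add_uminus_conv_diff)

lemma nsubgrp_cong_add:
  assumes "nsubgrp N" "a - a' \<in> N" "b - b' \<in> N"
  shows "(a + b) - (a' + b') \<in> N"
proof -
  have "(a + b) - (a' + b') = (a + (b - b') - a) + (a - a')"
    by (simp add: group_norm del: add_uminus_conv_diff)
  then show ?thesis using assms by (metis nsubgrpD(1,2) subgrpD(2))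
qed

lemma nsubgrp_cong_minus:
  assumes "nsubgrp N" "a - a' \<in> N"
  shows "(- a) - (- a') \<in> N"
proof -
  have "(- a) - (- a') = - a + (- (a - a')) + a"
    by (simp add: group_norm del: add_uminus_conv_diff)
  then show ?thesis using assms by (metis nsubgrpD(1,3) subgrpD(3))
qed

lemma nsubgrp_cong_diff:
  assumes "nsubgrp N" "a - a' \<in> N" "b - b' \<in> N"
  shows "(a - b) - (a' - b') \<in> N"
  using nsubgrp_cong_add[OF assms(1,2) nsubgrp_cong_minus[OF assms(1,3)]] by simp

lemma nsubgrp_cong_sym: "nsubgrp N \<Longrightarrow> a - b \<in> N \<Longrightarrow> b - a \<in> N"
  by (metis minus_diff_eq nsubgrpD(1) subgrpD(3))

lemma nsubgrp_cong_trans: "nsubgrp N \<Longrightarrow> a - b \<in> N \<Longrightarrow> b - c \<in> N \<Longrightarrow> a - c \<in> N"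
  by (metis diff_add_cancel add_diff_eq nsubgrpD(1) subgrpD(2))

lemma nsubgrp_cong_comm:
  "nsubgrp N \<Longrightarrow> a - a' \<in> N \<Longrightarrow> b - b' \<in> N \<Longrightarrow> comm a b - comm a' b' \<in> N"
  unfolding comm_def by (intro nsubgrp_cong_add nsubgrp_cong_diff) auto

lemma nsubgrp_comm:
  assumes "nsubgrp N" "a \<in> N" shows "comm a b \<in> N" "comm b a \<in> N"
  using nsubgrp_cong_comm[of N a 0 b b] nsubgrp_cong_comm[of N b b a 0] assms
  by (simp_all add: nsubgrp_mem(1))

lemma nsubgrp_lcs: "nsubgrp (lcs n :: 'a::group_add set)"
proof (induction n)
  case (Suc m)
  have ?case if [simp]: "m = Suc n" for n
  proof -
  note 3 = Suc[unfolded that]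
  have "g + a - g \<in> lcs (Suc (Suc n))" if "a \<in> lcs (Suc (Suc n))" for a g :: 'a
    using that unfolding lcs.simps
  proof induction
    case (gen_base a)
    then obtain h k where a: "a = comm h k" and h: "h \<in> lcs (Suc n)" by auto
    have "g + a - g = comm (g + h - g) (g + k - g)"
      by (simp add: a comm_def group_norm del: add_uminus_conv_diff)
    moreover have "g + h - g \<in> lcs (Suc n)" using nsubgrpD(2)[OF 3 h] .
    ultimately show ?case by (intro gen.gen_base CollectI exI conjI)
  next
    case (gen_add a b)
    have "g + (a + b) - g = (g + a - g) + (g + b - g)"
      by (simp add: group_norm del: add_uminus_conv_diff)
    with gen_add show ?case by (simp only: gen.gen_add)
  next
    case (gen_minus a)
    have "g + - a - g = - (g + a - g)"
      by (simp add: group_norm del: add_uminus_conv_diff)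
    with gen_minus show ?case by (simp only: gen.gen_minus)
  qed (simp add: gen_zero)
  then show ?thesis by (simp add: nsubgrp_def)
  qed
  then show ?case by (cases m) (auto simp: nsubgrp_def subgrp_def)
qed (auto simp: nsubgrp_def subgrp_def)

lemma lcs_Suc_subset: "lcs (Suc n) \<subseteq> lcs n"
proof (cases n)
  case (Suc m)
  have "comm h k \<in> lcs n" if "h \<in> lcs n" for h k :: 'a
    using that nsubgrp_comm[OF nsubgrp_lcs] by blast
  then show ?thesis unfolding Suc lcs.simps
    by (intro gen_least nsubgrpD(1)[OF nsubgrp_lcs]) (auto simp: Suc)
qed auto

lemma lcs_1 [simp]: "lcs (Suc 0) = UNIV" "lcs 1 = UNIV"
  by auto

lemma comm_lcs_right: "h \<in> lcs n \<Longrightarrow> comm h k \<in> lcs (Suc n)"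
  by (cases n) (auto intro: gen_base)

text \<open>The two expansions of \<open>comm (a + b) w\<close> and \<open>comm (b + a) w\<close>, compared by means of
  \<open>a + b = b + a + comm (- a) (- b)\<close>, give the three subgroups lemma.\<close>

lemma comm_lcs:
  "1 \<le> i \<Longrightarrow> 1 \<le> j \<Longrightarrow> a \<in> lcs i \<Longrightarrow> b \<in> lcs j \<Longrightarrow> comm a b \<in> lcs (i + j)"
proof (induction i arbitrary: j a b rule: nat_induct_at_least)
  case base
  then show ?case using comm_lcs_right[of b j a] minus_comm[of b a] nsubgrp_lcs
    by (metis nsubgrpD(1) plus_1_eq_Suc subgrpD(3))
next
  case (Suc i)
  let ?N = "lcs (Suc i + j) :: 'a set"
  note N = nsubgrp_lcs[of "Suc i + j"]
  have gens: "comm (comm h k) b \<in> ?N" if h: "h \<in> lcs i" for h k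
  proof -
    define A B where "A = - h" and "B = - k"
    have A: "A \<in> lcs i" using h nsubgrp_lcs subgrpD(3) nsubgrpD(1) unfolding A_def by blast
    define P where "P = comm B b"
    define Q where "Q = comm A b"
    have P: "P \<in> lcs (Suc j)" unfolding P_def
      using comm_lcs_right[OF \<open>b \<in> lcs j\<close>, of B] minus_comm[of b B] nsubgrp_lcs
      by (metis nsubgrpD(1) subgrpD(3))
    have Q: "Q \<in> lcs (i + j)" unfolding Q_def using Suc.IH Suc.prems A by blast
    have 1: "comm (A + B) b = comm A P + (P + Q)"
      unfolding comm_add_left_eq[of A B] conj_eq_comm P_def Q_def by (simp add: add.assoc)
    have 2: "comm (B + A) b = comm B Q + (Q + P)"
      unfolding comm_add_left_eq[of B A] conj_eq_comm P_def Q_def by (simp add: add.assoc)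
    have "comm A P \<in> ?N" using Suc.IH[of "Suc j" A P] A P by simp
    moreover have "comm B Q \<in> ?N" using comm_lcs_right[OF Q, of B] minus_comm[of Q B] N
      by (metis add_Suc nsubgrpD(1) subgrpD(3))
    moreover have "comm P Q \<in> ?N" using comm_lcs_right[OF Q, of P] minus_comm[of Q P] N
      by (metis add_Suc nsubgrpD(1) subgrpD(3))
    moreover have "(P + Q) - (Q + P) = comm P Q"
      by (simp add: comm_def group_norm del: add_uminus_conv_diff)
    ultimately have "comm (A + B) b - comm (B + A) b \<in> ?N"
      unfolding 1 2 using nsubgrp_mem(4)[OF N] by - (rule nsubgrp_cong_add[OF N], simp_all)
    moreover have "comm (A + B) b - comm (B + A) b = (B + A) + comm (comm h k) b - (B + A)"
    proof -
      have "A + B = (B + A) + comm h k"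
        by (simp add: comm_def A_def B_def group_norm del: add_uminus_conv_diff)
      then show ?thesis by (simp add: comm_add_left_eq)
    qed
    ultimately have "- (B + A) + ((B + A) + comm (comm h k) b - (B + A)) + (B + A) \<in> ?N"
      using nsubgrpD(3)[OF N] by metis
    then show ?thesis by (simp add: group_norm del: add_uminus_conv_diff)
  qed
  \<comment> \<open>Normality of \<open>?N\<close> makes this a subgroup, so the generators treated
    in \<open>gens\<close> suffice.\<close>
  have "subgrp {a. comm a b \<in> ?N}"
    unfolding subgrp_def mem_Collect_eq comm_add_left_eq comm_minus_left_eq
    by (intro conjI ballI)
      (simp_all add: nsubgrp_mem(1-3)[OF nsubgrp_lcs] nsubgrpD(2,3)[OF nsubgrp_lcs] del: minus_add)
  moreover obtain i' where i': "i = Suc i'" using \<open>1 \<le> i\<close> by (cases i) auto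
  ultimately have "lcs (Suc i) \<subseteq> {a. comm a b \<in> ?N}"
    unfolding i' lcs.simps using gens by (intro gen_least) (auto simp: i')
  then show ?case using Suc.prems by auto
qed

section \<open>Multiples and ordered linear combinations\<close>

primrec nmul :: "nat \<Rightarrow> 'g::group_add \<Rightarrow> 'g" where
  "nmul 0 a = 0"
| "nmul (Suc n) a = a + nmul n a"

lemma nmul_add: "nmul (m + n) a = nmul m a + nmul n a"
  by (induction m) (auto simp: add.assoc)

lemma nmul_mult: "nmul (m * n) a = nmul m (nmul n a)"
  by (induction m) (auto simp: nmul_add)

lemma nmul_commute: "nmul n a + a = a + nmul n a"
  by (induction n) (auto simp: add.assoc)

lemma nmul_1 [simp]: "nmul 1 a = a" "nmul (Suc 0) a = a"
  by simp_all

lemma nmul_0_right [simp]: "nmul n 0 = 0"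
  by (induction n) auto

lemma nmul_in: "subgrp H \<Longrightarrow> a \<in> H \<Longrightarrow> nmul n a \<in> H"
  by (induction n) (auto intro: subgrpD)

text \<open>A list, because the order of the summands matters in the group. Natural coefficients are
  enough, because modulo the subgroups in use every inverse is a positive multiple.\<close>

definition lin :: "('i \<Rightarrow> 'g::group_add) \<Rightarrow> ('i \<Rightarrow> nat) \<Rightarrow> 'i list \<Rightarrow> 'g" where
  "lin e \<mu> is = sum_list (map (\<lambda>i. nmul (\<mu> i) (e i)) is)"

lemma lin_simps [simp]: "lin e \<mu> [] = 0" "lin e \<mu> (i # is) = nmul (\<mu> i) (e i) + lin e \<mu> is"
  by (simp_all add: lin_def)

lemma lin_in: "subgrp H \<Longrightarrow> (\<And>i. i \<in> set is \<Longrightarrow> e i \<in> H) \<Longrightarrow> lin e \<mu> is \<in> H"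
  by (induction "is") (auto intro: subgrpD nmul_in)

lemma lin_unit: "distinct is \<Longrightarrow> i \<in> set is \<Longrightarrow> lin e (\<lambda>j. if j = i then 1 else 0) is = e i"
proof (induction "is")
  case (Cons k ks)
  have "lin e (\<lambda>j. if j = i then 1 else 0) js = 0" if "i \<notin> set js" for js
    using that by (induction js) auto
  with Cons show ?case by auto
qed simp

text \<open>An N-series in the sense of Lazard, whose successive quotients form a graded Lie ring.
  It is kept abstract because it is used both for \<open>lcs\<close> itself and for
  \<open>lcs\<close> multiplied by a congruence subgroup.\<close>

locale nseries =
  fixes D :: "nat \<Rightarrow> 'g::group_add set"
  assumes nsub: "nsubgrp (D n)"
    and D_Suc: "D (Suc n) \<subseteq> D n"
    and D_1: "D (Suc 0) = UNIV"
    and comm_D: "Suc 0 \<le> i \<Longrightarrow> Suc 0 \<le> j \<Longrightarrow> a \<in> D i \<Longrightarrow> b \<in> D j \<Longrightarrow> comm a b \<in> D (i + j)"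
begin

lemma D_antimono: "i \<le> j \<Longrightarrow> D j \<subseteq> D i"
  by (rule lift_Suc_antimono_le[of D]) (use D_Suc in auto)

lemma D_mem_le: "a \<in> D j \<Longrightarrow> i \<le> j \<Longrightarrow> a \<in> D i"
  using D_antimono by blast

lemmas D_group = subgrpD[OF nsubgrpD(1)[OF nsub]]

definition eqv :: "nat \<Rightarrow> 'g \<Rightarrow> 'g \<Rightarrow> bool" where
  "eqv n a b \<longleftrightarrow> a - b \<in> D n"

lemma eqv_refl [simp]: "eqv n a a"
  by (simp add: eqv_def D_group)

lemma eqv_sym: "eqv n a b \<Longrightarrow> eqv n b a"
  unfolding eqv_def by (rule nsubgrp_cong_sym[OF nsub])

lemma eqv_trans [trans]: "eqv n a b \<Longrightarrow> eqv n b c \<Longrightarrow> eqv n a c"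
  unfolding eqv_def by (rule nsubgrp_cong_trans[OF nsub])

lemma eqv_add: "eqv n a a' \<Longrightarrow> eqv n b b' \<Longrightarrow> eqv n (a + b) (a' + b')"
  unfolding eqv_def by (rule nsubgrp_cong_add[OF nsub])

lemma eqv_minus: "eqv n a a' \<Longrightarrow> eqv n (- a) (- a')"
  unfolding eqv_def by (rule nsubgrp_cong_minus[OF nsub])

lemma eqv_le: "eqv n a b \<Longrightarrow> m \<le> n \<Longrightarrow> eqv m a b"
  unfolding eqv_def by (rule D_mem_le)

lemma eqv_0: "eqv n a 0 \<longleftrightarrow> a \<in> D n"
  by (simp add: eqv_def)

lemma eqv_mem: "eqv n a b \<Longrightarrow> b \<in> D n \<Longrightarrow> a \<in> D n"
  using eqv_trans[of n a b 0] by (simp add: eqv_0)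

lemma comm_D': "Suc 0 \<le> i \<Longrightarrow> Suc 0 \<le> j \<Longrightarrow> a \<in> D i \<Longrightarrow> b \<in> D j \<Longrightarrow> k \<le> i + j \<Longrightarrow> comm a b \<in> D k"
  by (meson comm_D D_mem_le)

lemma comm_X: "b \<in> D n \<Longrightarrow> comm a b \<in> D (Suc n)"
  using comm_D[of "Suc 0" n a b] by (cases n) (auto simp: D_1)

lemma eqv_commute: "comm a b \<in> D n \<Longrightarrow> eqv n (a + b) (b + a)"
  unfolding eqv_def add_commute_comm[of a b] by (simp flip: add_diff_eq)

text \<open>Bilinearity of the bracket of the graded Lie ring: the conjugation in the exact
  expansion costs only \<open>comm a (comm a' b)\<close>, of weight above
  \<open>i + j\<close>.\<close>

lemma comm_add_left:
  assumes "Suc 0 \<le> j" "b \<in> D j" "a \<in> D i" "a' \<in> D i" "Suc 0 \<le> i"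
  shows "eqv (Suc (i + j)) (comm (a + a') b) (comm a b + comm a' b)"
proof -
  have 1: "comm (a + a') b = comm a (comm a' b) + (comm a' b + comm a b)"
    by (simp add: comm_add_left_eq conj_eq_comm add.assoc)
  have "comm a (comm a' b) \<in> D (Suc (i + j))"
    using comm_D[of i "i + j" a "comm a' b"] comm_D[of i j a' b] assms D_mem_le by fastforce
  moreover have "comm (comm a' b) (comm a b) \<in> D (Suc (i + j))"
    using comm_X[OF comm_D[of i j a b]] assms by auto
  ultimately show ?thesis
    using eqv_add[of "Suc (i + j)" "comm a (comm a' b)" 0] eqv_commute
    unfolding 1 by (metis add.left_neutral eqv_0)
qed

lemma comm_minus_left:
  assumes "Suc 0 \<le> j" "b \<in> D j" "a \<in> D i" "Suc 0 \<le> i"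
  shows "eqv (Suc (i + j)) (comm (- a) b) (- comm a b)"
proof -
  have "eqv (Suc (i + j)) (comm (- a) b + comm a b) 0"
    using comm_add_left[OF assms(1,2), of "- a" i a] assms D_group eqv_sym by fastforce
  from eqv_add[OF this eqv_refl, of "- comm a b"] show ?thesis by (simp add: add.assoc)
qed

lemma comm_add_right:
  assumes "Suc 0 \<le> i" "a \<in> D i" "b \<in> D j" "b' \<in> D j" "Suc 0 \<le> j"
  shows "eqv (Suc (i + j)) (comm a (b + b')) (comm a b + comm a b')"
proof -
  have "eqv (Suc (i + j)) (comm a (b + b')) (- (comm b a + comm b' a))"
    using eqv_minus[OF comm_add_left[OF assms]] minus_comm by (metis add.commute)
  also have "- (comm b a + comm b' a) = comm a b' + comm a b"
    by (simp add: minus_add minus_comm del: add_uminus_conv_diff)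
  also have "eqv (Suc (i + j)) \<dots> (comm a b + comm a b')"
    using comm_X[OF comm_D[of i j a b]] assms by (intro eqv_commute) auto
  finally show ?thesis .
qed

lemma comm_minus_right:
  assumes "Suc 0 \<le> i" "a \<in> D i" "b \<in> D j" "Suc 0 \<le> j"
  shows "eqv (Suc (i + j)) (comm a (- b)) (- comm a b)"
  using eqv_minus[OF comm_minus_left[OF assms]] minus_comm by (metis add.commute)

lemma comm_cong_left:
  assumes "eqv (Suc i) a a'" "b \<in> D j" "Suc 0 \<le> j"
  shows "eqv (Suc (i + j)) (comm a b) (comm a' b)"
proof -
  define d where "d = a - a'"
  have d: "d \<in> D (Suc i)" using assms(1) by (simp add: eqv_def d_def)
  have "comm a b = (d + comm a' b - d) + comm d b"
    using comm_add_left_eq[of d a' b] by (simp add: d_def)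
  also have "\<dots> = comm d (comm a' b) + (comm a' b + comm d b)"
    by (simp add: conj_eq_comm add.assoc)
  finally have 1: "comm a b = comm d (comm a' b) + (comm a' b + comm d b)" .
  have "comm d (comm a' b) \<in> D (Suc (i + j))"
    using comm_D[of "Suc i" j d] d assms comm_X[of b j] D_Suc by fastforce
  moreover have "comm d b \<in> D (Suc (i + j))"
    using comm_D[of "Suc i" j d b] d assms by auto
  ultimately have "eqv (Suc (i + j)) (comm a b) (0 + (comm a' b + 0))"
    unfolding 1 by (intro eqv_add eqv_refl) (auto simp: eqv_0)
  then show ?thesis by simp
qed

lemma comm_cong_right:
  assumes "eqv (Suc j) b b'" "a \<in> D i" "Suc 0 \<le> i"
  shows "eqv (Suc (i + j)) (comm a b) (comm a b')"
  using eqv_minus[OF comm_cong_left[OF assms]] minus_comm by (metis add.commute)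

lemma comm_X_cong: "eqv n b b' \<Longrightarrow> eqv (Suc n) (comm a b) (comm a b')"
  using comm_cong_right[of "n - 1" b b' a "Suc 0"] D_1
  by (cases n) (auto simp: eqv_def)

text \<open>As in the three subgroups lemma, \<open>comm (a + b) w\<close> and
  \<open>comm (b + a) w\<close> are expanded exactly and compared through
  \<open>a + b = c + (b + a)\<close> with \<open>c = comm a b\<close>. The corrections
  \<open>comm c (comm (b + a) w)\<close>, \<open>comm P Q\<close> and the commutator of
  \<open>comm c w\<close> all have weight above \<open>i + j + n\<close>.\<close>

lemma jacobi:
  assumes "Suc 0 \<le> i" "Suc 0 \<le> j" "Suc 0 \<le> n" "a \<in> D i" "b \<in> D j" "w \<in> D n"
  shows "eqv (Suc (i + j + n)) (comm a (comm b w)) (comm b (comm a w) + comm (comm a b) w)"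
proof -
  define P Q c M where "P = comm b w" and "Q = comm a w" and "c = comm a b" and "M = Suc (i + j + n)"
  have P: "P \<in> D (j + n)" and Q: "Q \<in> D (i + n)" and c: "c \<in> D (i + j)"
    using comm_D assms by (auto simp: P_def Q_def c_def)
  have cw: "comm c w \<in> D (i + j + n)" using comm_D c assms by auto
  have 1: "comm (a + b) w = comm a P + (P + Q)"
    unfolding comm_add_left_eq[of a b] conj_eq_comm P_def Q_def by (simp add: add.assoc)
  have 2: "comm (b + a) w = comm b Q + (Q + P)"
    unfolding comm_add_left_eq[of b a] conj_eq_comm P_def Q_def by (simp add: add.assoc)
  have "a + b = c + (b + a)" by (simp add: c_def comm_def group_norm del: add_uminus_conv_diff)
  then have 3: "comm (a + b) w = comm c (comm (b + a) w) + (comm (b + a) w + comm c w)"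
    by (simp add: comm_add_left_eq conj_eq_comm add.assoc)
  have "comm c (comm (b + a) w) \<in> D M"
    using comm_D[of "i + j" "Suc n" c "comm (b + a) w"] c comm_X assms by (simp add: M_def)
  then have 4: "eqv M (comm (a + b) w) (comm (b + a) w + comm c w)"
    using eqv_add[of M "comm c (comm (b + a) w)" 0 "comm (b + a) w + comm c w", OF _ eqv_refl]
    unfolding 3 by (simp add: eqv_0)
  have PQ: "eqv M (P + Q) (Q + P)"
    using comm_D'[of "j + n" "i + n" P Q M] P Q assms by (intro eqv_commute) (auto simp: M_def)
  have "eqv M (Q + P + comm c w) (comm c w + (Q + P))"
    using comm_X[OF cw, of "Q + P"] by (intro eqv_commute) (simp add: M_def)
  then have 5: "eqv M (comm b Q + (Q + P) + comm c w) (comm b Q + comm c w + (Q + P))"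
    using eqv_add[OF eqv_refl, of M _ _ "comm b Q"] by (simp add: add.assoc)
  have "eqv M (comm a P + (Q + P)) (comm b Q + comm c w + (Q + P))"
    using eqv_trans[OF eqv_trans[OF eqv_add[OF eqv_refl eqv_sym[OF PQ], of "comm a P"] 4[unfolded 1 2]] 5] .
  from eqv_add[OF this eqv_refl, of "- (Q + P)"] show ?thesis
    by (simp add: P_def Q_def c_def M_def group_norm del: add_uminus_conv_diff)
qed

lemma jacobi':
  assumes "w \<in> D n" "Suc 0 \<le> n"
  shows "eqv (n + 3) (comm a (comm b w)) (comm b (comm a w) + comm (comm a b) w)"
  using jacobi[of "Suc 0" "Suc 0" n a b w] assms by (simp add: D_1 numeral_3_eq_3)

end

text \<open>\<open>D_Suc_gen\<close> is what lets a spanning set of one graded piece produce one of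
  the next. Allowing generators from the term after the next makes it stable under multiplication by
  a normal subgroup.\<close>

locale generated_nseries = nseries D for D :: "nat \<Rightarrow> 'g::group_add set" +
  fixes X Y :: 'g
  assumes gen_XY: "gen {X, Y} = UNIV"
    and D_Suc_gen: "Suc 0 \<le> n \<Longrightarrow> D (Suc n) \<subseteq> gen ({comm h k | h k. h \<in> D n} \<union> D (Suc (Suc n)))"
begin

definition spans :: "nat \<Rightarrow> 'g set \<Rightarrow> bool" where
  "spans n E \<longleftrightarrow> D n \<subseteq> gen (E \<union> D (Suc n))"

lemma gen_eqv: "eqv (Suc n) a b \<Longrightarrow> b \<in> gen (E \<union> D (Suc n)) \<Longrightarrow> a \<in> gen (E \<union> D (Suc n))"
  unfolding eqv_def by (metis UnI2 diff_add_cancel gen_add gen_base)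

lemma spans_subset:
  assumes "spans n E" "E \<subseteq> gen (E' \<union> D (Suc n))"
  shows "spans n E'"
proof -
  have "gen (E \<union> D (Suc n)) \<subseteq> gen (E' \<union> D (Suc n))"
    using assms(2) by (intro gen_least) (auto intro: gen_base)
  with assms(1) show ?thesis by (auto simp: spans_def)
qed

lemma spans_1: "spans (Suc 0) {X, Y}"
  using gen_mono[of "{X, Y}" "{X, Y} \<union> D (Suc (Suc 0))"] gen_XY by (auto simp: spans_def)

lemma spans_Suc:
  assumes n: "Suc 0 \<le> n" and E: "spans n E" "E \<subseteq> D n"
  shows "spans (Suc n) (comm X ` E \<union> comm Y ` E)"
proof -
  define S where "S = gen (comm X ` E \<union> comm Y ` E \<union> D (Suc (Suc n)))"
  have S: "subgrp S" by (simp add: S_def)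
  have DS: "D (Suc (Suc n)) \<subseteq> S" by (auto simp: S_def intro: gen_base)
  have eqvS: "a \<in> S" if "eqv (Suc (Suc n)) a b" "b \<in> S" for a b
    using that gen_eqv unfolding S_def by blast
  \<comment> \<open>First linearity in \<open>h\<close>, which reduces to the spanning set
    \<open>E\<close>; afterwards linearity in \<open>k\<close>, which reduces to the two
    generators.\<close>
  have 1: "comm k h \<in> S" if k: "k = X \<or> k = Y" and h: "h \<in> D n" for h k
  proof -
    have "h \<in> D n \<and> comm k h \<in> S" if "h \<in> gen (E \<union> D (Suc n))" for h
      using that
    proof induction
      case (gen_base a)
      then show ?case
      proof
        assume "a \<in> E"
        then show ?thesis using k E by (auto simp: S_def intro: gen.gen_base)
      next
        assume "a \<in> D (Suc n)"
        then show ?thesis using comm_X DS D_Suc by blast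
      qed
    next
      case (gen_add a b)
      then have "eqv (Suc (Suc n)) (comm k (a + b)) (comm k a + comm k b)"
        using comm_add_right[of "Suc 0" k a n b] n by (auto simp: D_1)
      with gen_add eqvS S show ?case by (meson D_group subgrpD(2))
    next
      case (gen_minus a)
      then have "eqv (Suc (Suc n)) (comm k (- a)) (- comm k a)"
        using comm_minus_right[of "Suc 0" k a n] n by (auto simp: D_1)
      with gen_minus eqvS S show ?case by (meson D_group subgrpD(3))
    qed (auto simp: D_group S_def gen_zero)
    then show ?thesis using h E by (auto simp: spans_def)
  qed
  have 2: "comm k h \<in> S" if h: "h \<in> D n" for h k
  proof -
    have "k \<in> gen {X, Y}" by (simp add: gen_XY)
    then show ?thesis
    proof induction
      case (gen_add a b)
      have "eqv (Suc (Suc n)) (comm (a + b) h) (comm a h + comm b h)"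
        using comm_add_left[OF n h, of a "Suc 0" b] by (auto simp: D_1)
      with gen_add eqvS S show ?case by (meson subgrpD(2))
    next
      case (gen_minus a)
      have "eqv (Suc (Suc n)) (comm (- a) h) (- comm a h)"
        using comm_minus_left[OF n h, of a "Suc 0"] by (auto simp: D_1)
      with gen_minus eqvS S show ?case by (meson subgrpD(3))
    qed (use 1 h in \<open>auto simp: S_def gen_zero\<close>)
  qed
  have "comm h k \<in> S" if "h \<in> D n" for h k
    using subgrpD(3)[OF S 2[OF that, of k]] by (simp add: minus_comm)
  then have "{comm h k | h k. h \<in> D n} \<union> D (Suc (Suc n)) \<subseteq> S"
    using DS by blast
  then have "gen ({comm h k | h k. h \<in> D n} \<union> D (Suc (Suc n))) \<subseteq> S"
    using S by (intro gen_least)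
  then show ?thesis using D_Suc_gen[OF n] by (auto simp: spans_def S_def)
qed

lemma lin_add:
  assumes "Suc 0 \<le> n" "\<And>i. i \<in> set is \<Longrightarrow> e i \<in> D n"
  shows "eqv (Suc n) (lin e (\<lambda>i. \<mu> i + \<nu> i) is) (lin e \<mu> is + lin e \<nu> is)"
  using assms(2)
proof (induction "is")
  case (Cons i "is")
  let ?a = "nmul (\<mu> i) (e i)" and ?b = "nmul (\<nu> i) (e i)"
  have "nmul (\<nu> i) (e i) \<in> D n" using Cons.prems nmul_in[OF nsubgrpD(1)[OF nsub]] by simp
  then have c: "eqv (Suc n) (?b + lin e \<mu> is) (lin e \<mu> is + ?b)"
    using comm_X[of ?b n "lin e \<mu> is"] minus_comm[of "lin e \<mu> is" ?b] D_group
    by (intro eqv_commute) (metis)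
  have "eqv (Suc n) (lin e (\<lambda>i. \<mu> i + \<nu> i) (i # is)) (?a + ?b + (lin e \<mu> is + lin e \<nu> is))"
    using Cons by (auto simp: nmul_add intro: eqv_add)
  also have "?a + ?b + (lin e \<mu> is + lin e \<nu> is) = ?a + (?b + lin e \<mu> is) + lin e \<nu> is"
    by (simp add: add.assoc)
  also have "eqv (Suc n) \<dots> (?a + (lin e \<mu> is + ?b) + lin e \<nu> is)"
    by (intro eqv_add eqv_refl c)
  finally show ?case by (simp add: add.assoc)
qed simp

text \<open>Since \<open>Suc q\<close> annihilates modulo the next term, \<open>- a\<close> is
  congruent to \<open>nmul q a\<close>; hence the classes of combinations with natural coefficients
  are already closed under inverses.\<close>

lemma spans_lin:
  assumes n: "Suc 0 \<le> n" and E: "spans n (e ` set is)" "\<And>i. i \<in> set is \<Longrightarrow> e i \<in> D n"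
    and "distinct is" and q: "\<And>g. nmul (Suc q) g \<in> D (Suc n)" and g: "g \<in> D n"
  shows "\<exists>\<mu>. eqv (Suc n) g (lin e \<mu> is)"
proof -
  define W where "W = {g. \<exists>\<mu>. eqv (Suc n) g (lin e \<mu> is)}"
  have W_add: "a + b \<in> W" if "a \<in> W" "b \<in> W" for a b
  proof -
    from that obtain \<mu> \<nu> where "eqv (Suc n) a (lin e \<mu> is)" "eqv (Suc n) b (lin e \<nu> is)"
      by (auto simp: W_def)
    then have "eqv (Suc n) (a + b) (lin e \<mu> is + lin e \<nu> is)" by (rule eqv_add)
    with lin_add[OF n E(2)] show ?thesis unfolding W_def
      by (intro CollectI exI) (rule eqv_trans, assumption, rule eqv_sym)
  qed
  have W_D: "a \<in> W" if "a \<in> D (Suc n)" for a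
  proof -
    have "lin e (\<lambda>_. 0) is = 0" by (induction "is") auto
    with that show ?thesis by (auto simp: W_def eqv_0 intro!: exI[of _ "\<lambda>_. 0"])
  qed
  have W_nmul: "nmul k a \<in> W" if "a \<in> W" for k a
    by (induction k) (use that W_add W_D D_group in auto)
  have "subgrp W"
    unfolding subgrp_def
  proof (intro conjI ballI)
    fix a assume a: "a \<in> W"
    have "- a = nmul q a + - nmul (Suc q) a"
      by (simp add: group_norm del: add_uminus_conv_diff)
    then show "- a \<in> W" using W_add[OF W_nmul[OF a] W_D[OF D_group(3)[OF q]]] by simp
  qed (simp_all add: W_add W_D[OF D_group(1)])
  moreover have "e i \<in> W" if "i \<in> set is" for i
    unfolding W_def
    by (intro CollectI exI[of _ "\<lambda>j. if j = i then 1 else 0"])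
      (simp add: lin_unit[OF \<open>distinct is\<close> that])
  ultimately have "gen (e ` set is \<union> D (Suc n)) \<subseteq> W"
    using W_D by (intro gen_least) auto
  then show ?thesis using g E by (auto simp: spans_def W_def)
qed

end

text \<open>This is the lower central series of the quotient by \<open>V\<close>, pulled back to the
  group, so that no quotient type is needed.\<close>

lemma lcs_nseries:
  assumes V: "nsubgrp V"
  shows "nseries (\<lambda>n. {a + v | a v. a \<in> lcs n \<and> v \<in> V})"
proof -
  define D where "D n = {a + v | a v. a \<in> lcs n \<and> v \<in> V}" for n
  have D_iff: "x \<in> D n \<longleftrightarrow> (\<exists>a\<in>lcs n. x - a \<in> V)" for x n
  proof
    assume "x \<in> D n"
    then obtain a v where "x = a + v" "a \<in> lcs n" "v \<in> V" by (auto simp: D_def)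
    then show "\<exists>a\<in>lcs n. x - a \<in> V" using nsubgrpD(2)[OF V] by auto
  next
    assume "\<exists>a\<in>lcs n. x - a \<in> V"
    then obtain a where a: "a \<in> lcs n" "x - a \<in> V" by auto
    then have "- a + (x - a) + a \<in> V" using nsubgrpD(3)[OF V] by metis
    moreover have "x = a + (- a + (x - a) + a)" by (simp add: group_norm del: add_uminus_conv_diff)
    ultimately show "x \<in> D n" using a unfolding D_def by blast
  qed
  have "nsubgrp (D n)" for n
    unfolding nsubgrp_def subgrp_def
  proof (intro conjI ballI allI)
    show "0 \<in> D n" unfolding D_iff
      by (intro bexI[of _ 0]) (simp_all add: nsubgrp_mem(1)[OF V] nsubgrp_mem(1)[OF nsubgrp_lcs])
    fix a assume "a \<in> D n"
    then obtain a' where a: "a' \<in> lcs n" "a - a' \<in> V" by (auto simp: D_iff)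
    then show "- a \<in> D n" unfolding D_iff
      using nsubgrp_cong_minus[OF V] nsubgrp_lcs nsubgrpD(1) subgrpD(3) by blast
    show "g + a - g \<in> D n" for g
    proof -
      have "(g + a - g) - (g + a' - g) \<in> V"
        using a V by (intro nsubgrp_cong_diff nsubgrp_cong_add) (simp_all add: nsubgrp_mem(1))
      then show ?thesis unfolding D_iff using nsubgrpD(2)[OF nsubgrp_lcs a(1)] by blast
    qed
    fix b assume "b \<in> D n"
    then obtain b' where b: "b' \<in> lcs n" "b - b' \<in> V" by (auto simp: D_iff)
    then show "a + b \<in> D n" unfolding D_iff
      using nsubgrp_cong_add[OF V a(2) b(2)] a(1) nsubgrp_lcs nsubgrpD(1) subgrpD(2) by blast
  qed
  moreover have "D (Suc n) \<subseteq> D n" for n using lcs_Suc_subset[of n] unfolding D_def by blast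
  moreover have "x \<in> D (Suc 0)" for x
    unfolding D_iff using nsubgrp_mem(1)[OF V] by (intro bexI[of _ x]) simp_all
  then have "D (Suc 0) = UNIV" by blast
  moreover have "comm a b \<in> D (i + j)" if "Suc 0 \<le> i" "Suc 0 \<le> j" "a \<in> D i" "b \<in> D j" for a b i j
  proof -
    from that obtain a' b' where "a' \<in> lcs i" "a - a' \<in> V" "b' \<in> lcs j" "b - b' \<in> V"
      by (auto simp: D_iff)
    then show ?thesis unfolding D_iff
      using nsubgrp_cong_comm[OF V] comm_lcs[of i j a' b'] that by (intro bexI) auto
  qed
  ultimately show ?thesis unfolding D_def by unfold_locales
qed

lemma lcs_generated_nseries:
  assumes V: "nsubgrp V" and XY: "gen {X, Y} = UNIV"
  shows "generated_nseries (\<lambda>n. {a + v | a v. a \<in> lcs n \<and> v \<in> V}) X Y"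
proof -
  define D where "D n = {a + v | a v. a \<in> lcs n \<and> v \<in> V}" for n
  interpret nseries D unfolding D_def by (rule lcs_nseries[OF V])
  have lcs_D: "lcs n \<subseteq> D n" for n
    using nsubgrp_mem(1)[OF V] unfolding D_def by force
  have V_D: "V \<subseteq> D n" for n
    using nsubgrp_mem(1)[OF nsubgrp_lcs[of n]] unfolding D_def by force
  have "D (Suc n) \<subseteq> gen ({comm h k | h k. h \<in> D n} \<union> D (Suc (Suc n)))" (is "_ \<subseteq> ?R")
    if n: "Suc 0 \<le> n" for n
  proof
    fix x assume "x \<in> D (Suc n)"
    then obtain a v where x: "x = a + v" "a \<in> lcs (Suc n)" "v \<in> V" by (auto simp: D_def)
    obtain m where m: "n = Suc m" using n by (cases n) auto
    have "lcs (Suc n) \<subseteq> ?R" unfolding m lcs.simps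
      using lcs_D by (intro gen_mono) (auto simp: m)
    moreover have "v \<in> ?R" using x V_D by (blast intro: gen_base)
    ultimately show "x \<in> ?R" using x by (auto intro: gen_add)
  qed
  then show ?thesis using XY nseries_axioms unfolding D_def
    by (intro generated_nseries.intro generated_nseries_axioms.intro)
qed

subsection \<open>The discrete group generated by the generic matrices\<close>

definition gmat :: "letter \<Rightarrow> var mps mat2" where
  "gmat c = Mat2 (mmono {#(c,1,1)#}) (mmono {#(c,1,2)#}) (mmono {#(c,2,1)#}) (mmono {#(c,2,2)#})"

text \<open>Cramer's rule; the determinant is a unit because its constant term is 1.\<close>

definition ginv :: "letter \<Rightarrow> var mps mat2" where
  "ginv c = scal (mps_inv (det2 (1 + gmat c))) * adj2 (1 + gmat c)"

lemma gmat_fil: "gmat c \<in> mfil 0 1"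
proof -
  have "mmono {#v#} \<in> fil 0 1" for v :: var using fil_mmono[of "{#v#}" 0] by simp
  then show ?thesis by (simp only: mfil_def gmat_def mat2.sel mem_Collect_eq simp_thms)
qed

lemma ginv: "(1 + gmat c) * ginv c = 1" "ginv c * (1 + gmat c) = 1"
proof -
  have e: "e11 (gmat c) \<in> fil 0 1" "e12 (gmat c) \<in> fil 0 1" "e21 (gmat c) \<in> fil 0 1" "e22 (gmat c) \<in> fil 0 1"
    using gmat_fil[of c] by (auto simp: mfil_def)
  have "1 - det2 (1 + gmat c) =
      - (e11 (gmat c) + e22 (gmat c) + e11 (gmat c) * e22 (gmat c) - e12 (gmat c) * e21 (gmat c))"
    by (simp add: det2_def algebra_simps)
  also have "\<dots> \<in> fil 0 1"
    using e by (intro fil_minus fil_diff fil_add fil_mult_right)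
  finally have d: "det2 (1 + gmat c) * mps_inv (det2 (1 + gmat c)) = 1" by (rule mps_inv_right)
  show "(1 + gmat c) * ginv c = 1"
    unfolding ginv_def scal_commute_left mult_adj2 scal_hom(2)[symmetric] using d
    by (simp add: mult.commute scal_hom)
  show "ginv c * (1 + gmat c) = 1"
    unfolding ginv_def mult.assoc mult_adj2 scal_hom(2)[symmetric] using d
    by (simp add: mult.commute scal_hom)
qed

inductive_set gam_mats :: "var mps mat2 set" where
  gam_one: "1 \<in> gam_mats"
| gam_gmat: "A \<in> gam_mats \<Longrightarrow> A * (1 + gmat c) \<in> gam_mats"
| gam_ginv: "A \<in> gam_mats \<Longrightarrow> A * ginv c \<in> gam_mats"

lemma gam_mult: "B \<in> gam_mats \<Longrightarrow> A \<in> gam_mats \<Longrightarrow> A * B \<in> gam_mats"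
  by (induction B rule: gam_mats.induct)
     (simp_all only: mult.assoc[symmetric] mult_1_right gam_mats.intros)

lemma gam_inverse: "A \<in> gam_mats \<Longrightarrow> \<exists>B\<in>gam_mats. A * B = 1 \<and> B * A = 1"
proof (induction A rule: gam_mats.induct)
  case gam_one
  then show ?case by (intro bexI[of _ 1]) (auto intro: gam_mats.gam_one)
next
  case (gam_gmat A c)
  then obtain B where B: "B \<in> gam_mats" "A * B = 1" "B * A = 1" by blast
  have "1 * ginv c * B \<in> gam_mats" using gam_mult[OF B(1)] gam_mats.intros by blast
  moreover have "A * (1 + gmat c) * (ginv c * B) = A * ((1 + gmat c) * ginv c) * B"
    by (simp only: mult.assoc)
  moreover have "ginv c * B * (A * (1 + gmat c)) = ginv c * (B * A) * (1 + gmat c)"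
    by (simp only: mult.assoc)
  ultimately show ?case using B by (intro bexI[of _ "ginv c * B"]) (simp_all only: ginv mult_1_right mult_1_left)
next
  case (gam_ginv A c)
  then obtain B where B: "B \<in> gam_mats" "A * B = 1" "B * A = 1" by blast
  have "1 * (1 + gmat c) * B \<in> gam_mats" using gam_mult[OF B(1)] gam_mats.intros by blast
  moreover have "A * ginv c * ((1 + gmat c) * B) = A * (ginv c * (1 + gmat c)) * B"
    by (simp only: mult.assoc)
  moreover have "(1 + gmat c) * B * (A * ginv c) = (1 + gmat c) * (B * A) * ginv c"
    by (simp only: mult.assoc)
  ultimately show ?case using B by (intro bexI[of _ "(1 + gmat c) * B"]) (simp_all only: ginv mult_1_right mult_1_left)
qed

text \<open>The words in \<open>1 + x\<close>, \<open>1 + y\<close> and their inverses get a type of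
  their own, so that the additive group class and the commutator calculus apply; \<open>rep\<close>
  turns sums into matrix products.\<close>

typedef gam = gam_mats morphisms rep Gam
  using gam_one by blast

instantiation gam :: group_add
begin

definition "0 = Gam 1"
definition "a + b = Gam (rep a * rep b)"
definition "- a = Gam (SOME B. B \<in> gam_mats \<and> rep a * B = 1 \<and> B * rep a = 1)"
definition "a - b = a + - (b :: gam)"

lemma rep_0 [simp]: "rep 0 = 1"
  by (simp add: zero_gam_def Gam_inverse gam_one)

lemma rep_add: "rep (a + b) = rep a * rep b"
  by (simp add: plus_gam_def Gam_inverse gam_mult rep)

lemma rep_minus: "rep a * rep (- a) = 1" "rep (- a) * rep a = 1"
proof -
  define B where "B = (SOME B. B \<in> gam_mats \<and> rep a * B = 1 \<and> B * rep a = 1)"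
  have "B \<in> gam_mats \<and> rep a * B = 1 \<and> B * rep a = 1"
    unfolding B_def by (rule someI_ex) (use gam_inverse[OF rep[of a]] in blast)
  moreover have "- a = Gam B" by (simp add: uminus_gam_def B_def)
  ultimately show "rep a * rep (- a) = 1" "rep (- a) * rep a = 1"
    by (simp_all add: Gam_inverse)
qed

lemma rep_diff: "rep (a - b) = rep a * rep (- b)"
  by (simp add: minus_gam_def rep_add)

instance
proof
  fix a b c :: gam
  show "a + b + c = a + (b + c)" "0 + a = a" "a + 0 = a" "- a + a = 0" "a + - b = a - b"
    by (simp_all add: rep_inject[symmetric] rep_add rep_minus mult.assoc minus_gam_def)
qed

end

lemma rep_minus_left: "rep a * (rep (- a) * B) = B" "rep (- a) * (rep a * B) = B"
  by (simp_all add: rep_minus flip: mult.assoc)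

definition gx :: "letter \<Rightarrow> gam" where
  "gx c = Gam (1 + gmat c)"

lemma rep_gx: "rep (gx c) = 1 + gmat c"
proof -
  have "1 * (1 + gmat c) \<in> gam_mats" by (intro gam_mats.intros)
  then show ?thesis by (simp add: gx_def Gam_inverse)
qed

lemma rep_minus_gx: "rep (- gx c) = ginv c"
proof -
  have "rep (- gx c) = rep (- gx c) * (rep (gx c) * ginv c)"
    unfolding rep_gx ginv by simp
  then show ?thesis by (simp add: rep_minus_left)
qed

lemma gen_gx: "gen {gx gen_x, gx gen_y} = UNIV"
proof -
  have gx: "gx c \<in> gen {gx gen_x, gx gen_y}" for c
    by (cases c) (auto intro: gen_base)
  have "\<exists>a\<in>gen {gx gen_x, gx gen_y}. rep a = A" if "A \<in> gam_mats" for A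
    using that
  proof (induction rule: gam_mats.induct)
    case gam_one
    then show ?case by (intro bexI[of _ 0]) (simp_all add: gen_zero)
  next
    case (gam_gmat A c)
    then obtain a where "a \<in> gen {gx gen_x, gx gen_y}" "rep a = A" by blast
    then show ?case using gx[of c] by (intro bexI[of _ "a + gx c"]) (auto simp: rep_add rep_gx intro: gen_add)
  next
    case (gam_ginv A c)
    then obtain a where "a \<in> gen {gx gen_x, gx gen_y}" "rep a = A" by blast
    then show ?case using gx[of c]
      by (intro bexI[of _ "a + - gx c"] gen_add gen_minus) (simp_all only: rep_add rep_minus_gx)
  qed
  then have "a \<in> gen {gx gen_x, gx gen_y}" for a
    using rep[of a] rep_inject by metis
  then show ?thesis by blast
qed

section \<open>Congruence subgroups and leading terms\<close>

definition adicU :: "int \<Rightarrow> nat \<Rightarrow> gam set" where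
  "adicU P n = {g. rep g - 1 \<in> mfil P n}"

lemma nsubgrp_U: "nsubgrp (adicU P n)"
  unfolding nsubgrp_def subgrp_def
proof (intro conjI ballI allI)
  show "0 \<in> adicU P n" by (simp add: adicU_def)
  fix a assume a: "a \<in> adicU P n"
  have "rep (- a) - 1 = - (rep (- a) * (rep a - 1))"
    by (simp add: right_diff_distrib rep_minus)
  then show "- a \<in> adicU P n" using a by (simp add: adicU_def mfil_minus mfil_mult_left)
  show "g + a - g \<in> adicU P n" for g
  proof -
    have "rep (g + a - g) - 1 = rep g * (rep a - 1) * rep (- g)"
      by (simp add: right_diff_distrib left_diff_distrib rep_minus rep_add rep_diff)
    then show ?thesis using a by (simp add: adicU_def mfil_mult_left mfil_mult_right)
  qed
  fix b assume b: "b \<in> adicU P n"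
  have "rep (a + b) - 1 = (rep a - 1) * rep b + (rep b - 1)"
    by (simp add: left_diff_distrib rep_add)
  then have "rep (a + b) - 1 = (rep a - 1) * rep b + (rep b - 1)" by simp
  then show "a + b \<in> adicU P n" using a b unfolding adicU_def mem_Collect_eq
    by (simp only: mfil_add mfil_mult_right)
qed

lemma gam_U_1: "a \<in> adicU P (Suc 0)"
proof -
  have "rep (gx c) - 1 \<in> mfil P 1" for c
    using mfil_0_mono[OF gmat_fil[of c]] by (simp add: rep_gx)
  then have "{gx gen_x, gx gen_y} \<subseteq> adicU P 1" by (auto simp: adicU_def)
  then have "gen {gx gen_x, gx gen_y} \<subseteq> adicU P 1" by (intro gen_least nsubgrpD(1)[OF nsubgrp_U])
  then show ?thesis by (auto simp: gen_gx)
qed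

lemma U_antimono: "a \<in> adicU P n \<Longrightarrow> P' dvd P \<Longrightarrow> m \<le> n \<Longrightarrow> a \<in> adicU P' m"
  unfolding adicU_def by (auto intro: mfil_antimono)

text \<open>With a, b the two matrices, the commutator is 1 + (a b - b a) times the product of the
  inverses, and the identity matrix drops out of the bracket. This is why group commutators have Lie
  brackets as leading terms.\<close>

lemma rep_comm:
  "rep (comm a b) = 1 + ((rep a - 1) * (rep b - 1) - (rep b - 1) * (rep a - 1)) * (rep (- a) * rep (- b))"
proof -
  have "(rep a - 1) * (rep b - 1) - (rep b - 1) * (rep a - 1) = rep a * rep b - rep b * rep a"
    by (simp add: algebra_simps)
  moreover have "rep b * rep a * (rep (- a) * rep (- b)) = 1"
    by (simp add: mult.assoc rep_minus rep_minus_left)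
  ultimately show ?thesis
    by (simp add: left_diff_distrib comm_def rep_add rep_diff mult.assoc)
qed

lemma comm_U: "a \<in> adicU P i \<Longrightarrow> b \<in> adicU P j \<Longrightarrow> comm a b \<in> adicU P (i + j)"
  using mfil_mult[of "rep a - 1" P i "rep b - 1" j] mfil_mult[of "rep b - 1" P j "rep a - 1" i]
  by (simp add: adicU_def rep_comm mfil_mult_right mfil_diff add.commute)

lemma lcs_U: "lcs n \<subseteq> adicU 0 n"
proof (induction n)
  case 0
  then show ?case by (simp add: adicU_def)
next
  case (Suc n)
  show ?case
  proof (cases n)
    case 0
    then show ?thesis using gam_U_1[of _ 0] by auto
  next
    case (Suc m)
    have "comm h k \<in> adicU 0 (Suc n)" if "h \<in> lcs n" for h k
      using comm_U[of h 0 n k "Suc 0"] gam_U_1 Suc.IH that by auto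
    then show ?thesis unfolding Suc lcs.simps
      by (intro gen_least nsubgrpD(1)[OF nsubgrp_U]) (auto simp: Suc)
  qed
qed

definition lead :: "nat \<Rightarrow> gam \<Rightarrow> var mps mat2 \<Rightarrow> bool" where
  "lead n g L \<longleftrightarrow> L \<in> mfil 0 n \<and> rep g - 1 - L \<in> mfil 0 (Suc n)"

lemma lead_U: "lead n g L \<Longrightarrow> rep g - 1 \<in> mfil 0 n"
  using mfil_add[of "rep g - 1 - L" 0 n L] mfil_antimono[of "rep g - 1 - L" 0 "Suc n" 0 n]
  by (simp add: lead_def)

lemma lead_0 [simp]: "lead n 0 0"
  by (simp add: lead_def)

lemma lead_add:
  assumes "Suc 0 \<le> n" "lead n a L" "lead n b M"
  shows "lead n (a + b) (L + M)"
proof -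
  have "rep (a + b) - 1 - (L + M) =
      (rep a - 1 - L) + (rep b - 1 - M) + (rep a - 1) * (rep b - 1)"
    by (simp add: rep_add algebra_simps)
  moreover have "(rep a - 1) * (rep b - 1) \<in> mfil 0 (Suc n)"
    using mfil_mult3[OF lead_U lead_U, OF assms(2,3), of "Suc n"] assms(1) by simp
  ultimately show ?thesis using assms unfolding lead_def by (simp only: mfil_add simp_thms)
qed

lemma lead_minus:
  assumes "Suc 0 \<le> n" "lead n a L"
  shows "lead n (- a) (- L)"
proof -
  have "rep (- a) - 1 - - L = - (rep a - 1 - L) + (rep (- a) - 1) * - (rep a - 1)"
    by (simp add: algebra_simps rep_minus)
  moreover have "rep (- a) - 1 \<in> mfil 0 1" using gam_U_1[of "- a" 0] by (simp add: adicU_def)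
  then have "(rep (- a) - 1) * - (rep a - 1) \<in> mfil 0 (Suc n)"
    using mfil_mult3[OF _ mfil_minus[OF lead_U[OF assms(2)]]] by simp
  ultimately show ?thesis using assms unfolding lead_def
    by (simp only: mfil_add mfil_minus simp_thms)
qed

lemma lead_nmul: "Suc 0 \<le> n \<Longrightarrow> lead n a L \<Longrightarrow> lead n (nmul k a) (of_nat k * L)"
  by (induction k) (auto simp: distrib_right intro: lead_add)

lemma lead_lin:
  assumes "Suc 0 \<le> n" "distinct is" "\<And>i. i \<in> set is \<Longrightarrow> lead n (e i) (L i)"
  shows "lead n (lin e \<mu> is) (\<Sum>i\<in>set is. of_nat (\<mu> i) * L i)"
  using assms(2,3) by (induction "is") (auto intro!: lead_add lead_nmul assms(1))

lemma mult_unit_mfil: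
  assumes "A \<in> mfil 0 n" "B - 1 \<in> mfil 0 1" "A - C \<in> mfil 0 (Suc n)"
  shows "A * B - C \<in> mfil 0 (Suc n)"
proof -
  have "A * (B - 1) \<in> mfil 0 (Suc n)" using mfil_mult[OF assms(1,2)] by simp
  from mfil_add[OF this assms(3)] show ?thesis by (simp add: right_diff_distrib)
qed

lemma rep_unit: "rep a * rep b - 1 \<in> mfil P 1"
  using gam_U_1[of "a + b" P] by (simp add: adicU_def rep_add)

lemma mfil_bracket:
  assumes "A \<in> mfil P i" "A - L \<in> mfil P (Suc i)" "B \<in> mfil P j" "B - M \<in> mfil P (Suc j)"
    "L \<in> mfil P i" "M \<in> mfil P j"
  shows "(A * B - B * A) - (L * M - M * L) \<in> mfil P (Suc (i + j))"
proof -
  have "(A * B - B * A) - (L * M - M * L) =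
      ((A - L) * B + L * (B - M)) - (B * (A - L) + (B - M) * L)"
    by (simp add: algebra_simps)
  then show ?thesis
    using mfil_mult[OF assms(2,3)] mfil_mult[OF assms(5,4)] mfil_mult[OF assms(3,2)] mfil_mult[OF assms(4,5)]
    by (simp add: mfil_add mfil_diff add.commute)
qed

lemma lead_comm:
  assumes "lead i a L" "lead j b M"
  shows "lead (i + j) (comm a b) (L * M - M * L)"
proof -
  let ?C = "(rep a - 1) * (rep b - 1) - (rep b - 1) * (rep a - 1)"
  have "?C - (L * M - M * L) \<in> mfil 0 (Suc (i + j))"
    using assms lead_U by (intro mfil_bracket) (auto simp: lead_def)
  moreover have "?C \<in> mfil 0 (i + j)"
    using mfil_mult[OF lead_U lead_U, OF assms] mfil_mult[OF lead_U lead_U, OF assms(2,1)]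
    by (simp add: mfil_diff add.commute)
  ultimately have "?C * (rep (- a) * rep (- b)) - (L * M - M * L) \<in> mfil 0 (Suc (i + j))"
    using rep_unit by (intro mult_unit_mfil)
  moreover have "L * M - M * L \<in> mfil 0 (i + j)"
    using mfil_mult[of L 0 i M j] mfil_mult[of M 0 j L i] assms
    by (simp add: lead_def mfil_diff add.commute)
  ultimately show ?thesis by (simp add: lead_def rep_comm)
qed

lemma lead_gx: "lead (Suc 0) (gx c) (gmat c)"
  using gmat_fil[of c] by (simp add: lead_def rep_gx)

lemma lead_comm_gx: "lead n b M \<Longrightarrow> lead (Suc n) (comm (gx c) b) (gmat c * M - M * gmat c)"
  using lead_comm[OF lead_gx, of n b M c] by simp

text \<open>A single index for divisibility and degree yields a decreasing sequence of normal
  subgroups that is still cofinal among the congruence subgroups for powers of p.\<close>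

definition adicV :: "nat \<Rightarrow> nat \<Rightarrow> gam set" where
  "adicV p k = adicU (int p ^ k) k"

lemma nsubgrp_V: "nsubgrp (adicV p k)"
  by (simp add: adicV_def nsubgrp_U)

lemma V_antimono: "a \<in> adicV p k \<Longrightarrow> l \<le> k \<Longrightarrow> a \<in> adicV p l"
  unfolding adicV_def by (erule U_antimono) (auto intro: le_imp_power_dvd)

text \<open>For a = 1 + B the power a^N is 1 + N B up to terms of degree \<open>t + 1\<close>, and
  \<open>P\<close> divides N B. So the multiple moves up one degree.\<close>

lemma nmul_U:
  assumes "a \<in> adicU P t" "Suc 0 \<le> t" "P dvd int N"
  shows "nmul N a \<in> adicU P (Suc t)"
proof -
  define B where "B = rep a - 1"
  have B: "B \<in> mfil P t" using assms by (simp add: adicU_def B_def)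
  have "rep (nmul k a) - 1 - of_nat k * B \<in> mfil P (Suc t)" for k
  proof (induction k)
    case (Suc k)
    have 1: "rep (nmul (Suc k) a) - 1 - of_nat (Suc k) * B =
        (rep (nmul k a) - 1 - of_nat k * B) + B * (rep (nmul k a) - 1)"
      by (simp add: rep_add B_def algebra_simps)
    have "nmul k a \<in> adicU P t" using assms nmul_in nsubgrpD(1)[OF nsubgrp_U] by blast
    then have "B * (rep (nmul k a) - 1) \<in> mfil P (Suc t)"
      using mfil_mult3[OF B] assms(2) by (simp add: adicU_def)
    with Suc show ?case unfolding 1 by (intro mfil_add)
  qed simp
  moreover obtain c where "int N = P * c" using assms(3) by blast
  then have "of_nat N * B = of_int P * (of_int c * B)"
    by (metis of_int_mult of_int_of_nat_eq mult.assoc)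
  then have "of_nat N * B \<in> mfil P (Suc t)" by (simp add: mfil_of_int_mult)
  ultimately have "(rep (nmul N a) - 1 - of_nat N * B) + of_nat N * B \<in> mfil P (Suc t)"
    by (intro mfil_add)
  then show ?thesis by (simp add: adicU_def)
qed

text \<open>Everything lies in degree 1, and each of the k factors \<open>p ^ k\<close> raises the
  degree by one by \<open>nmul_U\<close>; this is where the exponent \<open>k * k\<close>, used
  throughout, comes from.\<close>

lemma nmul_V: "nmul (p ^ (k * k)) a \<in> adicV p k"
proof -
  have "nmul ((p ^ k) ^ j) a \<in> adicU (int p ^ k) (Suc j)" for j
  proof (induction j)
    case (Suc j)
    then show ?case using nmul_U[OF Suc, of "p ^ k"] by (simp add: nmul_mult)
  qed (simp add: gam_U_1)
  from U_antimono[OF this[of k], of "int p ^ k" k] show ?thesis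
    by (simp add: adicV_def power_mult)
qed

definition lcsV :: "nat \<Rightarrow> nat \<Rightarrow> nat \<Rightarrow> gam set" where
  "lcsV p k n = {a + v | a v. a \<in> lcs n \<and> v \<in> adicV p k}"

lemma lcs_D: "a \<in> lcs n \<Longrightarrow> a \<in> lcsV p k n"
  using nsubgrp_mem(1)[OF nsubgrp_V] unfolding lcsV_def by force

lemma V_D: "a \<in> adicV p k \<Longrightarrow> a \<in> lcsV p k n"
  using nsubgrp_mem(1)[OF nsubgrp_lcs[of n]] unfolding lcsV_def by force

lemma D_antimono_level:
  assumes "a \<in> lcsV p k n" "l \<le> k"
  shows "a \<in> lcsV p l n"
  using assms V_antimono unfolding lcsV_def by blast

interpretation D: generated_nseries "lcsV p k" "gx gen_x" "gx gen_y" for p k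
  unfolding lcsV_def by (rule lcs_generated_nseries[OF nsubgrp_V gen_gx])

interpretation L: nseries "lcs :: nat \<Rightarrow> gam set"
  by unfold_locales (use nsubgrp_lcs lcs_Suc_subset comm_lcs in auto)

subsection \<open>The automorphism inverting the generators\<close>

definition zmat :: "var mps mat2" where
  "zmat = gmat gen_x * gmat gen_y - gmat gen_y * gmat gen_x"

text \<open>The product with \<open>x\<^sub>1\<^sub>1 y\<^sub>1\<^sub>2\<close> has the largest weight among the four terms of \<open>z\<^sub>1\<^sub>2\<close> when
  \<open>x\<^sub>1\<^sub>1\<close> and \<open>y\<^sub>1\<^sub>2\<close> have weight 1 and the other variables have weight 0.\<close>

lemma fil_cancel_z12:
  assumes "f * e12 zmat \<in> fil P (n + 2)"
  shows "f \<in> fil P n"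
proof -
  define x11 :: var where "x11 = (gen_x, 1, 1)"
  define x12 :: var where "x12 = (gen_x, 1, 2)"
  define x22 :: var where "x22 = (gen_x, 2, 2)"
  define y11 :: var where "y11 = (gen_y, 1, 1)"
  define y12 :: var where "y12 = (gen_y, 1, 2)"
  define y22 :: var where "y22 = (gen_y, 2, 2)"
  have ne: "x11 \<noteq> x12" "x11 \<noteq> x22" "x11 \<noteq> y11" "x11 \<noteq> y12" "x11 \<noteq> y22" "y12 \<noteq> x12" "y12 \<noteq> x22"
      "y12 \<noteq> y11" "y12 \<noteq> y22"
    by (auto simp: x11_def x12_def x22_def y11_def y12_def y22_def)
  have z: "f * e12 zmat = f * mmono {#x11, y12#} + f * mmono {#x12, y22#}
      - f * mmono {#y11, x12#} - f * mmono {#y12, x22#}"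
    by (simp add: zmat_def gmat_def mmono_mult_mmono x11_def x12_def x22_def y11_def y12_def y22_def
        add_mset_commute algebra_simps)
  define w where "w m = count m x11 + count m y12" for m :: "var multiset"
  have "P dvd mcoef f m" if "size m < n" for m
    using that
  \<comment> \<open>Descending induction on the weight: each of the other three products relates the
    coefficient at \<open>m\<close> only to coefficients at monomials of the same degree and larger
    weight, and the weight is at most the degree. The distinguished product has coefficient 1, so
    nothing is lost from \<open>P\<close>.\<close>
  proof (induction "size m - w m" arbitrary: m rule: less_induct)
    case less
    have other: "P dvd mcoef (f * mmono k) (m + {#x11, y12#})"
      if k: "size k = 2" "count k x11 + count k y12 < 2" for k
    proof (cases "k \<subseteq># m + {#x11, y12#}")
      case True
      define m' where "m' = m + {#x11, y12#} - k"
      have le: "count k v \<le> count (m + {#x11, y12#}) v" for v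
        by (rule mset_subset_eq_count[OF True])
      have s: "size m' = size m"
        using size_Diff_submset[OF True] k by (simp add: m'_def)
      have w1: "w m < w m'"
        using le[of x11] le[of y12] ne(4) ne(4)[symmetric] k unfolding w_def m'_def by simp
      have "count m' x11 + count m' y12 = size (filter_mset (\<lambda>v. v = x11 \<or> v = y12) m')"
      proof -
        have "filter_mset (\<lambda>v. v = x11 \<or> v = y12) m' = filter_mset (\<lambda>v. v = x11) m' + filter_mset (\<lambda>v. v = y12) m'"
          using ne by (intro multiset_eqI) auto
        then show ?thesis by (simp add: filter_eq_replicate_mset)
      qed
      then have "w m' \<le> size m'" unfolding w_def by (simp add: size_mset_mono)
      then have "P dvd mcoef f m'"
        using less.prems s w1 by (intro less.hyps) auto
      then show ?thesis using True by (simp add: mcoef_mult_mmono m'_def)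
    qed (simp add: mcoef_mult_mmono)
    have "P dvd mcoef (f * e12 zmat) (m + {#x11, y12#})"
      using assms less.prems by (auto simp: fil_def)
    moreover have "P dvd mcoef (f * mmono {#x12, y22#}) (m + {#x11, y12#})"
        "P dvd mcoef (f * mmono {#y11, x12#}) (m + {#x11, y12#})"
        "P dvd mcoef (f * mmono {#y12, x22#}) (m + {#x11, y12#})"
      by (rule other; use ne in auto)+
    moreover have "mcoef (f * mmono {#x11, y12#}) (m + {#x11, y12#}) = mcoef f m"
      by (simp add: mcoef_mult_mmono)
    moreover have "mcoef f m = mcoef (f * e12 zmat) (m + {#x11, y12#})
       - mcoef (f * mmono {#x12, y22#}) (m + {#x11, y12#})
       + mcoef (f * mmono {#y11, x12#}) (m + {#x11, y12#})
       + mcoef (f * mmono {#y12, x22#}) (m + {#x11, y12#})"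
      unfolding z using calculation(5) by simp
    ultimately show ?case by (metis dvd_add dvd_diff)
  qed
  then show ?thesis by (simp add: fil_def)
qed

text \<open>Modulo scalars, two matrices that commute with \<open>z\<close> are proportional to \<open>z\<close>.\<close>

lemma commutator_mfil:
  assumes A: "zmat * A - A * zmat \<in> mfil P (n + 4)" and B: "zmat * B - B * zmat \<in> mfil P (n + 4)"
  shows "A * B - B * A \<in> mfil P n"
proof -
  define a11 a12 a21 a22 where "a11 = e11 A" and "a12 = e12 A" and "a21 = e21 A" and "a22 = e22 A"
  define b11 b12 b21 b22 where "b11 = e11 B" and "b12 = e12 B" and "b21 = e21 B" and "b22 = e22 B"
  define c11 c12 c21 c22 where "c11 = e11 zmat" and "c12 = e12 zmat" and "c21 = e21 zmat" and "c22 = e22 zmat"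
  note defs = a11_def a12_def a21_def a22_def b11_def b12_def b21_def b22_def c11_def c12_def c21_def c22_def
  define p1 p2 p3 where "p1 = c12 * a21 - a12 * c21" and "p2 = (c11 - c22) * a12 - (a11 - a22) * c12"
    and "p3 = c21 * (a11 - a22) - a21 * (c11 - c22)"
  define q1 q2 q3 where "q1 = c12 * b21 - b12 * c21" and "q2 = (c11 - c22) * b12 - (b11 - b22) * c12"
    and "q3 = c21 * (b11 - b22) - b21 * (c11 - c22)"
  have pe: "p1 = e11 (zmat * A - A * zmat)" "p2 = e12 (zmat * A - A * zmat)" "p3 = e21 (zmat * A - A * zmat)"
    unfolding p1_def p2_def p3_def defs mat2_sel by (simp_all only: ring_distribs) (simp_all add: mult.commute)
  have qe: "q1 = e11 (zmat * B - B * zmat)" "q2 = e12 (zmat * B - B * zmat)" "q3 = e21 (zmat * B - B * zmat)"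
    unfolding q1_def q2_def q3_def defs mat2_sel by (simp_all only: ring_distribs) (simp_all add: mult.commute)
  have p: "p1 \<in> fil P (n + 4)" "p2 \<in> fil P (n + 4)" "p3 \<in> fil P (n + 4)"
    using A unfolding pe mfil_def by blast+
  have q: "q1 \<in> fil P (n + 4)" "q2 \<in> fil P (n + 4)" "q3 \<in> fil P (n + 4)"
    using B unfolding qe mfil_def by blast+
  have cancel: "f \<in> fil P m" if "f * c12 \<in> fil P (m + 2)" for f m
    using that fil_cancel_z12[of f P m] unfolding c12_def by blast
  have "n + 2 + 2 = n + 4" by simp
  then have cancel4: "f \<in> fil P (n + 2)" if "f * c12 \<in> fil P (n + 4)" for f
    using that cancel[of f "n + 2"] by presburger
  have "(a12 * b21 - b12 * a21) * c12 = a12 * q1 - b12 * p1"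
    by (simp add: p1_def q1_def algebra_simps)
  moreover have "a12 * q1 - b12 * p1 \<in> fil P (n + 4)"
    using p q by (simp add: fil_diff fil_mult_left)
  ultimately have r1: "a12 * b21 - b12 * a21 \<in> fil P (n + 2)"
    by (simp only: cancel4)
  have "((a11 - a22) * b12 - (b11 - b22) * a12) * c12 = q2 * a12 - p2 * b12"
    by (simp add: p2_def q2_def algebra_simps)
  moreover have "q2 * a12 - p2 * b12 \<in> fil P (n + 4)"
    using p q by (simp add: fil_diff fil_mult_right)
  ultimately have r2: "(a11 - a22) * b12 - (b11 - b22) * a12 \<in> fil P (n + 2)"
    by (simp only: cancel4)
  have le: "f \<in> fil P (n + 2)" if "f \<in> fil P (n + 4)" for f
    using that by (rule fil_antimono) auto
  \<comment> \<open>Two cancellations of \<open>c12\<close>, each costing two degrees, are needed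
    for this entry, because it is reached through the upper right one; hence the loss of 4 in the
    statement.\<close>
  have "(a21 * (b11 - b22) - b21 * (a11 - a22)) * c12 =
      p1 * (b11 - b22) - q1 * (a11 - a22) - c21 * ((a11 - a22) * b12 - (b11 - b22) * a12)"
    by (simp add: p1_def q1_def algebra_simps)
  moreover have "\<dots> \<in> fil P (n + 2)"
    using le[OF p(1)] le[OF q(1)] r2 by (intro fil_diff) (simp_all only: fil_mult_right fil_mult_left)
  ultimately have r3: "a21 * (b11 - b22) - b21 * (a11 - a22) \<in> fil P n"
    by (simp only: cancel)
  have "A * B - B * A = Mat2 (a12 * b21 - b12 * a21) ((a11 - a22) * b12 - (b11 - b22) * a12)
      (a21 * (b11 - b22) - b21 * (a11 - a22)) (- (a12 * b21 - b12 * a21))"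
    by (simp add: mat2_eq_iff defs algebra_simps)
  moreover have "a12 * b21 - b12 * a21 \<in> fil P n" "(a11 - a22) * b12 - (b11 - b22) * a12 \<in> fil P n"
    using r1 r2 by (auto elim!: fil_antimono)
  ultimately show ?thesis using r3 fil_minus[of "a12 * b21 - b12 * a21"]
    by (simp only: mfil_def mat2.sel mem_Collect_eq simp_thms)
qed

text \<open>\<open>twist g h\<close> expresses that \<open>h\<close> is \<open>z g z\<^sup>-\<^sup>1 / det g\<close>, without dividing by \<open>z\<close>.\<close>

definition twist :: "gam \<Rightarrow> gam \<Rightarrow> bool" where
  "twist g h \<longleftrightarrow> zmat * rep g = scal (det2 (rep g)) * rep h * zmat \<and>
     zmat * rep h = scal (det2 (rep h)) * rep g * zmat"

lemma twist_sym: "twist g h \<Longrightarrow> twist h g"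
  by (simp add: twist_def)

lemma twist_add:
  assumes "twist a a'" "twist b b'"
  shows "twist (a + b) (a' + b')"
proof -
  have "zmat * rep (a + b) = scal (det2 (rep (a + b))) * rep (a' + b') * zmat"
    if "zmat * rep a = scal (det2 (rep a)) * rep a' * zmat"
      "zmat * rep b = scal (det2 (rep b)) * rep b' * zmat" for a a' b b'
  proof -
    have "zmat * rep (a + b) = zmat * rep a * rep b" by (simp add: rep_add mult.assoc)
    also have "\<dots> = scal (det2 (rep a)) * rep a' * (zmat * rep b)" by (simp add: that(1) mult.assoc)
    also have "\<dots> = scal (det2 (rep (a + b))) * rep (a' + b') * zmat"
      by (simp only: that(2) rep_add mult.assoc det2_mult scal_hom scal_commute_left[of "rep _"])
    finally show ?thesis .
  qed
  then show ?thesis using assms by (auto simp: twist_def)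
qed

lemma det2_rep_minus: "det2 (rep a) * det2 (rep (- a)) = 1"
  by (simp add: rep_minus flip: det2_mult)

lemma twist_inverse:
  assumes "z * A = scal d * B * z" "A * A' = 1" "B' * B = 1" "d * d' = 1"
  shows "z * A' = scal d' * B' * z"
proof -
  have "scal d' * B' * z = scal d' * (B' * (z * A * A'))"
    using assms(2) by (simp add: mult.assoc)
  also have "\<dots> = scal d' * (B' * (scal d * (B * z * A')))"
    by (simp only: assms(1) mult.assoc)
  also have "\<dots> = scal (d' * d) * (B' * B) * z * A'"
    by (simp only: scal_commute_left[of B'] mult.assoc scal_hom)
  also have "\<dots> = z * A'"
    using assms(3,4) by (simp add: mult.commute[of d'] scal_hom)
  finally show ?thesis by simp
qed

lemma twist_minus:
  assumes "twist a a'"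
  shows "twist (- a) (- a')"
  using assms twist_inverse[OF _ rep_minus(1) rep_minus(2) det2_rep_minus] by (auto simp: twist_def)

lemma twist_0: "twist 0 0"
  by (simp add: twist_def scal_hom)

lemma twist_comm: "twist a a' \<Longrightarrow> twist b b' \<Longrightarrow> twist (comm a b) (comm a' b')"
  unfolding comm_def diff_conv_add_uminus by (intro twist_add twist_minus)

text \<open>The traces of z, z x and z y vanish, which for 2 by 2 matrices gives z x + x z = tr(x)
  z, and likewise for y. Hence moving z past a generator replaces it by its adjugate, that is, by
  its inverse times its determinant.\<close>

lemma zmat_gx: "zmat * rep (gx c) = adj2 (rep (gx c)) * zmat"
proof -
  have "(A * B - B * A) * (1 + A) = adj2 (1 + A) * (A * B - B * A)"
    "(A * B - B * A) * (1 + B) = adj2 (1 + B) * (A * B - B * A)" for A B :: "var mps mat2"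
    by (simp_all add: mat2_eq_iff adj2_def algebra_simps)
  then show ?thesis by (cases c) (simp_all add: zmat_def rep_gx)
qed

lemma twist_gx: "twist (gx c) (- gx c)"
proof -
  let ?X = "rep (gx c)" and ?Y = "rep (- gx c)"
  have adj: "adj2 ?X = scal (det2 ?X) * ?Y"
  proof -
    have "adj2 ?X = adj2 ?X * (?X * ?Y)" by (simp add: rep_minus)
    then show ?thesis by (simp add: mult_adj2 flip: mult.assoc)
  qed
  then have 1: "zmat * ?X = scal (det2 ?X) * ?Y * zmat" by (simp add: zmat_gx)
  from twist_inverse[OF this rep_minus(1) rep_minus(1) det2_rep_minus]
  show ?thesis using 1 by (simp add: twist_def)
qed

text \<open>The action on the n-th graded piece of the automorphism that inverts both
  generators.\<close>

definition sgn_gam :: "nat \<Rightarrow> gam \<Rightarrow> gam" where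
  "sgn_gam n g = (if even n then g else - g)"

lemma sgn_gam_add: 
  assumes "Suc 0 \<le> n" "a \<in> lcs n" "b \<in> lcs n"
  shows "L.eqv (Suc n) (sgn_gam n a + sgn_gam n b) (sgn_gam n (a + b))"
proof -
  have "comm b a \<in> lcs (Suc n)" by (rule L.comm_X[OF assms(2)])
  from L.eqv_minus[OF L.eqv_commute[OF this]] show ?thesis
    by (simp add: sgn_gam_def minus_add del: add_uminus_conv_diff)
qed

lemma twist_exists_1: "\<exists>h. twist g h \<and> L.eqv (Suc (Suc 0)) h (- g)"
proof -
  have "g \<in> gen {gx gen_x, gx gen_y}" by (simp add: gen_gx)
  then show ?thesis
  proof (induction rule: gen.induct)
    case gen_zero
    show ?case by (intro exI[of _ 0]) (simp add: twist_0)
  next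
    case (gen_base a)
    then obtain c where "a = gx c" by auto
    then show ?case by (intro exI[of _ "- a"]) (simp add: twist_gx)
  next
    case (gen_add a b)
    then obtain a' b' where *: "twist a a'" "L.eqv (Suc (Suc 0)) a' (- a)"
      "twist b b'" "L.eqv (Suc (Suc 0)) b' (- b)" by auto
    have "L.eqv (Suc (Suc 0)) (a' + b') (- a + - b)"
      using * by (intro L.eqv_add)
    also have "L.eqv (Suc (Suc 0)) (- a + - b) (- (a + b))"
      using sgn_gam_add[of "Suc 0" a b] by (simp add: sgn_gam_def)
    finally show ?case using * twist_add by blast
  next
    case (gen_minus a)
    then obtain a' where *: "twist a a'" "L.eqv (Suc (Suc 0)) a' (- a)" by auto
    then have "twist (- a) (- a')" "L.eqv (Suc (Suc 0)) (- a') (- (- a))"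
      using L.eqv_minus[OF *(2)] twist_minus by auto
    then show ?case by blast
  qed
qed

text \<open>Each commutation with an element of weight 1, itself sent to its inverse modulo weight
  2, contributes one more sign. Working with the relation \<open>twist\<close> avoids showing that
  the automorphism is well defined.\<close>

lemma twist_exists:
  "Suc 0 \<le> n \<Longrightarrow> g \<in> lcs n \<Longrightarrow> \<exists>h. twist g h \<and> L.eqv (Suc n) h (sgn_gam n g)"
proof (induction n arbitrary: g rule: nat_induct_at_least)
  case base
  show ?case using twist_exists_1[of g] by (simp add: sgn_gam_def)
next
  case (Suc n)
  then obtain m where m: "n = Suc m" by (cases n) auto
  have lcs_eq: "lcs (Suc n) = gen {comm h k | h k. h \<in> lcs n}" by (simp add: m)
  have "\<exists>h'. twist h h' \<and> L.eqv (Suc (Suc n)) h' (sgn_gam (Suc n) h)"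
    if "h \<in> gen {comm h k | h k. h \<in> lcs n}" for h
    using that
  proof (induction rule: gen.induct)
    case gen_zero
    show ?case by (intro exI[of _ 0]) (simp add: twist_0 sgn_gam_def)
  next
    case (gen_base a)
    then obtain h k where a: "a = comm h k" "h \<in> lcs n" by auto
    obtain h' where h': "twist h h'" "L.eqv (Suc n) h' (sgn_gam n h)"
      using Suc.IH a(2) by blast
    obtain k' where k': "twist k k'" "L.eqv (Suc (Suc 0)) k' (- k)"
      using twist_exists_1 by blast
    have sh: "sgn_gam n h \<in> lcs n"
      using a by (auto simp: sgn_gam_def intro: nsubgrp_mem(3)[OF nsubgrp_lcs])
    have "L.eqv (Suc (n + Suc 0)) (comm h' k') (comm (sgn_gam n h) k')"
      by (rule L.comm_cong_left[OF h'(2)]) auto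
    also have "L.eqv (Suc (n + Suc 0)) \<dots> (comm (sgn_gam n h) (- k))"
      by (rule L.comm_cong_right[OF k'(2) sh Suc.hyps[unfolded One_nat_def]])
    also have "L.eqv (Suc (n + Suc 0)) \<dots> (- comm (sgn_gam n h) k)"
      using Suc.hyps by (intro L.comm_minus_right[OF _ sh]) auto
    also have "L.eqv (Suc (n + Suc 0)) \<dots> (sgn_gam (Suc n) (comm h k))"
    proof (cases "even n")
      case False
      have "L.eqv (Suc (n + Suc 0)) (comm (- h) k) (- comm h k)"
        using Suc.hyps a by (intro L.comm_minus_left) auto
      from L.eqv_minus[OF this] show ?thesis using False by (simp add: sgn_gam_def)
    qed (simp add: sgn_gam_def)
    finally have "L.eqv (Suc (Suc n)) (comm h' k') (sgn_gam (Suc n) a)" by (simp add: a)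
    then show ?case using twist_comm[OF h'(1) k'(1)] a by blast
  next
    case (gen_add a b)
    then obtain a' b' where *: "twist a a'" "L.eqv (Suc (Suc n)) a' (sgn_gam (Suc n) a)"
      "twist b b'" "L.eqv (Suc (Suc n)) b' (sgn_gam (Suc n) b)" by auto
    have "L.eqv (Suc (Suc n)) (a' + b') (sgn_gam (Suc n) a + sgn_gam (Suc n) b)"
      using * by (intro L.eqv_add)
    also have "L.eqv (Suc (Suc n)) \<dots> (sgn_gam (Suc n) (a + b))"
      by (rule sgn_gam_add[OF _ gen_add(1,2)[folded lcs_eq]]) simp
    finally show ?case using * twist_add by blast
  next
    case (gen_minus a)
    then obtain a' where *: "twist a a'" "L.eqv (Suc (Suc n)) a' (sgn_gam (Suc n) a)" by auto
    then have "twist (- a) (- a')" "L.eqv (Suc (Suc n)) (- a') (sgn_gam (Suc n) (- a))"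
      using L.eqv_minus[OF *(2)] twist_minus by (auto simp: sgn_gam_def)
    then show ?case by blast
  qed
  then show ?case using Suc.prems lcs_eq by blast
qed

text \<open>Hence on commutators the determinant in \<open>twist\<close> disappears, and
  \<open>twist\<close> becomes conjugation by z.\<close>

lemma det2_lcs:
  assumes "g \<in> lcs (Suc (Suc 0))"
  shows "det2 (rep g) = 1"
proof -
  have "det2 (rep (comm a b)) = 1" for a b
  proof -
    have "det2 (rep (comm a b)) =
        (det2 (rep a) * det2 (rep (- a))) * (det2 (rep b) * det2 (rep (- b)))"
      by (simp add: comm_def rep_add rep_diff det2_mult algebra_simps)
    then show ?thesis by (simp add: det2_rep_minus)
  qed
  moreover have "det2 (rep (- a)) = 1" if "det2 (rep a) = 1" for a
    using det2_rep_minus[of a] that by simp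
  ultimately have "lcs (Suc (Suc 0)) \<subseteq> {g. det2 (rep g) = 1}"
    unfolding lcs.simps by (intro gen_least) (auto simp: subgrp_def rep_add det2_mult)
  with assms show ?thesis by blast
qed

lemma nmul_minus: "nmul n (- a) = - nmul n a"
  by (induction n) (simp_all add: minus_add nmul_commute[symmetric] del: add_uminus_conv_diff)

text \<open>If \<open>u = - v + h\<close> where \<open>h\<close> is the image of \<open>v\<close> under the automorphism, then \<open>v + u/2\<close>
  would be a fixed point; \<open>1/2\<close> is replaced by a \<open>p\<close>-adic approximation.\<close>

lemma almost_commuting_z:
  assumes p: "odd p" and i: "Suc 0 \<le> i" and v: "v \<in> lcs (2 * i)"
  shows "\<exists>v'. L.eqv (Suc (2 * i)) v' v \<and> zmat * rep v' - rep v' * zmat \<in> mfil (int p ^ k) k"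
proof -
  obtain h where h: "twist v h" "L.eqv (Suc (2 * i)) h v"
    using twist_exists[of "2 * i" v] v i by (auto simp: sgn_gam_def)
  define u where "u = - v + h"
  have u: "u \<in> lcs (Suc (2 * i))"
    using nsubgrpD(3)[OF nsubgrp_lcs, of "h - v" _ v] h(2)
    by (simp add: L.eqv_def u_def group_norm del: add_uminus_conv_diff)
  \<comment> \<open>\<open>twist\<close> is symmetric, so it exchanges \<open>v\<close> and
    \<open>h\<close> and therefore sends \<open>- v + h\<close> to \<open>- h + v\<close>.\<close>
  have tu: "twist u (- u)"
    using twist_add[OF twist_minus[OF h(1)] twist_sym[OF h(1)]] by (simp add: u_def minus_add)
  \<comment> \<open>\<open>N\<close> is odd and annihilates modulo \<open>adicV p k\<close>, so
    \<open>Suc r = (N + 1) / 2\<close> plays the role of 1/2: twice \<open>s\<close> is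
    \<open>u + e\<close>, where \<open>e\<close> is negligible.\<close>
  define N where "N = p ^ (k * k)"
  have "odd N" using p by (simp add: N_def)
  then obtain r where N: "N = Suc (2 * r)" using oddE by fastforce
  define s where "s = nmul (Suc r) u"
  define e where "e = nmul N u"
  have ts: "twist s (- s)"
    using tu by (simp only: s_def flip: nmul_minus) (rule nat.induct[of _ "Suc r"], simp add: twist_0, simp add: twist_add)
  have e: "e \<in> adicV p k" by (simp add: e_def N_def nmul_V)
  have "s \<in> lcs (Suc (2 * i))" unfolding s_def using u nmul_in nsubgrpD(1)[OF nsubgrp_lcs] by blast
  then have v': "L.eqv (Suc (2 * i)) (v + s) v"
    unfolding L.eqv_def using nsubgrpD(2)[OF nsubgrp_lcs] by blast
  have es: "u - s = s - e"
  proof -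
    have 1: "s = nmul r u + u" by (simp add: s_def nmul_commute)
    have "N = r + Suc r" by (simp add: N)
    then have 2: "e = nmul r u + s" by (simp only: e_def s_def nmul_add)
    have "u - s = - nmul r u" by (simp add: 1 group_norm del: add_uminus_conv_diff)
    also have "\<dots> = s - e" by (simp add: 2 group_norm del: add_uminus_conv_diff)
    finally show ?thesis .
  qed
  have "h = v + u" by (simp add: u_def flip: add.assoc)
  then have "twist (v + s) (v + s - e)"
    using twist_add[OF h(1) ts] es by (simp add: group_norm del: add_uminus_conv_diff)
  moreover have "det2 (rep (v + s)) = 1"
  proof (rule det2_lcs)
    have "v + s \<in> lcs (2 * i)" using L.eqv_mem[OF L.eqv_le[OF v'] v] by simp
    then show "v + s \<in> lcs (Suc (Suc 0))" by (rule L.D_mem_le) (use i in simp)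
  qed
  ultimately have "zmat * rep (v + s) = rep (v + s - e) * zmat"
    by (simp add: twist_def scal_hom)
  then have "zmat * rep (v + s) - rep (v + s) * zmat = rep (v + s) * (rep (- e) - 1) * zmat"
    by (simp add: rep_diff algebra_simps)
  moreover have "rep (- e) - 1 \<in> mfil (int p ^ k) k"
    using e nsubgrp_mem(3)[OF nsubgrp_V] unfolding adicV_def adicU_def by blast
  ultimately show ?thesis using v' mfil_mult_left mfil_mult_right by metis
qed

text \<open>Changing \<open>v\<close> and \<open>w\<close> in higher weight makes both nearly
  commute with z, hence nearly with each other by \<open>commutator_mfil\<close>. The change affects
  the commutator only beyond weight \<open>2 * i + 2 * j\<close>.\<close>

lemma comm_even_D:
  assumes p: "odd p" and "Suc 0 \<le> i" "Suc 0 \<le> j" "v \<in> lcsV p k (2 * i)" "w \<in> lcsV p k (2 * j)"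
  shows "comm v w \<in> lcsV p k (Suc (2 * i + 2 * j))"
proof -
  have "comm v w \<in> lcsV p k (Suc (2 * i + 2 * j))" if v: "v \<in> lcs (2 * i)" and w: "w \<in> lcs (2 * j)" for v w
  proof -
    \<comment> \<open>The precision is \<open>k + 4\<close> because \<open>commutator_mfil\<close>
      loses four degrees.\<close>
    obtain v' where v': "L.eqv (Suc (2 * i)) v' v"
      "zmat * rep v' - rep v' * zmat \<in> mfil (int p ^ (k + 4)) (k + 4)"
      using almost_commuting_z assms v by blast
    obtain w' where w': "L.eqv (Suc (2 * j)) w' w"
      "zmat * rep w' - rep w' * zmat \<in> mfil (int p ^ (k + 4)) (k + 4)"
      using almost_commuting_z assms w by blast
    have "rep v' * rep w' - rep w' * rep v' \<in> mfil (int p ^ (k + 4)) k"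
      using commutator_mfil v' w' by blast
    then have "rep v' * rep w' - rep w' * rep v' \<in> mfil (int p ^ k) k"
      by (rule mfil_antimono) (auto intro: le_imp_power_dvd)
    moreover have "rep (comm v' w') - 1 = (rep v' * rep w' - rep w' * rep v') * (rep (- v') * rep (- w'))"
      by (simp add: rep_comm algebra_simps)
    ultimately have "comm v' w' \<in> adicV p k" by (simp add: adicV_def adicU_def mfil_mult_right)
    then have "comm v' w' \<in> lcsV p k (Suc (2 * i + 2 * j))" by (rule V_D)
    moreover have "L.eqv (Suc (2 * i + 2 * j)) (comm v w) (comm v' w')"
    proof (rule L.eqv_trans)
      show "L.eqv (Suc (2 * i + 2 * j)) (comm v w) (comm v' w)"
        using assms w by (intro L.comm_cong_left L.eqv_sym[OF v'(1)]) auto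
      have "v' \<in> lcs (2 * i)" using L.eqv_mem[OF L.eqv_le[OF v'(1)] v] by simp
      then show "L.eqv (Suc (2 * i + 2 * j)) (comm v' w) (comm v' w')"
        using assms by (intro L.comm_cong_right L.eqv_sym[OF w'(1)]) auto
    qed
    then have "D.eqv p k (Suc (2 * i + 2 * j)) (comm v w) (comm v' w')"
      unfolding L.eqv_def D.eqv_def by (rule lcs_D)
    ultimately show ?thesis using D.eqv_mem by blast
  qed
  moreover have "\<exists>a'\<in>lcs n. D.eqv p k m a a'" if "a \<in> lcsV p k n" for a n m
  proof -
    from that obtain a' b where "a = a' + b" "a' \<in> lcs n" "b \<in> adicV p k" by (auto simp: lcsV_def)
    then show ?thesis
      using nsubgrpD(2)[OF nsubgrp_V] V_D unfolding D.eqv_def by (intro bexI[of _ a']) auto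
  qed
  ultimately obtain v' w' where *: "D.eqv p k (Suc (2 * i + 2 * j)) v v'" "D.eqv p k (Suc (2 * i + 2 * j)) w w'"
    "comm v' w' \<in> lcsV p k (Suc (2 * i + 2 * j))"
    using assms(4,5) by meson
  have "D.eqv p k (Suc (2 * i + 2 * j)) (comm v w) (comm v' w')"
    using nsubgrp_cong_comm[OF D.nsub] * unfolding D.eqv_def by blast
  then show ?thesis using *(3) D.eqv_mem by blast
qed

subsection \<open>Spanning sets\<close>

definition opA :: "'g::group_add \<Rightarrow> 'g \<Rightarrow> 'g \<Rightarrow> 'g" where
  "opA x y w = comm x (comm x w)"

definition opB :: "'g::group_add \<Rightarrow> 'g \<Rightarrow> 'g \<Rightarrow> 'g" where
  "opB x y w = comm x (comm y w)"

definition opC :: "'g::group_add \<Rightarrow> 'g \<Rightarrow> 'g \<Rightarrow> 'g" where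
  "opC x y w = comm y (comm y w)"

fun opE :: "'g::group_add \<Rightarrow> 'g \<Rightarrow> nat \<times> nat \<times> nat \<Rightarrow> 'g" where
  "opE x y (i, j, l) = (opA x y ^^ i) ((opB x y ^^ j) ((opC x y ^^ l) (comm x y)))"

context generated_nseries
begin

abbreviation "Z \<equiv> comm X Y"
abbreviation "A \<equiv> opA X Y"
abbreviation "B \<equiv> opB X Y"
abbreviation "C \<equiv> opC X Y"

lemma eqv_cast: "eqv n a b \<Longrightarrow> m = n \<Longrightarrow> eqv m a b"
  by simp

lemma D_cast: "a \<in> D n \<Longrightarrow> m = n \<Longrightarrow> a \<in> D m"
  by simp

lemma Z_mem: "Z \<in> D 2"
  using comm_X[of Y "Suc 0" X] by (simp add: D_1 numeral_2_eq_2)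

lemma op_mem: "w \<in> D n \<Longrightarrow> A w \<in> D (n + 2)" "w \<in> D n \<Longrightarrow> B w \<in> D (n + 2)" "w \<in> D n \<Longrightarrow> C w \<in> D (n + 2)"
  by (auto simp: opA_def opB_def opC_def intro!: comm_X)

lemma op_cong: "eqv n v w \<Longrightarrow> eqv (n + 2) (A v) (A w)" "eqv n v w \<Longrightarrow> eqv (n + 2) (B v) (B w)"
    "eqv n v w \<Longrightarrow> eqv (n + 2) (C v) (C w)"
  by (auto simp: opA_def opB_def opC_def intro!: comm_X_cong)

lemma op_pow_mem: "w \<in> D n \<Longrightarrow> (A ^^ i) w \<in> D (n + 2 * i)" "w \<in> D n \<Longrightarrow> (B ^^ i) w \<in> D (n + 2 * i)"
    "w \<in> D n \<Longrightarrow> (C ^^ i) w \<in> D (n + 2 * i)"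
proof -
  have 1: "(f ^^ i) w \<in> D (n + 2 * i)" if "w \<in> D n" "\<And>w n. w \<in> D n \<Longrightarrow> f w \<in> D (n + 2)" for f
    by (induction i) (use that in auto)
  show "w \<in> D n \<Longrightarrow> (A ^^ i) w \<in> D (n + 2 * i)" "w \<in> D n \<Longrightarrow> (B ^^ i) w \<in> D (n + 2 * i)"
    "w \<in> D n \<Longrightarrow> (C ^^ i) w \<in> D (n + 2 * i)"
    using 1 op_mem by blast+
qed

lemma opE_mem: "opE X Y (i, j, l) \<in> D (2 * (i + j + l) + 2)"
proof -
  have "(A ^^ i) ((B ^^ j) ((C ^^ l) Z)) \<in> D (2 + 2 * l + 2 * j + 2 * i)"
    using Z_mem by (intro op_pow_mem)
  then have "(A ^^ i) ((B ^^ j) ((C ^^ l) Z)) \<in> D (2 * (i + j + l) + 2)"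
    by (rule D_cast) simp
  then show ?thesis by simp
qed

lemma YX_XY:
  assumes "w \<in> D n" "Suc 0 \<le> n" "comm Z w \<in> D (n + 3)"
  shows "eqv (n + 3) (comm Y (comm X w)) (B w)"
proof -
  have "eqv (n + 3) (B w) (comm Y (comm X w) + comm Z w)"
    using jacobi'[OF assms(1,2)] by (simp add: opB_def)
  also have "eqv (n + 3) \<dots> (comm Y (comm X w) + 0)"
    using assms(3) by (intro eqv_add eqv_refl) (simp add: eqv_0)
  finally show ?thesis by (simp add: eqv_sym)
qed

text \<open>Of the four double commutators only \<open>comm Y (comm X w)\<close> is not A, B or C
  applied to \<open>w\<close>; by Jacobi it is \<open>B w - comm Z w\<close>, and \<open>R\<close>
  accounts for the second term.\<close>

lemma spans_step2:
  assumes "Suc 0 \<le> n" "spans n E" "E \<subseteq> D n"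
    and R: "\<And>w. w \<in> E \<Longrightarrow> comm Z w \<in> gen (R \<union> D (n + 3))"
  shows "spans (n + 2) (A ` E \<union> B ` E \<union> C ` E \<union> R)"
proof -
  let ?E1 = "comm X ` E \<union> comm Y ` E"
  let ?G = "gen (A ` E \<union> B ` E \<union> C ` E \<union> R \<union> D (Suc (n + 2)))"
  have 1: "spans (Suc n) ?E1" by (rule spans_Suc) fact+
  have "?E1 \<subseteq> D (Suc n)" using assms(3) comm_X by blast
  from spans_Suc[OF _ 1 this] have 2: "spans (n + 2) (comm X ` ?E1 \<union> comm Y ` ?E1)" by simp
  moreover have "comm X ` ?E1 \<union> comm Y ` ?E1 \<subseteq> ?G"
  proof -
    have "comm Y (comm X w) \<in> ?G" if w: "w \<in> E" for w
    proof -
      have "eqv (n + 3) (B w) (comm Y (comm X w) + comm Z w)"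
        using jacobi'[of w n X Y] w assms by (auto simp: opB_def)
      from eqv_add[OF this eqv_refl, of "- comm Z w"]
      have e: "eqv (n + 3) (comm Y (comm X w)) (B w - comm Z w)" by (simp add: eqv_sym add.assoc)
      have "gen (R \<union> D (n + 3)) \<subseteq> ?G" by (intro gen_mono) (auto simp: numeral_3_eq_3)
      then have "comm Z w \<in> ?G" using R[OF w] by blast
      moreover have "B w \<in> ?G" using w by (blast intro: gen_base)
      ultimately have "B w - comm Z w \<in> ?G" by (rule subgrpD(4)[OF subgrp_gen, rotated])
      moreover have "eqv (Suc (n + 2)) (comm Y (comm X w)) (B w - comm Z w)"
        using e by (simp add: numeral_3_eq_3)
      ultimately show ?thesis by (rule gen_eqv[rotated])
    qed
    moreover have "comm X (comm X w) \<in> ?G" "comm X (comm Y w) \<in> ?G" "comm Y (comm Y w) \<in> ?G"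
      if "w \<in> E" for w
      unfolding opA_def[of X Y, symmetric] opB_def[of X Y, symmetric] opC_def[of X Y, symmetric]
      using that by (auto intro!: gen_base)
    ultimately show ?thesis by blast
  qed
  ultimately show ?thesis by (rule spans_subset)
qed

lemma spans_2: "spans 2 {Z}"
proof -
  have "spans (Suc (Suc 0)) (comm X ` {X, Y} \<union> comm Y ` {X, Y})"
    by (rule spans_Suc[OF _ spans_1]) (auto simp: D_1)
  moreover have "comm Y X \<in> gen ({Z} \<union> S)" for S
    using gen_minus[OF gen_base, of Z "{Z} \<union> S"] by (simp add: minus_comm)
  then have "comm X ` {X, Y} \<union> comm Y ` {X, Y} \<subseteq> gen ({Z} \<union> D (Suc (Suc (Suc 0))))"
    by (auto intro: gen_zero gen_base)
  ultimately show ?thesis using spans_subset by (simp add: numeral_2_eq_2)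
qed

lemma spans_4: "spans 4 {A Z, B Z, C Z}"
proof -
  have "spans (2 + 2) (A ` {Z} \<union> B ` {Z} \<union> C ` {Z} \<union> {})"
    using spans_2 Z_mem by (intro spans_step2) (auto intro: gen_zero)
  then show ?thesis by (simp add: insert_commute)
qed

text \<open>This and \<open>M_eqv\<close> are the two rewriting rules of the Lie calculus below: the
  first moves \<open>d\<close> past \<open>Z\<close>, the second exchanges X and Y in inner position
  at the price of a bracket with \<open>Z\<close>.\<close>

lemma Q_eqv:
  assumes "w \<in> D n" "Suc 0 \<le> n"
  shows "eqv (n + 4) (comm d (comm Z w)) (comm Z (comm d w) + comm (comm d Z) w)"
  by (rule eqv_cast[OF jacobi[of "Suc 0" 2 n d Z w]]) (use assms Z_mem in \<open>simp_all add: D_1\<close>)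

lemma M_eqv:
  assumes "w \<in> D n" "Suc 0 \<le> n"
  shows "eqv (n + 4) (comm c (comm X (comm Y w))) (comm c (comm Y (comm X w)) + comm c (comm Z w))"
proof -
  have "eqv (Suc (n + 3)) (comm c (comm X (comm Y w))) (comm c (comm Y (comm X w) + comm Z w))"
    by (rule comm_X_cong[OF jacobi'[OF assms]])
  also have "eqv (Suc (n + 3)) \<dots> (comm c (comm Y (comm X w)) + comm c (comm Z w))"
  proof (rule eqv_cast)
    show "eqv (Suc (Suc 0 + (n + 2))) (comm c (comm Y (comm X w) + comm Z w))
        (comm c (comm Y (comm X w)) + comm c (comm Z w))"
      using comm_D[of 2 n Z w] Z_mem assms comm_X by (intro comm_add_right) (simp_all add: D_1)
  qed simp
  finally show ?thesis by (rule eqv_cast) simp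
qed

definition R6 :: "'g set" where
  "R6 = {comm Z (A Z), comm Z (B Z), comm Z (C Z)}"

text \<open>In \<open>D 6 / D 7\<close> one has \<open>AB z = BA z + [z, A z]\<close>, \<open>BC z = CB z + 2 [z, C z]\<close> and
  \<open>AC z = CA z + 3 [z, B z]\<close>.\<close>

lemma spans_6: "spans 6 ({A (A Z), A (B Z), A (C Z), B (B Z), B (C Z), C (C Z)} \<union> R6)" (is "spans 6 ?E")
proof -
  let ?S = "{A Z, B Z, C Z}"
  have "spans (4 + 2) (A ` ?S \<union> B ` ?S \<union> C ` ?S \<union> R6)"
    using spans_4 op_mem[OF Z_mem] by (intro spans_step2) (auto simp: R6_def intro: gen_base)
  then have 1: "spans 6 (A ` ?S \<union> B ` ?S \<union> C ` ?S \<union> R6)" by simp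
  define G where "G = gen (?E \<union> D (Suc 6))"
  have G: "subgrp G" by (simp add: G_def)
  have EG: "?E \<subseteq> G" by (auto simp: G_def intro: gen_base)
  have Geqv: "a \<in> G" if "eqv 7 a b" "b \<in> G" for a b
    using gen_eqv[of 6 a b ?E] that by (simp add: G_def)
  have r: "comm Z (A Z) \<in> G" "comm Z (B Z) \<in> G" "comm Z (C Z) \<in> G" using EG by (auto simp: R6_def)
  have Zc: "comm a Z \<in> D 3" for a using comm_X[OF Z_mem, of a] by (simp add: numeral_eq_Suc)
  have ZY: "eqv 5 (comm Y (comm X Z)) (B Z)"
    using YX_XY[OF Z_mem] D_group(1) by simp
  have cong: "eqv 7 (comm a (comm b u)) (comm a (comm b v))" if "eqv 5 u v" for a b u v
    using comm_X_cong[OF comm_X_cong[OF that]] by (simp add: numeral_eq_Suc)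
  have M: "eqv 7 (comm c (comm X (comm Y (comm d Z)))) (comm c (comm Y (comm X (comm d Z))) + comm c (comm Z (comm d Z)))" for c d
    using M_eqv[OF Zc, of c d] by (simp add: numeral_eq_Suc)
  have Q: "eqv 7 (comm c (comm Z (comm d Z))) (comm Z (comm c (comm d Z)) + comm (comm c Z) (comm d Z))" for c d
    using Q_eqv[OF Zc, of c d] by (simp add: numeral_eq_Suc)
  have Gl: "a \<in> G" if "a + b \<in> G" "b \<in> G" for a b
    using subgrpD(4)[OF G that] by simp
  have Gr: "b \<in> G" if "a + b \<in> G" "a \<in> G" for a b
    using subgrpD(2)[OF G subgrpD(3)[OF G that(2)] that(1)] by (simp add: add.assoc)
  have "B (A Z) \<in> G"
  proof -
    have "comm X (comm Z (comm X Z)) \<in> G"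
      by (rule Geqv[OF Q[of X X]]) (use r in \<open>simp add: opA_def\<close>)
    moreover have "comm X (comm Y (comm X (comm X Z))) + comm X (comm Z (comm X Z)) \<in> G"
    proof (rule Geqv[OF eqv_sym[OF M[of X X]]])
      have "eqv 7 (comm X (comm X (comm Y (comm X Z)))) (A (B Z))"
        using cong[OF ZY] by (simp add: opA_def)
      then show "comm X (comm X (comm Y (comm X Z))) \<in> G" using EG Geqv by blast
    qed
    ultimately show ?thesis using Gl by (simp add: opA_def opB_def)
  qed
  moreover have "C (B Z) \<in> G"
  proof -
    have "comm Y (comm Z (comm Y Z)) \<in> G"
      by (rule Geqv[OF Q[of Y Y]]) (use r in \<open>simp add: opC_def\<close>)
    moreover have "comm Y (comm X (comm Y (comm Y Z))) \<in> G"
    proof -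
      have "eqv 7 (B (C Z)) (comm Y (comm X (C Z)) + comm Z (C Z))"
        using jacobi'[OF op_mem(3)[OF Z_mem], of X Y] by (simp add: opB_def)
      then have "comm Y (comm X (C Z)) + comm Z (C Z) \<in> G"
        using EG Geqv[OF eqv_sym] by blast
      then show ?thesis using r Gl by (simp add: opC_def)
    qed
    then have "comm Y (comm Y (comm X (comm Y Z))) + comm Y (comm Z (comm Y Z)) \<in> G"
      by (rule Geqv[OF eqv_sym[OF M[of Y Y]]])
    ultimately show ?thesis using Gl by (simp add: opC_def opB_def)
  qed
  moreover have "C (A Z) \<in> G"
  proof -
    \<comment> \<open>In weight 6 this bracket of two elements of weight 3 equals
      \<open>A (C Z) - B (B Z) - comm Z (B Z)\<close>, by one use of \<open>M\<close> and one of
      \<open>Q\<close>.\<close>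
    have s: "comm (comm X Z) (comm Y Z) \<in> G"
    proof -
      have "comm X (comm Y (comm X (comm Y Z))) + comm X (comm Z (comm Y Z)) \<in> G"
        using EG by (intro Geqv[OF eqv_sym[OF M[of X Y]]]) (auto simp: opA_def opC_def)
      moreover have "comm X (comm Y (comm X (comm Y Z))) \<in> G" using EG by (auto simp: opB_def)
      ultimately have "comm X (comm Z (comm Y Z)) \<in> G" using Gr by blast
      then have "comm Z (comm X (comm Y Z)) + comm (comm X Z) (comm Y Z) \<in> G"
        by (rule Geqv[OF eqv_sym[OF Q[of X Y]]])
      then show ?thesis using r Gr by (simp add: opB_def)
    qed
    have "comm Y (comm Z (comm X Z)) \<in> G"
    proof (rule Geqv[OF Q[of Y X]])
      have "eqv 7 (comm Z (comm Y (comm X Z))) (comm Z (B Z))"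
        using comm_cong_right[of 4 "comm Y (comm X Z)" "B Z" Z 2] ZY Z_mem by simp
      moreover have "comm (comm Y Z) (comm X Z) \<in> G"
        using subgrpD(3)[OF G s] by (simp add: minus_comm)
      ultimately show "comm Z (comm Y (comm X Z)) + comm (comm Y Z) (comm X Z) \<in> G"
        using r Geqv G by (blast intro: subgrpD(2))
    qed
    moreover have "comm Y (comm X (comm Y (comm X Z))) \<in> G"
    proof (rule Geqv[OF cong[OF ZY]])
      have "eqv 7 (B (B Z)) (comm Y (comm X (B Z)) + comm Z (B Z))"
        using jacobi'[OF op_mem(2)[OF Z_mem], of X Y] by (simp add: opB_def)
      then have "comm Y (comm X (B Z)) + comm Z (B Z) \<in> G"
        using EG Geqv[OF eqv_sym] by blast
      then show "comm Y (comm X (B Z)) \<in> G" using r Gl by blast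
    qed
    then have "comm Y (comm Y (comm X (comm X Z))) + comm Y (comm Z (comm X Z)) \<in> G"
      by (rule Geqv[OF eqv_sym[OF M[of Y X]]])
    ultimately show ?thesis using Gl by (simp add: opC_def opA_def)
  qed
  ultimately have "A ` ?S \<union> B ` ?S \<union> C ` ?S \<union> R6 \<subseteq> G"
    using EG by auto
  with 1 show ?thesis unfolding G_def by (rule spans_subset)
qed

end

text \<open>The two consequences of p being odd on which commutativity of the operators rests. For
  \<open>lcsV p k\<close> the first comes from conjugation by z, the second from the oddness of
  \<open>p ^ (k * k)\<close>.\<close>

locale even_nseries = generated_nseries +
  assumes even_comm: "Suc 0 \<le> i \<Longrightarrow> Suc 0 \<le> j \<Longrightarrow> v \<in> D (2 * i) \<Longrightarrow> w \<in> D (2 * j) \<Longrightarrow>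
      comm v w \<in> D (Suc (2 * i + 2 * j))"
    and halve: "a + a \<in> D n \<Longrightarrow> a \<in> D n"
begin

context
  fixes w n k
  assumes w: "w \<in> D n" and n: "n = 2 * k" and k: "Suc 0 \<le> k"
begin

lemma n_pos: "Suc 0 \<le> n"
  using n k by simp

lemma even_comm':
  assumes "a \<in> D (2 * i)" "b \<in> D (n + 2 * j)" "Suc 0 \<le> i"
  shows "comm a b \<in> D (Suc (2 * i + 2 * j + n))"
  using even_comm[of i "k + j" a b] assms k by (simp add: n algebra_simps)

lemma Z_w: "comm Z w \<in> D (n + 3)"
  using even_comm'[of Z 1 w 0] Z_mem w by (simp add: numeral_eq_Suc)

lemma Z_op: "comm Z (comm c (comm d w)) \<in> D (n + 5)"
  using even_comm'[of Z 1 "comm c (comm d w)" 1] Z_mem comm_X[OF comm_X[OF w]] by (simp add: numeral_eq_Suc)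

lemma op_Z: "comm (comm c (comm d Z)) w \<in> D (n + 5)"
  using even_comm'[of "comm c (comm d Z)" 2 w 0] w comm_X[OF comm_X[OF Z_mem]]
  by (simp add: numeral_eq_Suc)

lemma Q_even: "eqv (n + 5) (comm d (comm Z (comm c w))) (comm (comm d Z) (comm c w))"
proof -
  have "eqv (n + 5) (comm d (comm Z (comm c w))) (comm Z (comm d (comm c w)) + comm (comm d Z) (comm c w))"
    using Q_eqv[OF comm_X[OF w], of d c] by (simp add: numeral_eq_Suc)
  also have "eqv (n + 5) \<dots> (0 + comm (comm d Z) (comm c w))"
    using Z_op by (intro eqv_add eqv_refl) (simp add: eqv_0)
  finally show ?thesis by simp
qed

text \<open>\<open>comm Z w\<close> is a commutator of even elements, so it and its brackets with
  \<open>c\<close> and then \<open>d\<close> vanish to one weight more. Expanding the latter by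
  Jacobi and dropping all further brackets of even elements leaves exactly these two brackets of odd
  elements.\<close>

lemma P_even: "eqv (n + 5) (comm (comm d Z) (comm c w) + comm (comm c Z) (comm d w)) 0"
proof -
  have 1: "comm Z (comm c w) \<in> D (n + 3)"
    using comm_D[of 2 "Suc n" Z "comm c w"] Z_mem comm_X[OF w] by (simp add: numeral_eq_Suc)
  have 2: "comm (comm c Z) w \<in> D (n + 3)"
    using comm_D[of 3 n "comm c Z" w] comm_X[OF Z_mem] w n_pos by (simp add: numeral_eq_Suc)
  have "eqv (n + 4) (comm Z (comm c w) + comm (comm c Z) w) (comm c (comm Z w))"
    by (rule eqv_sym[OF Q_eqv[OF w n_pos]])
  also have "eqv (n + 4) (comm c (comm Z w)) 0"
    using comm_X[OF Z_w, of c] by (simp add: eqv_0 numeral_eq_Suc)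
  finally have "eqv (n + 4) (comm Z (comm c w) + comm (comm c Z) w) 0" .
  then have z0: "eqv (n + 5) (comm d (comm Z (comm c w) + comm (comm c Z) w)) 0"
    using comm_X_cong[of "n + 4" "comm Z (comm c w) + comm (comm c Z) w" 0 d] by (simp add: numeral_eq_Suc)
  have 3: "eqv (n + 5) (comm d (comm Z (comm c w) + comm (comm c Z) w))
      (comm d (comm Z (comm c w)) + comm d (comm (comm c Z) w))"
    by (rule eqv_cast[OF comm_add_right[of "Suc 0" d, OF _ _ 1 2]]) (simp_all add: D_1)
  have 4: "eqv (n + 5) (comm d (comm (comm c Z) w)) (comm (comm c Z) (comm d w))"
  proof -
    have "eqv (n + 5) (comm d (comm (comm c Z) w)) (comm (comm c Z) (comm d w) + comm (comm d (comm c Z)) w)"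
      by (rule eqv_cast[OF jacobi[of "Suc 0" 3 n d "comm c Z" w]])
        (use w n_pos comm_X[OF Z_mem] in \<open>simp_all add: D_1 numeral_eq_Suc\<close>)
    also have "eqv (n + 5) \<dots> (comm (comm c Z) (comm d w) + 0)"
      using op_Z by (intro eqv_add eqv_refl) (simp add: eqv_0)
    finally show ?thesis by simp
  qed
  show ?thesis
    by (rule eqv_trans[OF eqv_trans[OF eqv_sym[OF eqv_add[OF Q_even 4]] eqv_sym[OF 3]] z0])
qed

text \<open>With equal letters \<open>P_even\<close> gives only twice the bracket; here
  \<open>halve\<close> is used.\<close>

lemma P_even_self: "comm (comm c Z) (comm c w) \<in> D (n + 5)"
  using P_even[of c c] by - (rule halve, simp add: eqv_0)

lemma M_even: "eqv (n + 5) (comm c (comm X (comm Y (comm d w)))) (comm c (comm Y (comm X (comm d w))) + comm (comm c Z) (comm d w))"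
proof -
  have "eqv (n + 5) (comm c (comm X (comm Y (comm d w)))) (comm c (comm Y (comm X (comm d w))) + comm c (comm Z (comm d w)))"
    using M_eqv[OF comm_X[OF w], of c d] by (simp add: numeral_eq_Suc)
  also have "eqv (n + 5) \<dots> (comm c (comm Y (comm X (comm d w))) + comm (comm c Z) (comm d w))"
    by (intro eqv_add eqv_refl Q_even)
  finally show ?thesis .
qed

lemma M_even_self: "eqv (n + 5) (comm c (comm X (comm Y (comm c w)))) (comm c (comm Y (comm X (comm c w))))"
proof -
  note M_even[of c c]
  also have "eqv (n + 5) (comm c (comm Y (comm X (comm c w))) + comm (comm c Z) (comm c w)) (comm c (comm Y (comm X (comm c w))) + 0)"
    using P_even_self by (intro eqv_add eqv_refl) (simp add: eqv_0)
  finally show ?thesis by simp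
qed

lemma YX_w: "eqv (n + 3) (comm Y (comm X w)) (comm X (comm Y w))"
  using YX_XY[OF w n_pos Z_w] by (simp add: opB_def)

lemma YX_op: "eqv (n + 5) (comm Y (comm X (comm c (comm d w)))) (comm X (comm Y (comm c (comm d w))))"
  using YX_XY[OF comm_X[OF comm_X[OF w]], of c d] Z_op by (simp add: opB_def numeral_eq_Suc)

lemma cong2: "eqv (n + 3) u v \<Longrightarrow> eqv (n + 5) (comm a (comm b u)) (comm a (comm b v))"
  using comm_X_cong[OF comm_X_cong[of "n + 3" u v]] by (simp add: numeral_eq_Suc)

lemma AB_commute: "eqv (n + 5) (B (A w)) (A (B w))"
proof -
  have "eqv (n + 5) (A (B w)) (comm X (comm X (comm Y (comm X w))))"
    using cong2[OF eqv_sym[OF YX_w]] by (simp add: opA_def opB_def)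
  also have "eqv (n + 5) \<dots> (B (A w))"
    using M_even_self[of X] by (simp add: opA_def opB_def)
  finally show ?thesis by (rule eqv_sym)
qed

lemma BC_commute: "eqv (n + 5) (C (B w)) (B (C w))"
proof -
  have "eqv (n + 5) (C (B w)) (comm Y (comm X (comm Y (comm Y w))))"
    using eqv_sym[OF M_even_self[of Y]] by (simp add: opC_def opB_def)
  also have "eqv (n + 5) \<dots> (B (C w))"
    using YX_op[of Y Y] by (simp add: opC_def opB_def)
  finally show ?thesis .
qed

text \<open>Getting from \<open>A (C w)\<close> to \<open>C (A w)\<close> produces the two mixed
  brackets \<open>s\<close> and \<open>t\<close>; it is their sum that vanishes, by
  \<open>P_even\<close>.\<close>

lemma AC_commute: "eqv (n + 5) (C (A w)) (A (C w))"
proof -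
  define s t where "s = comm (comm Y Z) (comm X w)" and "t = comm (comm X Z) (comm Y w)"
  have "eqv (n + 5) (A (C w)) (comm X (comm Y (comm X (comm Y w))) + t)"
    using M_even[of X Y] by (simp add: opC_def opA_def t_def)
  also have "eqv (n + 5) \<dots> (comm Y (comm X (comm X (comm Y w))) + t)"
    by (intro eqv_add eqv_refl eqv_sym[OF YX_op])
  also have "eqv (n + 5) \<dots> (comm Y (comm X (comm Y (comm X w))) + t)"
    by (intro eqv_add eqv_refl cong2 eqv_sym[OF YX_w])
  also have "eqv (n + 5) \<dots> (C (A w) + s + t)"
    using eqv_add[OF M_even[of Y X] eqv_refl] by (simp add: opC_def opA_def s_def)
  also have "C (A w) + s + t = C (A w) + (s + t)" by (simp add: add.assoc)
  also have "eqv (n + 5) \<dots> (C (A w) + 0)"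
    using P_even[of Y X] by (intro eqv_add eqv_refl) (simp add: s_def t_def)
  finally show ?thesis by (simp add: eqv_sym)
qed

end

lemma pow_commute:
  assumes F: "\<And>w n. w \<in> D n \<Longrightarrow> F w \<in> D (n + 2)"
    and Fc: "\<And>v w n. eqv n v w \<Longrightarrow> eqv (n + 2) (F v) (F w)"
    and FG: "\<And>w k. w \<in> D (2 * k) \<Longrightarrow> Suc 0 \<le> k \<Longrightarrow> eqv (2 * k + 5) (G (F w)) (F (G w))"
    and w: "w \<in> D (2 * k)" "Suc 0 \<le> k"
  shows "eqv (2 * (k + i) + 3) (G ((F ^^ i) w)) ((F ^^ i) (G w))"
proof (induction i)
  case (Suc i)
  have "(F ^^ i) w \<in> D (2 * (k + i))"
    by (induction i) (use F w in \<open>auto simp: algebra_simps\<close>)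
  then have "eqv (2 * (k + i) + 5) (G (F ((F ^^ i) w))) (F (G ((F ^^ i) w)))"
    using w by (intro FG) auto
  also have "eqv (2 * (k + i) + 5) \<dots> (F ((F ^^ i) (G w)))"
    by (rule eqv_cast[OF Fc[OF Suc]]) simp
  finally show ?case by (simp add: numeral_eq_Suc)
qed simp

text \<open>Normal ordering: a new A is simply put in front, a new B is pushed past the powers of A,
  and a new C past the powers of A and B.\<close>

lemma spans_even: "spans (2 * K + 2) (opE X Y ` {(i, j, l). i + j + l = K})"
proof (induction K)
  case 0
  have "{(i, j, l). i + j + l = (0::nat)} = {(0, 0, 0)}" by auto
  then show ?case using spans_2 by (simp add: numeral_2_eq_2)
next
  case (Suc K)
  let ?T = "{(i, j, l). i + j + l = K}" and ?E = "opE X Y ` {(i, j, l). i + j + l = Suc K}"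
  define G where "G = gen (?E \<union> D (Suc (2 * K + 2 + 2)))"
  have mem: "opE X Y t \<in> D (2 * (K + 1))" if "t \<in> ?T" for t
    using that opE_mem by auto
  have "spans (2 * K + 2 + 2) (A ` opE X Y ` ?T \<union> B ` opE X Y ` ?T \<union> C ` opE X Y ` ?T \<union> {})"
  proof (rule spans_step2[OF _ Suc])
    show "opE X Y ` ?T \<subseteq> D (2 * K + 2)" using mem by auto
    show "comm Z v \<in> gen ({} \<union> D (2 * K + 2 + 3))" if "v \<in> opE X Y ` ?T" for v
      using that Z_w[OF mem refl] by (auto intro!: gen_base)
  qed simp
  moreover have "A ` opE X Y ` ?T \<union> B ` opE X Y ` ?T \<union> C ` opE X Y ` ?T \<union> {} \<subseteq> G"
  proof -
    have "A (opE X Y (i, j, l)) \<in> G \<and> B (opE X Y (i, j, l)) \<in> G \<and> C (opE X Y (i, j, l)) \<in> G"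
      if t: "i + j + l = K" for i j l
    proof (intro conjI)
      have base: "opE X Y (i', j', l') \<in> G" if "i' + j' + l' = Suc K" for i' j' l'
        unfolding G_def by (rule gen_base, rule UnI1, rule imageI) (use that in simp)
      have Geqv: "a \<in> G" if "eqv (2 * K + 5) a b" "b \<in> G" for a b
        using gen_eqv[of "2 * K + 4" a b ?E] that by (simp add: G_def numeral_eq_Suc)
      show "A (opE X Y (i, j, l)) \<in> G" using base[of "Suc i" j l] t by simp
      define u where "u = (C ^^ l) Z"
      have u: "u \<in> D (2 * (l + 1))" using op_pow_mem(3)[OF Z_mem, of l] by (simp add: u_def)
      define v where "v = (B ^^ j) u"
      have v: "v \<in> D (2 * (j + l + 1))" using op_pow_mem(2)[OF u, of j] by (simp add: v_def algebra_simps)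
      have "eqv (2 * (j + l + 1 + i) + 3) (B ((A ^^ i) v)) ((A ^^ i) (B v))"
        using op_mem op_cong AB_commute v by (intro pow_commute) auto
      then have "eqv (2 * K + 5) (B ((A ^^ i) v)) ((A ^^ i) (B v))"
        by (rule eqv_cast) (use t in simp)
      moreover have "(A ^^ i) (B v) \<in> G" using base[of i "Suc j" l] t by (simp add: v_def u_def)
      ultimately show "B (opE X Y (i, j, l)) \<in> G"
        using Geqv by (simp add: v_def u_def)
      have "eqv (2 * (l + 1 + j) + 3) (C ((B ^^ j) u)) ((B ^^ j) (C u))"
        using op_mem op_cong BC_commute u by (intro pow_commute) auto
      then have *: "eqv (2 * (l + 1 + j) + 3 + 2 * i) ((A ^^ i) (C v)) ((A ^^ i) ((B ^^ j) (C u)))"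
      proof -
        assume *: "eqv (2 * (l + 1 + j) + 3) (C ((B ^^ j) u)) ((B ^^ j) (C u))"
        show ?thesis
        proof (induction i)
          case (Suc i)
          have "eqv (2 * (l + 1 + j) + 3 + 2 * Suc i) (A ((A ^^ i) (C v))) (A ((A ^^ i) ((B ^^ j) (C u))))"
            by (rule eqv_cast[OF op_cong(1)[OF Suc]]) simp
          then show ?case by simp
        qed (use * in \<open>simp add: v_def\<close>)
      qed
      have "eqv (2 * (j + l + 1 + i) + 3) (C ((A ^^ i) v)) ((A ^^ i) (C v))"
        using op_mem op_cong AC_commute v by (intro pow_commute) auto
      also have "eqv (2 * (j + l + 1 + i) + 3) \<dots> ((A ^^ i) ((B ^^ j) (C u)))"
        using * by (simp add: algebra_simps)
      finally have "eqv (2 * K + 5) (C ((A ^^ i) v)) ((A ^^ i) ((B ^^ j) (C u)))"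
        by (rule eqv_cast) (use t in simp)
      moreover have "(A ^^ i) ((B ^^ j) (C u)) \<in> G" using base[of i j "Suc l"] t by (simp add: u_def)
      ultimately show "C (opE X Y (i, j, l)) \<in> G"
        using Geqv by (simp add: v_def u_def)
    qed
    then show ?thesis by auto
  qed
  ultimately show ?case unfolding G_def using spans_subset by simp
qed

end

subsection \<open>Leading terms\<close>

abbreviation "xmat \<equiv> gmat gen_x"
abbreviation "ymat \<equiv> gmat gen_y"

definition umat :: "letter \<Rightarrow> var mps mat2" where
  "umat c = gmat c * zmat - zmat * gmat c"

text \<open>\<open>disc A A\<close> is the discriminant tr(A)^2 - 4 det(A) of the characteristic
  polynomial, and \<open>disc A B\<close> is its polarization 2 tr(A B) - tr(A) tr(B).\<close>

definition disc :: "'a::comm_ring_1 mat2 \<Rightarrow> 'a mat2 \<Rightarrow> 'a" where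
  "disc A B = (e11 A - e22 A) * (e11 B - e22 B) + 2 * (e12 A * e21 B + e21 A * e12 B)"

abbreviation "disc_xx \<equiv> disc xmat xmat"
abbreviation "disc_xy \<equiv> disc xmat ymat"
abbreviation "disc_yy \<equiv> disc ymat ymat"

lemma disc_commute: "disc A B = disc B A"
  by (simp add: disc_def algebra_simps)

text \<open>On traceless parts the bracket is a cross product up to scale, and \<open>Z\<close> is
  orthogonal to \<open>A\<close> and \<open>B\<close>; so the expansion of the triple product leaves
  only a multiple of \<open>Z\<close>.\<close>

lemma bracket_bracket:
  fixes A B :: "'a::comm_ring_1 mat2"
  defines "Z \<equiv> A * B - B * A"
  shows "A * (A * Z - Z * A) - (A * Z - Z * A) * A = scal (disc A A) * Z"
    "A * (B * Z - Z * B) - (B * Z - Z * B) * A = scal (disc A B) * Z"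
  unfolding Z_def by (simp_all add: mat2_eq_iff disc_def algebra_simps)

lemma gmat_umat: "gmat c * umat d - umat d * gmat c = scal (disc (gmat c) (gmat d)) * zmat"
proof -
  have swap: "ymat * xmat - xmat * ymat = - zmat" by (simp add: zmat_def)
  have "xmat * umat gen_x - umat gen_x * xmat = scal disc_xx * zmat"
    "xmat * umat gen_y - umat gen_y * xmat = scal disc_xy * zmat"
    using bracket_bracket[of xmat ymat] by (simp_all add: umat_def zmat_def)
  moreover have "ymat * umat gen_y - umat gen_y * ymat = scal disc_yy * zmat"
    "ymat * umat gen_x - umat gen_x * ymat = scal disc_xy * zmat"
    using bracket_bracket[of ymat xmat] unfolding swap
    by (simp_all add: umat_def disc_commute[of ymat xmat] algebra_simps)
  ultimately show ?thesis by (cases c; cases d) (simp_all add: disc_commute[of ymat xmat])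
qed

lemma scal_bracket:
  "A * (scal f * M) - scal f * M * A = scal f * (A * M - M * A)"
  by (simp add: scal_commute_left right_diff_distrib mult.assoc)

lemma zmat_fil: "zmat \<in> mfil 0 2"
  using mfil_mult[OF gmat_fil gmat_fil] unfolding zmat_def by (simp add: mfil_diff numeral_2_eq_2)

lemma umat_fil: "umat c \<in> mfil 0 3"
  using mfil_mult[OF gmat_fil zmat_fil] mfil_mult[OF zmat_fil gmat_fil]
  unfolding umat_def by (simp add: mfil_diff numeral_3_eq_3)

abbreviation "gX \<equiv> gx gen_x"
abbreviation "gY \<equiv> gx gen_y"

lemma lead_Z: "lead 2 (comm gX gY) zmat"
  using lead_comm[OF lead_gx lead_gx, of gen_x gen_y] by (simp add: zmat_def numeral_2_eq_2)

lemma lead_gx_z: "lead n w (scal f * zmat) \<Longrightarrow> lead (Suc n) (comm (gx c) w) (scal f * umat c)"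
  using lead_comm_gx[of n w "scal f * zmat" c] unfolding scal_bracket umat_def .

lemma lead_gx_u: "lead n w (scal f * umat d) \<Longrightarrow>
    lead (Suc n) (comm (gx c) w) (scal (disc (gmat c) (gmat d) * f) * zmat)"
  using lead_comm_gx[of n w "scal f * umat d" c] unfolding scal_bracket gmat_umat
  by (simp add: scal_hom mult.commute flip: mult.assoc)

fun disc_mono :: "nat \<times> nat \<times> nat \<Rightarrow> var mps" where
  "disc_mono (i, j, l) = disc_xx ^ i * disc_xy ^ j * disc_yy ^ l"

lemma lead_opE:
  assumes "i + j + l = K"
  shows "lead (2 * K + 2) (opE gX gY (i, j, l)) (scal (disc_mono (i, j, l)) * zmat)"
proof -
  have A: "lead (n + 2) (opA gX gY w) (scal (disc_xx * f) * zmat)"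
    and B: "lead (n + 2) (opB gX gY w) (scal (disc_xy * f) * zmat)"
    and C: "lead (n + 2) (opC gX gY w) (scal (disc_yy * f) * zmat)"
    if "lead n w (scal f * zmat)" for n w f
    using lead_gx_u[OF lead_gx_z[OF that]] by (simp_all add: opA_def opB_def opC_def)
  have pow: "lead (n + 2 * i) ((F ^^ i) w) (scal (d ^ i * f) * zmat)"
    if "lead n w (scal f * zmat)" "\<And>n w f. lead n w (scal f * zmat) \<Longrightarrow> lead (n + 2) (F w) (scal (d * f) * zmat)"
    for F d n w f i
    by (induction i) (use that in \<open>auto simp: mult.assoc\<close>)
  have "lead 2 (comm gX gY) (scal 1 * zmat)" using lead_Z by (simp add: scal_hom)
  from pow[OF pow[OF pow[OF this C, where i = l] B, where i = j] A, where i = i]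
  have "lead (2 + 2 * l + 2 * j + 2 * i) (opE gX gY (i, j, l)) (scal (disc_mono (i, j, l)) * zmat)"
    by (simp add: mult.assoc)
  moreover have "2 + 2 * l + 2 * j + 2 * i = 2 * K + 2" using assms by simp
  ultimately show ?thesis by simp
qed

lemma lead_comm_opE:
  assumes "i + j + l = K"
  shows "lead (2 * K + 3) (comm (gx c) (opE gX gY (i, j, l))) (scal (disc_mono (i, j, l)) * umat c)"
  using lead_gx_z[OF lead_opE[OF assms], of c] by (simp add: numeral_eq_Suc)

subsection \<open>Independence of the leading terms\<close>

text \<open>Substitution of 0 for the variables outside \<open>S\<close>, a ring
  homomorphism.\<close>

definition kill :: "'v set \<Rightarrow> 'v mps \<Rightarrow> 'v mps" where
  "kill S f = Mps (\<lambda>m. if set_mset m \<subseteq> S then mcoef f m else 0)"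

lemma mcoef_kill: "mcoef (kill S f) m = (if set_mset m \<subseteq> S then mcoef f m else 0)"
  by (simp add: kill_def)

lemma kill_hom [simp]: "kill S (f + g) = kill S f + kill S g" "kill S (f - g) = kill S f - kill S g"
    "kill S (f * g) = kill S f * kill S g" "kill S 0 = 0" "kill S 1 = 1" "kill S (- f) = - kill S f"
    "kill S (of_int n * f) = of_int n * kill S f" "kill S (numeral k * f) = numeral k * kill S f"
proof -
  show "kill S (f * g) = kill S f * kill S g"
  proof (rule mps_eqI)
    fix m
    show "mcoef (kill S (f * g)) m = mcoef (kill S f * kill S g) m"
    proof (cases "set_mset m \<subseteq> S")
      case True
      have "set_mset k \<subseteq> S \<and> set_mset (m - k) \<subseteq> S" if "k \<subseteq># m" for k
        using True set_mset_mono[OF that] set_mset_mono[OF diff_subset_eq_self[of m k]] by blast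
      then show ?thesis using True by (auto simp: mcoef_kill mcoef_mult intro!: sum.cong)
    next
      case False
      have "\<not> (set_mset k \<subseteq> S \<and> set_mset (m - k) \<subseteq> S)" if "k \<subseteq># m" for k
        using False that by (metis le_sup_iff set_mset_union subset_mset.add_diff_inverse)
      then have "mcoef (kill S f * kill S g) m = 0"
        unfolding mcoef_mult by (intro sum.neutral) (auto simp: mcoef_kill)
      then show ?thesis using False by (simp add: mcoef_kill)
    qed
  qed
qed (auto intro!: mps_eqI simp: mcoef_kill mcoef_1)

lemma kill_power [simp]: "kill S (f ^ n) = kill S f ^ n"
  by (induction n) auto

lemma kill_sum [simp]: "kill S (sum f A) = (\<Sum>x\<in>A. kill S (f x))"
  by (induction A rule: infinite_finite_induct) auto

lemma kill_mmono: "kill S (mmono m) = (if set_mset m \<subseteq> S then mmono m else 0)"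
  by (rule mps_eqI) (auto simp: mcoef_kill mcoef_mmono)

text \<open>Writing r, s, t, u for the surviving variables, x becomes diag(r, 0) and y gets the rows
  (s, t) and (u, 0). The three discriminants become r^2, r s and s^2 + 4 t u, which is the origin of
  the powers of 4, and z has the off-diagonal entries r t and - r u.\<close>

definition kvars :: "var set" where
  "kvars = {(gen_x, 1, 1), (gen_y, 1, 1), (gen_y, 1, 2), (gen_y, 2, 1)}"

abbreviation "vr \<equiv> (gen_x, 1, 1) :: var"
abbreviation "vs \<equiv> (gen_y, 1, 1) :: var"
abbreviation "vt \<equiv> (gen_y, 1, 2) :: var"
abbreviation "vu \<equiv> (gen_y, 2, 1) :: var"

lemma kill_gmat [simp]:
  "kill kvars (e11 xmat) = mmono {#vr#}" "kill kvars (e12 xmat) = 0" "kill kvars (e21 xmat) = 0"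
  "kill kvars (e22 xmat) = 0" "kill kvars (e11 ymat) = mmono {#vs#}" "kill kvars (e12 ymat) = mmono {#vt#}"
  "kill kvars (e21 ymat) = mmono {#vu#}" "kill kvars (e22 ymat) = 0"
  by (auto simp: gmat_def kill_mmono kvars_def)

lemma kill_zmat:
  "kill kvars (e11 zmat) = 0" "kill kvars (e12 zmat) = mmono {#vr, vt#}"
  "kill kvars (e21 zmat) = - mmono {#vr, vu#}" "kill kvars (e22 zmat) = 0"
  by (simp_all add: zmat_def mmono_mult_mmono add_mset_commute)

lemma kill_umat:
  "kill kvars (e11 (umat gen_x)) = 0" "kill kvars (e12 (umat gen_x)) = mmono {#vr, vr, vt#}"
  "kill kvars (e11 (umat gen_y)) = - (2 * mmono {#vr, vt, vu#})"
  "kill kvars (e12 (umat gen_y)) = mmono {#vr, vs, vt#}"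
  by (simp_all add: umat_def kill_zmat mmono_mult_mmono add_mset_commute)

definition kmono :: "nat \<Rightarrow> nat \<Rightarrow> nat \<Rightarrow> var multiset" where
  "kmono a b c = replicate_mset a vr + replicate_mset b vs + replicate_mset c vt + replicate_mset c vu"

lemma kmono_eq_iff: "kmono a b c = kmono a' b' c' \<longleftrightarrow> a = a' \<and> b = b' \<and> c = c'"
proof
  assume eq: "kmono a b c = kmono a' b' c'"
  have "count (kmono a b c) vr = a" "count (kmono a b c) vs = b" "count (kmono a b c) vt = c" for a b c
    by (simp_all add: kmono_def)
  with eq show "a = a' \<and> b = b' \<and> c = c'" by metis
qed auto

lemma size_kmono: "size (kmono a b c) = a + b + 2 * c"
  by (simp add: kmono_def)

lemma set_kmono: "set_mset (kmono a b c) \<subseteq> kvars"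
  by (auto simp: kmono_def kvars_def split: if_splits)

lemma kill_disc_mono:
  "kill kvars (disc_mono (i, j, l)) =
    (\<Sum>t\<le>l. of_int (int (l choose t) * 4 ^ t) * mmono (kmono (2 * i + j) (j + 2 * (l - t)) t))"
proof -
  let ?r = "mmono {#vr#}" and ?s = "mmono {#vs#}" and ?q = "mmono {#vt, vu#}"
  have pw: "mmono {#v#} ^ n = mmono (replicate_mset n v)" for n and v :: var
    by (induction n) (simp_all add: mmono_mult_mmono)
  have pq: "?q ^ n = mmono (replicate_mset n vt + replicate_mset n vu)" for n
    by (induction n) (simp_all add: mmono_mult_mmono add_mset_commute)
  have four: "kill kvars 4 = (4 :: var mps)" "kill kvars 2 = (2 :: var mps)"
    using kill_hom(8)[of kvars _ 1] by simp_all
  have d: "kill kvars disc_xx = ?r ^ 2" "kill kvars disc_xy = ?r * ?s" "kill kvars disc_yy = 4 * ?q + ?s ^ 2"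
    by (simp_all add: disc_def four mmono_mult_mmono power2_eq_square add_mset_commute)
  have "kill kvars (disc_mono (i, j, l)) = (?r ^ (2 * i + j) * ?s ^ j) * (4 * ?q + ?s ^ 2) ^ l"
    unfolding disc_mono.simps kill_hom kill_power d power_mult_distrib power_add power_mult
    by (simp only: mult_ac)
  also have "\<dots> = (\<Sum>t\<le>l. (?r ^ (2 * i + j) * ?s ^ j) * (of_nat (l choose t) * (4 * ?q) ^ t * (?s ^ 2) ^ (l - t)))"
    by (simp add: binomial_ring sum_distrib_left)
  also have "\<dots> = (\<Sum>t\<le>l. of_int (int (l choose t) * 4 ^ t) * mmono (kmono (2 * i + j) (j + 2 * (l - t)) t))"
  proof (rule sum.cong[OF refl])
    fix t
    have "(?r ^ (2 * i + j) * ?s ^ j) * (of_nat (l choose t) * (4 * ?q) ^ t * (?s ^ 2) ^ (l - t)) =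
        of_nat (l choose t) * 4 ^ t * (?r ^ (2 * i + j) * ?s ^ (j + 2 * (l - t)) * ?q ^ t)"
      unfolding power_mult_distrib power_add power_mult[of _ 2 "l - t"] by (simp only: mult_ac)
    also have "\<dots> = of_int (int (l choose t) * 4 ^ t) * mmono (kmono (2 * i + j) (j + 2 * (l - t)) t)"
      unfolding pw pq by (simp add: mmono_mult_mmono kmono_def add.assoc)
    finally show "(?r ^ (2 * i + j) * ?s ^ j) * (of_nat (l choose t) * (4 * ?q) ^ t * (?s ^ 2) ^ (l - t)) =
        of_int (int (l choose t) * 4 ^ t) * mmono (kmono (2 * i + j) (j + 2 * (l - t)) t)" .
  qed
  finally show ?thesis .
qed

lemma mcoef_disc_mono:
  "mcoef (disc_mono (i, j, l)) (kmono a b c) =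
    (if c \<le> l \<and> a = 2 * i + j \<and> b = j + 2 * (l - c) then int (l choose c) * 4 ^ c else 0)"
proof -
  have "mcoef (disc_mono (i, j, l)) (kmono a b c) = mcoef (kill kvars (disc_mono (i, j, l))) (kmono a b c)"
    using set_kmono by (simp add: mcoef_kill del: disc_mono.simps)
  also have "\<dots> = (\<Sum>t\<le>l. if t = c then (if a = 2 * i + j \<and> b = j + 2 * (l - c) then int (l choose c) * 4 ^ c else 0) else 0)"
    unfolding kill_disc_mono mcoef_sum mcoef_of_int_mult mcoef_mmono
    by (intro sum.cong refl) (auto simp: kmono_eq_iff)
  finally show ?thesis by (simp add: sum.delta)
qed

definition triples :: "nat \<Rightarrow> (nat \<times> nat \<times> nat) set" where
  "triples K = {(i, j, l). i + j + l = K}"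

lemma finite_triples [simp]: "finite (triples K)"
proof (rule finite_subset)
  show "triples K \<subseteq> {..K} \<times> {..K} \<times> {..K}" by (auto simp: triples_def)
qed simp

definition disc_poly :: "nat \<Rightarrow> (nat \<times> nat \<times> nat \<Rightarrow> int) \<Rightarrow> var mps" where
  "disc_poly K \<nu> = (\<Sum>t\<in>triples K. of_int (\<nu> t) * disc_mono t)"

text \<open>Only triples whose third exponent is at least \<open>l\<close> involve the l-th power of
  t u, and among those with third exponent \<open>l\<close> only (i, j, l) has the prescribed powers
  of r and s, with coefficient 4^l. Solving from large \<open>l\<close> downwards costs at most 4^K
  per step.\<close>

lemma disc_poly_indep_aux:
  assumes P: "\<And>i j l. i + j + l = K \<Longrightarrow> P dvd mcoef (disc_poly K \<nu>) (kmono (2 * i + j) j l)"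
  shows "i + j + l = K \<Longrightarrow> P dvd 4 ^ (K * (K + 1 - l)) * \<nu> (i, j, l)"
proof (induction "K - l" arbitrary: i j l rule: less_induct)
  case less
  let ?N = "K * (K - l)"
  let ?g = "\<lambda>t. 4 ^ ?N * (\<nu> t * mcoef (disc_mono t) (kmono (2 * i + j) j l))"
  have t: "(i, j, l) \<in> triples K" using less.prems by (simp add: triples_def)
  have "4 ^ ?N * mcoef (disc_poly K \<nu>) (kmono (2 * i + j) j l) = sum ?g (triples K)"
    by (simp add: disc_poly_def sum_distrib_left)
  also have "\<dots> = ?g (i, j, l) + sum ?g (triples K - {(i, j, l)})"
    using t by (subst sum.remove[of _ "(i, j, l)"]) auto
  finally have eq: "4 ^ ?N * mcoef (disc_poly K \<nu>) (kmono (2 * i + j) j l) =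
    ?g (i, j, l) + sum ?g (triples K - {(i, j, l)})" .
  have "P dvd sum ?g (triples K - {(i, j, l)})"
  proof (rule dvd_sum)
    fix s assume s: "s \<in> triples K - {(i, j, l)}"
    obtain i' j' l' where s': "s = (i', j', l')" by (cases s)
    show "P dvd ?g s"
    proof (cases "l < l'")
      case True
      have "P dvd 4 ^ (K * (K + 1 - l')) * \<nu> s"
        using less.hyps[of l' i' j'] True s by (auto simp: s' triples_def)
      moreover have "K * (K + 1 - l') \<le> ?N" using True by (intro mult_le_mono) auto
      then have "(4::int) ^ (K * (K + 1 - l')) dvd 4 ^ ?N" by (rule le_imp_power_dvd)
      ultimately have "P dvd 4 ^ ?N * \<nu> s" by (meson dvd_refl dvd_trans mult_dvd_mono)
      then show ?thesis by (metis dvd_mult2 mult.assoc)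
    next
      case False
      then have "mcoef (disc_mono s) (kmono (2 * i + j) j l) = 0"
        using s less.prems unfolding s' mcoef_disc_mono by (auto simp: triples_def)
      then show ?thesis by simp
    qed
  qed
  moreover have "P dvd 4 ^ ?N * mcoef (disc_poly K \<nu>) (kmono (2 * i + j) j l)"
    using P[OF less.prems] by simp
  ultimately have "P dvd ?g (i, j, l)" unfolding eq by (simp add: dvd_add_left_iff)
  then have "P dvd 4 ^ (?N + l) * \<nu> (i, j, l)"
    unfolding mcoef_disc_mono by (simp add: power_add mult.commute mult.left_commute)
  moreover have "?N + l \<le> K * (K + 1 - l)"
    using less.prems by (simp add: Suc_diff_le)
  then have "(4::int) ^ (?N + l) dvd 4 ^ (K * (K + 1 - l))" by (rule le_imp_power_dvd)
  ultimately show ?case by (meson dvd_refl dvd_trans mult_dvd_mono)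
qed

lemma disc_poly_indep:
  assumes "\<And>i j l. i + j + l = K \<Longrightarrow> P dvd mcoef (disc_poly K \<nu>) (kmono (2 * i + j) j l)"
    and "t \<in> triples K"
  shows "P dvd 4 ^ (K * (K + 1)) * \<nu> t"
proof -
  obtain i j l where t: "t = (i, j, l)" by (cases t)
  have "P dvd 4 ^ (K * (K + 1 - l)) * \<nu> t"
    using disc_poly_indep_aux[OF assms(1), of i j l] assms(2) by (simp add: t triples_def)
  moreover have "(4::int) ^ (K * (K + 1 - l)) dvd 4 ^ (K * (K + 1))"
    by (intro le_imp_power_dvd mult_le_mono) auto
  ultimately show ?thesis by (meson dvd_refl dvd_trans mult_dvd_mono)
qed

lemma mcoef_kill_mult:
  assumes "set_mset k \<subseteq> kvars"
  shows "mcoef (f * g) (kmono a b c + k) = mcoef (kill kvars f * kill kvars g) (kmono a b c + k)"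
  using set_kmono[of a b c] assms by (simp add: mcoef_kill flip: kill_hom(3))

text \<open>Read off in the upper right entry, where z specializes to the single monomial r
  t.\<close>

lemma even_indep:
  assumes "scal (disc_poly K \<nu>) * zmat \<in> mfil P (2 * K + 3)" and t: "t \<in> triples K"
  shows "P dvd 4 ^ (K * (K + 1)) * \<nu> t"
proof (rule disc_poly_indep[OF _ t])
  fix i j l assume ijl: "i + j + l = K"
  have "disc_poly K \<nu> * e12 zmat \<in> fil P (2 * K + 3)" using assms by (simp add: mfil_def)
  then have "P dvd mcoef (disc_poly K \<nu> * e12 zmat) (kmono (2 * i + j) j l + {#vr, vt#})"
    using ijl by (auto simp: fil_def size_kmono)
  also have "mcoef (disc_poly K \<nu> * e12 zmat) (kmono (2 * i + j) j l + {#vr, vt#}) =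
      mcoef (kill kvars (disc_poly K \<nu>)) (kmono (2 * i + j) j l)"
    by (subst mcoef_kill_mult, simp add: kvars_def, simp add: kill_zmat mcoef_mult_mmono)
  also have "\<dots> = mcoef (disc_poly K \<nu>) (kmono (2 * i + j) j l)"
    using set_kmono by (simp add: mcoef_kill)
  finally show "P dvd mcoef (disc_poly K \<nu>) (kmono (2 * i + j) j l)" .
qed

lemma disc_poly_scale: "disc_poly K (\<lambda>t. c * \<nu> t) = of_int c * disc_poly K \<nu>"
  by (simp add: disc_poly_def sum_distrib_left mult.assoc)

text \<open>After specialization the upper left entry of [x, z] is 0 and that of [y, z] is - 2 r t
  u, which determines the second family up to a factor 2. The upper right entry of [x, z] is the
  monomial r^2 t and then determines the first.\<close>

lemma odd_indep:
  assumes "scal (disc_poly K \<nu>) * umat gen_x + scal (disc_poly K \<nu>') * umat gen_y \<in> mfil P (2 * K + 4)"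
    and t: "t \<in> triples K"
  shows "P dvd 2 * 4 ^ (2 * (K * (K + 1))) * \<nu> t" "P dvd 2 * 4 ^ (2 * (K * (K + 1))) * \<nu>' t"
proof -
  \<comment> \<open>The factor needed to make the second family divisible by \<open>P\<close>;
    multiplying by it removes that family from the upper right entry, so it enters the final
    constant.\<close>
  define c :: int where "c = 2 * 4 ^ (K * (K + 1))"
  have P': "P dvd c * \<nu>' t" if "t \<in> triples K" for t
  proof -
    have "P dvd 4 ^ (K * (K + 1)) * (2 * \<nu>' t)"
    proof (rule disc_poly_indep[OF _ that])
      fix i j l assume ijl: "i + j + l = K"
      let ?m = "kmono (2 * i + j) j l + {#vr, vt, vu#}"
      have "disc_poly K \<nu> * e11 (umat gen_x) + disc_poly K \<nu>' * e11 (umat gen_y) \<in> fil P (2 * K + 4)"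
        using assms by (simp add: mfil_def)
      moreover have "size ?m < 2 * K + 4" using ijl by (simp add: size_kmono)
      ultimately have "P dvd mcoef (disc_poly K \<nu> * e11 (umat gen_x) + disc_poly K \<nu>' * e11 (umat gen_y)) ?m"
        unfolding fil_def by blast
      then have "P dvd mcoef (disc_poly K \<nu> * e11 (umat gen_x)) ?m + mcoef (disc_poly K \<nu>' * e11 (umat gen_y)) ?m"
        by (simp only: mcoef_add)
      also have "mcoef (disc_poly K \<nu> * e11 (umat gen_x)) ?m = 0"
        by (subst mcoef_kill_mult, simp add: kvars_def, simp add: kill_umat)
      also have "mcoef (disc_poly K \<nu>' * e11 (umat gen_y)) ?m =
          mcoef (of_int (- 2) * kill kvars (disc_poly K \<nu>') * mmono {#vr, vt, vu#}) ?m"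
        by (subst mcoef_kill_mult, simp add: kvars_def, simp add: kill_umat algebra_simps)
      also have "\<dots> = - 2 * mcoef (kill kvars (disc_poly K \<nu>')) (kmono (2 * i + j) j l)"
        unfolding mcoef_mult_mmono mcoef_of_int_mult by simp
      also have "\<dots> = - 2 * mcoef (disc_poly K \<nu>') (kmono (2 * i + j) j l)"
        using set_kmono by (simp add: mcoef_kill)
      finally show "P dvd mcoef (disc_poly K (\<lambda>t. 2 * \<nu>' t)) (kmono (2 * i + j) j l)"
        by (simp add: disc_poly_scale)
    qed
    then show ?thesis by (simp add: c_def mult_ac)
  qed
  have "P dvd 4 ^ (K * (K + 1)) * (c * \<nu> t)"
  proof (rule disc_poly_indep[OF _ t])
    fix i j l assume ijl: "i + j + l = K"
    let ?m = "kmono (2 * i + j) j l + {#vr, vr, vt#}"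
    have "disc_poly K \<nu> * e12 (umat gen_x) + disc_poly K \<nu>' * e12 (umat gen_y) \<in> fil P (2 * K + 4)"
      using assms by (simp add: mfil_def)
    moreover have "size ?m < 2 * K + 4" using ijl by (simp add: size_kmono)
    ultimately have "P dvd mcoef (disc_poly K \<nu> * e12 (umat gen_x) + disc_poly K \<nu>' * e12 (umat gen_y)) ?m"
      unfolding fil_def by blast
    then have "P dvd mcoef (disc_poly K \<nu> * e12 (umat gen_x)) ?m + mcoef (disc_poly K \<nu>' * e12 (umat gen_y)) ?m"
      by (simp only: mcoef_add)
    then have "P dvd c * mcoef (disc_poly K \<nu> * e12 (umat gen_x)) ?m + c * mcoef (disc_poly K \<nu>' * e12 (umat gen_y)) ?m"
      unfolding distrib_left[symmetric] by (rule dvd_mult)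
    moreover have "P dvd c * mcoef (disc_poly K \<nu>' * e12 (umat gen_y)) ?m"
    proof -
      have "P dvd mcoef (disc_poly K (\<lambda>t. c * \<nu>' t)) m" for m
        unfolding disc_poly_def mcoef_sum mcoef_of_int_mult using P' by (intro dvd_sum) simp
      then have "disc_poly K (\<lambda>t. c * \<nu>' t) \<in> fil P (Suc (size ?m))"
        by (simp add: fil_def)
      then have "disc_poly K (\<lambda>t. c * \<nu>' t) * e12 (umat gen_y) \<in> fil P (Suc (size ?m))"
        by (rule fil_mult_right)
      then have "P dvd mcoef (of_int c * (disc_poly K \<nu>' * e12 (umat gen_y))) ?m"
        unfolding fil_def disc_poly_scale mult.assoc by blast
      then show ?thesis by (simp only: mcoef_of_int_mult)
    qed
    ultimately have "P dvd c * mcoef (disc_poly K \<nu> * e12 (umat gen_x)) ?m"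
      by (simp add: dvd_add_left_iff)
    also have "mcoef (disc_poly K \<nu> * e12 (umat gen_x)) ?m =
        mcoef (kill kvars (disc_poly K \<nu>)) (kmono (2 * i + j) j l)"
      by (subst mcoef_kill_mult, simp add: kvars_def, simp add: kill_umat mcoef_mult_mmono)
    also have "\<dots> = mcoef (disc_poly K \<nu>) (kmono (2 * i + j) j l)"
      using set_kmono by (simp add: mcoef_kill)
    finally show "P dvd mcoef (disc_poly K (\<lambda>t. c * \<nu> t)) (kmono (2 * i + j) j l)"
      by (simp add: disc_poly_scale)
  qed
  moreover have e: "4 ^ (K * (K + 1)) * (c * n) = 2 * 4 ^ (2 * (K * (K + 1))) * n" for n
    unfolding c_def mult_2[of "K * (K + 1)"] power_add by (simp only: mult_ac)
  ultimately show "P dvd 2 * 4 ^ (2 * (K * (K + 1))) * \<nu> t" by (simp only:)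
  have "P dvd 4 ^ (K * (K + 1)) * (c * \<nu>' t)" using P'[OF t] by simp
  then show "P dvd 2 * 4 ^ (2 * (K * (K + 1))) * \<nu>' t" by (simp only: e)
qed

lemma one_indep:
  assumes "of_int a * xmat + of_int b * ymat \<in> mfil P 2"
  shows "P dvd a" "P dvd b"
proof -
  have "of_int a * mmono {#vr#} + of_int b * mmono {#vs#} \<in> fil P 2"
    using assms by (simp add: mfil_def of_int_eq_scal gmat_def)
  then have *: "size m < 2 \<Longrightarrow> P dvd a * (if m = {#vr#} then 1 else 0) + b * (if m = {#vs#} then 1 else 0)" for m
    by (simp add: fil_def mcoef_mmono)
  show "P dvd a" using *[of "{#vr#}"] by simp
  show "P dvd b" using *[of "{#vs#}"] by simp
qed

text \<open>The exponent \<open>e\<close> is the multiplicity of p in \<open>c\<close>. In this way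
  the constants 2 and 4 become harmless also for p = 2.\<close>

lemma dvd_cancel_power:
  fixes c :: int
  assumes "prime p" "c \<noteq> 0"
  shows "\<exists>e. \<forall>m \<nu>. int p ^ (m + e) dvd c * \<nu> \<longrightarrow> int p ^ m dvd \<nu>"
proof -
  have pp: "prime (int p)" using assms by simp
  obtain c' where c': "c = int p ^ multiplicity (int p) c * c'" "\<not> int p dvd c'"
    using multiplicity_decompose'[of c "int p"] assms pp by (metis not_prime_unit)
  have "int p ^ m dvd \<nu>" if "int p ^ (m + multiplicity (int p) c) dvd c * \<nu>" for m \<nu>
  proof -
    have "int p ^ multiplicity (int p) c * int p ^ m dvd int p ^ multiplicity (int p) c * (c' * \<nu>)"
      using that c'(1) by (metis add.commute mult.assoc power_add)
    then have "int p ^ m dvd c' * \<nu>" using assms by (simp add: prime_gt_0_nat)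
    moreover have "coprime (int p ^ m) c'"
      using c'(2) pp by (simp add: prime_imp_coprime)
    ultimately show ?thesis by (simp add: coprime_dvd_mult_right_iff)
  qed
  then show ?thesis by blast
qed

lemma D_mfil:
  assumes "g \<in> lcsV p k (Suc n)" "Suc n \<le> k"
  shows "rep g - 1 \<in> mfil (int p ^ k) (Suc n)"
proof -
  obtain a v where g: "g = a + v" "a \<in> lcs (Suc n)" "v \<in> adicV p k" using assms by (auto simp: lcsV_def)
  have "a \<in> adicU (int p ^ k) (Suc n)"
    using lcs_U[of "Suc n"] g(2) U_antimono[of a 0 "Suc n" "int p ^ k" "Suc n"] by auto
  moreover have "v \<in> adicU (int p ^ k) (Suc n)"
    using g(3) U_antimono[of v "int p ^ k" k "int p ^ k" "Suc n"] assms by (auto simp: adicV_def)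
  ultimately have "g \<in> adicU (int p ^ k) (Suc n)"
    using g nsubgrp_mem(2)[OF nsubgrp_U] by blast
  then show ?thesis by (simp add: adicU_def)
qed

lemma lead_lin_diff:
  assumes "Suc 0 \<le> n" "distinct is" "\<And>i. i \<in> set is \<Longrightarrow> lead n (e i) (L i)"
  shows "lead n (lin e \<mu> is - lin e \<mu>' is) (\<Sum>i\<in>set is. of_int (int (\<mu> i) - int (\<mu>' i)) * L i)"
proof -
  have "lead n (lin e \<mu> is + - lin e \<mu>' is)
      ((\<Sum>i\<in>set is. of_nat (\<mu> i) * L i) + - (\<Sum>i\<in>set is. of_nat (\<mu>' i) * L i))"
    using assms by (intro lead_add lead_minus lead_lin)
  then show ?thesis by (simp add: sum_subtractf left_diff_distrib)
qed

text \<open>If two combinations agree in \<open>lcsV p k\<close>, the leading term of their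
  difference vanishes modulo p^k in degree n, and \<open>L\<close> turns this into divisibility of
  the differences of the coefficients.\<close>

lemma lin_indep:
  assumes p: "prime p" and n: "Suc 0 \<le> n" and "distinct is"
    and lead: "\<And>i. i \<in> set is \<Longrightarrow> lead n (e i) (L i)"
    and c: "c \<noteq> 0"
    and L: "\<And>P \<nu> i. (\<Sum>i\<in>set is. of_int (\<nu> i) * L i) \<in> mfil P (Suc n) \<Longrightarrow> i \<in> set is \<Longrightarrow> P dvd c * \<nu> i"
  shows "\<exists>k. \<forall>\<mu> \<mu>'. D.eqv p k (Suc n) (lin e \<mu> is) (lin e \<mu>' is) \<longrightarrow>
      (\<forall>i\<in>set is. int p ^ m dvd int (\<mu> i) - int (\<mu>' i))"
proof -
  obtain d where d: "\<And>m \<nu>. int p ^ (m + d) dvd c * \<nu> \<Longrightarrow> int p ^ m dvd \<nu>"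
    using dvd_cancel_power[OF p c] by blast
  define k where "k = m + d + Suc n"
  have "int p ^ m dvd int (\<mu> i) - int (\<mu>' i)"
    if "D.eqv p k (Suc n) (lin e \<mu> is) (lin e \<mu>' is)" "i \<in> set is" for \<mu> \<mu>' i
  proof -
    define g where "g = lin e \<mu> is - lin e \<mu>' is"
    define S where "S = (\<Sum>i\<in>set is. of_int (int (\<mu> i) - int (\<mu>' i)) * L i)"
    have "lead n g S" unfolding g_def S_def by (rule lead_lin_diff) fact+
    then have "rep g - 1 - S \<in> mfil (int p ^ k) (Suc n)"
      by (auto simp: lead_def intro: mfil_0_mono)
    moreover have "rep g - 1 \<in> mfil (int p ^ k) (Suc n)"
      using that(1) by (intro D_mfil) (auto simp: D.eqv_def g_def k_def)
    ultimately have "(rep g - 1) - (rep g - 1 - S) \<in> mfil (int p ^ k) (Suc n)"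
      by (rule mfil_diff[rotated])
    then have "S \<in> mfil (int p ^ k) (Suc n)" by simp
    then have "int p ^ k dvd c * (int (\<mu> i) - int (\<mu>' i))"
      unfolding S_def by (rule L[OF _ that(2)])
    then have "int p ^ (m + d) dvd c * (int (\<mu> i) - int (\<mu>' i))"
      by (rule dvd_trans[OF le_imp_power_dvd, rotated]) (simp add: k_def)
    then show ?thesis by (rule d)
  qed
  then show ?thesis by blast
qed

subsection \<open>Bases of the graded pieces\<close>

text \<open>A discrete version of a topological basis of the n-th quotient over the p-adic integers:
  coordinates exist to every precision k, and their residues modulo p^m are determined once k is
  large enough in terms of m.\<close>

definition graded_basis :: "nat \<Rightarrow> nat \<Rightarrow> ('i \<Rightarrow> gam) \<Rightarrow> 'i list \<Rightarrow> bool" where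
  "graded_basis p n e is \<longleftrightarrow> distinct is \<and> (\<forall>i\<in>set is. e i \<in> lcs n) \<and>
     (\<forall>k. \<forall>g\<in>lcs n. \<exists>\<mu>. g - lin e \<mu> is \<in> lcsV p k (Suc n)) \<and>
     (\<forall>m. \<exists>k. \<forall>\<mu> \<mu>'. lin e \<mu> is - lin e \<mu>' is \<in> lcsV p k (Suc n) \<longrightarrow>
        (\<forall>i\<in>set is. int p ^ m dvd int (\<mu> i) - int (\<mu>' i)))"

text \<open>The trivial normal subgroup recovers the lower central series itself.\<close>

interpretation LG: generated_nseries "lcs :: nat \<Rightarrow> gam set" gX gY
proof -
  have "nsubgrp {0 :: gam}" by (simp add: nsubgrp_def subgrp_def)
  from lcs_generated_nseries[OF this gen_gx] show "generated_nseries (lcs :: nat \<Rightarrow> gam set) gX gY"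
    by simp
qed

lemma nmul_D: "0 < p \<Longrightarrow> \<exists>q. \<forall>g. nmul (Suc q) g \<in> lcsV p k n"
proof -
  assume "0 < p"
  then obtain q where "p ^ (k * k) = Suc q" by (metis gr0_conv_Suc zero_less_power)
  then show ?thesis using V_D[OF nmul_V] by metis
qed

lemma lcs_lin:
  assumes "0 < p" "Suc 0 \<le> n" "distinct is" "\<And>i. i \<in> set is \<Longrightarrow> e i \<in> lcs n"
    "D.spans p k n (e ` set is)" "g \<in> lcs n"
  shows "\<exists>\<mu>. D.eqv p k (Suc n) g (lin e \<mu> is)"
proof -
  obtain q where q: "\<And>g. nmul (Suc q) g \<in> lcsV p k (Suc n)" using nmul_D assms by blast
  show ?thesis
    using assms lcs_D by (intro D.spans_lin[OF assms(2,5) _ assms(3) q]) auto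
qed

lemma graded_basisI:
  assumes p: "prime p" and n: "Suc 0 \<le> n" and d: "distinct is"
    and lead: "\<And>i. i \<in> set is \<Longrightarrow> lead n (e i) (L i)"
    and mem: "\<And>i. i \<in> set is \<Longrightarrow> e i \<in> lcs n"
    and spans: "\<And>k. D.spans p k n (e ` set is)"
    and c: "c \<noteq> 0"
    and L: "\<And>P \<nu> i. (\<Sum>i\<in>set is. of_int (\<nu> i) * L i) \<in> mfil P (Suc n) \<Longrightarrow> i \<in> set is \<Longrightarrow> P dvd c * \<nu> i"
  shows "graded_basis p n e is"
  unfolding graded_basis_def
proof (intro conjI ballI allI)
  fix k and g :: gam assume "g \<in> lcs n"
  then show "\<exists>\<mu>. g - lin e \<mu> is \<in> lcsV p k (Suc n)"
    using lcs_lin[OF prime_gt_0_nat[OF p] n d mem spans] by (auto simp: D.eqv_def)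
next
  fix m
  show "\<exists>k. \<forall>\<mu> \<mu>'. lin e \<mu> is - lin e \<mu>' is \<in> lcsV p k (Suc n) \<longrightarrow>
        (\<forall>i\<in>set is. int p ^ m dvd int (\<mu> i) - int (\<mu>' i))"
    unfolding D.eqv_def[symmetric]
    by (rule lin_indep[where L = L and c = c]) (use p n d lead c L in blast)+
qed (use d mem in auto)

lemma graded_basis_1:
  assumes "prime p"
  shows "graded_basis p 1 gx [gen_x, gen_y]"
proof (rule graded_basisI[where L = gmat and c = 1])
  show "D.spans p k 1 (gx ` set [gen_x, gen_y])" for k using D.spans_1 by simp
  show "P dvd 1 * \<nu> i" if "(\<Sum>i\<in>set [gen_x, gen_y]. of_int (\<nu> i) * gmat i) \<in> mfil P (Suc 1)" for P \<nu> i
    using one_indep[of "\<nu> gen_x" "\<nu> gen_y" P] that by (cases i) (simp_all add: numeral_2_eq_2)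
qed (use assms lead_gx in auto)

lemma even_nseries_D:
  assumes "odd p"
  shows "even_nseries (lcsV p k) gX gY"
proof (intro even_nseries.intro even_nseries_axioms.intro)
  show "generated_nseries (lcsV p k) gX gY" by (rule D.generated_nseries_axioms)
  show "comm v w \<in> lcsV p k (Suc (2 * i + 2 * j))"
    if "Suc 0 \<le> i" "Suc 0 \<le> j" "v \<in> lcsV p k (2 * i)" "w \<in> lcsV p k (2 * j)" for i j v w
    using comm_even_D assms that by blast
  show "a \<in> lcsV p k n" if a: "a + a \<in> lcsV p k n" for a n
  proof -
    have "odd (p ^ (k * k))" using assms by simp
    \<comment> \<open>Since \<open>p ^ (k * k)\<close> annihilates modulo \<open>adicV p k\<close>,
      the element \<open>a\<close> is minus r times its double there.\<close>
    then obtain r where "p ^ (k * k) = 2 * r + 1" by (rule oddE)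
    then have r: "p ^ (k * k) = r * 2 + 1" by simp
    have "nmul r (nmul 2 a) + a \<in> lcsV p k n"
    proof -
      have "nmul (r * 2 + 1) a \<in> lcsV p k n" using V_D[OF nmul_V[of p k a]] by (simp only: r)
      then show ?thesis by (simp only: nmul_add nmul_mult nmul_1)
    qed
    moreover have "nmul r (nmul 2 a) \<in> lcsV p k n"
      using nmul_in[OF nsubgrpD(1)[OF D.nsub] a] by (simp add: numeral_2_eq_2)
    ultimately have "- nmul r (nmul 2 a) + (nmul r (nmul 2 a) + a) \<in> lcsV p k n"
      by (rule D.D_group(2)[OF D.D_group(3), rotated])
    then show ?thesis by (simp only: add.assoc[symmetric] left_minus add_0_left)
  qed
qed

lemma triples_0: "triples 0 = {(0, 0, 0)}"
  by (auto simp: triples_def)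

lemma triples_1: "triples (Suc 0) = {(1, 0, 0), (0, 1, 0), (0, 0, 1)}"
proof -
  have "i + j + l = Suc 0 \<longleftrightarrow> i = 1 \<and> j = 0 \<and> l = 0 \<or> i = 0 \<and> j = 1 \<and> l = 0 \<or> i = 0 \<and> j = 0 \<and> l = 1"
    for i j l :: nat by presburger
  then show ?thesis by (simp only: triples_def) auto
qed

lemma triples_2: "triples 2 = {(2, 0, 0), (1, 1, 0), (1, 0, 1), (0, 2, 0), (0, 1, 1), (0, 0, 2)}"
proof -
  have "i + j + l = 2 \<longleftrightarrow> i = 2 \<and> j = 0 \<and> l = 0 \<or> i = 1 \<and> j = 1 \<and> l = 0 \<or> i = 1 \<and> j = 0 \<and> l = 1 \<or>
      i = 0 \<and> j = 2 \<and> l = 0 \<or> i = 0 \<and> j = 1 \<and> l = 1 \<or> i = 0 \<and> j = 0 \<and> l = 2"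
    for i j l :: nat by presburger
  then show ?thesis by (simp only: triples_def) auto
qed

lemma card_triples: "2 * card (triples K) = (K + 1) * (K + 2)"
proof -
  have "triples K = (\<lambda>(i, j). (i, j, K - i - j)) ` (SIGMA i:{..K}. {..K - i})"
    by (force simp: triples_def)
  moreover have "inj_on (\<lambda>(i, j). (i, j, K - i - j)) (SIGMA i:{..K}. {..K - i})"
    by (auto simp: inj_on_def)
  ultimately have "card (triples K) = (\<Sum>i\<le>K. Suc (K - i))"
    by (simp add: card_image)
  also have "\<dots> = (\<Sum>i\<le>K. Suc i)"
    by (rule sum.reindex_bij_witness[of _ "\<lambda>i. K - i" "\<lambda>i. K - i"]) auto
  finally have "card (triples K) = (\<Sum>i\<le>K. Suc i)" .
  moreover have "2 * (\<Sum>i\<le>K. Suc i) = (K + 1) * (K + 2)"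
    by (induction K) auto
  ultimately show ?thesis by simp
qed

definition triple_list :: "nat \<Rightarrow> (nat \<times> nat \<times> nat) list" where
  "triple_list K = (SOME xs. set xs = triples K \<and> distinct xs)"

lemma triple_list: "set (triple_list K) = triples K" "distinct (triple_list K)"
  "length (triple_list K) = card (triples K)"
proof -
  have "set (triple_list K) = triples K \<and> distinct (triple_list K)"
    unfolding triple_list_def by (rule someI_ex) (rule finite_distinct_list[OF finite_triples])
  then show "set (triple_list K) = triples K" "distinct (triple_list K)"
    "length (triple_list K) = card (triples K)"
    by (auto simp flip: distinct_card)
qed

text \<open>In weights 2 and 4 at most one operator is applied, so no two have to be exchanged and p
  = 2 is allowed.\<close>

lemma spans_triples:
  assumes "odd p \<or> K \<le> 1"
  shows "D.spans p k (2 * K + 2) (opE gX gY ` triples K)"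
proof (cases "odd p")
  case True
  interpret even_nseries "lcsV p k" gX gY by (rule even_nseries_D[OF True])
  show ?thesis using spans_even unfolding triples_def .
next
  case False
  then have "K = 0 \<or> K = 1" using assms by auto
  then show ?thesis
  proof
    assume "K = 0"
    then show ?thesis using D.spans_2[of p k] by (simp add: triples_0 numeral_2_eq_2)
  next
    assume "K = 1"
    then show ?thesis using D.spans_4[of p k] by (simp add: triples_1)
  qed
qed

lemma opE_lcs: "t \<in> triples K \<Longrightarrow> opE gX gY t \<in> lcs (2 * K + 2)"
  using LG.opE_mem by (cases t) (auto simp: triples_def simp del: opE.simps)

lemma lead_triples:
  assumes "t \<in> triples K"
  shows "lead (2 * K + 2) (opE gX gY t) (scal (disc_mono t) * zmat)"
    "lead (2 * K + 3) (comm (gx c) (opE gX gY t)) (scal (disc_mono t) * umat c)"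
proof -
  obtain i j l where t: "t = (i, j, l)" by (cases t)
  have "i + j + l = K" using assms by (simp add: t triples_def)
  then show "lead (2 * K + 2) (opE gX gY t) (scal (disc_mono t) * zmat)"
    "lead (2 * K + 3) (comm (gx c) (opE gX gY t)) (scal (disc_mono t) * umat c)"
    unfolding t by (rule lead_opE, rule lead_comm_opE)
qed

lemma graded_basis_even:
  assumes p: "prime p" and "odd p \<or> K \<le> 1"
  shows "graded_basis p (2 * K + 2) (opE gX gY) (triple_list K)"
proof (rule graded_basisI[where L = "\<lambda>t. scal (disc_mono t) * zmat" and c = "4 ^ (K * (K + 1))"])
  show "P dvd 4 ^ (K * (K + 1)) * \<nu> i"
    if *: "(\<Sum>i\<in>set (triple_list K). of_int (\<nu> i) * (scal (disc_mono i) * zmat)) \<in> mfil P (Suc (2 * K + 2))"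
      and i: "i \<in> set (triple_list K)" for P \<nu> i
  proof -
    have "(\<Sum>i\<in>set (triple_list K). of_int (\<nu> i) * (scal (disc_mono i) * zmat)) = scal (disc_poly K \<nu>) * zmat"
      by (simp add: mat2_eq_iff triple_list disc_poly_def sum_distrib_right of_int_eq_scal mult.assoc)
    then show ?thesis using even_indep[of K \<nu> P i] * i
      by (simp add: triple_list numeral_3_eq_3)
  qed
  show "lead (2 * K + 2) (opE gX gY i) (scal (disc_mono i) * zmat)" if "i \<in> set (triple_list K)" for i
    using that by (intro lead_triples) (simp add: triple_list)
  show "D.spans p k (2 * K + 2) (opE gX gY ` set (triple_list K))" for k
    using spans_triples[OF assms(2)] by (simp add: triple_list)
qed (use p triple_list opE_lcs in auto)

lemma graded_basis_odd:
  assumes p: "prime p" and "odd p \<or> K \<le> 1"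
  shows "graded_basis p (2 * K + 3) (\<lambda>(c, t). comm (gx c) (opE gX gY t)) (List.product [gen_x, gen_y] (triple_list K))"
proof (rule graded_basisI[where L = "\<lambda>(c, t). scal (disc_mono t) * umat c" and c = "2 * 4 ^ (2 * (K * (K + 1)))"])
  let ?is = "List.product [gen_x, gen_y] (triple_list K)"
  have set_is: "set ?is = Pair gen_x ` triples K \<union> Pair gen_y ` triples K"
    by (auto simp: triple_list)
  show "P dvd 2 * 4 ^ (2 * (K * (K + 1))) * \<nu> i"
    if *: "(\<Sum>i\<in>set ?is. of_int (\<nu> i) * (case i of (c, t) \<Rightarrow> scal (disc_mono t) * umat c)) \<in> mfil P (Suc (2 * K + 3))"
      and i: "i \<in> set ?is" for P \<nu> i
  proof -
    have "(\<Sum>i\<in>set ?is. of_int (\<nu> i) * (case i of (c, t) \<Rightarrow> scal (disc_mono t) * umat c)) =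
        (\<Sum>i\<in>Pair gen_x ` triples K. of_int (\<nu> i) * (case i of (c, t) \<Rightarrow> scal (disc_mono t) * umat c)) +
        (\<Sum>i\<in>Pair gen_y ` triples K. of_int (\<nu> i) * (case i of (c, t) \<Rightarrow> scal (disc_mono t) * umat c))"
      unfolding set_is by (rule sum.union_disjoint) auto
    also have "\<dots> = scal (disc_poly K (\<lambda>t. \<nu> (gen_x, t))) * umat gen_x + scal (disc_poly K (\<lambda>t. \<nu> (gen_y, t))) * umat gen_y"
      by (simp add: sum.reindex inj_on_def mat2_eq_iff disc_poly_def sum_distrib_right of_int_eq_scal mult.assoc)
    finally have "scal (disc_poly K (\<lambda>t. \<nu> (gen_x, t))) * umat gen_x + scal (disc_poly K (\<lambda>t. \<nu> (gen_y, t))) * umat gen_y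
        \<in> mfil P (2 * K + 4)"
      using * by (simp add: numeral_eq_Suc)
    from odd_indep[OF this] show ?thesis using i unfolding set_is by auto
  qed
  show "lead (2 * K + 3) (case i of (c, t) \<Rightarrow> comm (gx c) (opE gX gY t)) (case i of (c, t) \<Rightarrow> scal (disc_mono t) * umat c)"
    if "i \<in> set ?is" for i
    using that lead_triples(2) unfolding set_is by (auto simp del: opE.simps disc_mono.simps)
  show "D.spans p k (2 * K + 3) ((\<lambda>(c, t). comm (gx c) (opE gX gY t)) ` set ?is)" for k
  proof -
    have "opE gX gY ` triples K \<subseteq> lcsV p k (2 * K + 2)" using opE_lcs lcs_D by blast
    from D.spans_Suc[OF _ spans_triples[OF assms(2)] this]
    have "D.spans p k (Suc (2 * K + 2)) (comm gX ` opE gX gY ` triples K \<union> comm gY ` opE gX gY ` triples K)"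
      by simp
    then show ?thesis unfolding set_is by (simp add: image_Un image_image numeral_3_eq_3)
  qed
  show "(case i of (c, t) \<Rightarrow> comm (gx c) (opE gX gY t)) \<in> lcs (2 * K + 3)" if "i \<in> set ?is" for i
    using that L.comm_X[OF opE_lcs] unfolding set_is by (auto simp: numeral_3_eq_3)
qed (use p triple_list in \<open>auto simp: distinct_map inj_on_def\<close>)

subsection \<open>Degree six over the 2-adic integers\<close>

definition HP :: "nat \<Rightarrow> var mps set" where
  "HP K = range (disc_poly K)"

lemma HP_add: "f \<in> HP K \<Longrightarrow> g \<in> HP K \<Longrightarrow> f + g \<in> HP K"
proof -
  have "disc_poly K \<nu> + disc_poly K \<nu>' = disc_poly K (\<lambda>t. \<nu> t + \<nu>' t)" for \<nu> \<nu>'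
    by (simp add: disc_poly_def sum.distrib distrib_right)
  then show "f \<in> HP K \<Longrightarrow> g \<in> HP K \<Longrightarrow> f + g \<in> HP K" by (auto simp: HP_def)
qed

lemma HP_of_int: "f \<in> HP K \<Longrightarrow> of_int c * f \<in> HP K"
  by (auto simp: HP_def simp flip: disc_poly_scale)

lemma HP_minus: "f \<in> HP K \<Longrightarrow> - f \<in> HP K"
  using HP_of_int[of f K "-1"] by simp

lemma HP_disc_mono: "t \<in> triples K \<Longrightarrow> disc_mono t \<in> HP K"
proof -
  assume t: "t \<in> triples K"
  have "disc_poly K (\<lambda>s. if s = t then 1 else 0) = (\<Sum>s\<in>triples K. if s = t then disc_mono t else 0)"
    unfolding disc_poly_def by (intro sum.cong) auto
  also have "\<dots> = disc_mono t" using t by (simp add: sum.delta)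
  finally show ?thesis by (metis HP_def rangeI)
qed

lemma HP_0: "0 \<in> HP K"
  by (auto simp: HP_def disc_poly_def intro!: image_eqI[of _ _ "\<lambda>_. 0"])

lemma HP_sum: "(\<And>x. x \<in> S \<Longrightarrow> f x \<in> HP K) \<Longrightarrow> sum f S \<in> HP K"
  by (induction S rule: infinite_finite_induct) (auto intro: HP_add HP_0)

lemma HP_mult:
  assumes "f \<in> HP 1" "g \<in> HP K"
  shows "f * g \<in> HP (Suc K)"
proof -
  have m: "disc_mono s * disc_mono t \<in> HP (Suc K)" if s: "s \<in> triples 1" and t: "t \<in> triples K" for s t
  proof -
    obtain i j l i' j' l' where st: "s = (i, j, l)" "t = (i', j', l')" by (cases s; cases t)
    have "disc_mono s * disc_mono t = disc_mono (i + i', j + j', l + l')"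
      by (simp add: st power_add mult_ac)
    also have "\<dots> \<in> HP (Suc K)" using s t by (intro HP_disc_mono) (auto simp: st triples_def)
    finally show ?thesis .
  qed
  from assms obtain \<nu> \<nu>' where fg: "f = disc_poly 1 \<nu>" "g = disc_poly K \<nu>'" by (auto simp: HP_def)
  have "f * g = (\<Sum>s\<in>triples 1. \<Sum>t\<in>triples K. of_int (\<nu> s * \<nu>' t) * (disc_mono s * disc_mono t))"
    unfolding fg disc_poly_def sum_product by (simp add: mult_ac)
  then show ?thesis using m by (auto intro!: HP_sum HP_of_int simp del: of_int_mult)
qed

lemma HP_disc: "disc (gmat c) (gmat d) \<in> HP 1"
proof -
  have "disc_mono (1, 0, 0) \<in> HP 1" "disc_mono (0, 1, 0) \<in> HP 1" "disc_mono (0, 0, 1) \<in> HP 1"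
    by (intro HP_disc_mono; simp add: triples_def)+
  then show ?thesis by (cases c; cases d) (simp_all add: disc_commute[of ymat xmat])
qed

lemma HP_0_1: "1 \<in> HP 0"
  using HP_disc_mono[of "(0, 0, 0)" 0] by (simp add: triples_def)

lemma lead_exists_1: "\<exists>a b. lead (Suc 0) k (scal (of_int a) * xmat + scal (of_int b) * ymat)"
proof -
  have "k \<in> gen {gX, gY}" by (simp add: gen_gx)
  then show ?thesis
  proof (induction rule: gen.induct)
    case gen_zero
    then show ?case by (intro exI[of _ 0]) (simp add: scal_hom)
  next
    case (gen_base k)
    then obtain c where c: "k = gx c" by auto
    show ?case
      using lead_gx[of c]
      by (intro exI[of _ "if c = gen_x then 1 else 0"] exI[of _ "if c = gen_y then 1 else 0"])
        (cases c; simp add: c scal_hom)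
  next
    case (gen_add k k')
    then obtain a b a' b' where "lead (Suc 0) k (scal (of_int a) * xmat + scal (of_int b) * ymat)"
      "lead (Suc 0) k' (scal (of_int a') * xmat + scal (of_int b') * ymat)" by blast
    from lead_add[OF _ this] show ?case
      by (intro exI[of _ "a + a'"] exI[of _ "b + b'"]) (simp add: scal_hom algebra_simps)
  next
    case (gen_minus k)
    then obtain a b where "lead (Suc 0) k (scal (of_int a) * xmat + scal (of_int b) * ymat)" by blast
    from lead_minus[OF _ this] show ?case
      by (intro exI[of _ "- a"] exI[of _ "- b"]) (simp add: scal_hom algebra_simps)
  qed
qed

lemma bracket_combination:
  "(scal f * P + scal h * Q) * (scal a * A + scal b * B) - (scal a * A + scal b * B) * (scal f * P + scal h * Q) =
    - (scal (a * f) * (A * P - P * A) + scal (a * h) * (A * Q - Q * A) +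
       scal (b * f) * (B * P - P * B) + scal (b * h) * (B * Q - Q * B))"
  by (simp add: mat2_eq_iff algebra_simps)

lemma lead_exists_gen:
  assumes n: "Suc 0 \<le> n"
    and gens: "\<And>h k. h \<in> lcs n \<Longrightarrow> \<exists>L\<in>S. lead (Suc n) (comm h k) L"
    and S: "0 \<in> S" "\<And>L M. L \<in> S \<Longrightarrow> M \<in> S \<Longrightarrow> L + M \<in> S" "\<And>L. L \<in> S \<Longrightarrow> - L \<in> S"
    and g: "g \<in> lcs (Suc n)"
  shows "\<exists>L\<in>S. lead (Suc n) g L"
proof -
  obtain m where "n = Suc m" using n by (cases n) auto
  then have "g \<in> gen {comm h k | h k. h \<in> lcs n}" using g by simp
  then show ?thesis
  proof (induction rule: gen.induct)
    case (gen_add a b)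
    then show ?case using lead_add S(2) by (metis Suc_leI zero_less_Suc)
  next
    case (gen_minus a)
    then show ?case using lead_minus S(3) by (metis Suc_leI zero_less_Suc)
  qed (use gens S(1) lead_0 in blast)+
qed

text \<open>The point is integrality: elements of \<open>lcs n\<close> have leading terms with
  integer coefficients in these shapes, whereas the commutators of z with A z, B z, C z turn out to
  be half integral.\<close>

definition even_leads :: "nat \<Rightarrow> var mps mat2 set" where
  "even_leads K = {scal f * zmat | f. f \<in> HP K}"

definition odd_leads :: "nat \<Rightarrow> var mps mat2 set" where
  "odd_leads K = {scal f * umat gen_x + scal h * umat gen_y | f h. f \<in> HP K \<and> h \<in> HP K}"

lemma even_leads_group: "0 \<in> even_leads K" "L \<in> even_leads K \<Longrightarrow> M \<in> even_leads K \<Longrightarrow> L + M \<in> even_leads K"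
  "L \<in> even_leads K \<Longrightarrow> - L \<in> even_leads K"
proof -
  show "0 \<in> even_leads K" unfolding even_leads_def using HP_0 by (force simp: scal_hom)
  show "L + M \<in> even_leads K" if "L \<in> even_leads K" "M \<in> even_leads K"
    using that HP_add unfolding even_leads_def by (force simp: scal_hom distrib_right)
  show "- L \<in> even_leads K" if "L \<in> even_leads K"
    using that HP_minus unfolding even_leads_def by (force simp: scal_hom)
qed

lemma odd_leads_group: "0 \<in> odd_leads K" "L \<in> odd_leads K \<Longrightarrow> M \<in> odd_leads K \<Longrightarrow> L + M \<in> odd_leads K"
  "L \<in> odd_leads K \<Longrightarrow> - L \<in> odd_leads K"
proof -
  show "0 \<in> odd_leads K" unfolding odd_leads_def using HP_0 by (force simp: scal_hom)
  show "L + M \<in> odd_leads K" if LM: "L \<in> odd_leads K" "M \<in> odd_leads K"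
  proof -
    obtain f h f' h' where "f \<in> HP K" "h \<in> HP K" "f' \<in> HP K" "h' \<in> HP K"
      and "L = scal f * umat gen_x + scal h * umat gen_y" "M = scal f' * umat gen_x + scal h' * umat gen_y"
      using LM by (auto simp: odd_leads_def)
    then show ?thesis unfolding odd_leads_def
      by (intro CollectI exI[of _ "f + f'"] exI[of _ "h + h'"])
        (auto simp: HP_add scal_hom algebra_simps)
  qed
  show "- L \<in> odd_leads K" if L: "L \<in> odd_leads K"
  proof -
    obtain f h where "f \<in> HP K" "h \<in> HP K" and "L = scal f * umat gen_x + scal h * umat gen_y"
      using L by (auto simp: odd_leads_def)
    then show ?thesis unfolding odd_leads_def
      by (intro CollectI exI[of _ "- f"] exI[of _ "- h"])
        (auto simp: HP_minus scal_hom algebra_simps)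
  qed
qed

lemma lead_exists_odd_step:
  assumes even: "\<And>g. g \<in> lcs (2 * K + 2) \<Longrightarrow> \<exists>L\<in>even_leads K. lead (2 * K + 2) g L"
    and g: "g \<in> lcs (2 * K + 3)"
  shows "\<exists>L\<in>odd_leads K. lead (2 * K + 3) g L"
proof -
  have "\<exists>L\<in>odd_leads K. lead (Suc (2 * K + 2)) g L"
  proof (rule lead_exists_gen)
    fix h k :: gam assume "h \<in> lcs (2 * K + 2)"
    then obtain f where f: "f \<in> HP K" "lead (2 * K + 2) h (scal f * zmat)"
      using even by (auto simp: even_leads_def)
    obtain a b where ab: "lead (Suc 0) k (scal (of_int a) * xmat + scal (of_int b) * ymat)"
      using lead_exists_1 by blast
    have "lead (Suc (2 * K + 2)) (comm h k)
       (- (scal (of_int a * f) * umat gen_x + scal (of_int b * f) * umat gen_y))"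
      using lead_comm[OF f(2) ab] bracket_combination[of f zmat 0 0 "of_int a" xmat "of_int b" ymat]
      by (simp add: scal_hom umat_def)
    moreover have "- (scal (of_int a * f) * umat gen_x + scal (of_int b * f) * umat gen_y) \<in> odd_leads K"
      using f by (intro odd_leads_group(3)) (auto simp: odd_leads_def intro!: exI HP_of_int)
    ultimately show "\<exists>L\<in>odd_leads K. lead (Suc (2 * K + 2)) (comm h k) L" by blast
  qed (use g odd_leads_group in \<open>simp_all add: numeral_3_eq_3\<close>)
  then show ?thesis by (simp add: numeral_3_eq_3)
qed

lemma lead_exists_even_step:
  assumes odd: "\<And>g. g \<in> lcs (2 * K + 3) \<Longrightarrow> \<exists>L\<in>odd_leads K. lead (2 * K + 3) g L"
    and g: "g \<in> lcs (2 * Suc K + 2)"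
  shows "\<exists>L\<in>even_leads (Suc K). lead (2 * Suc K + 2) g L"
proof -
  have "\<exists>L\<in>even_leads (Suc K). lead (Suc (2 * K + 3)) g L"
  proof (rule lead_exists_gen)
    fix h k :: gam assume h: "h \<in> lcs (2 * K + 3)"
    obtain f f' where f: "f \<in> HP K" "f' \<in> HP K" "lead (2 * K + 3) h (scal f * umat gen_x + scal f' * umat gen_y)"
      using odd[OF h] unfolding odd_leads_def by blast
    obtain a b where ab: "lead (Suc 0) k (scal (of_int a) * xmat + scal (of_int b) * ymat)"
      using lead_exists_1 by blast
    define F where "F = - (of_int a * (disc_xx * f) + of_int a * (disc_xy * f') + of_int b * (disc_xy * f) + of_int b * (disc_yy * f'))"
    have F: "F \<in> HP (Suc K)"
      unfolding F_def using f HP_disc by (intro HP_minus HP_add HP_of_int HP_mult)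
    have "lead (Suc (2 * K + 3)) (comm h k) (scal F * zmat)"
      using lead_comm[OF f(3) ab]
      unfolding bracket_combination gmat_umat F_def
      by (simp add: scal_hom algebra_simps disc_commute[of ymat xmat])
    then show "\<exists>L\<in>even_leads (Suc K). lead (Suc (2 * K + 3)) (comm h k) L"
      using F by (auto simp: even_leads_def)
  qed (use g even_leads_group in \<open>simp_all add: numeral_3_eq_3\<close>)
  then show ?thesis by (simp add: numeral_3_eq_3)
qed

lemma lead_exists_2:
  assumes "g \<in> lcs 2"
  shows "\<exists>L\<in>even_leads 0. lead 2 g L"
proof -
  have "\<exists>L\<in>even_leads 0. lead (Suc 1) g L"
  proof (rule lead_exists_gen)
    fix h k :: gam
    obtain a b where ab: "lead (Suc 0) h (scal (of_int a) * xmat + scal (of_int b) * ymat)"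
      using lead_exists_1 by blast
    obtain a' b' where ab': "lead (Suc 0) k (scal (of_int a') * xmat + scal (of_int b') * ymat)"
      using lead_exists_1 by blast
    define F :: "var mps" where "F = of_int (a * b' - b * a') * 1"
    have "lead (Suc 1) (comm h k) (scal F * zmat)"
      using lead_comm[OF ab ab'] unfolding bracket_combination F_def
      by (simp add: zmat_def scal_hom algebra_simps)
    moreover have "F \<in> HP 0" unfolding F_def by (intro HP_of_int HP_0_1)
    ultimately show "\<exists>L\<in>even_leads 0. lead (Suc 1) (comm h k) L" by (auto simp: even_leads_def)
  qed (use assms even_leads_group in \<open>simp_all add: numeral_2_eq_2\<close>)
  then show ?thesis by (simp add: numeral_2_eq_2)
qed

lemma lead_exists_even: "g \<in> lcs (2 * K + 2) \<Longrightarrow> \<exists>L\<in>even_leads K. lead (2 * K + 2) g L"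
proof (induction K arbitrary: g)
  case 0
  then show ?case using lead_exists_2[of g] by (simp only: mult_0_right add_0)
next
  case (Suc K)
  then show ?case using lead_exists_even_step lead_exists_odd_step by blast
qed

lemma lead_exists_odd: "g \<in> lcs (2 * K + 3) \<Longrightarrow> \<exists>L\<in>odd_leads K. lead (2 * K + 3) g L"
  using lead_exists_odd_step lead_exists_even by blast

text \<open>\<open>L\<close> records two consecutive degrees. The leading terms of z and A z are
  both multiples of the matrix z and commute, so the commutator starts only in degree 7, where the
  second-order terms contribute.\<close>

definition lead2 :: "nat \<Rightarrow> gam \<Rightarrow> var mps mat2 \<Rightarrow> bool" where
  "lead2 n g L \<longleftrightarrow> L \<in> mfil 0 n \<and> rep g - 1 - L \<in> mfil 0 (n + 2)"

text \<open>Numerals are expanded into sums so that \<open>algebra_simps\<close> can collect terms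
  in the noncommutative matrix ring.\<close>

lemma mult_small_numeral: "3 * t = t + t + t" "4 * t = t + t + t + t" for t :: "'a::ring_1"
proof -
  have "(3::'a) = 1 + 1 + 1" "(4::'a) = 1 + 1 + 1 + 1" by simp_all
  then show "3 * t = t + t + t" "4 * t = t + t + t + t" by (simp_all only: distrib_right mult_1_left)
qed

lemma numeral_scal: "numeral k = (scal (numeral k) :: 'a::comm_ring_1 mat2)"
  using of_int_eq_scal[of "numeral k"] by simp

lemma mat2_sel_numeral:
  "e11 (numeral k * A) = numeral k * e11 A" "e12 (numeral k * A) = numeral k * e12 A"
  "e21 (numeral k * A) = numeral k * e21 A" "e22 (numeral k * A) = numeral k * e22 A"
  "e11 (numeral k :: 'a mat2) = numeral k" "e12 (numeral k :: 'a mat2) = 0"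
  "e21 (numeral k :: 'a mat2) = 0" "e22 (numeral k :: 'a mat2) = numeral k"
  for A :: "'a::comm_ring_1 mat2"
  unfolding numeral_scal[where 'a = 'a] by simp_all

lemma mat2_numeral_commute:
  "A * numeral k = numeral k * A" "A * (numeral k * B) = numeral k * (A * B)" for A B :: "'a::comm_ring_1 mat2"
  unfolding numeral_scal[of k, where 'a = 'a] by (rule scal_commute, rule scal_commute_left)

lemmas numeral_pull = mat2_numeral_commute[where A = "gmat c" for c] mat2_numeral_commute[where A = zmat]
  mat2_numeral_commute[where A = "umat c" for c] mat2_numeral_commute[where A = "scal a" for a]
  mult_2 mult_small_numeral

lemma mfil_le: "A \<in> mfil P a \<Longrightarrow> b \<le> a \<Longrightarrow> A \<in> mfil P b"
  by (erule mfil_antimono) auto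

lemma lead2_mfil: "lead2 n g L \<Longrightarrow> rep g - 1 \<in> mfil 0 n"
  using mfil_add[of "rep g - 1 - L" 0 n L] mfil_le[of "rep g - 1 - L" 0 "n + 2" n]
  by (simp add: lead2_def)

lemma mult_approx:
  assumes "A - A' \<in> mfil 0 (a + 2)" "B \<in> mfil 0 b" "A' \<in> mfil 0 a" "B - B' \<in> mfil 0 (b + 2)"
  shows "A * B - A' * B' \<in> mfil 0 (a + b + 2)"
proof -
  have "A * B - A' * B' = (A - A') * B + A' * (B - B')" by (simp add: algebra_simps)
  moreover have "(A - A') * B \<in> mfil 0 (a + b + 2)" "A' * (B - B') \<in> mfil 0 (a + b + 2)"
    using mfil_mult[OF assms(1,2)] mfil_mult[OF assms(3,4)] by (simp_all add: ac_simps)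
  ultimately show ?thesis by (simp add: mfil_add)
qed

lemma bracket_approx:
  assumes "A - A' \<in> mfil 0 (a + 2)" "B \<in> mfil 0 b" "A' \<in> mfil 0 a" "B - B' \<in> mfil 0 (b + 2)"
    "A \<in> mfil 0 a" "B' \<in> mfil 0 b"
  shows "(A * B - B * A) - (A' * B' - B' * A') \<in> mfil 0 (a + b + 2)"
proof -
  have "(A * B - B * A) - (A' * B' - B' * A') = (A * B - A' * B') - (B * A - B' * A')" by simp
  moreover have "B * A - B' * A' \<in> mfil 0 (b + a + 2)"
    by (rule mult_approx) fact+
  ultimately show ?thesis using mult_approx[OF assms(1-4)] by (simp only: mfil_diff add.commute[of b a])
qed

lemma rep_minus_gx_approx: "rep (- gx c) - (1 - gmat c) \<in> mfil 0 2"
proof -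
  have "rep (- gx c) - (1 - gmat c) = (1 - (1 - gmat c) * rep (gx c)) * rep (- gx c)"
    by (simp add: left_diff_distrib mult.assoc rep_minus)
  also have "1 - (1 - gmat c) * rep (gx c) = gmat c * gmat c"
    by (simp add: rep_gx algebra_simps)
  finally show ?thesis
    using mfil_mult_right[OF mfil_mult[OF gmat_fil gmat_fil]] by (simp add: numeral_2_eq_2)
qed

text \<open>To this precision the inverses in \<open>rep_comm\<close> reduce to
  \<open>1 - gmat c\<close>: the inverse of \<open>b\<close> is 1 up to degree 2 because
  \<open>2 \<le> n\<close>.\<close>

lemma lead2_comm_gx:
  assumes M: "lead2 n b M" and n: "2 \<le> n"
    and L: "(gmat c * M - M * gmat c) * (1 - gmat c) - L \<in> mfil 0 (n + 3)" "L \<in> mfil 0 (n + 1)"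
  shows "lead2 (n + 1) (comm (gx c) b) L"
proof -
  let ?C = "gmat c * (rep b - 1) - (rep b - 1) * gmat c" and ?C' = "gmat c * M - M * gmat c"
  let ?W = "rep (- gx c) * rep (- b)"
  have b: "rep b - 1 \<in> mfil 0 n" "M \<in> mfil 0 n" "rep b - 1 - M \<in> mfil 0 (n + 2)"
    using M lead2_mfil[OF M] by (auto simp: lead2_def)
  have CC: "?C - ?C' \<in> mfil 0 (1 + n + 2)"
    by (rule bracket_approx) (use b gmat_fil in auto)
  have C': "?C' \<in> mfil 0 (1 + n)"
    using mfil_mult[OF gmat_fil[of c] b(2)] mfil_mult[OF b(2) gmat_fil[of c]]
    by (simp add: mfil_diff add.commute)
  have "b \<in> adicU 0 2" using mfil_le[OF b(1) n] by (simp add: adicU_def)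
  then have mb: "rep (- b) - 1 \<in> mfil 0 2" using nsubgrp_mem(3)[OF nsubgrp_U] by (auto simp: adicU_def)
  have "?W - (1 - gmat c) = rep (- gx c) * (rep (- b) - 1) + (rep (- gx c) - (1 - gmat c))"
    by (simp add: right_diff_distrib)
  then have W: "?W - (1 - gmat c) \<in> mfil 0 2"
    using mb rep_minus_gx_approx[of c] by (simp only: mfil_add mfil_mult_left)
  have "?C * ?W - ?C' * (1 - gmat c) \<in> mfil 0 (1 + n + 0 + 2)"
    by (rule mult_approx) (use CC C' W in \<open>simp_all add: numeral_2_eq_2\<close>)
  then have "?C * ?W - ?C' * (1 - gmat c) \<in> mfil 0 (n + 3)" by (simp add: numeral_3_eq_3 numeral_2_eq_2)
  from mfil_add[OF this L(1)] have "?C * ?W - L \<in> mfil 0 (n + 3)" by simp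
  moreover have "rep (comm (gx c) b) - 1 = ?C * ?W" by (simp add: rep_comm rep_gx)
  ultimately show ?thesis using L(2) by (simp add: lead2_def numeral_eq_Suc)
qed

lemma lead2_Z: "lead2 2 (comm gX gY) (zmat - zmat * (xmat + ymat))"
proof -
  let ?X = "rep (- gX)" and ?Y = "rep (- gY)"
  have "?X * ?Y - (1 - xmat - ymat) = (?X - (1 - xmat)) * ?Y + (1 - xmat) * (?Y - (1 - ymat)) + xmat * ymat"
    by (simp add: algebra_simps)
  moreover have "(?X - (1 - xmat)) * ?Y \<in> mfil 0 2" "(1 - xmat) * (?Y - (1 - ymat)) \<in> mfil 0 2" "xmat * ymat \<in> mfil 0 2"
    using rep_minus_gx_approx mfil_mult[OF gmat_fil gmat_fil]
    by (simp_all add: mfil_mult_left mfil_mult_right numeral_2_eq_2)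
  ultimately have "?X * ?Y - (1 - xmat - ymat) \<in> mfil 0 2" by (simp only: mfil_add)
  from mfil_mult[OF zmat_fil this]
  have "zmat * (?X * ?Y) - (zmat - zmat * (xmat + ymat)) \<in> mfil 0 (2 + 2)"
    by (simp add: algebra_simps)
  moreover have "rep (comm gX gY) - 1 = zmat * (?X * ?Y)" by (simp add: rep_comm rep_gx zmat_def)
  moreover have "zmat - zmat * (xmat + ymat) \<in> mfil 0 2"
    using zmat_fil by (simp add: mfil_diff mfil_mult_right)
  ultimately show ?thesis by (simp add: lead2_def)
qed

text \<open>Cayley-Hamilton for a matrix of trace 0.\<close>

lemma zmat_square: "zmat * zmat = scal (- det2 zmat)"
proof -
  have "adj2 zmat = - zmat" by (simp add: mat2_eq_iff adj2_def zmat_def)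
  then show ?thesis using mult_adj2(1)[of zmat] by (simp add: scal_hom) (metis minus_minus)
qed

text \<open>Up to sign this is the Gram determinant of x and y for the form \<open>disc\<close>, as
  for the length of a cross product.\<close>

lemma det2_zmat: "4 * (- det2 zmat) = disc_xy ^ 2 - disc_xx * disc_yy"
proof -
  have "4 * (- det2 (A * B - B * A)) = disc A B ^ 2 - disc A A * disc B B" for A B :: "var mps mat2"
    by (simp add: det2_def disc_def power2_eq_square algebra_simps)
  then show ?thesis by (simp add: zmat_def)
qed

lemma gmat_zmat2: "gmat c * (zmat * zmat) = zmat * zmat * gmat c"
  by (simp add: zmat_square scal_commute)

text \<open>The square of z is a scalar, so its bracket with a generator, which is u z + z u,
  vanishes.\<close>

lemma umat_zmat: "umat c * zmat = - (zmat * umat c)"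
proof -
  have "umat c * zmat + zmat * umat c = gmat c * (zmat * zmat) - zmat * zmat * gmat c"
    by (simp add: umat_def algebra_simps)
  then show ?thesis unfolding gmat_zmat2 by (simp add: eq_neg_iff_add_eq_0)
qed

abbreviation "ux \<equiv> umat gen_x"
abbreviation "uy \<equiv> umat gen_y"

text \<open>By anticommutation the bracket of z with u is 2 z u, and as z is the bracket of x and y,
  Jacobi expresses it by discriminants. This 2 is the source of the half integral coefficients in
  degree 7.\<close>

lemma two_zmat_umat:
  "2 * (zmat * ux) = scal disc_xy * ux - scal disc_xx * uy"
  "2 * (zmat * uy) = scal disc_yy * ux - scal disc_xy * uy"
proof -
  have jac: "zmat * M - M * zmat = (xmat * (ymat * M - M * ymat) - (ymat * M - M * ymat) * xmat) -
      (ymat * (xmat * M - M * xmat) - (xmat * M - M * xmat) * ymat)" for M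
    by (simp add: zmat_def algebra_simps)
  have z2: "2 * (zmat * umat c) = zmat * umat c - umat c * zmat" for c
    by (simp add: umat_zmat mult_2)
  show "2 * (zmat * ux) = scal disc_xy * ux - scal disc_xx * uy"
    unfolding z2 jac gmat_umat scal_bracket umat_def[symmetric] by (simp add: disc_commute[of ymat xmat])
  show "2 * (zmat * uy) = scal disc_yy * ux - scal disc_xy * uy"
    unfolding z2 jac gmat_umat scal_bracket umat_def[symmetric] by (simp add: disc_commute[of ymat xmat])
qed

text \<open>By the Leibniz rule [x, z (x + y)] = [x, z] (x + y) + z^2, since [x, y] = z; for y the
  sign of z^2 changes. The factor \<open>1 - gmat c\<close> contributes the second copy of the
  generator.\<close>

lemma lead2_XZ:
  "lead2 3 (comm gX (comm gX gY)) (ux - ux * (2 * xmat + ymat) - zmat * zmat)"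
  "lead2 3 (comm gY (comm gX gY)) (uy - uy * (xmat + 2 * ymat) + zmat * zmat)"
proof -
  have zz: "zmat * zmat \<in> mfil 0 3" using mfil_mult3[OF zmat_fil zmat_fil] by simp
  have u: "umat c * M \<in> mfil 0 3" for c M using umat_fil by (simp add: mfil_mult_right)
  have z3: "zmat * (xmat + ymat) \<in> mfil 0 3"
    using mfil_mult[OF zmat_fil mfil_add[OF gmat_fil gmat_fil]] by simp
  have rest: "(gmat c * (zmat * (xmat + ymat)) - zmat * (xmat + ymat) * gmat c) * gmat c \<in> mfil 0 5" for c
  proof -
    have "gmat c * (zmat * (xmat + ymat)) - zmat * (xmat + ymat) * gmat c \<in> mfil 0 4"
      using mfil_mult[OF gmat_fil z3] mfil_mult[OF z3 gmat_fil] by (simp add: mfil_diff)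
    from mfil_mult[OF this gmat_fil] show ?thesis by simp
  qed
  have "lead2 (2 + 1) (comm gX (comm gX gY)) (ux - ux * (2 * xmat + ymat) - zmat * zmat)"
  proof (rule lead2_comm_gx[OF lead2_Z])
    have "(xmat * (zmat - zmat * (xmat + ymat)) - (zmat - zmat * (xmat + ymat)) * xmat) * (1 - xmat) -
        (ux - ux * (2 * xmat + ymat) - zmat * zmat) =
        (xmat * (zmat * (xmat + ymat)) - zmat * (xmat + ymat) * xmat) * xmat"
      by (simp add: numeral_pull umat_def zmat_def algebra_simps)
    then show "(xmat * (zmat - zmat * (xmat + ymat)) - (zmat - zmat * (xmat + ymat)) * xmat) * (1 - xmat) -
        (ux - ux * (2 * xmat + ymat) - zmat * zmat) \<in> mfil 0 (2 + 3)"
      using rest[of gen_x] by simp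
  qed (use umat_fil u zz in \<open>simp_all add: mfil_diff\<close>)
  then show "lead2 3 (comm gX (comm gX gY)) (ux - ux * (2 * xmat + ymat) - zmat * zmat)" by simp
  have "lead2 (2 + 1) (comm gY (comm gX gY)) (uy - uy * (xmat + 2 * ymat) + zmat * zmat)"
  proof (rule lead2_comm_gx[OF lead2_Z])
    have "(ymat * (zmat - zmat * (xmat + ymat)) - (zmat - zmat * (xmat + ymat)) * ymat) * (1 - ymat) -
        (uy - uy * (xmat + 2 * ymat) + zmat * zmat) =
        (ymat * (zmat * (xmat + ymat)) - zmat * (xmat + ymat) * ymat) * ymat"
      by (simp add: numeral_pull umat_def zmat_def algebra_simps)
    then show "(ymat * (zmat - zmat * (xmat + ymat)) - (zmat - zmat * (xmat + ymat)) * ymat) * (1 - ymat) -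
        (uy - uy * (xmat + 2 * ymat) + zmat * zmat) \<in> mfil 0 (2 + 3)"
      using rest[of gen_y] by simp
  qed (use umat_fil u zz in \<open>simp_all add: mfil_diff mfil_add\<close>)
  then show "lead2 3 (comm gY (comm gX gY)) (uy - uy * (xmat + 2 * ymat) + zmat * zmat)" by simp
qed

text \<open>The scalar term z^2 of the previous step is central and drops out; the rest is the
  Leibniz rule and the factor \<open>1 - gmat c\<close>.\<close>

lemma lead2_step4:
  assumes b: "lead2 3 b (umat d - umat d * S + scal s)" and S: "S \<in> mfil 0 1" and s: "scal s \<in> mfil 0 4"
    and w: "gmat c * umat d - umat d * gmat c = w"
    and L: "L = w - w * S - umat d * (gmat c * S - S * gmat c) - w * gmat c"
  shows "lead2 4 (comm (gx c) b) L"
proof -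
  let ?M = "umat d - umat d * S + scal s"
  have wfil: "w \<in> mfil 0 4"
    using mfil_mult[OF gmat_fil umat_fil] mfil_mult[OF umat_fil gmat_fil] by (simp add: mfil_diff flip: w)
  have br: "gmat c * S - S * gmat c \<in> mfil 0 2"
    using mfil_mult[OF gmat_fil S] mfil_mult[OF S gmat_fil] by (simp add: mfil_diff numeral_2_eq_2)
  have r: "w * S + umat d * (gmat c * S - S * gmat c) \<in> mfil 0 5"
    using mfil_mult[OF wfil S] mfil_mult[OF umat_fil br] by (simp add: mfil_add)
  have "(gmat c * ?M - ?M * gmat c) * (1 - gmat c) - L = (w * S + umat d * (gmat c * S - S * gmat c)) * gmat c"
    unfolding L w[symmetric] by (simp add: algebra_simps scal_commute)
  moreover have "\<dots> \<in> mfil 0 (3 + 3)" using mfil_mult[OF r gmat_fil] by simp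
  moreover have "umat d * (gmat c * S - S * gmat c) \<in> mfil 0 4"
    by (rule mfil_mult3[OF umat_fil br]) simp
  then have "L \<in> mfil 0 (3 + 1)"
    unfolding L using wfil by (simp add: mfil_diff mfil_mult_right)
  ultimately have "lead2 (3 + 1) (comm (gx c) b) L"
    by (intro lead2_comm_gx[OF b]) auto
  then show ?thesis by simp
qed

text \<open>With z - z (x + y) and w4 + w5 as two-term expansions, the bracket of z and w4 in degree
  6 vanishes by hypothesis, and the mixed brackets make up degree 7.\<close>

lemma lead7:
  assumes W: "lead2 4 W (w4 + w5)" and w4: "w4 \<in> mfil 0 4" and w5: "w5 \<in> mfil 0 5"
    and c: "zmat * w4 = w4 * zmat"
    and L: "L = (w4 * (zmat * (xmat + ymat)) - zmat * (xmat + ymat) * w4) + (zmat * w5 - w5 * zmat)"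
  shows "lead 7 (comm (comm gX gY) W) L"
proof -
  let ?Z = "rep (comm gX gY) - 1" and ?W = "rep W - 1"
  let ?z = "zmat - zmat * (xmat + ymat)" and ?w = "w4 + w5"
  define z3 where "z3 = zmat * (xmat + ymat)"
  have z3: "z3 \<in> mfil 0 3"
    using mfil_mult[OF zmat_fil mfil_add[OF gmat_fil gmat_fil]] by (simp add: z3_def)
  have "(?Z * ?W - ?W * ?Z) - (?z * ?w - ?w * ?z) \<in> mfil 0 (2 + 4 + 2)"
    by (rule bracket_approx) (use lead2_Z W lead2_mfil[OF lead2_Z] lead2_mfil[OF W] in \<open>simp_all add: lead2_def\<close>)
  moreover have "(?z * ?w - ?w * ?z) - L = - (z3 * w5 - w5 * z3)"
    unfolding L z3_def using c by (simp add: algebra_simps)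
  moreover have "- (z3 * w5 - w5 * z3) \<in> mfil 0 8"
    using mfil_mult[OF z3 w5] mfil_mult[OF w5 z3] by (intro mfil_minus mfil_diff) simp_all
  ultimately have "((?Z * ?W - ?W * ?Z) - (?z * ?w - ?w * ?z)) + ((?z * ?w - ?w * ?z) - L) \<in> mfil 0 8"
    by (intro mfil_add) simp_all
  then have 1: "(?Z * ?W - ?W * ?Z) - L \<in> mfil 0 (Suc 7)" by simp
  have L7: "L \<in> mfil 0 7"
    unfolding L using mfil_mult[OF w4 z3] mfil_mult[OF z3 w4] mfil_mult[OF zmat_fil w5] mfil_mult[OF w5 zmat_fil]
    by (intro mfil_add mfil_diff) (simp_all add: z3_def)
  have "(?Z * ?W - ?W * ?Z - L) + L \<in> mfil 0 7"
    using mfil_le[OF 1, of 7] L7 by (intro mfil_add) simp_all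
  then have "?Z * ?W - ?W * ?Z \<in> mfil 0 7" by simp
  from mult_unit_mfil[OF this rep_unit 1] show ?thesis
    using L7 unfolding lead_def rep_comm by (simp only: add_diff_cancel_left' simp_thms)
qed

text \<open>Moving every \<open>z\<close> to the left, the terms in z z P and z z S cancel and only
  the commutators \<open>p\<close> and \<open>s\<close> survive.\<close>

lemma bracket_identity:
  assumes P: "P * z = z * P + p" and S: "S * z = z * S + s"
  shows "(scal a * z * (z * P) - z * P * (scal a * z)) + (z * (- (scal a * z * S) + T) - (- (scal a * z * S) + T) * z) =
     scal a * (z * (s - p)) + (z * T - T * z)"
proof -
  have 1: "z * P * (scal a * z) = scal a * (z * (z * P + p))"
    unfolding P[symmetric] by (simp only: mult.assoc scal_commute_left[of z] scal_commute_left[of P])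
  have 2: "scal a * z * S * z = scal a * (z * (z * S + s))"
    unfolding S[symmetric] by (simp only: mult.assoc)
  have 3: "z * (scal a * z * S) = scal a * (z * (z * S))"
    by (simp only: mult.assoc scal_commute_left[of z])
  have "(scal a * z * (z * P) - z * P * (scal a * z)) + (z * (- (scal a * z * S) + T) - (- (scal a * z * S) + T) * z) =
      scal a * z * (z * P) - z * P * (scal a * z) - z * (scal a * z * S) + scal a * z * S * z + (z * T - T * z)"
    by (simp add: algebra_simps)
  also have "\<dots> = scal a * (z * (s - p)) + (z * T - T * z)"
    unfolding 1 2 3 by (simp add: algebra_simps)
  finally show ?thesis .
qed

lemma gmat_times_zmat: "gmat c * zmat = zmat * gmat c + umat c"
  by (simp add: umat_def)

lemma bracket_umat_zmat: "zmat * (umat c * zmat) - umat c * zmat * zmat = - (2 * (zmat * zmat * umat c))"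
proof -
  have "zmat * (umat c * zmat) = - (zmat * zmat * umat c)" by (simp add: umat_zmat mult.assoc)
  moreover have "umat c * zmat * zmat = zmat * zmat * umat c"
  proof -
    have "umat c * zmat * zmat = - (zmat * umat c) * zmat" by (simp only: umat_zmat)
    also have "\<dots> = - (zmat * (umat c * zmat))" by (simp add: mult.assoc)
    also have "\<dots> = zmat * zmat * umat c" unfolding umat_zmat by (simp add: mult.assoc)
    finally show ?thesis .
  qed
  ultimately show ?thesis by (simp add: mult_2)
qed

lemma four_zmat_zmat: "4 * (zmat * zmat * M) = scal (disc_xy ^ 2 - disc_xx * disc_yy) * M"
proof -
  have "4 * (zmat * zmat * M) = scal (4 * (- det2 zmat)) * M"
    unfolding zmat_square numeral_scal[of "num.Bit0 (num.Bit0 num.One)", where 'a = "var mps"] by (simp only: scal_hom mult.assoc)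
  then show ?thesis by (simp only: det2_zmat)
qed

lemma lead2_opE1:
  "lead2 4 (opA gX gY (comm gX gY)) (scal disc_xx * zmat + (- (scal disc_xx * zmat * (3 * xmat + ymat)) + - (ux * zmat)))"
  "lead2 4 (opB gX gY (comm gX gY)) (scal disc_xy * zmat + (- (scal disc_xy * zmat * (2 * xmat + 2 * ymat)) + - (2 * (uy * zmat))))"
  "lead2 4 (opC gX gY (comm gX gY)) (scal disc_yy * zmat + (- (scal disc_yy * zmat * (xmat + 3 * ymat)) + uy * zmat))"
proof -
  have S: "2 * xmat + ymat \<in> mfil 0 1" "xmat + 2 * ymat \<in> mfil 0 1"
    using gmat_fil by (simp_all add: mfil_add mult_2)
  have s: "scal (- det2 zmat) \<in> mfil 0 4" "scal (det2 zmat) \<in> mfil 0 4"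
  proof -
    show *: "scal (- det2 zmat) \<in> mfil 0 4" using mfil_mult[OF zmat_fil zmat_fil] by (simp add: zmat_square)
    show "scal (det2 zmat) \<in> mfil 0 4" using mfil_minus[OF *] by (simp add: scal_hom)
  qed
  have X: "lead2 3 (comm gX (comm gX gY)) (ux - ux * (2 * xmat + ymat) + scal (det2 zmat))"
    using lead2_XZ(1) by (simp add: zmat_square scal_hom)
  have Y: "lead2 3 (comm gY (comm gX gY)) (uy - uy * (xmat + 2 * ymat) + scal (- det2 zmat))"
    using lead2_XZ(2) by (simp add: zmat_square)
  have bx: "xmat * (2 * xmat + ymat) - (2 * xmat + ymat) * xmat = zmat"
    "xmat * (xmat + 2 * ymat) - (xmat + 2 * ymat) * xmat = 2 * zmat"
    "ymat * (xmat + 2 * ymat) - (xmat + 2 * ymat) * ymat = - zmat"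
    by (simp_all add: zmat_def algebra_simps numeral_pull)
  show "lead2 4 (opA gX gY (comm gX gY)) (scal disc_xx * zmat + (- (scal disc_xx * zmat * (3 * xmat + ymat)) + - (ux * zmat)))"
    unfolding opA_def
    by (rule lead2_step4[OF X S(1) s(2) gmat_umat], unfold bx) (simp add: numeral_pull algebra_simps)
  show "lead2 4 (opB gX gY (comm gX gY)) (scal disc_xy * zmat + (- (scal disc_xy * zmat * (2 * xmat + 2 * ymat)) + - (2 * (uy * zmat))))"
    unfolding opB_def
    by (rule lead2_step4[OF Y S(2) s(1) gmat_umat], unfold bx) (simp add: numeral_pull algebra_simps)
  show "lead2 4 (opC gX gY (comm gX gY)) (scal disc_yy * zmat + (- (scal disc_yy * zmat * (xmat + 3 * ymat)) + uy * zmat))"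
    unfolding opC_def
    by (rule lead2_step4[OF Y S(2) s(1) gmat_umat], unfold bx) (simp add: numeral_pull algebra_simps)
qed

lemma lead7_disc:
  assumes W: "lead2 4 W (scal d * zmat + (- (scal d * zmat * S) + T))"
    and d: "scal d * zmat \<in> mfil 0 4" and S: "S \<in> mfil 0 1" "S * zmat = zmat * S + s" and T: "T \<in> mfil 0 5"
  shows "lead 7 (comm (comm gX gY) W) (scal d * (zmat * (s - (ux + uy))) + (zmat * T - T * zmat))"
proof (rule lead7[OF W d])
  show "- (scal d * zmat * S) + T \<in> mfil 0 5"
    using mfil_mult[OF d S(1)] T by (intro mfil_add mfil_minus) simp_all
  show "zmat * (scal d * zmat) = scal d * zmat * zmat"
    by (simp only: mult.assoc scal_commute_left[of zmat])
  have "(xmat + ymat) * zmat = zmat * (xmat + ymat) + (ux + uy)"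
    by (simp add: distrib_left distrib_right gmat_times_zmat)
  from bracket_identity[OF this S(2), of d T]
  show "scal d * (zmat * (s - (ux + uy))) + (zmat * T - T * zmat) =
      scal d * zmat * (zmat * (xmat + ymat)) - zmat * (xmat + ymat) * (scal d * zmat) +
      (zmat * (- (scal d * zmat * S) + T) - (- (scal d * zmat * S) + T) * zmat)" by simp
qed

abbreviation "dA \<equiv> disc_xx"
abbreviation "dB \<equiv> disc_xy"
abbreviation "dC \<equiv> disc_yy"

text \<open>\<open>R\<close> itself involves the products of z with \<open>ux\<close> and
  \<open>uy\<close>, which are integral combinations of discriminant multiples of \<open>ux\<close>
  and \<open>uy\<close> only after doubling.\<close>

lemma lead7_R6:
  "\<exists>R. lead 7 (comm (comm gX gY) (opA gX gY (comm gX gY))) R \<and>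
     2 * R = scal (2 * dA * dB + dB ^ 2 - dA * dC) * ux + scal (- 2 * dA ^ 2) * uy"
  "\<exists>R. lead 7 (comm (comm gX gY) (opB gX gY (comm gX gY))) R \<and>
     2 * R = scal (dB ^ 2 + dB * dC) * ux + scal (dB ^ 2 - dA * dB - 2 * dA * dC) * uy"
  "\<exists>R. lead 7 (comm (comm gX gY) (opC gX gY (comm gX gY))) R \<and>
     2 * R = scal (2 * dC ^ 2) * ux + scal (- 2 * dB * dC - dB ^ 2 + dA * dC) * uy"
proof -
  have d: "scal (disc (gmat c) (gmat d)) * zmat \<in> mfil 0 4" for c d
    using mfil_mult[OF gmat_fil umat_fil, of c d] mfil_mult[OF umat_fil gmat_fil, of d c]
    by (simp add: mfil_diff flip: gmat_umat)
  have S: "3 * xmat + ymat \<in> mfil 0 1" "2 * xmat + 2 * ymat \<in> mfil 0 1" "xmat + 3 * ymat \<in> mfil 0 1"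
    using gmat_fil by (simp_all add: mfil_add mult_2 mult_small_numeral)
  have Sz: "(3 * xmat + ymat) * zmat = zmat * (3 * xmat + ymat) + (3 * ux + uy)"
    "(2 * xmat + 2 * ymat) * zmat = zmat * (2 * xmat + 2 * ymat) + (2 * ux + 2 * uy)"
    "(xmat + 3 * ymat) * zmat = zmat * (xmat + 3 * ymat) + (ux + 3 * uy)"
    by (simp_all add: distrib_left distrib_right gmat_times_zmat numeral_pull)
  have T: "umat c * zmat \<in> mfil 0 5" for c
    using mfil_mult[OF umat_fil zmat_fil, of c] by simp
  have T2: "- (2 * (umat c * zmat)) \<in> mfil 0 5" for c
    unfolding mult_2 by (rule mfil_minus[OF mfil_add[OF T T]])
  note L = lead7_disc[OF lead2_opE1(1) d S(1) Sz(1) mfil_minus[OF T]]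
    lead7_disc[OF lead2_opE1(2) d S(2) Sz(2) T2] lead7_disc[OF lead2_opE1(3) d S(3) Sz(3) T]
  have bz: "zmat * - (umat c * zmat) - - (umat c * zmat) * zmat = 2 * (zmat * zmat * umat c)"
    "zmat * - (2 * (umat c * zmat)) - - (2 * (umat c * zmat)) * zmat = 4 * (zmat * zmat * umat c)" for c
    using bracket_umat_zmat[of c] by (simp_all add: numeral_pull algebra_simps)
  show "\<exists>R. lead 7 (comm (comm gX gY) (opA gX gY (comm gX gY))) R \<and>
     2 * R = scal (2 * dA * dB + dB ^ 2 - dA * dC) * ux + scal (- 2 * dA ^ 2) * uy"
  proof (intro exI conjI, rule L(1))
    have "2 * (scal dA * (zmat * (3 * ux + uy - (ux + uy))) + (zmat * - (ux * zmat) - - (ux * zmat) * zmat)) =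
        2 * (scal dA * (2 * (zmat * ux))) + 4 * (zmat * zmat * ux)"
      unfolding bz by (simp add: numeral_pull algebra_simps)
    also have "\<dots> = scal (2 * dA * dB + dB ^ 2 - dA * dC) * ux + scal (- 2 * dA ^ 2) * uy"
      unfolding two_zmat_umat four_zmat_zmat
      by (simp add: mat2_eq_iff mat2_sel_numeral algebra_simps power2_eq_square)
    finally show "2 * (scal dA * (zmat * (3 * ux + uy - (ux + uy))) + (zmat * - (ux * zmat) - - (ux * zmat) * zmat)) =
        scal (2 * dA * dB + dB ^ 2 - dA * dC) * ux + scal (- 2 * dA ^ 2) * uy" .
  qed
  show "\<exists>R. lead 7 (comm (comm gX gY) (opB gX gY (comm gX gY))) R \<and>
     2 * R = scal (dB ^ 2 + dB * dC) * ux + scal (dB ^ 2 - dA * dB - 2 * dA * dC) * uy"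
  proof (intro exI conjI, rule L(2))
    have "2 * (scal dB * (zmat * (2 * ux + 2 * uy - (ux + uy))) + (zmat * - (2 * (uy * zmat)) - - (2 * (uy * zmat)) * zmat)) =
        scal dB * (2 * (zmat * ux)) + scal dB * (2 * (zmat * uy)) + 2 * (4 * (zmat * zmat * uy))"
      unfolding bz by (simp add: numeral_pull algebra_simps)
    also have "\<dots> = scal (dB ^ 2 + dB * dC) * ux + scal (dB ^ 2 - dA * dB - 2 * dA * dC) * uy"
      unfolding two_zmat_umat four_zmat_zmat
      by (simp add: mat2_eq_iff mat2_sel_numeral algebra_simps power2_eq_square)
    finally show "2 * (scal dB * (zmat * (2 * ux + 2 * uy - (ux + uy))) + (zmat * - (2 * (uy * zmat)) - - (2 * (uy * zmat)) * zmat)) =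
        scal (dB ^ 2 + dB * dC) * ux + scal (dB ^ 2 - dA * dB - 2 * dA * dC) * uy" .
  qed
  show "\<exists>R. lead 7 (comm (comm gX gY) (opC gX gY (comm gX gY))) R \<and>
     2 * R = scal (2 * dC ^ 2) * ux + scal (- 2 * dB * dC - dB ^ 2 + dA * dC) * uy"
  proof (intro exI conjI, rule L(3))
    have "2 * (scal dC * (zmat * (ux + 3 * uy - (ux + uy))) + (zmat * (uy * zmat) - uy * zmat * zmat)) =
        2 * (scal dC * (2 * (zmat * uy))) - 4 * (zmat * zmat * uy)"
      unfolding bracket_umat_zmat by (simp add: numeral_pull algebra_simps)
    also have "\<dots> = scal (2 * dC ^ 2) * ux + scal (- 2 * dB * dC - dB ^ 2 + dA * dC) * uy"
      unfolding two_zmat_umat four_zmat_zmat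
      by (simp add: mat2_eq_iff mat2_sel_numeral algebra_simps power2_eq_square)
    finally show "2 * (scal dC * (zmat * (ux + 3 * uy - (ux + uy))) + (zmat * (uy * zmat) - uy * zmat * zmat)) =
        scal (2 * dC ^ 2) * ux + scal (- 2 * dB * dC - dB ^ 2 + dA * dC) * uy" .
  qed
qed

section \<open>The nine elements of weight six\<close>

lemma nmul_cong_V:
  assumes "int p ^ (k * k) dvd int a - int b"
  shows "nmul a g - nmul b g \<in> adicV p k"
proof -
  have *: "nmul (b + q * p ^ (k * k)) g - nmul b g \<in> adicV p k" for b q
  proof -
    have "nmul (q * p ^ (k * k)) g \<in> adicV p k"
      unfolding nmul_mult using nmul_V nmul_in[OF nsubgrpD(1)[OF nsubgrp_V]] by blast
    then show ?thesis unfolding nmul_add using nsubgrpD(2)[OF nsubgrp_V] by blast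
  qed
  have "\<exists>q. a = b + q * p ^ (k * k) \<or> b = a + q * p ^ (k * k)"
  proof (cases "b \<le> a")
    case True
    then have "p ^ (k * k) dvd a - b" using assms by (metis of_nat_diff of_nat_dvd_iff of_nat_power)
    then obtain q where "a - b = q * p ^ (k * k)" by (metis dvdE mult.commute)
    then show ?thesis using True by (metis le_add_diff_inverse)
  next
    case False
    then have "p ^ (k * k) dvd b - a"
      using assms by (metis dvd_diff_commute nat_le_linear of_nat_diff of_nat_dvd_iff of_nat_power)
    then obtain q where "b - a = q * p ^ (k * k)" by (metis dvdE mult.commute)
    then show ?thesis using False by (metis le_add_diff_inverse nat_le_linear)
  qed
  then show ?thesis using * nsubgrp_cong_sym[OF nsubgrp_V] by metis
qed

lemma lin_cong_V:
  "(\<And>i. i \<in> set is \<Longrightarrow> int p ^ (k * k) dvd int (\<mu> i) - int (\<mu>' i)) \<Longrightarrow> lin e \<mu> is - lin e \<mu>' is \<in> adicV p k"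
proof (induction "is")
  case Nil
  then show ?case using nsubgrp_mem(1)[OF nsubgrp_V] by simp
next
  case (Cons i "is")
  then show ?case unfolding lin_simps by (intro nsubgrp_cong_add[OF nsubgrp_V] nmul_cong_V) auto
qed

text \<open>\<open>True\<close> tags the six monomials, \<open>False\<close> the three commutators
  with z.\<close>

definition e6 :: "bool \<times> nat \<times> nat \<times> nat \<Rightarrow> gam" where
  "e6 = (\<lambda>(b, t). if b then opE gX gY t else comm (comm gX gY) (opE gX gY t))"

definition ind6 :: "(bool \<times> nat \<times> nat \<times> nat) list" where
  "ind6 = map (Pair True) (triple_list 2) @ map (Pair False) (triple_list (Suc 0))"

lemma set_ind6: "set ind6 = Pair True ` triples 2 \<union> Pair False ` triples (Suc 0)"
  by (simp add: ind6_def triple_list)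

lemma distinct_ind6: "distinct ind6"
  by (auto simp: ind6_def distinct_map triple_list inj_on_def)

lemma length_ind6: "length ind6 = 9"
  using card_triples[of 2] card_triples[of "Suc 0"] by (simp add: ind6_def triple_list(3))

lemma e6_lcs: "i \<in> set ind6 \<Longrightarrow> e6 i \<in> lcs 6"
proof -
  have "opE gX gY t \<in> lcs 6" if "t \<in> triples 2" for t
    using opE_lcs[OF that] by simp
  moreover have "comm (comm gX gY) (opE gX gY t) \<in> lcs 6" if "t \<in> triples (Suc 0)" for t
    using comm_lcs[of 2 4 "comm gX gY" "opE gX gY t"] LG.Z_mem opE_lcs[OF that] by simp
  ultimately show "i \<in> set ind6 \<Longrightarrow> e6 i \<in> lcs 6" unfolding set_ind6 e6_def by auto
qed

lemma lin_append: "lin e \<mu> (xs @ ys) = lin e \<mu> xs + lin e \<mu> ys"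
  by (induction xs) (simp_all add: add.assoc)

lemma lin_map: "lin e \<mu> (map h xs) = lin (e \<circ> h) (\<mu> \<circ> h) xs"
  by (induction xs) simp_all

lemma spans_ind6: "D.spans p k 6 (e6 ` set ind6)"
proof -
  have "e6 ` set ind6 = {opA gX gY (opA gX gY (comm gX gY)), opA gX gY (opB gX gY (comm gX gY)),
     opA gX gY (opC gX gY (comm gX gY)), opB gX gY (opB gX gY (comm gX gY)),
     opB gX gY (opC gX gY (comm gX gY)), opC gX gY (opC gX gY (comm gX gY))} \<union> D.R6"
    unfolding set_ind6 triples_1 triples_2 D.R6_def
    by (simp add: e6_def numeral_2_eq_2 image_Un insert_commute)
  then show ?thesis using D.spans_6[of p k] by simp
qed

text \<open>The combination of the elements \<open>[z, A z]\<close>, \<open>[z, B z]\<close>, \<open>[z, C z]\<close> with coefficients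
  \<open>a\<close>, \<open>b\<close>, \<open>c\<close> has a leading term of degree 7, which is half of an integral combination
  of the leading terms of degree 7 of commutators.\<close>

definition kap_x :: "int \<Rightarrow> int \<Rightarrow> int \<Rightarrow> nat \<times> nat \<times> nat \<Rightarrow> int" where
  "kap_x a b c t = (if t = (1, 1, 0) then 2 * a else if t = (0, 2, 0) then a + b
     else if t = (1, 0, 1) then - a else if t = (0, 1, 1) then b else if t = (0, 0, 2) then 2 * c else 0)"

definition kap_y :: "int \<Rightarrow> int \<Rightarrow> int \<Rightarrow> nat \<times> nat \<times> nat \<Rightarrow> int" where
  "kap_y a b c t = (if t = (2, 0, 0) then - 2 * a else if t = (1, 1, 0) then - b else if t = (0, 2, 0) then b - c
     else if t = (1, 0, 1) then c - 2 * b else if t = (0, 1, 1) then - 2 * c else 0)"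

lemma disc_poly_2:
  "disc_poly 2 \<nu> = of_int (\<nu> (2, 0, 0)) * dA ^ 2 + of_int (\<nu> (1, 1, 0)) * (dA * dB) + of_int (\<nu> (1, 0, 1)) * (dA * dC)
     + of_int (\<nu> (0, 2, 0)) * dB ^ 2 + of_int (\<nu> (0, 1, 1)) * (dB * dC) + of_int (\<nu> (0, 0, 2)) * dC ^ 2"
  by (simp add: disc_poly_def triples_2 power2_eq_square)

lemma lead7_kap:
  "\<exists>R. (\<forall>t\<in>triples (Suc 0). lead 7 (comm (comm gX gY) (opE gX gY t)) (R t)) \<and>
     (\<forall>\<nu>. 2 * (\<Sum>t\<in>triples (Suc 0). of_int (\<nu> t) * R t) =
        scal (disc_poly 2 (kap_x (\<nu> (1, 0, 0)) (\<nu> (0, 1, 0)) (\<nu> (0, 0, 1)))) * ux +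
        scal (disc_poly 2 (kap_y (\<nu> (1, 0, 0)) (\<nu> (0, 1, 0)) (\<nu> (0, 0, 1)))) * uy)"
proof -
  obtain RA RB RC where
    RA: "lead 7 (comm (comm gX gY) (opA gX gY (comm gX gY))) RA"
      "2 * RA = scal (2 * dA * dB + dB ^ 2 - dA * dC) * ux + scal (- 2 * dA ^ 2) * uy" and
    RB: "lead 7 (comm (comm gX gY) (opB gX gY (comm gX gY))) RB"
      "2 * RB = scal (dB ^ 2 + dB * dC) * ux + scal (dB ^ 2 - dA * dB - 2 * dA * dC) * uy" and
    RC: "lead 7 (comm (comm gX gY) (opC gX gY (comm gX gY))) RC"
      "2 * RC = scal (2 * dC ^ 2) * ux + scal (- 2 * dB * dC - dB ^ 2 + dA * dC) * uy"
    using lead7_R6 by blast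
  define R where "R t = (if t = (1, 0, 0) then RA else if t = (0, 1, 0) then RB else RC)"
    for t :: "nat \<times> nat \<times> nat"
  have "\<forall>t\<in>triples (Suc 0). lead 7 (comm (comm gX gY) (opE gX gY t)) (R t)"
    using RA(1) RB(1) RC(1) by (simp add: triples_1 R_def)
  moreover have "2 * (\<Sum>t\<in>triples (Suc 0). of_int (\<nu> t) * R t) =
        scal (disc_poly 2 (kap_x (\<nu> (1, 0, 0)) (\<nu> (0, 1, 0)) (\<nu> (0, 0, 1)))) * ux +
        scal (disc_poly 2 (kap_y (\<nu> (1, 0, 0)) (\<nu> (0, 1, 0)) (\<nu> (0, 0, 1)))) * uy" for \<nu>
  proof -
    define a b c where "a = \<nu> (1, 0, 0)" and "b = \<nu> (0, 1, 0)" and "c = \<nu> (0, 0, 1)"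
    have "2 * (\<Sum>t\<in>triples (Suc 0). of_int (\<nu> t) * R t) = 2 * (of_int a * RA + of_int b * RB + of_int c * RC)"
      by (simp add: triples_1 R_def a_def b_def c_def)
    also have "\<dots> = scal (of_int a) * (2 * RA) + scal (of_int b) * (2 * RB) + scal (of_int c) * (2 * RC)"
      by (simp add: of_int_eq_scal distrib_left mat2_numeral_commute[where A = "scal a" for a])
    also have "\<dots> = scal (disc_poly 2 (kap_x a b c)) * ux + scal (disc_poly 2 (kap_y a b c)) * uy"
      unfolding RA(2) RB(2) RC(2) disc_poly_2 kap_x_def kap_y_def
      by (simp add: mat2_eq_iff algebra_simps)
    finally show ?thesis by (simp add: a_def b_def c_def)
  qed
  ultimately show ?thesis by blast
qed

text \<open>Write \<open>s\<close> through coordinates and compare with twice them. Degree 6 makes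
  the differences on the monomials highly divisible, so the monomials drop out. The remaining
  combination of the three commutators then lies in \<open>lcs 7\<close> to high precision, so its
  half integral leading term must be integral, which forces its coefficients to be even.\<close>

lemma independence_mod_squares:
  "\<exists>k. \<forall>\<mu>. \<forall>s\<in>lcs 6. lin e6 \<mu> ind6 - (s + s) \<in> lcsV 2 k 7 \<longrightarrow> (\<forall>i\<in>set ind6. even (\<mu> i))"
proof -
  define c :: int where "c = 4 ^ (2 * (2 + 1))"
  obtain d where d: "\<And>m \<nu>. int 2 ^ (m + d) dvd c * \<nu> \<Longrightarrow> int 2 ^ m dvd \<nu>"
    using dvd_cancel_power[of 2 c] by (auto simp: c_def)
  \<comment> \<open>\<open>odd_indep\<close> for \<open>K = 2\<close> loses the factor 2 * 4^12 =
    2^25, so 2^26 leaves one factor 2 to decide parity; moreover \<open>j\<close> exceeds degree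
    8.\<close>
  define j where "j = (26 :: nat)"
  \<comment> \<open>\<open>j * j\<close> is the divisibility required by \<open>lin_cong_V\<close>
    at level \<open>j\<close>, \<open>d\<close> pays for the constant of \<open>even_indep\<close>,
    and 8 covers the degrees involved.\<close>
  define k where "k = j * j + d + 8"
  have jk: "j \<le> k" by (simp add: j_def k_def)
  have "even (\<mu> i)" if s: "s \<in> lcs 6" and \<mu>: "lin e6 \<mu> ind6 - (s + s) \<in> lcsV 2 k 7" and i: "i \<in> set ind6" for \<mu> s i
  proof -
    obtain \<sigma> where \<sigma>: "D.eqv 2 k 7 s (lin e6 \<sigma> ind6)"
      using lcs_lin[OF _ _ distinct_ind6 e6_lcs spans_ind6 s, of 2 k] by auto
    define \<tau> where "\<tau> = (\<lambda>i. \<sigma> i + \<sigma> i)"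
    have "D.eqv 2 k 7 (lin e6 \<tau> ind6) (lin e6 \<sigma> ind6 + lin e6 \<sigma> ind6)"
      using D.lin_add[of 6 ind6 e6 2 k \<sigma> \<sigma>] e6_lcs lcs_D by (simp add: \<tau>_def)
    also have "D.eqv 2 k 7 \<dots> (s + s)" by (intro D.eqv_add D.eqv_sym[OF \<sigma>])
    also have "D.eqv 2 k 7 (s + s) (lin e6 \<mu> ind6)" using \<mu> D.eqv_sym by (simp add: D.eqv_def)
    finally have "D.eqv 2 k 7 (lin e6 \<mu> ind6) (lin e6 \<tau> ind6)" by (rule D.eqv_sym)
    define T where "T \<mu> = lin (opE gX gY) (\<mu> \<circ> Pair True) (triple_list 2)" for \<mu>
    define F where "F \<mu> = lin (\<lambda>t. comm (comm gX gY) (opE gX gY t)) (\<mu> \<circ> Pair False) (triple_list (Suc 0))" for \<mu>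
    have lin6: "lin e6 \<mu> ind6 = T \<mu> + F \<mu>" for \<mu>
      unfolding ind6_def lin_append lin_map T_def F_def by (simp add: e6_def comp_def)
    define g where "g = (T \<mu> + F \<mu>) - (T \<tau> + F \<tau>)"
    have g: "g \<in> lcsV 2 k 7"
      using \<open>D.eqv 2 k 7 (lin e6 \<mu> ind6) (lin e6 \<tau> ind6)\<close> by (simp add: D.eqv_def lin6 g_def)
    define \<nu> where "\<nu> i = int (\<mu> i) - int (\<tau> i)" for i
    obtain R where R: "\<And>t. t \<in> triples (Suc 0) \<Longrightarrow> lead 7 (comm (comm gX gY) (opE gX gY t)) (R t)"
      "\<And>\<nu>. 2 * (\<Sum>t\<in>triples (Suc 0). of_int (\<nu> t) * R t) =
        scal (disc_poly 2 (kap_x (\<nu> (1, 0, 0)) (\<nu> (0, 1, 0)) (\<nu> (0, 0, 1)))) * ux +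
        scal (disc_poly 2 (kap_y (\<nu> (1, 0, 0)) (\<nu> (0, 1, 0)) (\<nu> (0, 0, 1)))) * uy"
      using lead7_kap by blast
    have lead6_0: "lead 6 (F \<mu>) 0" for \<mu>
    proof -
      have "lead 7 (F \<mu>) (\<Sum>t\<in>set (triple_list (Suc 0)). of_nat ((\<mu> \<circ> Pair False) t) * R t)"
        unfolding F_def using R(1) triple_list by (intro lead_lin) auto
      from lead_U[OF this] show ?thesis by (simp add: lead_def numeral_eq_Suc)
    qed
    have leadT: "lead 6 (T \<mu>) (\<Sum>t\<in>set (triple_list 2). of_nat ((\<mu> \<circ> Pair True) t) * (scal (disc_mono t) * zmat))" for \<mu>
      unfolding T_def using lead_triples(1)[of _ 2] triple_list by (intro lead_lin) auto
    have "lead 6 g (scal (disc_poly 2 (\<lambda>t. \<nu> (True, t))) * zmat)"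
    proof -
      have "lead 6 ((T \<mu> + F \<mu>) + - (T \<tau> + F \<tau>))
         ((\<Sum>t\<in>set (triple_list 2). of_nat ((\<mu> \<circ> Pair True) t) * (scal (disc_mono t) * zmat)) + 0 +
         - ((\<Sum>t\<in>set (triple_list 2). of_nat ((\<tau> \<circ> Pair True) t) * (scal (disc_mono t) * zmat)) + 0))"
        by (intro lead_add lead_minus leadT lead6_0) auto
      moreover have "(\<Sum>t\<in>set (triple_list 2). of_nat ((\<mu> \<circ> Pair True) t) * (scal (disc_mono t) * zmat)) + 0 +
         - ((\<Sum>t\<in>set (triple_list 2). of_nat ((\<tau> \<circ> Pair True) t) * (scal (disc_mono t) * zmat)) + 0) =
         (\<Sum>t\<in>triples 2. of_int (\<nu> (True, t)) * (scal (disc_mono t) * zmat))"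
        by (simp add: triple_list \<nu>_def left_diff_distrib sum_subtractf)
      moreover have "\<dots> = scal (disc_poly 2 (\<lambda>t. \<nu> (True, t))) * zmat"
        by (simp add: mat2_eq_iff disc_poly_def sum_distrib_right of_int_eq_scal mult.assoc)
      ultimately show ?thesis by (simp add: g_def)
    qed
    then have "rep g - 1 - scal (disc_poly 2 (\<lambda>t. \<nu> (True, t))) * zmat \<in> mfil (int 2 ^ k) 7"
      unfolding lead_def by (auto intro: mfil_0_mono)
    moreover have "rep g - 1 \<in> mfil (int 2 ^ k) 7"
      using D_mfil[of g 2 k 6] g by (simp add: k_def)
    ultimately have "(rep g - 1) - (rep g - 1 - scal (disc_poly 2 (\<lambda>t. \<nu> (True, t))) * zmat) \<in> mfil (int 2 ^ k) 7"
      by (rule mfil_diff[rotated])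
    then have S7: "scal (disc_poly 2 (\<lambda>t. \<nu> (True, t))) * zmat \<in> mfil (int 2 ^ k) (2 * 2 + 3)" by simp
    have \<nu>T: "int 2 ^ (j * j) dvd \<nu> (True, t)" if "t \<in> triples 2" for t
    proof (rule d)
      have "int 2 ^ k dvd c * \<nu> (True, t)"
        using even_indep[OF S7 that] by (simp add: c_def)
      then show "int 2 ^ (j * j + d) dvd c * \<nu> (True, t)"
        by (rule dvd_trans[OF le_imp_power_dvd, rotated]) (simp add: k_def)
    qed
    have "T \<mu> - T \<tau> \<in> adicV 2 j"
      unfolding T_def using \<nu>T by (intro lin_cong_V) (auto simp: triple_list \<nu>_def)
    then have T: "T \<mu> - T \<tau> \<in> lcsV 2 j 7" by (rule V_D)
    have "F \<mu> - F \<tau> \<in> lcsV 2 j 7"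
    proof -
      have "F \<mu> - F \<tau> = (- T \<mu> + g + T \<mu>) + (- T \<mu> + (- (T \<mu> - T \<tau>)) + T \<mu>)"
        by (simp add: g_def group_norm del: add_uminus_conv_diff)
      then show ?thesis
        using T D_antimono_level[OF g jk] nsubgrpD(3)[OF D.nsub] D.D_group(2,3) by metis
    qed
    \<comment> \<open>\<open>a\<close> lies in \<open>lcs 7\<close> and so has an integral leading
      term, while the left side is known to have the leading term \<open>S\<close>, of which only
      the double is integral in the same coordinates.\<close>
    then obtain a v where av: "F \<mu> - F \<tau> = a + v" "a \<in> lcs 7" "v \<in> adicV 2 j" by (auto simp: lcsV_def)
    obtain \<Lambda> where "\<Lambda> \<in> odd_leads 2" and \<Lambda>: "lead 7 a \<Lambda>"
      using lead_exists_odd[of a 2] av(2) by auto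
    then obtain lx ly where lxy: "\<Lambda> = scal (disc_poly 2 lx) * ux + scal (disc_poly 2 ly) * uy"
      by (auto simp: odd_leads_def HP_def)
    define P where "P = int 2 ^ j"
    define S where "S = (\<Sum>t\<in>triples (Suc 0). of_int (\<nu> (False, t)) * R t)"
    have "lead 7 (F \<mu> - F \<tau>) (\<Sum>t\<in>set (triple_list (Suc 0)). of_int (int ((\<mu> \<circ> Pair False) t) - int ((\<tau> \<circ> Pair False) t)) * R t)"
      unfolding F_def using R(1) triple_list by (intro lead_lin_diff) auto
    then have "lead 7 (F \<mu> - F \<tau>) S" by (simp add: S_def triple_list \<nu>_def)
    then have 1: "rep (F \<mu> - F \<tau>) - 1 - S \<in> mfil P 8"
      unfolding lead_def by (auto intro: mfil_0_mono)
    have "rep (F \<mu> - F \<tau>) - 1 - \<Lambda> = (rep a - 1 - \<Lambda>) * rep v + (\<Lambda> * (rep v - 1) + (rep v - 1))"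
      by (simp add: av(1) rep_add algebra_simps)
    moreover have "rep v - 1 \<in> mfil P 8"
      using av(3) mfil_le[of "rep v - 1" P j 8] by (simp add: adicV_def adicU_def P_def j_def)
    moreover have "rep a - 1 - \<Lambda> \<in> mfil P 8"
      using \<Lambda> unfolding lead_def by (auto intro: mfil_0_mono)
    ultimately have 2: "rep (F \<mu> - F \<tau>) - 1 - \<Lambda> \<in> mfil P 8"
      by (simp only: mfil_add mfil_mult_left mfil_mult_right)
    from mfil_diff[OF 2 1] have "S - \<Lambda> \<in> mfil P 8" by simp
    then have "2 * S - 2 * \<Lambda> \<in> mfil P 8"
      using mfil_mult_left[of "S - \<Lambda>" P 8 2] by (simp add: right_diff_distrib)
    define a' b' c' where "a' = \<nu> (False, 1, 0, 0)" and "b' = \<nu> (False, 0, 1, 0)" and "c' = \<nu> (False, 0, 0, 1)"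
    have "2 * S - 2 * \<Lambda> = scal (disc_poly 2 (\<lambda>t. kap_x a' b' c' t - 2 * lx t)) * ux +
        scal (disc_poly 2 (\<lambda>t. kap_y a' b' c' t - 2 * ly t)) * uy"
    proof -
      have sub: "disc_poly 2 (\<lambda>t. \<kappa> t - 2 * lx t) = disc_poly 2 \<kappa> - 2 * disc_poly 2 lx" for \<kappa> lx
        unfolding disc_poly_2 by (simp add: algebra_simps)
      have "2 * S = scal (disc_poly 2 (kap_x a' b' c')) * ux + scal (disc_poly 2 (kap_y a' b' c')) * uy"
        unfolding S_def a'_def b'_def c'_def by (rule R(2))
      then show ?thesis unfolding sub lxy
        by (simp add: mat2_eq_iff mat2_sel_numeral algebra_simps)
    qed
    with \<open>2 * S - 2 * \<Lambda> \<in> mfil P 8\<close>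
    have S8: "scal (disc_poly 2 (\<lambda>t. kap_x a' b' c' t - 2 * lx t)) * ux +
        scal (disc_poly 2 (\<lambda>t. kap_y a' b' c' t - 2 * ly t)) * uy \<in> mfil P (2 * 2 + 4)" by simp
    have ev: "even n" if "P dvd 2 * 4 ^ (2 * (2 * (2 + 1))) * n" for n
    proof -
      have "P = 2 ^ 25 * 2" "2 * 4 ^ (2 * (2 * (2 + 1))) * n = 2 ^ 25 * n"
        by (simp_all add: P_def j_def)
      then show ?thesis using that by (metis dvd_mult_cancel_left zero_neq_numeral power_eq_0_iff)
    qed
    \<comment> \<open>These three coefficients are - a', b' and c' - 2 b'.\<close>
    have "even (kap_x a' b' c' (1, 0, 1))" "even (kap_x a' b' c' (0, 1, 1))" "even (kap_y a' b' c' (1, 0, 1))"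
      using ev[OF odd_indep(1)[OF S8, of "(1, 0, 1)"]] ev[OF odd_indep(1)[OF S8, of "(0, 1, 1)"]]
        ev[OF odd_indep(2)[OF S8, of "(1, 0, 1)"]] by (simp_all add: triples_2)
    then have "even a'" "even b'" "even c'" by (simp_all add: kap_x_def kap_y_def)
    then have \<nu>F: "even (\<nu> (False, t))" if "t \<in> triples (Suc 0)" for t
      using that by (auto simp: triples_1 a'_def b'_def c'_def)
    have "even (\<nu> (True, t))" if "t \<in> triples 2" for t
      using dvd_trans[OF _ \<nu>T[OF that], of 2] by (simp add: j_def)
    with \<nu>F i have "even (\<nu> i)" by (auto simp: set_ind6)
    then show ?thesis by (simp add: \<nu>_def \<tau>_def)
  qed
  then show ?thesis by blast
qed

subsection \<open>Topologies given by decreasing equivalence relations\<close>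

text \<open>One description for all the topologies involved: p-adic integers, matrices, their
  subgroups and the quotients. A set is open if with each point it contains one of its
  classes.\<close>

definition utop :: "(nat \<Rightarrow> 'a \<Rightarrow> 'a \<Rightarrow> bool) \<Rightarrow> 'a set \<Rightarrow> 'a topology" where
  "utop R W = topology (\<lambda>U. U \<subseteq> W \<and> (\<forall>a\<in>U. \<exists>k. \<forall>b\<in>W. R k a b \<longrightarrow> b \<in> U))"

locale decreasing_equivs =
  fixes R :: "nat \<Rightarrow> 'a \<Rightarrow> 'a \<Rightarrow> bool" and W :: "'a set"
  assumes R_refl: "R k a a"
    and R_sym: "R k a b \<Longrightarrow> R k b a"
    and R_trans: "R k a b \<Longrightarrow> R k b c \<Longrightarrow> R k a c"
    \<comment> \<open>Monotonicity is asked only on \<open>W\<close>, because for residues it rests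
      on the coherence of the sequences.\<close>
    and R_Suc: "a \<in> W \<Longrightarrow> b \<in> W \<Longrightarrow> R (Suc k) a b \<Longrightarrow> R k a b"
begin

lemma R_le: "R k a b \<Longrightarrow> l \<le> k \<Longrightarrow> a \<in> W \<Longrightarrow> b \<in> W \<Longrightarrow> R l a b"
proof (induction k)
  case (Suc k)
  then show ?case using R_Suc by (metis le_Suc_eq)
qed simp

lemma openin_utop:
  assumes "W' \<subseteq> W"
  shows "openin (utop R W') U \<longleftrightarrow> U \<subseteq> W' \<and> (\<forall>a\<in>U. \<exists>k. \<forall>b\<in>W'. R k a b \<longrightarrow> b \<in> U)"
proof -
  have "istopology (\<lambda>U. U \<subseteq> W' \<and> (\<forall>a\<in>U. \<exists>k. \<forall>b\<in>W'. R k a b \<longrightarrow> b \<in> U))"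
    unfolding istopology_def
  proof (intro conjI allI impI ballI)
    fix S T a
    assume S: "S \<subseteq> W' \<and> (\<forall>a\<in>S. \<exists>k. \<forall>b\<in>W'. R k a b \<longrightarrow> b \<in> S)"
      and T: "T \<subseteq> W' \<and> (\<forall>a\<in>T. \<exists>k. \<forall>b\<in>W'. R k a b \<longrightarrow> b \<in> T)" and a: "a \<in> S \<inter> T"
    then obtain k l where kl: "\<forall>b\<in>W'. R k a b \<longrightarrow> b \<in> S" "\<forall>b\<in>W'. R l a b \<longrightarrow> b \<in> T" by blast
    have aW: "a \<in> W'" using a S by blast
    have "b \<in> S \<inter> T" if b: "b \<in> W'" "R (max k l) a b" for b
    proof -
      have "a \<in> W" "b \<in> W" using aW b(1) assms by blast+
      then have "R k a b" "R l a b" using R_le[OF b(2), of k] R_le[OF b(2), of l] by simp_all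
      with kl b show ?thesis by blast
    qed
    then show "\<exists>k. \<forall>b\<in>W'. R k a b \<longrightarrow> b \<in> S \<inter> T" by blast
  next
    fix K a
    assume K: "\<forall>S\<in>K. S \<subseteq> W' \<and> (\<forall>a\<in>S. \<exists>k. \<forall>b\<in>W'. R k a b \<longrightarrow> b \<in> S)" and "a \<in> \<Union>K"
    then obtain S where S: "S \<in> K" "a \<in> S" by blast
    with K obtain k where "\<forall>b\<in>W'. R k a b \<longrightarrow> b \<in> S" by meson
    with S show "\<exists>k. \<forall>b\<in>W'. R k a b \<longrightarrow> b \<in> \<Union>K" by blast
  qed blast+
  then show ?thesis by (simp add: utop_def)
qed

lemma topspace_utop: "W' \<subseteq> W \<Longrightarrow> topspace (utop R W') = W'"
  unfolding topspace_def by (auto simp: openin_utop intro!: exI[of _ W'])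

lemma openin_class: "W' \<subseteq> W \<Longrightarrow> openin (utop R W') {b \<in> W'. R k a b}"
  unfolding openin_utop using R_trans by blast

lemma subtopology_utop:
  assumes "W'' \<subseteq> W'" "W' \<subseteq> W"
  shows "subtopology (utop R W') W'' = utop R W''"
proof (rule topology_eq[THEN iffD2], intro allI)
  fix U
  show "openin (subtopology (utop R W') W'') U \<longleftrightarrow> openin (utop R W'') U"
  proof
    assume "openin (subtopology (utop R W') W'') U"
    then obtain T where T: "openin (utop R W') T" "U = T \<inter> W''" by (auto simp: openin_subtopology)
    then show "openin (utop R W'') U"
      using assms openin_utop[OF assms(2), of T] by (subst openin_utop) (blast, blast)
  next
    assume "openin (utop R W'') U"
    then have U: "U \<subseteq> W''" "\<forall>a\<in>U. \<exists>k. \<forall>b\<in>W''. R k a b \<longrightarrow> b \<in> U"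
      using openin_utop[of W'' U] assms by auto
    define T where "T = \<Union>{{b \<in> W'. R k a b} | k a. a \<in> U \<and> (\<forall>b\<in>W''. R k a b \<longrightarrow> b \<in> U)}"
    have "openin (utop R W') T"
      unfolding T_def using openin_class[OF assms(2)] by (intro openin_Union) auto
    moreover have "U = T \<inter> W''"
    proof
      show "U \<subseteq> T \<inter> W''"
      proof
        fix a assume a: "a \<in> U"
        then obtain k where "\<forall>b\<in>W''. R k a b \<longrightarrow> b \<in> U" using U by blast
        with a have "{b \<in> W'. R k a b} \<in> {{b \<in> W'. R k a b} | k a. a \<in> U \<and> (\<forall>b\<in>W''. R k a b \<longrightarrow> b \<in> U)}" by blast
        moreover have "a \<in> {b \<in> W'. R k a b}" using a U assms R_refl by auto
        ultimately show "a \<in> T \<inter> W''" using a U unfolding T_def by blast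
      qed
      show "T \<inter> W'' \<subseteq> U" unfolding T_def by blast
    qed
    ultimately show "openin (subtopology (utop R W') W'') U" by (auto simp: openin_subtopology)
  qed
qed

lemma closure_utop:
  assumes "S \<subseteq> W'" "W' \<subseteq> W"
  shows "utop R W' closure_of S = {a \<in> W'. \<forall>k. \<exists>s\<in>S. R k a s}"
proof -
  have "(\<forall>T. a \<in> T \<and> openin (utop R W') T \<longrightarrow> (\<exists>y\<in>S. y \<in> T)) \<longleftrightarrow> (\<forall>k. \<exists>s\<in>S. R k a s)"
    if a: "a \<in> W'" for a
  proof
    assume *: "\<forall>T. a \<in> T \<and> openin (utop R W') T \<longrightarrow> (\<exists>y\<in>S. y \<in> T)"
    show "\<forall>k. \<exists>s\<in>S. R k a s"
    proof
      fix k
      have "a \<in> {b \<in> W'. R k a b}" using a R_refl by simp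
      from *[THEN spec, THEN mp, OF conjI[OF this openin_class[OF assms(2)]]]
      show "\<exists>s\<in>S. R k a s" by auto
    qed
  next
    assume *: "\<forall>k. \<exists>s\<in>S. R k a s"
    show "\<forall>T. a \<in> T \<and> openin (utop R W') T \<longrightarrow> (\<exists>y\<in>S. y \<in> T)"
    proof (intro allI impI)
      fix T assume T: "a \<in> T \<and> openin (utop R W') T"
      then obtain k where k: "\<forall>b\<in>W'. R k a b \<longrightarrow> b \<in> T"
        using openin_utop[OF assms(2), of T] by meson
      obtain s where "s \<in> S" "R k a s" using * by meson
      with k assms(1) show "\<exists>y\<in>S. y \<in> T" by blast
    qed
  qed
  then show ?thesis unfolding closure_of_def topspace_utop[OF assms(2)]
    by (intro Collect_cong conj_cong refl)
qed

text \<open>Comparison of a subbasis with the classes; it is applied to the cosets of the subgroups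
  in \<open>subgroup_topology\<close>.\<close>

lemma generated_utop:
  assumes "\<And>S. S \<in> \<S> \<Longrightarrow> openin (utop R W) S"
    and "\<And>a k. a \<in> W \<Longrightarrow> \<exists>S\<in>\<S>. a \<in> S \<and> S \<subseteq> {b \<in> W. R k a b}"
  shows "topology_generated_by \<S> = utop R W"
proof (rule topology_eq[THEN iffD2], intro allI iffI)
  fix U assume "openin (topology_generated_by \<S>) U"
  then have "generate_topology_on \<S> U" by (simp add: openin_topology_generated_by_iff)
  from generate_topology_on_coarsest[OF istopology_openin[of "utop R W"] assms(1) this]
  show "openin (utop R W) U" .
next
  fix U assume U: "openin (utop R W) U"
  have that_cover: "\<exists>S\<in>\<S>. a \<in> S \<and> S \<subseteq> U" if "a \<in> U" for a
  proof -
    have "U \<subseteq> W" "\<forall>a\<in>U. \<exists>k. \<forall>b\<in>W. R k a b \<longrightarrow> b \<in> U"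
      using U openin_utop[OF order_refl] by auto
    then obtain k where k: "\<forall>b\<in>W. R k a b \<longrightarrow> b \<in> U" using \<open>a \<in> U\<close> by meson
    have "a \<in> W" using \<open>U \<subseteq> W\<close> \<open>a \<in> U\<close> by blast
    from assms(2)[OF this, of k] obtain S where S: "S \<in> \<S>" "a \<in> S" "S \<subseteq> {b \<in> W. R k a b}" by (elim bexE conjE)
    have "S \<subseteq> U" using S(3) k by auto
    with S show ?thesis by (intro bexI[of _ S] conjI)
  qed
  then have "U = \<Union>{S \<in> \<S>. S \<subseteq> U}"
  proof (intro equalityI subsetI)
    fix a assume "a \<in> U"
    with that_cover obtain S where "S \<in> \<S>" "a \<in> S" "S \<subseteq> U" by meson
    then show "a \<in> \<Union>{S \<in> \<S>. S \<subseteq> U}" by (intro UnionI[of S]) simp_all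
  qed auto
  moreover have "openin (topology_generated_by \<S>) (\<Union>{S \<in> \<S>. S \<subseteq> U})"
    by (intro openin_Union) (auto intro: topology_generated_by_Basis)
  ultimately show "openin (topology_generated_by \<S>) U" by simp
qed

text \<open>A cover without finite subcover would produce a coherent sequence of classes without
  finite subcover, hence a limit point that is not covered.\<close>

lemma compact_utop:
  assumes "W' \<subseteq> W"
    and fin: "\<And>k. \<exists>F. finite F \<and> (\<forall>a\<in>W'. \<exists>f\<in>F. R k a f)"
    and complete: "\<And>s. (\<And>k. s k \<in> W') \<Longrightarrow> (\<And>k. R k (s k) (s (Suc k))) \<Longrightarrow> \<exists>a\<in>W'. \<forall>k. R k a (s k)"
  shows "compact_space (utop R W')"
  unfolding compact_space_alt topspace_utop[OF assms(1)]
proof (intro allI impI)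
  fix \<U> assume \<U>: "(\<forall>U\<in>\<U>. openin (utop R W') U) \<and> W' \<subseteq> \<Union>\<U>"
  define bad where "bad B \<longleftrightarrow> \<not> (\<exists>\<F>. finite \<F> \<and> \<F> \<subseteq> \<U> \<and> B \<subseteq> \<Union>\<F>)" for B
  show "\<exists>\<F>. finite \<F> \<and> \<F> \<subseteq> \<U> \<and> W' \<subseteq> \<Union>\<F>"
  proof (rule ccontr)
    assume "\<not> ?thesis"
    then have bad_W: "bad W'" by (simp add: bad_def)
    have bad_mono: "bad C" if "B \<subseteq> C" "bad B" for B C
      using that unfolding bad_def by (meson order_trans)
    \<comment> \<open>Finitely many classes of level \<open>k\<close> cover \<open>B\<close>; if
      each had a finite subcover, so would \<open>B\<close>.\<close>
    have step: "\<exists>b\<in>B. bad {c \<in> B. R k b c}" if "bad B" and BW: "B \<subseteq> W'" for B k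
    proof (rule ccontr)
      assume *: "\<not> (\<exists>b\<in>B. bad {c \<in> B. R k b c})"
      obtain F where F: "finite F" "\<forall>a\<in>W'. \<exists>f\<in>F. R k a f" using fin by blast
      have "\<exists>\<F>. finite \<F> \<and> \<F> \<subseteq> \<U> \<and> {c \<in> B. R k c f} \<subseteq> \<Union>\<F>" for f
      proof (cases "\<exists>b\<in>B. R k b f")
        case True
        then obtain b where b: "b \<in> B" "R k b f" by blast
        then have "{c \<in> B. R k c f} \<subseteq> {c \<in> B. R k b c}" using R_trans R_sym by blast
        then show ?thesis using * b unfolding bad_def by (meson order_trans)
      next
        case False
        then show ?thesis by (intro exI[of _ "{}"]) auto
      qed
      then obtain \<F> where \<F>: "\<And>f. finite (\<F> f)" "\<And>f. \<F> f \<subseteq> \<U>" "\<And>f. {c \<in> B. R k c f} \<subseteq> \<Union>(\<F> f)" by metis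
      have "B \<subseteq> \<Union>(\<Union>f\<in>F. \<F> f)"
      proof
        fix c assume c: "c \<in> B"
        then obtain f where "f \<in> F" "R k c f" using F BW by blast
        with c \<F>(3)[of f] show "c \<in> \<Union>(\<Union>f\<in>F. \<F> f)" by blast
      qed
      moreover have "finite (\<Union>f\<in>F. \<F> f)" "(\<Union>f\<in>F. \<F> f) \<subseteq> \<U>" using F \<F> by auto
      ultimately show False using \<open>bad B\<close> unfolding bad_def by blast
    qed
    define P where "P k b \<longleftrightarrow> b \<in> W' \<and> bad {c \<in> W'. R k b c}" for k b
    have "\<exists>s. \<forall>k. P k (s k) \<and> R k (s k) (s (Suc k))"
    proof (rule dependent_nat_choice)
      obtain b where "b \<in> W'" "bad {c \<in> W'. R 0 b c}" using step[OF bad_W subset_refl, of 0] by (elim bexE)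
      then show "\<exists>x. P 0 x" unfolding P_def by (intro exI[of _ b] conjI)
    next
      fix b k assume "P k b"
      then have b: "b \<in> W'" "bad {c \<in> W'. R k b c}" by (simp_all add: P_def)
      have "{c \<in> W'. R k b c} \<subseteq> W'" by simp
      from step[OF b(2) this, of "Suc k"]
      obtain b' where b': "b' \<in> W'" "R k b b'" "bad {c \<in> {c \<in> W'. R k b c}. R (Suc k) b' c}"
        by auto
      have "{c \<in> {c \<in> W'. R k b c}. R (Suc k) b' c} \<subseteq> {c \<in> W'. R (Suc k) b' c}" by auto
      from bad_mono[OF this b'(3)] show "\<exists>y. P (Suc k) y \<and> R k b y"
        unfolding P_def using b'(1,2) by (intro exI[of _ b'] conjI)
    qed
    then obtain s where s: "\<And>k. P k (s k)" "\<And>k. R k (s k) (s (Suc k))" by metis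
    have "s k \<in> W'" for k using s(1)[of k] by (simp add: P_def)
    from complete[OF this s(2)] obtain a where a: "a \<in> W'" "\<And>k. R k a (s k)" by metis
    obtain U where U: "U \<in> \<U>" "a \<in> U" using \<U> a(1) by auto
    have "openin (utop R W') U" using \<U> U(1) by simp
    then obtain k where k: "\<forall>b\<in>W'. R k a b \<longrightarrow> b \<in> U"
      using openin_utop[OF assms(1), of U] U(2) by meson
    have "c \<in> U" if "c \<in> W'" "R k (s k) c" for c
      using k that R_trans[OF a(2) that(2)] by simp
    then have "{c \<in> W'. R k (s k) c} \<subseteq> \<Union>{U}" by auto
    then have "\<not> bad {c \<in> W'. R k (s k) c}"
      unfolding bad_def using U(1) by (intro notI) (metis bot_least finite.simps insert_subset)
    then show False using s(1)[of k] by (simp add: P_def)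
  qed
qed

end

subsection \<open>Coordinates of power series and matrices\<close>

definition coherent :: "nat \<Rightarrow> (nat \<Rightarrow> int) \<Rightarrow> bool" where
  "coherent p a \<longleftrightarrow> (\<forall>n. a n \<in> {0..<int p ^ n} \<and> a (Suc n) mod int p ^ n = a n)"

lemma carrier_padic_int: "a \<in> carrier (padic_int p) \<longleftrightarrow> coherent p a"
  by (simp add: padic_int_def coherent_def)

lemma coherent_mod:
  assumes "coherent p a" "m \<le> n"
  shows "a n mod int p ^ m = a m"
  using assms(2)
proof (induction n rule: dec_induct)
  case base
  then show ?case using assms(1) by (simp add: coherent_def)
next
  case (step n)
  have "a (Suc n) mod int p ^ m = a (Suc n) mod int p ^ n mod int p ^ m"
    using step.hyps by (simp add: mod_mod_cancel le_imp_power_dvd)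
  then show ?case using assms(1) step.IH by (simp add: coherent_def)
qed

lemma coherentI:
  assumes "0 < p" "\<And>n. f (Suc n) mod int p ^ n = f n mod int p ^ n"
  shows "coherent p (\<lambda>n. f n mod int p ^ n)"
  unfolding coherent_def using assms by (simp add: mod_mod_cancel)

lemma coherent_of_int: "0 < p \<Longrightarrow> coherent p (\<lambda>n. z mod int p ^ n)"
  by (rule coherentI) auto

lemma coherent_bounds: "coherent p a \<Longrightarrow> 0 \<le> a n" "coherent p a \<Longrightarrow> a n < int p ^ n"
  "coherent p a \<Longrightarrow> a n mod int p ^ n = a n"
  using coherent_mod[of p a n n] by (auto simp: coherent_def)

lemma coherent_0 [simp]: "0 < p \<Longrightarrow> coherent p (\<lambda>n. 0)"
  by (simp add: coherent_def)

locale prime_base =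
  fixes p :: nat
  assumes prime_p: "prime p"
begin

lemma p_pos: "0 < p"
  using prime_p by (rule prime_gt_0_nat)

lemma finsum_padic:
  assumes "finite S" "\<And>s. s \<in> S \<Longrightarrow> coherent p (f s)"
  shows "finsum (padic_int p) f S n = (\<Sum>s\<in>S. f s n) mod int p ^ n"
proof -
  interpret cring "padic_int p" by (rule padic_int_cring[OF p_pos])
  show ?thesis using assms
  proof (induction S rule: finite_induct)
    case empty
    then show ?case by (simp only: finsum_empty) (simp add: padic_int_def)
  next
    case (insert s S)
    then have "finsum (padic_int p) f (insert s S) = f s \<oplus>\<^bsub>padic_int p\<^esub> finsum (padic_int p) f S"
      by (intro finsum_insert) (auto simp: carrier_padic_int)
    then show ?case using insert by (simp add: padic_int_def mod_add_right_eq)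
  qed
qed

lemma finsum_coherent:
  assumes "finite S" "\<And>s. s \<in> S \<Longrightarrow> coherent p (f s)"
  shows "coherent p (finsum (padic_int p) f S)"
proof -
  interpret cring "padic_int p" by (rule padic_int_cring[OF p_pos])
  show ?thesis using assms finsum_closed[of f S] by (auto simp: carrier_padic_int)
qed

lemma padic_mult: "(a \<otimes>\<^bsub>padic_int p\<^esub> b) n = a n * b n mod int p ^ n"
  by (simp add: padic_int_def)

lemma padic_mult_coherent: "coherent p a \<Longrightarrow> coherent p b \<Longrightarrow> coherent p (a \<otimes>\<^bsub>padic_int p\<^esub> b)"
proof -
  interpret cring "padic_int p" by (rule padic_int_cring[OF p_pos])
  show "coherent p a \<Longrightarrow> coherent p b \<Longrightarrow> coherent p (a \<otimes>\<^bsub>padic_int p\<^esub> b)"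
    using m_closed[of a b] by (simp add: carrier_padic_int)
qed

lemma padic_add_coherent: "coherent p a \<Longrightarrow> coherent p b \<Longrightarrow> coherent p (\<lambda>n. (a n + b n) mod int p ^ n)"
proof -
  interpret cring "padic_int p" by (rule padic_int_cring[OF p_pos])
  show "coherent p a \<Longrightarrow> coherent p b \<Longrightarrow> coherent p (\<lambda>n. (a n + b n) mod int p ^ n)"
    using a_closed[of a b] unfolding carrier_padic_int by (simp add: padic_int_def)
qed

lemma carrier_Pi: "f \<in> carrier (Pi_star p) \<longleftrightarrow> (\<forall>m. coherent p (f m))"
  by (simp add: Pi_star_def power_series_ring_def carrier_padic_int)

lemma Pi_add: "(f \<oplus>\<^bsub>Pi_star p\<^esub> g) m n = (f m n + g m n) mod int p ^ n"
  by (simp add: Pi_star_def power_series_ring_def padic_int_def)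

lemma Pi_zero: "\<zero>\<^bsub>Pi_star p\<^esub> = (\<lambda>m n. 0)"
  by (simp add: Pi_star_def power_series_ring_def padic_int_def)

lemma Pi_one: "\<one>\<^bsub>Pi_star p\<^esub> = (\<lambda>m n. if m = {#} then 1 mod int p ^ n else 0)"
  by (auto simp: Pi_star_def power_series_ring_def padic_int_def fun_eq_iff)

lemma Pi_mult:
  assumes "f \<in> carrier (Pi_star p)" "g \<in> carrier (Pi_star p)"
  shows "(f \<otimes>\<^bsub>Pi_star p\<^esub> g) m n = (\<Sum>k | k \<subseteq># m. f k n * g (m - k) n) mod int p ^ n"
proof -
  have "(f \<otimes>\<^bsub>Pi_star p\<^esub> g) m n = finsum (padic_int p) (\<lambda>k. f k \<otimes>\<^bsub>padic_int p\<^esub> g (m - k)) {k. k \<subseteq># m} n"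
    by (simp add: Pi_star_def power_series_ring_def)
  also have "\<dots> = (\<Sum>k | k \<subseteq># m. f k n * g (m - k) n mod int p ^ n) mod int p ^ n"
    using assms by (subst finsum_padic) (auto simp: carrier_Pi padic_mult padic_mult_coherent)
  finally show ?thesis by (simp add: mod_sum_eq)
qed

lemma Pi_mult_closed:
  assumes "f \<in> carrier (Pi_star p)" "g \<in> carrier (Pi_star p)"
  shows "f \<otimes>\<^bsub>Pi_star p\<^esub> g \<in> carrier (Pi_star p)"
  unfolding carrier_Pi
proof
  fix m
  have "(f \<otimes>\<^bsub>Pi_star p\<^esub> g) m = finsum (padic_int p) (\<lambda>k. f k \<otimes>\<^bsub>padic_int p\<^esub> g (m - k)) {k. k \<subseteq># m}"
    by (simp add: Pi_star_def power_series_ring_def)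
  then show "coherent p ((f \<otimes>\<^bsub>Pi_star p\<^esub> g) m)"
    using assms by (auto intro!: finsum_coherent padic_mult_coherent simp: carrier_Pi)
qed

lemma Pi_add_closed: "f \<in> carrier (Pi_star p) \<Longrightarrow> g \<in> carrier (Pi_star p) \<Longrightarrow> f \<oplus>\<^bsub>Pi_star p\<^esub> g \<in> carrier (Pi_star p)"
  unfolding carrier_Pi using padic_add_coherent
  by (simp add: Pi_star_def power_series_ring_def) (simp add: padic_int_def)

lemma Pi_abelian_monoid: "abelian_monoid (Pi_star p)"
proof (rule abelian_monoidI)
  show "\<zero>\<^bsub>Pi_star p\<^esub> \<in> carrier (Pi_star p)" using p_pos by (simp add: Pi_zero carrier_Pi)
  fix x y z assume xyz: "x \<in> carrier (Pi_star p)" "y \<in> carrier (Pi_star p)" "z \<in> carrier (Pi_star p)"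
  show "x \<oplus>\<^bsub>Pi_star p\<^esub> y \<oplus>\<^bsub>Pi_star p\<^esub> z = x \<oplus>\<^bsub>Pi_star p\<^esub> (y \<oplus>\<^bsub>Pi_star p\<^esub> z)"
    by (intro ext) (simp add: Pi_add mod_add_left_eq mod_add_right_eq add.assoc)
qed (auto simp: Pi_add_closed fun_eq_iff Pi_add Pi_zero add.commute coherent_bounds(3)
    dest: carrier_Pi[THEN iffD1])

definition cM :: "series_matrix set" where
  "cM = {A. \<forall>i j m. coherent p (A i j m)}"

lemma carrier_M2: "carrier (M2 p) = cM"
  by (auto simp: M2_def matrix_ring_def cM_def carrier_Pi)

lemma cM_entry: "A \<in> cM \<Longrightarrow> A i j \<in> carrier (Pi_star p)"
  by (simp add: cM_def carrier_Pi)

lemma cM_coherent: "A \<in> cM \<Longrightarrow> coherent p (A i j m)"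
  by (simp add: cM_def)

lemma finsum_Pi_2:
  fixes f :: "2 \<Rightarrow> series"
  assumes "\<And>l. f l \<in> carrier (Pi_star p)"
  shows "finsum (Pi_star p) f UNIV = f 1 \<oplus>\<^bsub>Pi_star p\<^esub> f 2"
proof -
  interpret abelian_monoid "Pi_star p" by (rule Pi_abelian_monoid)
  have "finsum (Pi_star p) f {1, 2} = f 1 \<oplus>\<^bsub>Pi_star p\<^esub> finsum (Pi_star p) f {2}"
    using assms by (intro finsum_insert) auto
  also have "finsum (Pi_star p) f {2} = f 2"
    using assms finsum_insert[of "{}" 2 f] by simp
  finally show ?thesis by (simp add: UNIV_2)
qed

abbreviation mm :: "series_matrix \<Rightarrow> series_matrix \<Rightarrow> series_matrix" (infixl "\<odot>" 70) where
  "A \<odot> B \<equiv> A \<otimes>\<^bsub>M2 p\<^esub> B"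

lemma M2_mult_entry:
  assumes "A \<in> cM" "B \<in> cM"
  shows "(A \<odot> B) i j = (A i 1 \<otimes>\<^bsub>Pi_star p\<^esub> B 1 j) \<oplus>\<^bsub>Pi_star p\<^esub> (A i 2 \<otimes>\<^bsub>Pi_star p\<^esub> B 2 j)"
proof -
  have "(A \<odot> B) i j = finsum (Pi_star p) (\<lambda>l. A i l \<otimes>\<^bsub>Pi_star p\<^esub> B l j) UNIV"
    by (simp add: M2_def matrix_ring_def)
  then show ?thesis using assms by (simp add: finsum_Pi_2 Pi_mult_closed cM_entry)
qed

lemma M2_mult:
  assumes "A \<in> cM" "B \<in> cM"
  shows "(A \<odot> B) i j m n = ((\<Sum>k | k \<subseteq># m. A i 1 k n * B 1 j (m - k) n) +
     (\<Sum>k | k \<subseteq># m. A i 2 k n * B 2 j (m - k) n)) mod int p ^ n"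
  using assms by (simp add: M2_mult_entry Pi_add Pi_mult cM_entry mod_add_eq)

lemma M2_mult_closed: "A \<in> cM \<Longrightarrow> B \<in> cM \<Longrightarrow> A \<odot> B \<in> cM"
proof -
  assume AB: "A \<in> cM" "B \<in> cM"
  have "(A \<odot> B) i j \<in> carrier (Pi_star p)" for i j
    unfolding M2_mult_entry[OF AB] by (intro Pi_add_closed Pi_mult_closed cM_entry AB)
  then show ?thesis by (simp add: cM_def carrier_Pi)
qed

lemma M2_one: "\<one>\<^bsub>M2 p\<^esub> = (\<lambda>i j m n. if i = j \<and> m = {#} then 1 mod int p ^ n else 0)"
  by (auto simp: M2_def matrix_ring_def Pi_one Pi_zero fun_eq_iff)

lemma M2_one_closed: "\<one>\<^bsub>M2 p\<^esub> \<in> cM"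
proof -
  have "coherent p (\<lambda>n. if c then 1 mod int p ^ n else 0)" for c
    using coherent_of_int[OF p_pos, of 1] p_pos by (cases c) auto
  then show ?thesis by (simp add: M2_one cM_def)
qed

lemma M2_add: "(A \<oplus>\<^bsub>M2 p\<^esub> B) i j m n = (A i j m n + B i j m n) mod int p ^ n"
  by (simp add: M2_def matrix_ring_def Pi_add)

text \<open>Component \<open>k\<close> of a p-adic integer is its residue modulo p^k, so a single
  \<open>k\<close> bounds both the degree and the p-adic precision, as in
  \<open>adicV\<close>.\<close>

definition agree :: "nat \<Rightarrow> series_matrix \<Rightarrow> series_matrix \<Rightarrow> bool" where
  "agree k A B \<longleftrightarrow> (\<forall>i j m. size m < k \<longrightarrow> A i j m k = B i j m k)"

sublocale agree: decreasing_equivs agree cM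
proof
  fix a b k assume "a \<in> cM" "b \<in> cM" "agree (Suc k) a b"
  then have "a i j m k = b i j m k" if "size m < k" for i j m
    using that coherent_mod[OF cM_coherent[OF \<open>a \<in> cM\<close>], of k "Suc k" i j m]
      coherent_mod[OF cM_coherent[OF \<open>b \<in> cM\<close>], of k "Suc k" i j m] by (simp add: agree_def)
  then show "agree k a b" by (simp add: agree_def)
qed (simp_all add: agree_def)

lemma agree_mult:
  assumes "A \<in> cM" "B \<in> cM" "A' \<in> cM" "B' \<in> cM" "agree k A A'" "agree k B B'"
  shows "agree k (A \<odot> B) (A' \<odot> B')"
  unfolding agree_def
proof (intro allI impI)
  fix i j m assume m: "size (m :: var multiset) < k"
  have "size l < k" "size (m - l) < k" if "l \<subseteq># m" for l
    using size_mset_mono[OF that] size_mset_mono[of "m - l" m] m by auto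
  then have "(\<Sum>l | l \<subseteq># m. A i r l k * B r j (m - l) k) = (\<Sum>l | l \<subseteq># m. A' i r l k * B' r j (m - l) k)" for r
    using assms(5,6) by (intro sum.cong) (auto simp: agree_def)
  then show "(A \<odot> B) i j m k = (A' \<odot> B') i j m k"
    by (simp add: M2_mult assms)
qed

lemma agree_all:
  assumes "A \<in> cM" "B \<in> cM" "\<And>k. agree k A B"
  shows "A = B"
proof (intro ext)
  fix i j n and m :: "var multiset"
  define k where "k = max n (Suc (size m))"
  have "A i j m k = B i j m k" using assms(3)[of k] by (auto simp: agree_def k_def)
  then have "A i j m k mod int p ^ n = B i j m k mod int p ^ n" by simp
  then show "A i j m n = B i j m n"
    using coherent_mod[OF cM_coherent[OF assms(1)], of n k] coherent_mod[OF cM_coherent[OF assms(2)], of n k]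
    by (simp add: k_def)
qed

lemma agree_complete:
  assumes s: "\<And>k. s k \<in> cM" and c: "\<And>k. agree k (s k) (s (Suc k))"
  shows "\<exists>a\<in>cM. \<forall>k. agree k a (s k)"
proof -
  have later: "agree k (s k) (s l)" if "k \<le> l" for k l
    using that
  proof (induction l rule: dec_induct)
    case (step l)
    then show ?case using agree.R_trans agree.R_le[OF c[of l]] s by blast
  qed (simp add: agree.R_refl)
  have comp: "s k i j m n = s l i j m n" if "n \<le> k" "size m < k" "k \<le> l" for k l i j m n
  proof -
    have "s k i j m k = s l i j m k" using later[OF that(3)] that by (auto simp: agree_def)
    moreover have "s l i j m k mod int p ^ n = s l i j m n" "s k i j m k mod int p ^ n = s k i j m n"
      using coherent_mod[OF cM_coherent[OF s]] that by auto
    ultimately show ?thesis by simp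
  qed
  \<comment> \<open>From this index on the value at \<open>m\<close> and \<open>n\<close> is stable,
    the index being at least \<open>n\<close> and larger than \<open>size m\<close>.\<close>
  define a where "a = (\<lambda>i j m n. s (n + size m + 1) i j m n)"
  have a: "a i j m n = s k i j m n" if "n \<le> k" "size m < k" for i j m n k
    unfolding a_def using comp[of n "n + size m + 1" m k i j] comp[of n k m "n + size m + 1" i j] that
    by (cases "n + size m + 1 \<le> k") auto
  have "coherent p (a i j m)" for i j m
    unfolding coherent_def
  proof
    fix n
    have "a i j m n = s (Suc n + size m + 1) i j m n" "a i j m (Suc n) = s (Suc n + size m + 1) i j m (Suc n)"
      by (intro a; simp)+
    then show "a i j m n \<in> {0..<int p ^ n} \<and> a i j m (Suc n) mod int p ^ n = a i j m n"
      using cM_coherent[OF s[of "Suc n + size m + 1"], of i j m] by (simp add: coherent_def)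
  qed
  then have "a \<in> cM" by (simp add: cM_def)
  moreover have "agree k a (s k)" for k unfolding agree_def using a by blast
  ultimately show ?thesis by blast
qed

subsection \<open>Integral approximations\<close>

definition ent :: "'a mat2 \<Rightarrow> 2 \<Rightarrow> 2 \<Rightarrow> 'a" where
  "ent A i j = (if i = 1 then if j = 1 then e11 A else e12 A else if j = 1 then e21 A else e22 A)"

definition iota :: "var mps mat2 \<Rightarrow> series_matrix" where
  "iota A i j m n = mcoef (ent A i j) m mod int p ^ n"

lemma iota_closed: "iota A \<in> cM"
  using coherent_of_int[OF p_pos] unfolding cM_def iota_def[abs_def] by simp

lemma ent_mult: "ent (A * B) i j = ent A i 1 * ent B 1 j + ent A i 2 * ent B 2 j"
  by (auto simp: ent_def)

lemma iota_mult: "iota (A * B) = iota A \<odot> iota B"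
proof (intro ext)
  fix i j m n
  have "(\<Sum>k | k \<subseteq># m. iota A i l k n * iota B l j (m - k) n) mod int p ^ n = mcoef (ent A i l * ent B l j) m mod int p ^ n" for l
  proof -
    have "(\<Sum>k | k \<subseteq># m. iota A i l k n * iota B l j (m - k) n) mod int p ^ n =
        (\<Sum>k | k \<subseteq># m. iota A i l k n * iota B l j (m - k) n mod int p ^ n) mod int p ^ n"
      by (rule mod_sum_eq[symmetric])
    also have "\<dots> = (\<Sum>k | k \<subseteq># m. mcoef (ent A i l) k * mcoef (ent B l j) (m - k) mod int p ^ n) mod int p ^ n"
      unfolding iota_def mod_mult_eq ..
    also have "\<dots> = (\<Sum>k | k \<subseteq># m. mcoef (ent A i l) k * mcoef (ent B l j) (m - k)) mod int p ^ n"
      by (rule mod_sum_eq)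
    finally show ?thesis by (simp only: mcoef_mult)
  qed
  from mod_add_cong[OF this[of 1] this[of 2]]
  show "iota (A * B) i j m n = (iota A \<odot> iota B) i j m n"
    unfolding M2_mult[OF iota_closed iota_closed] iota_def[of "A * B"] ent_mult mcoef_add by (rule sym)
qed

lemma iota_1: "iota 1 = \<one>\<^bsub>M2 p\<^esub>"
proof -
  have "iota 1 i j m n = \<one>\<^bsub>M2 p\<^esub> i j m n" for i j m n
    using exhaust_2[of i] exhaust_2[of j] by (auto simp: M2_one iota_def ent_def mcoef_1)
  then show ?thesis by (intro ext)
qed

lemma approx_iota:
  assumes "A \<in> cM"
  shows "\<exists>A'. agree k A (iota A')"
proof -
  define A' where "A' = Mat2 (Mps (\<lambda>m. A 1 1 m k)) (Mps (\<lambda>m. A 1 2 m k)) (Mps (\<lambda>m. A 2 1 m k)) (Mps (\<lambda>m. A 2 2 m k))"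
  have "mcoef (ent A' i j) m = A i j m k" for i j m
    using exhaust_2[of i] exhaust_2[of j] by (auto simp: A'_def ent_def)
  then have "agree k A (iota A')"
    using coherent_bounds(3)[OF cM_coherent[OF assms]] by (simp add: agree_def iota_def)
  then show ?thesis by blast
qed

lemma agree_iota_iff: "agree k (iota A) (iota B) \<longleftrightarrow> A - B \<in> mfil (int p ^ k) k"
proof -
  have "agree k (iota A) (iota B) \<longleftrightarrow> (\<forall>i j m. size m < k \<longrightarrow> int p ^ k dvd mcoef (ent A i j) m - mcoef (ent B i j) m)"
    by (simp add: agree_def iota_def mod_eq_dvd_iff)
  also have "\<dots> \<longleftrightarrow> A - B \<in> mfil (int p ^ k) k"
    by (auto simp: mfil_def fil_def forall_2 ent_def)
  finally show ?thesis .
qed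

text \<open>Integral matrices are dense and multiplication respects \<open>agree\<close>, so ring
  identities are inherited from \<open>mat2\<close> without a separate ring structure on the p-adic
  power series.\<close>

lemma M2_assoc:
  assumes "A \<in> cM" "B \<in> cM" "C \<in> cM"
  shows "A \<odot> B \<odot> C = A \<odot> (B \<odot> C)"
proof (rule agree_all)
  fix k
  obtain A' B' C' where *: "agree k A (iota A')" "agree k B (iota B')" "agree k C (iota C')"
    using approx_iota assms by meson
  have "agree k (A \<odot> B \<odot> C) (iota (A' * B' * C'))"
    unfolding iota_mult by (intro agree_mult M2_mult_closed iota_closed assms *)
  moreover have "agree k (A \<odot> (B \<odot> C)) (iota (A' * B' * C'))"
    unfolding mult.assoc unfolding iota_mult by (intro agree_mult M2_mult_closed iota_closed assms *)
  ultimately show "agree k (A \<odot> B \<odot> C) (A \<odot> (B \<odot> C))" by (rule agree.R_trans[OF _ agree.R_sym])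
qed (use M2_mult_closed assms in auto)

lemma M2_one_left: "A \<in> cM \<Longrightarrow> \<one>\<^bsub>M2 p\<^esub> \<odot> A = A" and M2_one_right: "A \<in> cM \<Longrightarrow> A \<odot> \<one>\<^bsub>M2 p\<^esub> = A"
proof -
  assume A: "A \<in> cM"
  show "\<one>\<^bsub>M2 p\<^esub> \<odot> A = A"
  proof (rule agree_all[OF M2_mult_closed[OF M2_one_closed A] A])
    fix k
    obtain A' where A': "agree k A (iota A')" using approx_iota A by blast
    have "agree k (\<one>\<^bsub>M2 p\<^esub> \<odot> A) (iota (1 * A'))"
      unfolding iota_mult iota_1 by (intro agree_mult M2_one_closed iota_closed A A' agree.R_refl)
    then have "agree k (\<one>\<^bsub>M2 p\<^esub> \<odot> A) (iota A')" by simp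
    then show "agree k (\<one>\<^bsub>M2 p\<^esub> \<odot> A) A" by (rule agree.R_trans[OF _ agree.R_sym[OF A']])
  qed
  show "A \<odot> \<one>\<^bsub>M2 p\<^esub> = A"
  proof (rule agree_all[OF M2_mult_closed[OF A M2_one_closed] A])
    fix k
    obtain A' where A': "agree k A (iota A')" using approx_iota A by blast
    have "agree k (A \<odot> \<one>\<^bsub>M2 p\<^esub>) (iota (A' * 1))"
      unfolding iota_mult iota_1 by (intro agree_mult M2_one_closed iota_closed A A' agree.R_refl)
    then have "agree k (A \<odot> \<one>\<^bsub>M2 p\<^esub>) (iota A')" by simp
    then show "agree k (A \<odot> \<one>\<^bsub>M2 p\<^esub>) A" by (rule agree.R_trans[OF _ agree.R_sym[OF A']])
  qed
qed

end

context prime_base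
begin

lemma coherent_diff: "coherent p a \<Longrightarrow> coherent p b \<Longrightarrow> coherent p (\<lambda>n. (a n - b n) mod int p ^ n)"
  by (rule coherentI[OF p_pos]) (intro mod_diff_cong; simp add: coherent_def)

text \<open>Division by p^m shifts the sequence of residues by \<open>m\<close>: the residue of the
  quotient modulo p^k needs \<open>a\<close> modulo p^(k+m).\<close>

lemma coherent_divisible:
  assumes a: "coherent p a" and m: "a m = 0"
  shows "\<exists>g. coherent p g \<and> (\<forall>k. a k = int p ^ m * g k mod int p ^ k)"
proof -
  define g where "g k = a (k + m) div int p ^ m" for k
  have P: "0 < int p ^ k" for k using p_pos by simp
  have ag: "a (k + m) = int p ^ m * g k" for k
  proof -
    have "a (k + m) mod int p ^ m = 0" using coherent_mod[OF a, of m "k + m"] m by simp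
    then show ?thesis unfolding g_def by (simp add: mod_eq_0_iff_dvd)
  qed
  have "coherent p g"
    unfolding coherent_def
  proof
    fix k
    have "0 \<le> int p ^ m * g k" "int p ^ m * g k < int p ^ m * int p ^ k"
      using coherent_bounds[OF a, of "k + m"] ag[of k] by (simp_all add: power_add mult.commute)
    then have "g k \<in> {0..<int p ^ k}" using P[of m] by (simp add: zero_le_mult_iff)
    moreover have "int p ^ m * (g (Suc k) mod int p ^ k) = int p ^ m * g k"
    proof -
      have "int p ^ m * (g (Suc k) mod int p ^ k) = (int p ^ m * g (Suc k)) mod (int p ^ m * int p ^ k)"
        by (rule mult_mod_right)
      also have "\<dots> = a (Suc k + m) mod int p ^ (k + m)" by (simp only: ag power_add mult.commute)
      also have "\<dots> = a (k + m)" by (rule coherent_mod[OF a]) simp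
      finally show ?thesis by (simp only: ag)
    qed
    then have "g (Suc k) mod int p ^ k = g k" using P[of m] p_pos by simp
    ultimately show "g k \<in> {0..<int p ^ k} \<and> g (Suc k) mod int p ^ k = g k" by blast
  qed
  moreover have "a k = int p ^ m * g k mod int p ^ k" for k
    using coherent_mod[OF a, of k "k + m"] ag[of k] by simp
  ultimately show ?thesis by blast
qed

lemma padic_add_pow: "([k] \<cdot>\<^bsub>padic_int p\<^esub> a) n = (int k * a n) mod int p ^ n"
proof (induction k)
  case 0
  then show ?case by (simp add: add_pow_def nat_pow_def padic_int_def)
next
  case (Suc k)
  have "([Suc k] \<cdot>\<^bsub>padic_int p\<^esub> a) n = (([k] \<cdot>\<^bsub>padic_int p\<^esub> a) n + a n) mod int p ^ n"
    by (simp add: add_pow_def nat_pow_def) (simp add: padic_int_def)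
  then show ?case unfolding Suc by (simp add: mod_add_left_eq mod_add_right_eq algebra_simps)
qed

lemma Pi_add_pow: "([k] \<cdot>\<^bsub>Pi_star p\<^esub> f) m n = (int k * f m n) mod int p ^ n"
proof (induction k)
  case 0
  then show ?case by (simp add: add_pow_def nat_pow_def Pi_zero)
next
  case (Suc k)
  have "([Suc k] \<cdot>\<^bsub>Pi_star p\<^esub> f) m n = (([k] \<cdot>\<^bsub>Pi_star p\<^esub> f) m n + f m n) mod int p ^ n"
    by (simp add: add_pow_def nat_pow_def Pi_add)
  then show ?case unfolding Suc by (simp add: mod_add_left_eq mod_add_right_eq algebra_simps)
qed

lemma coherent_scale: "coherent p a \<Longrightarrow> coherent p (\<lambda>n. (z * a n) mod int p ^ n)"
proof (rule coherentI[OF p_pos])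
  fix n assume "coherent p a"
  then have "a (Suc n) mod int p ^ n = a n mod int p ^ n" using coherent_bounds(3) by (simp add: coherent_def)
  then show "z * a (Suc n) mod int p ^ n = z * a n mod int p ^ n" by (rule mod_mult_cong[OF refl])
qed

section \<open>The topologies of the p-adic integers and of the matrix ring\<close>

definition Zc :: "(nat \<Rightarrow> int) set" where
  "Zc = {a. coherent p a}"

lemma carrier_Zc: "carrier (padic_int p) = Zc"
  by (auto simp: Zc_def carrier_padic_int)

lemma multiples_padic: "a \<in> multiples (padic_int p) (p ^ m) \<longleftrightarrow> coherent p a \<and> a m = 0"
proof
  assume "a \<in> multiples (padic_int p) (p ^ m)"
  then obtain g where g: "coherent p g" "a = ([(p ^ m)] \<cdot>\<^bsub>padic_int p\<^esub> g)"
    by (auto simp: multiples_def carrier_padic_int)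
  have "a = (\<lambda>n. (int (p ^ m) * g n) mod int p ^ n)" unfolding g(2) by (intro ext padic_add_pow)
  then show "coherent p a \<and> a m = 0" using coherent_scale[OF g(1)] by simp
next
  assume "coherent p a \<and> a m = 0"
  then obtain g where g: "coherent p g" "\<forall>k. a k = int p ^ m * g k mod int p ^ k"
    using coherent_divisible by blast
  then have "a = ([(p ^ m)] \<cdot>\<^bsub>padic_int p\<^esub> g)" by (intro ext) (simp add: padic_add_pow)
  then show "a \<in> multiples (padic_int p) (p ^ m)" using g by (auto simp: multiples_def carrier_padic_int)
qed

abbreviation zeq :: "nat \<Rightarrow> (nat \<Rightarrow> int) \<Rightarrow> (nat \<Rightarrow> int) \<Rightarrow> bool" where
  "zeq k a b \<equiv> a k = b k"

sublocale zeq: decreasing_equivs zeq Zc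
proof
  fix a b k assume "a \<in> Zc" "b \<in> Zc" "a (Suc k) = b (Suc k)"
  then show "a k = b k"
    using coherent_mod[of p a k "Suc k"] coherent_mod[of p b k "Suc k"] by (simp add: Zc_def)
qed simp_all

lemma padic_top_utop: "padic_top p = utop zeq Zc"
proof -
  have coset: "multiples (padic_int p) (p ^ m) +>\<^bsub>padic_int p\<^esub> a = {b \<in> Zc. a m = b m}" if a: "a \<in> Zc" for a m
  proof
    show "multiples (padic_int p) (p ^ m) +>\<^bsub>padic_int p\<^esub> a \<subseteq> {b \<in> Zc. a m = b m}"
    proof
      fix b assume "b \<in> multiples (padic_int p) (p ^ m) +>\<^bsub>padic_int p\<^esub> a"
      then obtain h where h: "coherent p h" "h m = 0" "b = h \<oplus>\<^bsub>padic_int p\<^esub> a"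
        by (auto simp: a_r_coset_def' multiples_padic)
      have "b = (\<lambda>n. (h n + a n) mod int p ^ n)" by (simp add: h(3) padic_int_def)
      then show "b \<in> {b \<in> Zc. a m = b m}"
        using padic_add_coherent[OF h(1), of a] a h(2) coherent_bounds(3)[of p a m] by (simp add: Zc_def)
    qed
    show "{b \<in> Zc. a m = b m} \<subseteq> multiples (padic_int p) (p ^ m) +>\<^bsub>padic_int p\<^esub> a"
    proof
      fix b assume b: "b \<in> {b \<in> Zc. a m = b m}"
      define h where "h = (\<lambda>n. (b n - a n) mod int p ^ n)"
      have "coherent p h" unfolding h_def using a b by (intro coherent_diff) (auto simp: Zc_def)
      moreover have "h m = 0" using b by (simp add: h_def)
      moreover have "b = h \<oplus>\<^bsub>padic_int p\<^esub> a"
        using b coherent_bounds(3)[of p b] by (auto simp: h_def padic_int_def mod_add_left_eq Zc_def fun_eq_iff)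
      ultimately show "b \<in> multiples (padic_int p) (p ^ m) +>\<^bsub>padic_int p\<^esub> a"
        by (auto simp: a_r_coset_def' multiples_padic)
    qed
  qed
  have "topology_generated_by (\<Union>N\<in>range (\<lambda>m. multiples (padic_int p) (p ^ m)). a_rcosets\<^bsub>padic_int p\<^esub> N) = utop zeq Zc"
  proof (rule zeq.generated_utop)
    fix S assume "S \<in> (\<Union>N\<in>range (\<lambda>m. multiples (padic_int p) (p ^ m)). a_rcosets\<^bsub>padic_int p\<^esub> N)"
    then obtain m a where "a \<in> Zc" "S = {b \<in> Zc. a m = b m}"
      by (auto simp: A_RCOSETS_def' carrier_Zc coset)
    then show "openin (utop zeq Zc) S" using zeq.openin_class[of Zc a m] by simp
  next
    fix a k assume "a \<in> Zc"
    then show "\<exists>S\<in>\<Union>N\<in>range (\<lambda>m. multiples (padic_int p) (p ^ m)). a_rcosets\<^bsub>padic_int p\<^esub> N. a \<in> S \<and> S \<subseteq> {b \<in> Zc. a k = b k}"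
      by (intro bexI[of _ "{b \<in> Zc. a k = b k}"]) (auto simp: A_RCOSETS_def' carrier_Zc coset)
  qed
  then show ?thesis by (simp add: padic_top_def subgroup_topology_def)
qed

lemma Hausdorff_padic: "Hausdorff_space (padic_top p)"
  unfolding Hausdorff_space_def padic_top_utop zeq.topspace_utop[OF subset_refl]
proof (intro allI impI)
  fix a b assume ab: "a \<in> Zc \<and> b \<in> Zc \<and> a \<noteq> b"
  then obtain k where k: "a k \<noteq> b k" by blast
  define B where "B c = {d \<in> Zc. c k = d k}" for c
  have "openin (utop zeq Zc) (B c)" for c
    unfolding B_def by (rule zeq.openin_class[OF subset_refl])
  moreover have "a \<in> B a" "b \<in> B b" "disjnt (B a) (B b)"
    using ab k by (auto simp: B_def disjnt_iff)
  ultimately show "\<exists>U V. openin (utop zeq Zc) U \<and> openin (utop zeq Zc) V \<and> a \<in> U \<and> b \<in> V \<and> disjnt U V"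
    by blast
qed

text \<open>Conversely \<open>f\<close> is split by degree: the coefficients below degree
  \<open>n\<close> are divided by p^m, all others go into the summand from
  \<open>Q_star\<close>.\<close>

lemma Q_plus_multiples:
  "f \<in> Q_star p n <+>\<^bsub>Pi_star p\<^esub> multiples (Pi_star p) (p ^ m) \<longleftrightarrow>
     f \<in> carrier (Pi_star p) \<and> (\<forall>mon. size mon < n \<longrightarrow> f mon m = 0)"
proof
  assume "f \<in> Q_star p n <+>\<^bsub>Pi_star p\<^esub> multiples (Pi_star p) (p ^ m)"
  then obtain q g where q: "q \<in> Q_star p n" and g: "g \<in> carrier (Pi_star p)"
    and f: "f = q \<oplus>\<^bsub>Pi_star p\<^esub> ([(p ^ m)] \<cdot>\<^bsub>Pi_star p\<^esub> g)"
    by (auto simp: set_add_def' multiples_def)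
  have pg: "([(p ^ m)] \<cdot>\<^bsub>Pi_star p\<^esub> g) = (\<lambda>mon k. (int (p ^ m) * g mon k) mod int p ^ k)"
    by (intro ext Pi_add_pow)
  have "([(p ^ m)] \<cdot>\<^bsub>Pi_star p\<^esub> g) \<in> carrier (Pi_star p)"
    using g coherent_scale unfolding pg carrier_Pi by blast
  then have "f \<in> carrier (Pi_star p)" using q unfolding f by (intro Pi_add_closed) (auto simp: Q_star_def)
  moreover have "f mon m = 0" if "size mon < n" for mon
    using q that unfolding f Pi_add pg by (auto simp: Q_star_def padic_int_def)
  ultimately show "f \<in> carrier (Pi_star p) \<and> (\<forall>mon. size mon < n \<longrightarrow> f mon m = 0)" by blast
next
  assume f: "f \<in> carrier (Pi_star p) \<and> (\<forall>mon. size mon < n \<longrightarrow> f mon m = 0)"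
  have "\<exists>g. coherent p g \<and> (if size mon < n then \<forall>k. f mon k = int p ^ m * g k mod int p ^ k else g = (\<lambda>n. 0))" for mon
    proof (cases "size mon < n")
      case True
      then show ?thesis using coherent_divisible[of "f mon" m] f by (simp add: carrier_Pi)
    next
      case False
      then show ?thesis using coherent_0[OF p_pos] by auto
    qed
  then obtain g where g: "\<And>mon. coherent p (g mon)"
    "\<And>mon. if size mon < n then \<forall>k. f mon k = int p ^ m * g mon k mod int p ^ k else g mon = (\<lambda>n. 0)"
    by metis
  define q where "q = (\<lambda>mon. if size mon < n then (\<lambda>n. 0) else f mon)"
  have "q \<in> Q_star p n"
    using f p_pos by (auto simp: Q_star_def q_def carrier_Pi padic_int_def)
  moreover have "f = q \<oplus>\<^bsub>Pi_star p\<^esub> ([(p ^ m)] \<cdot>\<^bsub>Pi_star p\<^esub> g)"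
  proof (intro ext)
    fix mon k
    show "f mon k = (q \<oplus>\<^bsub>Pi_star p\<^esub> ([(p ^ m)] \<cdot>\<^bsub>Pi_star p\<^esub> g)) mon k"
    proof (cases "size mon < n")
      case True
      then show ?thesis unfolding Pi_add Pi_add_pow using g(2)[of mon] by (simp add: q_def)
    next
      case False
      then show ?thesis unfolding Pi_add Pi_add_pow using g(2)[of mon] f coherent_bounds(3)[of p "f mon" k]
        by (simp add: q_def carrier_Pi)
    qed
  qed
  moreover have "g \<in> carrier (Pi_star p)" using g(1) by (simp add: carrier_Pi)
  ultimately show "f \<in> Q_star p n <+>\<^bsub>Pi_star p\<^esub> multiples (Pi_star p) (p ^ m)"
    unfolding set_add_def' multiples_def by blast
qed

lemma agree_comp:
  assumes "agree k A B" "A \<in> cM" "B \<in> cM" "n \<le> k" "size m < k"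
  shows "A i j m n = B i j m n"
  using assms coherent_mod[OF cM_coherent[OF assms(2), of i j m] assms(4)]
    coherent_mod[OF cM_coherent[OF assms(3), of i j m] assms(4)] by (simp add: agree_def)

text \<open>The basic neighbourhoods have two indices, but those with equal indices are exactly the
  \<open>agree\<close> classes and are cofinal.\<close>

lemma M2_top_utop: "M2_top p = utop agree cM"
proof -
  define N :: "nat \<Rightarrow> nat \<Rightarrow> series_matrix set" where "N n m = {A. \<forall>i j. A i j \<in> Q_star p n <+>\<^bsub>Pi_star p\<^esub> multiples (Pi_star p) (p ^ m)}"
    for n m
  define cls :: "nat \<Rightarrow> nat \<Rightarrow> series_matrix \<Rightarrow> series_matrix set" where "cls n m a = {b \<in> cM. \<forall>i j mon. size mon < n \<longrightarrow> b i j mon m = a i j mon m}" for n m a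
  have N_iff: "h \<in> N n m \<longleftrightarrow> h \<in> cM \<and> (\<forall>i j mon. size mon < n \<longrightarrow> h i j mon m = 0)" for h n m
    by (auto simp: N_def Q_plus_multiples cM_def carrier_Pi)
  have coset: "N n m +>\<^bsub>M2 p\<^esub> a = cls n m a" if a: "a \<in> cM" for n m a
  proof
    show "N n m +>\<^bsub>M2 p\<^esub> a \<subseteq> cls n m a"
    proof
      fix b assume "b \<in> N n m +>\<^bsub>M2 p\<^esub> a"
      then obtain h where h: "h \<in> N n m" "b = h \<oplus>\<^bsub>M2 p\<^esub> a" by (auto simp: a_r_coset_def')
      have b: "b = (\<lambda>i j mon k. (h i j mon k + a i j mon k) mod int p ^ k)"
        unfolding h(2) by (intro ext M2_add)
      have "b \<in> cM" using h(1) a padic_add_coherent unfolding b cM_def N_iff by (simp add: cM_def)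
      moreover have "b i j mon m = a i j mon m" if "size mon < n" for i j mon
        using h(1) that coherent_bounds(3)[OF cM_coherent[OF a]] by (simp add: b N_iff)
      ultimately show "b \<in> cls n m a" by (simp add: cls_def)
    qed
    show "cls n m a \<subseteq> N n m +>\<^bsub>M2 p\<^esub> a"
    proof
      fix b assume b: "b \<in> cls n m a"
      define h where "h = (\<lambda>i j mon k. (b i j mon k - a i j mon k) mod int p ^ k)"
      have "h \<in> cM" using a b coherent_diff unfolding h_def by (simp add: cM_def cls_def)
      then have "h \<in> N n m" using b by (simp add: N_iff h_def cls_def)
      moreover have "b = h \<oplus>\<^bsub>M2 p\<^esub> a"
      proof (intro ext)
        fix i j mon k
        have "b i j mon k mod int p ^ k = b i j mon k"
          using b by (intro coherent_bounds(3)[OF cM_coherent]) (simp add: cls_def)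
        then show "b i j mon k = (h \<oplus>\<^bsub>M2 p\<^esub> a) i j mon k" by (simp add: M2_add h_def mod_add_left_eq)
      qed
      ultimately show "b \<in> N n m +>\<^bsub>M2 p\<^esub> a" by (auto simp: a_r_coset_def')
    qed
  qed
  have cosets: "S \<in> (\<Union>N\<in>{N n m | n m. True}. a_rcosets\<^bsub>M2 p\<^esub> N) \<longleftrightarrow> (\<exists>n m. \<exists>a\<in>cM. S = cls n m a)" for S
    using coset by (auto simp: A_RCOSETS_def' carrier_M2) blast+
  have "topology_generated_by (\<Union>N\<in>{N n m | n m. True}. a_rcosets\<^bsub>M2 p\<^esub> N) = utop agree cM"
  proof (rule agree.generated_utop)
    fix S assume "S \<in> (\<Union>N\<in>{N n m | n m. True}. a_rcosets\<^bsub>M2 p\<^esub> N)"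
    then obtain n m a where a: "a \<in> cM" and S: "S = cls n m a" using cosets by blast
    have "c \<in> S" if b: "b \<in> S" "c \<in> cM" "agree (max n m) b c" for b c
    proof -
      have bM: "b \<in> cM" using b(1) by (simp add: S cls_def)
      have "c i j mon m = a i j mon m" if "size mon < n" for i j mon
        using agree_comp[OF b(3) bM b(2), of m mon i j] that b(1) by (simp add: S cls_def)
      then show ?thesis using b(2) by (simp add: S cls_def)
    qed
    moreover have "S \<subseteq> cM" by (auto simp: S cls_def)
    ultimately show "openin (utop agree cM) S" by (subst agree.openin_utop) auto
  next
    fix a k assume a: "a \<in> cM"
    have "cls k k a \<subseteq> {b \<in> cM. agree k a b}" by (auto simp: cls_def agree_def)
    moreover have "a \<in> cls k k a" using a by (simp add: cls_def)
    moreover have "cls k k a \<in> (\<Union>N\<in>{N n m | n m. True}. a_rcosets\<^bsub>M2 p\<^esub> N)"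
      unfolding cosets by (rule exI, rule exI, rule bexI[OF refl a])
    ultimately show "\<exists>S\<in>\<Union>N\<in>{N n m | n m. True}. a_rcosets\<^bsub>M2 p\<^esub> N. a \<in> S \<and> S \<subseteq> {b \<in> cM. agree k a b}"
      by (intro bexI[of _ "cls k k a"] conjI)
  qed
  then show ?thesis unfolding M2_top_def subgroup_topology_def N_def .
qed

definition cC :: "series_matrix set" where
  "cC = {A \<in> cM. \<forall>i j n. A i j {#} n = \<one>\<^bsub>M2 p\<^esub> i j {#} n}"

lemma Q1_coset:
  assumes f: "f \<in> carrier (Pi_star p)"
  shows "Q_star p 1 +>\<^bsub>Pi_star p\<^esub> f = Q_star p 1 \<longleftrightarrow> (\<forall>n. f {#} n = 0)"
proof -
  have Q: "g \<in> Q_star p 1 \<longleftrightarrow> g \<in> carrier (Pi_star p) \<and> (\<forall>n. g {#} n = 0)" for g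
    by (auto simp: Q_star_def padic_int_def fun_eq_iff)
  have mf: "f m n mod int p ^ n = f m n" for m n
    using f by (intro coherent_bounds(3)) (simp add: carrier_Pi)
  show ?thesis
  proof
    assume eq: "Q_star p 1 +>\<^bsub>Pi_star p\<^esub> f = Q_star p 1"
    have "\<zero>\<^bsub>Pi_star p\<^esub> \<in> Q_star p 1" unfolding Q using p_pos by (simp add: Pi_zero carrier_Pi)
    then have "\<zero>\<^bsub>Pi_star p\<^esub> \<oplus>\<^bsub>Pi_star p\<^esub> f \<in> Q_star p 1 +>\<^bsub>Pi_star p\<^esub> f" by (auto simp: a_r_coset_def')
    then have "\<zero>\<^bsub>Pi_star p\<^esub> \<oplus>\<^bsub>Pi_star p\<^esub> f \<in> Q_star p 1" by (simp only: eq)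
    then show "\<forall>n. f {#} n = 0" unfolding Q by (simp add: Pi_add Pi_zero mf)
  next
    assume f0: "\<forall>n. f {#} n = 0"
    show "Q_star p 1 +>\<^bsub>Pi_star p\<^esub> f = Q_star p 1"
    proof
      show "Q_star p 1 +>\<^bsub>Pi_star p\<^esub> f \<subseteq> Q_star p 1"
      proof
        fix g assume "g \<in> Q_star p 1 +>\<^bsub>Pi_star p\<^esub> f"
        then obtain h where h: "h \<in> Q_star p 1" "g = h \<oplus>\<^bsub>Pi_star p\<^esub> f" by (auto simp: a_r_coset_def')
        show "g \<in> Q_star p 1"
          unfolding Q using h(1)[unfolded Q] f f0 Pi_add_closed[of h f] by (simp add: h(2) Pi_add)
      qed
      show "Q_star p 1 \<subseteq> Q_star p 1 +>\<^bsub>Pi_star p\<^esub> f"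
      proof
        fix g assume g: "g \<in> Q_star p 1"
        define h where "h = (\<lambda>m n. (g m n - f m n) mod int p ^ n)"
        have "h \<in> Q_star p 1"
          using g f f0 coherent_diff unfolding Q h_def carrier_Pi by simp
        moreover have "g = h \<oplus>\<^bsub>Pi_star p\<^esub> f"
        proof (intro ext)
          fix m n
          have "g m n mod int p ^ n = g m n"
            using g unfolding Q carrier_Pi by (intro coherent_bounds(3)) simp
          then show "g m n = (h \<oplus>\<^bsub>Pi_star p\<^esub> f) m n" by (simp add: h_def Pi_add mod_add_left_eq)
        qed
        ultimately show "g \<in> Q_star p 1 +>\<^bsub>Pi_star p\<^esub> f" by (auto simp: a_r_coset_def')
      qed
    qed
  qed
qed

lemma M2_ker_iff: "A \<in> M2_ker p \<longleftrightarrow> A \<in> cM \<and> (\<forall>i j n. A i j {#} n = 0)"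
proof -
  have "A \<in> M2_ker p \<longleftrightarrow> A \<in> cM \<and> (\<forall>i j. Q_star p 1 +>\<^bsub>Pi_star p\<^esub> A i j = Q_star p 1)"
    by (simp add: M2_ker_def a_kernel_def kernel_def carrier_M2) (simp add: matrix_ring_def FactRing_def fun_eq_iff)
  then show ?thesis using Q1_coset[OF cM_entry] by blast
qed

lemma carrier_congruence: "carrier (congruence_group p) = cC"
proof -
  have "(\<lambda>A. \<one>\<^bsub>M2 p\<^esub> \<oplus>\<^bsub>M2 p\<^esub> A) ` M2_ker p = cC"
  proof
    show "(\<lambda>A. \<one>\<^bsub>M2 p\<^esub> \<oplus>\<^bsub>M2 p\<^esub> A) ` M2_ker p \<subseteq> cC"
    proof
      fix B assume "B \<in> (\<lambda>A. \<one>\<^bsub>M2 p\<^esub> \<oplus>\<^bsub>M2 p\<^esub> A) ` M2_ker p"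
      then obtain A where A: "A \<in> cM" "\<forall>i j n. A i j {#} n = 0" and B: "B = \<one>\<^bsub>M2 p\<^esub> \<oplus>\<^bsub>M2 p\<^esub> A"
        by (auto simp: M2_ker_iff)
      have B': "B = (\<lambda>i j m n. (\<one>\<^bsub>M2 p\<^esub> i j m n + A i j m n) mod int p ^ n)"
        unfolding B by (intro ext M2_add)
      have "B \<in> cM" using A(1) M2_one_closed padic_add_coherent unfolding B' by (simp add: cM_def)
      moreover have "B i j {#} n = \<one>\<^bsub>M2 p\<^esub> i j {#} n" for i j n
        using A(2) coherent_bounds(3)[OF cM_coherent[OF M2_one_closed]] by (simp add: B')
      ultimately show "B \<in> cC" by (simp add: cC_def)
    qed
    show "cC \<subseteq> (\<lambda>A. \<one>\<^bsub>M2 p\<^esub> \<oplus>\<^bsub>M2 p\<^esub> A) ` M2_ker p"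
    proof
      fix B assume B: "B \<in> cC"
      define A where "A = (\<lambda>i j m n. (B i j m n - \<one>\<^bsub>M2 p\<^esub> i j m n) mod int p ^ n)"
      have "A \<in> cM" using B M2_one_closed coherent_diff unfolding A_def by (simp add: cM_def cC_def)
      then have "A \<in> M2_ker p" using B by (simp add: M2_ker_iff A_def cC_def)
      moreover have "B = \<one>\<^bsub>M2 p\<^esub> \<oplus>\<^bsub>M2 p\<^esub> A"
      proof (intro ext)
        fix i j m n
        have "B i j m n mod int p ^ n = B i j m n"
          using B by (intro coherent_bounds(3)[OF cM_coherent]) (simp add: cC_def)
        then show "B i j m n = (\<one>\<^bsub>M2 p\<^esub> \<oplus>\<^bsub>M2 p\<^esub> A) i j m n"
          by (simp add: A_def M2_add mod_add_right_eq)
      qed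
      ultimately show "B \<in> (\<lambda>A. \<one>\<^bsub>M2 p\<^esub> \<oplus>\<^bsub>M2 p\<^esub> A) ` M2_ker p" by blast
    qed
  qed
  then show ?thesis by (simp add: congruence_group_def)
qed

lemma cC_cM: "cC \<subseteq> cM"
  by (auto simp: cC_def)

lemma congruence_top_utop: "congruence_top p = utop agree cC"
  unfolding congruence_top_def M2_top_utop carrier_congruence
  by (rule agree.subtopology_utop[OF cC_cM subset_refl])

lemma cC_mult:
  assumes "A \<in> cC" "B \<in> cC"
  shows "A \<odot> B \<in> cC"
proof -
  have M: "A \<in> cM" "B \<in> cM" using assms by (auto simp: cC_def)
  have "{k. k \<subseteq># ({#} :: var multiset)} = {{#}}" by auto
  then have "(A \<odot> B) i j {#} n = (\<one>\<^bsub>M2 p\<^esub> \<odot> \<one>\<^bsub>M2 p\<^esub>) i j {#} n" for i j n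
    using assms by (simp add: M2_mult M M2_one_closed cC_def)
  then show ?thesis using M2_mult_closed[OF M] M2_one_left[OF M2_one_closed] by (simp add: cC_def)
qed

lemma one_cC: "\<one>\<^bsub>M2 p\<^esub> \<in> cC"
  using M2_one_closed by (simp add: cC_def)

lemma congruence_simps: "mult (congruence_group p) = mult (M2 p)" "one (congruence_group p) = one (M2 p)"
  by (simp_all add: congruence_group_def)

lemma congruence_monoid: "monoid (congruence_group p)"
  by (rule monoidI)
    (auto simp: carrier_congruence congruence_simps cC_mult one_cC
      intro!: M2_assoc M2_one_left M2_one_right subsetD[OF cC_cM])

section \<open>The discrete group inside the congruence group\<close>

definition jg :: "gam \<Rightarrow> series_matrix" where
  "jg g = iota (rep g)"

lemma jg_add: "jg (a + b) = jg a \<odot> jg b"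
  by (simp add: jg_def rep_add iota_mult)

lemma jg_0: "jg 0 = \<one>\<^bsub>M2 p\<^esub>"
  by (simp add: jg_def iota_1)

lemma jg_cM: "jg g \<in> cM"
  by (simp add: jg_def iota_closed)

lemma jg_cC: "jg g \<in> cC"
proof -
  have "rep g - 1 \<in> mfil 0 1" using gam_U_1[of g 0] by (simp add: adicU_def)
  then have "mcoef (ent (rep g) i j) {#} = mcoef (ent (1 :: var mps mat2) i j) {#}" for i j
    using exhaust_2[of i] exhaust_2[of j] by (auto simp: ent_def mfil_def fil_def)
  then have "jg g i j {#} n = \<one>\<^bsub>M2 p\<^esub> i j {#} n" for i j n
    by (simp add: jg_def iota_def flip: iota_1)
  then show ?thesis using jg_cM by (simp add: cC_def)
qed

text \<open>The bridge between the two halves of the development: the topology of the matrix group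
  induces on the discrete group the filtration by \<open>adicV p k\<close>.\<close>

lemma agree_jg: "agree k (jg a) (jg b) \<longleftrightarrow> a - b \<in> adicV p k"
proof -
  have 1: "rep (a - b) - 1 = (rep a - rep b) * rep (- b)"
    by (simp add: rep_diff left_diff_distrib rep_minus)
  have 2: "(rep (a - b) - 1) * rep b = rep a - rep b"
    by (simp add: 1 mult.assoc rep_minus)
  show ?thesis unfolding jg_def agree_iota_iff adicV_def adicU_def mem_Collect_eq
    by (metis 1 2 mfil_mult_right)
qed

lemma jg_gx: "\<one>\<^bsub>M2 p\<^esub> \<oplus>\<^bsub>M2 p\<^esub> generic_matrix p c = jg (gx c)"
proof (intro ext)
  fix i j m n
  have "mcoef (ent (1 + gmat c) i j) m = mcoef (ent 1 i j) m + (if m = {#(c, i, j)#} then 1 else 0)"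
    using exhaust_2[of i] exhaust_2[of j] by (auto simp: ent_def gmat_def mcoef_mmono)
  then show "(\<one>\<^bsub>M2 p\<^esub> \<oplus>\<^bsub>M2 p\<^esub> generic_matrix p c) i j m n = jg (gx c) i j m n"
    unfolding M2_add iota_1[symmetric] jg_def rep_gx
    by (simp add: iota_def generic_matrix_def series_var_def padic_int_def mod_add_eq)
qed

lemma inv_jg: "inv\<^bsub>congruence_group p\<^esub> jg g = jg (- g)"
proof -
  interpret monoid "congruence_group p" by (rule congruence_monoid)
  show ?thesis
    by (rule inv_unique'[symmetric])
      (auto simp: carrier_congruence jg_cC congruence_simps jg_0 simp flip: jg_add)
qed

lemma generate_jg:
  "generate (congruence_group p) {\<one>\<^bsub>M2 p\<^esub> \<oplus>\<^bsub>M2 p\<^esub> generic_matrix p gen_x, \<one>\<^bsub>M2 p\<^esub> \<oplus>\<^bsub>M2 p\<^esub> generic_matrix p gen_y} = range jg"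
  (is "generate ?C ?S = _")
proof
  have "x \<in> range jg" if "x \<in> generate ?C ?S" for x
    using that
  proof induction
    case one
    then show ?case by (metis congruence_simps(2) jg_0 rangeI)
  next
    case (incl h)
    then show ?case by (auto simp: jg_gx)
  next
    case (inv h)
    then show ?case by (auto simp: jg_gx inv_jg)
  next
    case (eng h1 h2)
    then show ?case by (auto simp: congruence_simps simp flip: jg_add)
  qed
  then show "generate ?C ?S \<subseteq> range jg" by blast
  have "jg g \<in> generate ?C ?S \<and> jg (- g) \<in> generate ?C ?S" if "g \<in> gen {gX, gY}" for g
    using that
  proof (induction rule: gen.induct)
    case gen_zero
    then show ?case using generate.one[of ?C ?S] by (simp add: congruence_simps jg_0)
  next
    case (gen_base a)
    then obtain c where c: "a = gx c" by auto
    have "jg (gx c) \<in> ?S" by (cases c) (simp_all add: jg_gx)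
    then show ?case unfolding c using generate.incl generate.inv inv_jg by metis
  next
    case (gen_add a b)
    have "jg (- (a + b)) = jg (- b) \<odot> jg (- a)" by (simp only: minus_add jg_add)
    moreover have "jg (- b) \<odot> jg (- a) \<in> generate ?C ?S"
      using generate.eng[of "jg (- b)" ?C ?S "jg (- a)"] gen_add by (simp add: congruence_simps)
    moreover have "jg a \<odot> jg b \<in> generate ?C ?S"
      using generate.eng[of "jg a" ?C ?S "jg b"] gen_add by (simp add: congruence_simps)
    ultimately show ?case by (simp only: jg_add simp_thms)
  qed simp
  then show "range jg \<subseteq> generate ?C ?S" by (auto simp: gen_gx)
qed

text \<open>The closure of the image of \<open>S\<close>, written out by approximations.\<close>

definition cl :: "gam set \<Rightarrow> series_matrix set" where
  "cl S = {a \<in> cM. \<forall>k. \<exists>g\<in>S. agree k a (jg g)}"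

lemma cl_cC: "cl S \<subseteq> cC"
proof
  fix a assume a: "a \<in> cl S"
  have "a i j {#} n = \<one>\<^bsub>M2 p\<^esub> i j {#} n" for i j n
  proof -
    obtain g where "agree (Suc n) a (jg g)" using a unfolding cl_def by blast
    then have "a i j {#} n = jg g i j {#} n"
      using a by (intro agree_comp) (auto simp: cl_def jg_cM)
    then show ?thesis using jg_cC[of g] by (simp add: cC_def)
  qed
  then show "a \<in> cC" using a by (simp add: cl_def cC_def)
qed

lemma cl_mono: "S \<subseteq> T \<Longrightarrow> cl S \<subseteq> cl T"
  unfolding cl_def by blast

lemma jg_cl: "g \<in> S \<Longrightarrow> jg g \<in> cl S"
  unfolding cl_def using jg_cM agree.R_refl by blast

lemma cl_cM: "a \<in> cl S \<Longrightarrow> a \<in> cM"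
  by (simp add: cl_def)

lemma cl_approx: "a \<in> cl S \<Longrightarrow> \<exists>g\<in>S. agree k a (jg g)"
  by (simp add: cl_def)

lemma G_hat_simps: "carrier (G_hat p) = cl UNIV" "mult (G_hat p) = mult (M2 p)" "one (G_hat p) = one (M2 p)"
proof -
  have "utop agree cC closure_of range jg = {a \<in> cC. \<forall>k. \<exists>s\<in>range jg. agree k a s}"
    using jg_cC by (intro agree.closure_utop cC_cM) auto
  also have "\<dots> = cl UNIV" using cl_cC[of UNIV] cC_cM by (auto simp: cl_def)
  finally show "carrier (G_hat p) = cl UNIV"
    by (simp add: G_hat_def generate_jg congruence_top_utop)
qed (simp_all add: G_hat_def congruence_simps)

lemma G_hat_top_utop: "G_hat_top p = utop agree (cl UNIV)"
  unfolding G_hat_top_def congruence_top_utop G_hat_simps by (rule agree.subtopology_utop[OF cl_cC cC_cM])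

lemma cl_mult:
  assumes H: "subgrp H" and "a \<in> cl H" "b \<in> cl H"
  shows "a \<odot> b \<in> cl H"
  unfolding cl_def
proof (intro CollectI conjI allI)
  show "a \<odot> b \<in> cM" using assms cl_cM M2_mult_closed by blast
  fix k
  obtain g h where "g \<in> H" "h \<in> H" "agree k a (jg g)" "agree k b (jg h)" using assms cl_approx by meson
  then show "\<exists>g\<in>H. agree k (a \<odot> b) (jg g)"
    using agree_mult[of a b "jg g" "jg h" k] assms cl_cM jg_cM subgrpD(2)[OF H]
    by (intro bexI[of _ "g + h"]) (simp_all add: jg_add)
qed

text \<open>The inverses of approximating elements again form a coherent sequence, and its limit is
  the inverse.\<close>

lemma cl_inverse:
  assumes H: "subgrp H" and a: "a \<in> cl H"
  shows "\<exists>b\<in>cl H. b \<odot> a = \<one>\<^bsub>M2 p\<^esub>"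
proof -
  have aM: "a \<in> cM" using a by (rule cl_cM)
  obtain s where s: "\<And>k. s k \<in> H" "\<And>k. agree k a (jg (s k))" using cl_approx[OF a] by metis
  have "agree k (jg (- s k)) (jg (- s (Suc k)))" for k
  proof -
    have "agree k a (jg (s (Suc k)))" using agree.R_Suc[OF aM jg_cM s(2)[of "Suc k"]] .
    then have "agree k (jg (s k)) (jg (s (Suc k)))" using s(2)[of k] agree.R_sym agree.R_trans by blast
    then show ?thesis unfolding agree_jg by (rule nsubgrp_cong_minus[OF nsubgrp_V])
  qed
  then obtain b where b: "b \<in> cM" "\<And>k. agree k b (jg (- s k))"
    using agree_complete[of "\<lambda>k. jg (- s k)"] jg_cM by blast
  have "b \<in> cl H" unfolding cl_def using b s(1) subgrpD(3)[OF H] by blast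
  moreover have "b \<odot> a = \<one>\<^bsub>M2 p\<^esub>"
  proof (rule agree_all[OF M2_mult_closed[OF b(1) aM] M2_one_closed])
    fix k
    have "agree k (b \<odot> a) (jg (- s k) \<odot> jg (s k))"
      by (intro agree_mult b aM jg_cM s)
    then show "agree k (b \<odot> a) \<one>\<^bsub>M2 p\<^esub>" by (simp add: jg_0 flip: jg_add)
  qed
  ultimately show ?thesis by blast
qed

lemma subgrp_UNIV: "subgrp (UNIV :: gam set)"
  by (simp add: subgrp_def)

lemma G_hat_group: "group (G_hat p)"
proof (rule groupI)
  show "\<And>x y. x \<in> carrier (G_hat p) \<Longrightarrow> y \<in> carrier (G_hat p) \<Longrightarrow> x \<otimes>\<^bsub>G_hat p\<^esub> y \<in> carrier (G_hat p)"
    using cl_mult[OF subgrp_UNIV] by (simp add: G_hat_simps)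
  show "\<one>\<^bsub>G_hat p\<^esub> \<in> carrier (G_hat p)"
    using jg_cl[of 0 UNIV] by (simp add: G_hat_simps jg_0)
  show "\<And>x. x \<in> carrier (G_hat p) \<Longrightarrow> \<exists>y\<in>carrier (G_hat p). y \<otimes>\<^bsub>G_hat p\<^esub> x = \<one>\<^bsub>G_hat p\<^esub>"
    using cl_inverse[OF subgrp_UNIV] by (simp add: G_hat_simps)
qed (use M2_assoc M2_one_left cl_cM in \<open>auto simp: G_hat_simps\<close>)

sublocale G: group "G_hat p"
  by (rule G_hat_group)

lemma G_inv_approx:
  assumes a: "a \<in> cl UNIV" and g: "agree k a (jg g)"
  shows "agree k (inv\<^bsub>G_hat p\<^esub> a) (jg (- g))"
proof -
  let ?b = "inv\<^bsub>G_hat p\<^esub> a"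
  have b: "?b \<in> cM" using G.inv_closed[of a] a cl_cM by (auto simp: G_hat_simps)
  have ba: "?b \<odot> a = \<one>\<^bsub>M2 p\<^esub>" using G.l_inv[of a] a by (simp add: G_hat_simps)
  have "agree k (?b \<odot> (a \<odot> jg (- g))) (?b \<odot> (jg g \<odot> jg (- g)))"
    using b cl_cM[OF a] g jg_cM by (intro agree_mult M2_mult_closed agree.R_refl)
  moreover have "?b \<odot> (a \<odot> jg (- g)) = jg (- g)"
    using M2_assoc[OF b cl_cM[OF a] jg_cM] ba M2_one_left[OF jg_cM] by simp
  moreover have "?b \<odot> (jg g \<odot> jg (- g)) = ?b"
    using M2_one_right[OF b] by (simp add: jg_0 flip: jg_add)
  ultimately show ?thesis using agree.R_sym by simp
qed

lemma G_inv_jg: "inv\<^bsub>G_hat p\<^esub> (jg g) = jg (- g)"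
  by (rule G.inv_equality) (simp_all add: G_hat_simps jg_cl jg_0 flip: jg_add)

lemma cl_subgroup: "subgrp H \<Longrightarrow> subgroup (cl H) (G_hat p)"
proof (rule G.subgroupI)
  assume H: "subgrp H"
  show "cl H \<subseteq> carrier (G_hat p)" using cl_mono[of H UNIV] by (simp add: G_hat_simps)
  show "cl H \<noteq> {}" using jg_cl[OF subgrpD(1)[OF H]] by blast
  fix a assume a: "a \<in> cl H"
  then have a': "a \<in> cl UNIV" using cl_mono[of H UNIV] by blast
  show "inv\<^bsub>G_hat p\<^esub> a \<in> cl H"
    unfolding cl_def
  proof (intro CollectI conjI allI)
    show "inv\<^bsub>G_hat p\<^esub> a \<in> cM" using G.inv_closed[of a] a' cl_cM by (auto simp: G_hat_simps)
    fix k
    obtain g where "g \<in> H" "agree k a (jg g)" using cl_approx[OF a] by blast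
    then show "\<exists>g\<in>H. agree k (inv\<^bsub>G_hat p\<^esub> a) (jg g)"
      using G_inv_approx[OF a'] subgrpD(3)[OF H] by blast
  qed
  fix b assume "b \<in> cl H"
  then show "a \<otimes>\<^bsub>G_hat p\<^esub> b \<in> cl H" using cl_mult[OF H a] by (simp add: G_hat_simps)
qed

lemma lcs_subgrp: "subgrp (lcs n :: gam set)"
  by (rule nsubgrpD(1)[OF nsubgrp_lcs])

text \<open>Approximations of two elements give approximations of their commutator, which bounds the
  closed series from above; the commutators of the discrete group are themselves among the
  generators, which gives density.\<close>

lemma closed_lcs_cl: "closed_lcs (G_hat p) (G_hat_top p) n = cl (lcs n)"
proof (cases n)
  case (Suc m)
  have "closed_lcs (G_hat p) (G_hat_top p) (Suc m) = cl (lcs (Suc m))"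
  proof (induction m)
    case (Suc m)
    let ?S = "commutator_subgroup (G_hat p) (cl (lcs (Suc m))) (cl UNIV)"
    have 1: "?S \<subseteq> cl (lcs (Suc (Suc m)))"
      unfolding commutator_subgroup_def
    proof (rule G.generate_subgroup_incl[OF _ cl_subgroup[OF lcs_subgrp]], clarify)
      fix h k assume h: "h \<in> cl (lcs (Suc m))" and k: "k \<in> cl UNIV"
      have h': "h \<in> cl UNIV" using h cl_mono[of "lcs (Suc m)" UNIV] by blast
      let ?c = "h \<otimes>\<^bsub>G_hat p\<^esub> k \<otimes>\<^bsub>G_hat p\<^esub> inv\<^bsub>G_hat p\<^esub> h \<otimes>\<^bsub>G_hat p\<^esub> inv\<^bsub>G_hat p\<^esub> k"
      have inv: "inv\<^bsub>G_hat p\<^esub> h \<in> cl UNIV" "inv\<^bsub>G_hat p\<^esub> k \<in> cl UNIV"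
        using h' k G.inv_closed by (auto simp: G_hat_simps)
      show "?c \<in> cl (lcs (Suc (Suc m)))"
        unfolding cl_def
      proof (intro CollectI conjI allI)
        show "?c \<in> cM" using h' k inv cl_cM by (simp add: G_hat_simps M2_mult_closed)
        fix l
        obtain a b where a: "a \<in> lcs (Suc m)" "agree l h (jg a)" and b: "agree l k (jg b)"
          using cl_approx[OF h] cl_approx[OF k] by meson
        have "agree l ?c (jg a \<odot> jg b \<odot> jg (- a) \<odot> jg (- b))"
          unfolding G_hat_simps(2)
          by (intro agree_mult M2_mult_closed jg_cM cl_cM[OF h'] cl_cM[OF k] cl_cM[OF inv(1)] cl_cM[OF inv(2)]
              a(2) b G_inv_approx h' k)
        moreover have "jg a \<odot> jg b \<odot> jg (- a) \<odot> jg (- b) = jg (comm a b)"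
          by (simp add: comm_def jg_add[symmetric])
        ultimately show "\<exists>g\<in>lcs (Suc (Suc m)). agree l ?c (jg g)"
          using comm_lcs_right[OF a(1)] by (intro bexI[of _ "comm a b"]) simp_all
      qed
    qed
    have 2: "jg g \<in> ?S" if "g \<in> lcs (Suc (Suc m))" for g
    proof -
      have S: "subgroup ?S (G_hat p)"
        unfolding commutator_subgroup_def
      proof (rule G.generate_is_subgroup, clarify)
        fix h k assume "h \<in> cl (lcs (Suc m))" "k \<in> cl UNIV"
        then have "h \<in> carrier (G_hat p)" "k \<in> carrier (G_hat p)"
          using cl_mono[of "lcs (Suc m)" UNIV] by (auto simp: G_hat_simps(1))
        then show "h \<otimes>\<^bsub>G_hat p\<^esub> k \<otimes>\<^bsub>G_hat p\<^esub> inv\<^bsub>G_hat p\<^esub> h \<otimes>\<^bsub>G_hat p\<^esub> inv\<^bsub>G_hat p\<^esub> k \<in> carrier (G_hat p)"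
          by simp
      qed
      have "g \<in> gen {comm h k | h k. h \<in> lcs (Suc m)}" using that by simp
      then show ?thesis
      proof (induction rule: gen.induct)
        case gen_zero
        then show ?case using subgroup.one_closed[OF S] by (simp add: G_hat_simps jg_0)
      next
        case (gen_base a)
        then obtain h k where a: "a = comm h k" and h: "h \<in> lcs (Suc m)" by blast
        have "jg a = jg h \<otimes>\<^bsub>G_hat p\<^esub> jg k \<otimes>\<^bsub>G_hat p\<^esub> inv\<^bsub>G_hat p\<^esub> jg h \<otimes>\<^bsub>G_hat p\<^esub> inv\<^bsub>G_hat p\<^esub> jg k"
          unfolding G_inv_jg G_hat_simps(2) by (simp add: a comm_def jg_add[symmetric])
        then show ?case unfolding commutator_subgroup_def
          using jg_cl[OF h] jg_cl[of k UNIV] by (intro generate.incl) blast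
      next
        case (gen_add a b)
        then show ?case using subgroup.m_closed[OF S] by (simp add: G_hat_simps jg_add)
      next
        case (gen_minus a)
        show ?case using subgroup.m_inv_closed[OF S gen_minus.IH] by (simp only: G_inv_jg)
      qed
    qed
    have sub: "?S \<subseteq> cl UNIV" using 1 cl_mono[of "lcs (Suc (Suc m))" UNIV] by blast
    have "closed_lcs (G_hat p) (G_hat_top p) (Suc (Suc m)) = utop agree (cl UNIV) closure_of ?S"
      using Suc by (simp add: G_hat_top_utop G_hat_simps)
    also have "\<dots> = {a \<in> cl UNIV. \<forall>k. \<exists>s\<in>?S. agree k a s}"
      by (rule agree.closure_utop[OF sub order_trans[OF cl_cC cC_cM]])
    also have "\<dots> = cl (lcs (Suc (Suc m)))"
    proof (intro equalityI subsetI)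
      fix a assume a: "a \<in> {a \<in> cl UNIV. \<forall>k. \<exists>s\<in>?S. agree k a s}"
      have "\<exists>g\<in>lcs (Suc (Suc m)). agree k a (jg g)" for k
      proof -
        obtain s where s: "s \<in> ?S" "agree k a s" using a by blast
        then obtain g where "g \<in> lcs (Suc (Suc m))" "agree k s (jg g)" using 1 cl_approx by blast
        then show ?thesis using agree.R_trans[OF s(2)] by blast
      qed
      moreover have "a \<in> cM" using a by (intro cl_cM[of a UNIV]) simp
      ultimately show "a \<in> cl (lcs (Suc (Suc m)))" unfolding cl_def by (intro CollectI conjI allI)
    next
      fix a assume a: "a \<in> cl (lcs (Suc (Suc m)))"
      then have "a \<in> cl UNIV" using cl_mono[of "lcs (Suc (Suc m))" UNIV] by blast
      moreover have "\<exists>s\<in>?S. agree k a s" for k using cl_approx[OF a, of k] 2 by blast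
      ultimately show "a \<in> {a \<in> cl UNIV. \<forall>k. \<exists>s\<in>?S. agree k a s}" by blast
    qed
    finally show ?case .
  qed (simp add: G_hat_simps)
  then show ?thesis by (simp only: Suc)
qed (simp add: G_hat_simps)

end

subsection \<open>Groups complete with respect to a congruence filtration\<close>

lemma order_prime_power:
  assumes G: "group G" "finite (carrier G)" and p: "prime p"
    and pow: "\<And>x. x \<in> carrier G \<Longrightarrow> \<exists>j :: nat. x [^]\<^bsub>G\<^esub> (p ^ j) = \<one>\<^bsub>G\<^esub>"
  shows "\<exists>k. order G = p ^ k"
proof (rule ccontr)
  interpret group G by fact
  assume "\<nexists>k. order G = p ^ k"
  moreover have "order G \<noteq> 0" using G(2) one_closed by (auto simp: order_def)
  ultimately obtain q where q: "q \<in> prime_factors (order G)" "q \<noteq> p"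
    using Ex_other_prime_factor[of "order G" p] p by auto
  then have "prime q" "q dvd order G" by auto
  then obtain m where "order G = q ^ 1 * m" by (auto elim: dvdE)
  \<comment> \<open>Sylow's theorem with exponent 1 serves as Cauchy's theorem: it yields a
    nontrivial element whose order divides both q and a power of p.\<close>
  from sylow_thm[OF \<open>prime q\<close> G(1) this G(2)] obtain H where H: "subgroup H G" "card H = q" by auto
  have "1 < card H" using H(2) prime_gt_1_nat[OF \<open>prime q\<close>] by simp
  then obtain x where x: "x \<in> H" "x \<noteq> \<one>\<^bsub>G\<^esub>"
    by (metis One_nat_def card.empty card_1_singleton_iff is_singletonI' is_singleton_def less_nat_zero_code less_one nat_less_le)
  have xG: "x \<in> carrier G" using x H(1) subgroup.subset by blast
  interpret H: group "G\<lparr>carrier := H\<rparr>" by (rule subgroup_imp_group[OF H(1)])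
  have "x [^]\<^bsub>G\<lparr>carrier := H\<rparr>\<^esub> q = \<one>\<^bsub>G\<^esub>" using H.pow_order_eq_1[of x] x(1) H(2) by (simp add: order_def)
  then have "x [^]\<^bsub>G\<^esub> q = \<one>\<^bsub>G\<^esub>" by (simp add: nat_pow_def)
  then have "ord x dvd q" using pow_eq_id[OF xG] by simp
  moreover obtain j where "x [^]\<^bsub>G\<^esub> (p ^ j) = \<one>\<^bsub>G\<^esub>" using pow[OF xG] by blast
  then have "ord x dvd p ^ j" using pow_eq_id[OF xG] by simp
  moreover have "coprime q (p ^ j)" using primes_coprime[OF \<open>prime q\<close> p q(2)] by simp
  ultimately have "ord x = 1" using coprime_common_divisor[of q "p ^ j" "ord x"] by simp
  then have "x [^]\<^bsub>G\<^esub> (1 :: nat) = \<one>\<^bsub>G\<^esub>" using pow_eq_id[OF xG, of 1] by simp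
  then show False using x xG by simp
qed

text \<open>Finitely many classes at each level together with completeness give compactness, and
  separation gives the Hausdorff property.\<close>

locale filtered_group = group Y + decreasing_equivs R "carrier Y"
  for Y :: "('b, 'm) monoid_scheme" and R :: "nat \<Rightarrow> 'b \<Rightarrow> 'b \<Rightarrow> bool" +
  assumes R_mult: "\<lbrakk>a \<in> carrier Y; b \<in> carrier Y; a' \<in> carrier Y; b' \<in> carrier Y; R k a a'; R k b b'\<rbrakk>
      \<Longrightarrow> R k (a \<otimes>\<^bsub>Y\<^esub> b) (a' \<otimes>\<^bsub>Y\<^esub> b')"
    and separated: "\<lbrakk>a \<in> carrier Y; b \<in> carrier Y; \<And>k. R k a b\<rbrakk> \<Longrightarrow> a = b"
    and complete: "\<lbrakk>\<And>k. s k \<in> carrier Y; \<And>k. R k (s k) (s (Suc k))\<rbrakk> \<Longrightarrow> \<exists>a\<in>carrier Y. \<forall>k. R k a (s k)"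
    and finite_classes: "\<exists>F. finite F \<and> F \<subseteq> carrier Y \<and> (\<forall>a\<in>carrier Y. \<exists>f\<in>F. R k a f)"
begin

abbreviation T :: "'b topology" where
  "T \<equiv> utop R (carrier Y)"

lemma R_inv:
  assumes "a \<in> carrier Y" "b \<in> carrier Y" "R k a b"
  shows "R k (inv\<^bsub>Y\<^esub> a) (inv\<^bsub>Y\<^esub> b)"
proof -
  have "R k (inv\<^bsub>Y\<^esub> a \<otimes>\<^bsub>Y\<^esub> (a \<otimes>\<^bsub>Y\<^esub> inv\<^bsub>Y\<^esub> b)) (inv\<^bsub>Y\<^esub> a \<otimes>\<^bsub>Y\<^esub> (b \<otimes>\<^bsub>Y\<^esub> inv\<^bsub>Y\<^esub> b))"
    using assms by (intro R_mult R_refl m_closed inv_closed)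
  moreover have "inv\<^bsub>Y\<^esub> a \<otimes>\<^bsub>Y\<^esub> (a \<otimes>\<^bsub>Y\<^esub> inv\<^bsub>Y\<^esub> b) = inv\<^bsub>Y\<^esub> b"
    using assms by (simp add: m_assoc[symmetric])
  ultimately show ?thesis using assms R_sym by simp
qed

lemma R_pow:
  assumes "a \<in> carrier Y" "b \<in> carrier Y" "R k a b"
  shows "R k (a [^]\<^bsub>Y\<^esub> (m :: nat)) (b [^]\<^bsub>Y\<^esub> m)"
  using assms by (induction m) (simp_all add: R_refl R_mult)

lemma topological_group: "topological_group Y T"
proof -
  have sp: "topspace T = carrier Y" by (rule topspace_utop[OF subset_refl])
  have op: "openin T U \<longleftrightarrow> U \<subseteq> carrier Y \<and> (\<forall>a\<in>U. \<exists>k. \<forall>b\<in>carrier Y. R k a b \<longrightarrow> b \<in> U)" for U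
    by (rule openin_utop[OF subset_refl])
  have "continuous_map (prod_topology T T) T (\<lambda>(x, y). x \<otimes>\<^bsub>Y\<^esub> y)"
    unfolding continuous_map_def
  proof (intro conjI allI impI)
    fix U assume U: "openin T U"
    show "openin (prod_topology T T) {z \<in> topspace (prod_topology T T). (case z of (x, y) \<Rightarrow> x \<otimes>\<^bsub>Y\<^esub> y) \<in> U}"
      unfolding openin_prod_topology_alt
    proof (intro allI impI)
      fix x y assume "(x, y) \<in> {z \<in> topspace (prod_topology T T). (case z of (x, y) \<Rightarrow> x \<otimes>\<^bsub>Y\<^esub> y) \<in> U}"
      then have xy: "x \<in> carrier Y" "y \<in> carrier Y" "x \<otimes>\<^bsub>Y\<^esub> y \<in> U" by (auto simp: sp)
      then obtain k where k: "\<forall>b\<in>carrier Y. R k (x \<otimes>\<^bsub>Y\<^esub> y) b \<longrightarrow> b \<in> U" using U op by meson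
      define B where "B z = {b \<in> carrier Y. R k z b}" for z
      have "openin T (B z)" for z unfolding B_def by (rule openin_class[OF subset_refl])
      moreover have "x \<in> B x" "y \<in> B y" using xy R_refl by (auto simp: B_def)
      moreover have "B x \<times> B y \<subseteq> {z \<in> topspace (prod_topology T T). (case z of (x, y) \<Rightarrow> x \<otimes>\<^bsub>Y\<^esub> y) \<in> U}"
        using k xy R_mult by (auto simp: sp B_def)
      ultimately show "\<exists>V W. openin T V \<and> openin T W \<and> x \<in> V \<and> y \<in> W \<and>
          V \<times> W \<subseteq> {z \<in> topspace (prod_topology T T). (case z of (x, y) \<Rightarrow> x \<otimes>\<^bsub>Y\<^esub> y) \<in> U}" by blast
    qed
  qed (auto simp: sp)
  moreover have "continuous_map T T (\<lambda>x. inv\<^bsub>Y\<^esub> x)"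
    unfolding continuous_map_def
  proof (intro conjI allI impI)
    fix U assume U: "openin T U"
    show "openin T {x \<in> topspace T. inv\<^bsub>Y\<^esub> x \<in> U}"
      unfolding op sp
    proof (intro conjI ballI)
      fix x assume "x \<in> {x \<in> carrier Y. inv\<^bsub>Y\<^esub> x \<in> U}"
      then have x: "x \<in> carrier Y" "inv\<^bsub>Y\<^esub> x \<in> U" by auto
      then obtain k where k: "\<forall>b\<in>carrier Y. R k (inv\<^bsub>Y\<^esub> x) b \<longrightarrow> b \<in> U" using U op by meson
      have "b \<in> {x \<in> carrier Y. inv\<^bsub>Y\<^esub> x \<in> U}" if "b \<in> carrier Y" "R k x b" for b
        using k that R_inv[OF x(1) that] by simp
      then show "\<exists>k. \<forall>b\<in>carrier Y. R k x b \<longrightarrow> b \<in> {x \<in> carrier Y. inv\<^bsub>Y\<^esub> x \<in> U}" by blast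
    qed auto
  qed (auto simp: sp)
  ultimately show ?thesis by (simp add: topological_group_def sp group_axioms)
qed

lemma compact: "compact_space T"
proof (rule compact_utop[OF subset_refl _ complete])
  fix k show "\<exists>F. finite F \<and> (\<forall>a\<in>carrier Y. \<exists>f\<in>F. R k a f)" using finite_classes[of k] by meson
qed

lemma Hausdorff: "Hausdorff_space T"
  unfolding Hausdorff_space_def topspace_utop[OF subset_refl]
proof (intro allI impI)
  fix a b assume ab: "a \<in> carrier Y \<and> b \<in> carrier Y \<and> a \<noteq> b"
  then obtain k where k: "\<not> R k a b" using separated by meson
  define B where "B z = {b \<in> carrier Y. R k z b}" for z
  have "openin T (B z)" for z unfolding B_def by (rule openin_class[OF subset_refl])
  moreover have "a \<in> B a" "b \<in> B b" using ab R_refl by (auto simp: B_def)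
  moreover have "disjnt (B a) (B b)"
    unfolding disjnt_iff B_def using k R_sym R_trans by (metis mem_Collect_eq)
  ultimately show "\<exists>U V. openin T U \<and> openin T V \<and> a \<in> U \<and> b \<in> V \<and> disjnt U V" by blast
qed

lemma class_one_subgroup: "subgroup {b \<in> carrier Y. R k \<one>\<^bsub>Y\<^esub> b} Y"
proof (rule subgroupI)
  show "{b \<in> carrier Y. R k \<one>\<^bsub>Y\<^esub> b} \<noteq> {}" using R_refl one_closed by blast
  fix a assume "a \<in> {b \<in> carrier Y. R k \<one>\<^bsub>Y\<^esub> b}"
  then have a: "a \<in> carrier Y" "R k \<one>\<^bsub>Y\<^esub> a" by auto
  then show "inv\<^bsub>Y\<^esub> a \<in> {b \<in> carrier Y. R k \<one>\<^bsub>Y\<^esub> b}" using R_inv[of "\<one>\<^bsub>Y\<^esub>" a k] by simp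
  fix b assume "b \<in> {b \<in> carrier Y. R k \<one>\<^bsub>Y\<^esub> b}"
  then show "a \<otimes>\<^bsub>Y\<^esub> b \<in> {b \<in> carrier Y. R k \<one>\<^bsub>Y\<^esub> b}"
    using a R_mult[of "\<one>\<^bsub>Y\<^esub>" "\<one>\<^bsub>Y\<^esub>" a b k] by simp
qed auto

lemma open_contains_class: "openin T U \<Longrightarrow> \<one>\<^bsub>Y\<^esub> \<in> U \<Longrightarrow> \<exists>k. {b \<in> carrier Y. R k \<one>\<^bsub>Y\<^esub> b} \<subseteq> U"
  using openin_utop[OF subset_refl, of U] by blast

lemma profinite: "profinite_group Y T"
  unfolding profinite_group_def
  using topological_group compact Hausdorff open_contains_class class_one_subgroup openin_class[OF subset_refl]
  by meson

text \<open>An open normal subgroup contains a class of the identity, so the quotient is finite; by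
  \<open>pow\<close> its elements have p-power order, and \<open>order_prime_power\<close>
  applies.\<close>

lemma pro_p:
  assumes p: "prime p"
    and pow: "\<And>x k. x \<in> carrier Y \<Longrightarrow> \<exists>j :: nat. R k \<one>\<^bsub>Y\<^esub> (x [^]\<^bsub>Y\<^esub> (p ^ j))"
  shows "pro_p_group p Y T"
  unfolding pro_p_group_def
proof (intro conjI profinite allI impI)
  fix N assume N: "N \<lhd> Y \<and> openin T N"
  interpret N: normal N Y using N by simp
  have sub: "subgroup N Y" by (rule N.subgroup_axioms)
  obtain k where k: "{b \<in> carrier Y. R k \<one>\<^bsub>Y\<^esub> b} \<subseteq> N" using open_contains_class N N.one_closed by blast
  have eq: "N #>\<^bsub>Y\<^esub> x = N #>\<^bsub>Y\<^esub> f" if x: "x \<in> carrier Y" "f \<in> carrier Y" "R k x f" for x f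
  proof -
    have "R k (f \<otimes>\<^bsub>Y\<^esub> inv\<^bsub>Y\<^esub> f) (x \<otimes>\<^bsub>Y\<^esub> inv\<^bsub>Y\<^esub> f)"
      using x R_sym by (intro R_mult R_refl inv_closed) auto
    then have "x \<otimes>\<^bsub>Y\<^esub> inv\<^bsub>Y\<^esub> f \<in> N" using x k by auto
    then show ?thesis using x N.subset by (intro coset_mult_inv1 coset_join2[OF _ sub]) auto
  qed
  obtain F where F: "finite F" "F \<subseteq> carrier Y" "\<forall>a\<in>carrier Y. \<exists>f\<in>F. R k a f" using finite_classes by meson
  have "rcosets\<^bsub>Y\<^esub> N \<subseteq> (\<lambda>f. N #>\<^bsub>Y\<^esub> f) ` F"
  proof
    fix X assume "X \<in> rcosets\<^bsub>Y\<^esub> N"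
    then obtain x where x: "x \<in> carrier Y" "X = N #>\<^bsub>Y\<^esub> x" by (auto simp: RCOSETS_def)
    then obtain f where "f \<in> F" "R k x f" using F(3) by meson
    then show "X \<in> (\<lambda>f. N #>\<^bsub>Y\<^esub> f) ` F" using x F(2) eq[of x f] by blast
  qed
  then have fin: "finite (rcosets\<^bsub>Y\<^esub> N)" using F(1) finite_surj by blast
  have "\<exists>j. order (Y Mod N) = p ^ j"
  proof (rule order_prime_power[OF N.factorgroup_is_group _ p])
    show "finite (carrier (Y Mod N))" using fin by (simp add: FactGroup_def)
    fix X assume "X \<in> carrier (Y Mod N)"
    then obtain x where x: "x \<in> carrier Y" "X = N #>\<^bsub>Y\<^esub> x" by (auto simp: FactGroup_def RCOSETS_def)
    obtain j :: nat where "R k \<one>\<^bsub>Y\<^esub> (x [^]\<^bsub>Y\<^esub> (p ^ j))" using pow[OF x(1)] by blast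
    then have "x [^]\<^bsub>Y\<^esub> (p ^ j) \<in> N" using k x by auto
    then have "N #>\<^bsub>Y\<^esub> (x [^]\<^bsub>Y\<^esub> (p ^ j)) = N" using x by (intro coset_join2[OF _ sub]) auto
    moreover have "N #>\<^bsub>Y\<^esub> (x [^]\<^bsub>Y\<^esub> (p ^ j)) = X [^]\<^bsub>Y Mod N\<^esub> (p ^ j)"
      unfolding x(2) by (rule hom_nat_pow[OF N.r_coset_hom_Mod x(1) group_axioms N.factorgroup_is_group])
    ultimately show "\<exists>j :: nat. X [^]\<^bsub>Y Mod N\<^esub> (p ^ j) = \<one>\<^bsub>Y Mod N\<^esub>" by (auto simp: FactGroup_def)
  qed
  then show "\<exists>k. card (rcosets\<^bsub>Y\<^esub> N) = p ^ k" by (simp add: order_def FactGroup_def)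
qed

end

subsection \<open>The lower central quotients as completions\<close>

lemma r_coset_restrict: "A #>\<^bsub>G\<lparr>carrier := H\<rparr>\<^esub> a = A #>\<^bsub>G\<^esub> a"
  by (simp add: r_coset_def)

lemma finite_multisets_size:
  assumes "finite (UNIV :: 'a set)"
  shows "finite {m :: 'a multiset. size m < k}"
proof (rule finite_subset)
  show "{m :: 'a multiset. size m < k} \<subseteq> mset ` {xs. set xs \<subseteq> UNIV \<and> length xs \<le> k}"
  proof
    fix m :: "'a multiset" assume m: "m \<in> {m. size m < k}"
    obtain xs where "m = mset xs" using ex_mset by metis
    then show "m \<in> mset ` {xs. set xs \<subseteq> UNIV \<and> length xs \<le> k}" using m by auto
  qed
  show "finite (mset ` {xs :: 'a list. set xs \<subseteq> UNIV \<and> length xs \<le> k})"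
    by (intro finite_imageI finite_lists_length_le assms)
qed

lemma finite_var: "finite (UNIV :: var set)"
proof -
  have "(UNIV :: letter set) = {gen_x, gen_y}" using letter.exhaust by auto
  then have "finite (UNIV :: letter set)" by (metis finite.emptyI finite.insertI)
  then show ?thesis by (simp add: finite_prod)
qed

context prime_base
begin

abbreviation Up :: "nat \<Rightarrow> series_matrix set monoid" where
  "Up n \<equiv> Upsilon (G_hat p) (G_hat_top p) n"

lemma normal_cl:
  assumes N: "nsubgrp N"
  shows "cl N \<lhd> G_hat p"
  unfolding G.normal_inv_iff
proof (intro conjI ballI cl_subgroup nsubgrpD(1)[OF N])
  fix x h assume x: "x \<in> carrier (G_hat p)" and h: "h \<in> cl N"
  have h': "h \<in> carrier (G_hat p)" using h cl_mono[of N UNIV] by (auto simp: G_hat_simps(1))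
  have x': "x \<in> cl UNIV" using x by (simp add: G_hat_simps(1))
  have inv: "inv\<^bsub>G_hat p\<^esub> x \<in> cM" using G.inv_closed[OF x] cl_cM by (simp add: G_hat_simps(1))
  show "x \<otimes>\<^bsub>G_hat p\<^esub> h \<otimes>\<^bsub>G_hat p\<^esub> inv\<^bsub>G_hat p\<^esub> x \<in> cl N"
    unfolding cl_def G_hat_simps(2)
  proof (intro CollectI conjI allI)
    show "x \<odot> h \<odot> inv\<^bsub>G_hat p\<^esub> x \<in> cM" using M2_mult_closed inv cl_cM[OF x'] cl_cM[OF h] by simp
    fix k
    obtain a b where a: "agree k x (jg a)" and b: "b \<in> N" "agree k h (jg b)"
      using cl_approx[OF x'] cl_approx[OF h] by meson
    have "agree k (x \<odot> h \<odot> inv\<^bsub>G_hat p\<^esub> x) (jg a \<odot> jg b \<odot> jg (- a))"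
      by (intro agree_mult M2_mult_closed jg_cM cl_cM[OF x'] cl_cM[OF h] inv a b G_inv_approx x')
    moreover have "jg a \<odot> jg b \<odot> jg (- a) = jg (a + b - a)" by (simp flip: jg_add)
    ultimately show "\<exists>g\<in>N. agree k (x \<odot> h \<odot> inv\<^bsub>G_hat p\<^esub> x) (jg g)"
      using nsubgrpD(2)[OF N b(1)] by (intro bexI[of _ "a + b - a"]) simp_all
  qed
qed

lemma Upsilon_eq: "Up n = ((G_hat p)\<lparr>carrier := cl (lcs n)\<rparr>) Mod cl (lcs (Suc n))"
  by (simp only: Upsilon_def closed_lcs_cl)

lemma cl_lcs_normal: "cl (lcs (Suc n)) \<lhd> (G_hat p)\<lparr>carrier := cl (lcs n)\<rparr>"
  by (rule G.normal_restrict_supergroup[OF cl_subgroup[OF lcs_subgrp] normal_cl[OF nsubgrp_lcs] cl_mono[OF lcs_Suc_subset]])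

lemma Up_group: "group (Up n)"
  unfolding Upsilon_eq by (rule normal.factorgroup_is_group[OF cl_lcs_normal])

definition cos :: "nat \<Rightarrow> series_matrix \<Rightarrow> series_matrix set" where
  "cos n a = cl (lcs (Suc n)) #>\<^bsub>G_hat p\<^esub> a"

lemma carrier_Up: "carrier (Up n) = cos n ` cl (lcs n)"
  unfolding Upsilon_eq FactGroup_def RCOSETS_def r_coset_restrict cos_def by auto

lemma mult_Up:
  assumes "a \<in> cl (lcs n)" "b \<in> cl (lcs n)"
  shows "cos n a \<otimes>\<^bsub>Up n\<^esub> cos n b = cos n (a \<odot> b)"
proof -
  have "(cl (lcs (Suc n)) #>\<^bsub>(G_hat p)\<lparr>carrier := cl (lcs n)\<rparr>\<^esub> a) <#>\<^bsub>(G_hat p)\<lparr>carrier := cl (lcs n)\<rparr>\<^esub>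
      (cl (lcs (Suc n)) #>\<^bsub>(G_hat p)\<lparr>carrier := cl (lcs n)\<rparr>\<^esub> b) =
      cl (lcs (Suc n)) #>\<^bsub>(G_hat p)\<lparr>carrier := cl (lcs n)\<rparr>\<^esub> (a \<otimes>\<^bsub>(G_hat p)\<lparr>carrier := cl (lcs n)\<rparr>\<^esub> b)"
    by (rule normal.rcos_sum[OF cl_lcs_normal]) (use assms in simp_all)
  then show ?thesis unfolding Upsilon_eq FactGroup_def r_coset_restrict cos_def by (simp add: G_hat_simps(2))
qed

lemma cl_carrier: "a \<in> cl S \<Longrightarrow> a \<in> carrier (G_hat p)"
  using cl_mono[of S UNIV] by (auto simp: G_hat_simps(1))

lemma one_Up: "\<one>\<^bsub>Up n\<^esub> = cos n \<one>\<^bsub>M2 p\<^esub>"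
proof -
  have "cos n \<one>\<^bsub>M2 p\<^esub> = cl (lcs (Suc n))"
    unfolding cos_def G_hat_simps(3)[symmetric]
    by (rule G.coset_join2[OF G.one_closed cl_subgroup[OF lcs_subgrp] subgroup.one_closed[OF cl_subgroup[OF lcs_subgrp]]])
  then show ?thesis by (simp add: Upsilon_eq FactGroup_def)
qed

lemma cos_mem: "b \<in> cos n a \<longleftrightarrow> (\<exists>t\<in>cl (lcs (Suc n)). b = t \<odot> a)"
  by (auto simp: cos_def r_coset_def G_hat_simps(2))

lemma Up_elem:
  assumes "X \<in> carrier (Up n)" "a \<in> X"
  shows "a \<in> cl (lcs n)" "X = cos n a" "a \<in> cM"
proof -
  obtain b where b: "b \<in> cl (lcs n)" "X = cos n b" using assms(1) by (auto simp: carrier_Up)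
  obtain t where t: "t \<in> cl (lcs (Suc n))" "a = t \<odot> b" using assms(2) unfolding b(2) cos_mem by blast
  have "t \<in> cl (lcs n)" using t(1) cl_mono[OF lcs_Suc_subset] by blast
  then show a: "a \<in> cl (lcs n)" unfolding t(2) using cl_mult[OF lcs_subgrp _ b(1)] by blast
  then show "a \<in> cM" by (rule cl_cM)
  show "X = cos n a"
    unfolding b(2) cos_def
    by (rule G.repr_independence[OF _ cl_carrier[OF b(1)] cl_subgroup[OF lcs_subgrp]])
      (use assms(2) in \<open>simp add: b(2) cos_def\<close>)
qed

lemma cos_self: "a \<in> cl S \<Longrightarrow> a \<in> cos n a"
  unfolding cos_def by (rule G.rcos_self[OF cl_carrier cl_subgroup[OF lcs_subgrp]])

lemma Up_nonempty: "X \<in> carrier (Up n) \<Longrightarrow> \<exists>a. a \<in> X"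
  using cos_self by (auto simp: carrier_Up)

lemma Up_translate:
  assumes X: "X \<in> carrier (Up n)" and "a \<in> X" "b \<in> X"
  shows "\<exists>t\<in>cl (lcs (Suc n)). b = t \<odot> a"
  using assms(3) unfolding Up_elem(2)[OF X assms(2)] cos_mem .

text \<open>Cosets are close if they have close representatives. The case of equality makes the
  relation reflexive outside the carrier as well, as \<open>decreasing_equivs\<close>
  demands.\<close>

definition UR :: "nat \<Rightarrow> nat \<Rightarrow> series_matrix set \<Rightarrow> series_matrix set \<Rightarrow> bool" where
  "UR n k X Y \<longleftrightarrow> X = Y \<or> (X \<in> carrier (Up n) \<and> Y \<in> carrier (Up n) \<and> (\<exists>a\<in>X. \<exists>b\<in>Y. agree k a b))"

lemma UR_cos: "a \<in> cl (lcs n) \<Longrightarrow> b \<in> cl (lcs n) \<Longrightarrow> agree k a b \<Longrightarrow> UR n k (cos n a) (cos n b)"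
  unfolding UR_def carrier_Up using cos_self by blast

text \<open>Left translation by an element of the next term moves any representative to any other
  and preserves agreement. Transitivity of \<open>UR\<close> depends on this.\<close>

lemma UR_shift:
  assumes "X \<in> carrier (Up n)" "Y \<in> carrier (Up n)" "UR n k X Y" "a \<in> X"
  shows "\<exists>b\<in>Y. agree k a b"
proof (cases "X = Y")
  case True
  then show ?thesis using assms(4) agree.R_refl by blast
next
  case False
  then obtain a' b' where ab: "a' \<in> X" "b' \<in> Y" "agree k a' b'" using assms(3) unfolding UR_def by blast
  obtain t where t: "t \<in> cl (lcs (Suc n))" "a = t \<odot> a'" using Up_translate[OF assms(1) ab(1) assms(4)] by blast
  have "agree k (t \<odot> a') (t \<odot> b')"
    by (intro agree_mult agree.R_refl cl_cM[OF t(1)] Up_elem(3)[OF assms(1) ab(1)] Up_elem(3)[OF assms(2) ab(2)] ab(3))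
  moreover have "t \<odot> b' \<in> Y" unfolding Up_elem(2)[OF assms(2) ab(2)] cos_mem using t(1) by blast
  ultimately show ?thesis using t(2) by blast
qed

text \<open>Level \<open>k\<close> sees only finitely many coefficients, namely those of monomials
  of degree below \<open>k\<close>, and each takes finitely many values.\<close>

lemma finite_agree_classes: "\<exists>c :: series_matrix \<Rightarrow> (2 \<times> 2 \<times> var multiset \<Rightarrow> int).
  finite (c ` cM) \<and> (\<forall>a b. c a = c b \<longrightarrow> agree k a b)"
proof -
  define I where "I = (UNIV :: 2 set) \<times> (UNIV :: 2 set) \<times> {m :: var multiset. size m < k}"
  define c where "c a = (\<lambda>(i, j, m)\<in>I. a i j m k)" for a :: series_matrix
  have "finite I" unfolding I_def using finite_multisets_size[OF finite_var] by simp
  then have "finite (I \<rightarrow>\<^sub>E {0..<int p ^ k})" by (intro finite_PiE) auto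
  moreover have "c ` cM \<subseteq> I \<rightarrow>\<^sub>E {0..<int p ^ k}"
  proof (rule image_subsetI)
    fix a assume a: "a \<in> cM"
    have "a i j m k \<in> {0..<int p ^ k}" for i j m
      using coherent_bounds(1,2)[OF cM_coherent[OF a, of i j m]] by simp
    then show "c a \<in> I \<rightarrow>\<^sub>E {0..<int p ^ k}" by (simp add: c_def restrict_PiE_iff split: prod.split)
  qed
  ultimately have "finite (c ` cM)" by (rule rev_finite_subset)
  moreover have "agree k a b" if "c a = c b" for a b
    unfolding agree_def
  proof (intro allI impI)
    fix i j m assume "size (m :: var multiset) < k"
    then show "a i j m k = b i j m k" using fun_cong[OF that, of "(i, j, m)"] by (simp add: c_def I_def)
  qed
  ultimately show ?thesis by blast
qed

lemma Upsilon_filtered: "filtered_group (Up n) (UR n)"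
proof (intro filtered_group.intro Up_group decreasing_equivs.intro filtered_group_axioms.intro)
  fix k X Y Z assume "UR n k X Y" "UR n k Y Z"
  then show "UR n k X Z"
  proof (cases "X = Y \<or> Y = Z")
    case False
    with \<open>UR n k X Y\<close> \<open>UR n k Y Z\<close> obtain a b
      where c: "X \<in> carrier (Up n)" "Y \<in> carrier (Up n)" "Z \<in> carrier (Up n)" and ab: "a \<in> X" "b \<in> Y" "agree k a b"
      unfolding UR_def by blast
    obtain c where "c \<in> Z" "agree k b c" using UR_shift[OF c(2,3) \<open>UR n k Y Z\<close> ab(2)] by blast
    then show ?thesis unfolding UR_def using c ab agree.R_trans[OF ab(3)] by blast
  qed auto
next
  fix X Y k assume c: "X \<in> carrier (Up n)" "Y \<in> carrier (Up n)" and R: "UR n (Suc k) X Y"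
  obtain a where a: "a \<in> X" using Up_nonempty[OF c(1)] by blast
  obtain b where b: "b \<in> Y" "agree (Suc k) a b" using UR_shift[OF c R a] by blast
  have "agree k a b" by (rule agree.R_Suc[OF Up_elem(3)[OF c(1) a] Up_elem(3)[OF c(2) b(1)] b(2)])
  then show "UR n k X Y" unfolding UR_def using a b c by blast
next
  fix X Y X' Y' k
  assume c: "X \<in> carrier (Up n)" "Y \<in> carrier (Up n)" "X' \<in> carrier (Up n)" "Y' \<in> carrier (Up n)"
    and R: "UR n k X X'" "UR n k Y Y'"
  obtain a b where ab: "a \<in> X" "b \<in> Y" using Up_nonempty c(1,2) by meson
  obtain a' where a': "a' \<in> X'" "agree k a a'" using UR_shift[OF c(1,3) R(1) ab(1)] by blast
  obtain b' where b': "b' \<in> Y'" "agree k b b'" using UR_shift[OF c(2,4) R(2) ab(2)] by blast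
  note e = Up_elem[OF c(1) ab(1)] Up_elem[OF c(2) ab(2)] Up_elem[OF c(3) a'(1)] Up_elem[OF c(4) b'(1)]
  have "UR n k (cos n (a \<odot> b)) (cos n (a' \<odot> b'))"
    by (intro UR_cos cl_mult[OF lcs_subgrp] agree_mult e a' b')
  then show "UR n k (X \<otimes>\<^bsub>Up n\<^esub> Y) (X' \<otimes>\<^bsub>Up n\<^esub> Y')"
    by (simp only: mult_Up[OF e(1,4), folded e(2,5)] mult_Up[OF e(7,10), folded e(8,11)])
next
  fix X Y assume c: "X \<in> carrier (Up n)" "Y \<in> carrier (Up n)" and R: "\<And>k. UR n k X Y"
  obtain a b where a: "a \<in> X" and b: "b \<in> Y" using Up_nonempty c by meson
  let ?i = "inv\<^bsub>G_hat p\<^esub> b"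
  have bG: "b \<in> carrier (G_hat p)" and aG: "a \<in> carrier (G_hat p)"
    using cl_carrier Up_elem(1)[OF c(2) b] Up_elem(1)[OF c(1) a] by blast+
  have iM: "?i \<in> cM" using G.inv_closed[OF bG] cl_cM by (simp add: G_hat_simps(1))
  \<comment> \<open>Here the closedness of the next term is used: the quotient of the
    representatives is approximated by that term at every level, hence belongs to it.\<close>
  have "a \<odot> ?i \<in> cl (lcs (Suc n))"
    unfolding cl_def
  proof (intro CollectI conjI allI)
    show "a \<odot> ?i \<in> cM" by (intro M2_mult_closed iM Up_elem(3)[OF c(1) a])
    fix k
    obtain b' where b': "b' \<in> Y" "agree k a b'" using UR_shift[OF c R a] by blast
    obtain t where t: "t \<in> cl (lcs (Suc n))" "b' = t \<odot> b" using Up_translate[OF c(2) b b'(1)] by blast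
    have "agree k (a \<odot> ?i) (b' \<odot> ?i)"
      by (intro agree_mult agree.R_refl iM b'(2) Up_elem(3)[OF c(1) a] Up_elem(3)[OF c(2) b'(1)])
    moreover have "b' \<odot> ?i = t"
      using G.inv_solve_right'[of t b' b] cl_carrier[OF t(1)] bG cl_carrier[OF Up_elem(1)[OF c(2) b'(1)]] t(2)
      by (simp add: G_hat_simps(2))
    moreover obtain g where "g \<in> lcs (Suc n)" "agree k t (jg g)" using cl_approx[OF t(1)] by blast
    ultimately show "\<exists>g\<in>lcs (Suc n). agree k (a \<odot> ?i) (jg g)" using agree.R_trans by metis
  qed
  moreover have "a \<otimes>\<^bsub>G_hat p\<^esub> ?i \<otimes>\<^bsub>G_hat p\<^esub> b = a" using aG bG by (simp add: G.m_assoc)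
  then have "a = (a \<odot> ?i) \<odot> b" by (simp only: G_hat_simps(2))
  ultimately have "a \<in> Y" unfolding Up_elem(2)[OF c(2) b] cos_mem by blast
  then show "X = Y" using Up_elem(2)[OF c(1) a] Up_elem(2)[OF c(2)] by simp
next
  fix s assume s: "\<And>k. s k \<in> carrier (Up n)" "\<And>k. UR n k (s k) (s (Suc k))"
  \<comment> \<open>A coherent sequence of cosets is lifted to a coherent sequence of matrices,
    which has a limit.\<close>
  have "\<exists>a. \<forall>k. a k \<in> s k \<and> agree k (a k) (a (Suc k))"
  proof (rule dependent_nat_choice)
    show "\<exists>x. x \<in> s 0" by (rule Up_nonempty[OF s(1)])
    show "\<exists>y. y \<in> s (Suc k) \<and> agree k x y" if "x \<in> s k" for x k
      using UR_shift[OF s(1) s(1) s(2) that] by blast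
  qed
  then obtain a where a: "\<And>k. a k \<in> s k" "\<And>k. agree k (a k) (a (Suc k))" by metis
  obtain b where b: "b \<in> cM" "\<And>k. agree k b (a k)" using agree_complete[OF Up_elem(3)[OF s(1) a(1)] a(2)] by blast
  have "b \<in> cl (lcs n)"
    unfolding cl_def
  proof (intro CollectI conjI allI b(1))
    fix k
    obtain g where "g \<in> lcs n" "agree k (a k) (jg g)" using cl_approx[OF Up_elem(1)[OF s(1) a(1)]] by blast
    then show "\<exists>g\<in>lcs n. agree k b (jg g)" using agree.R_trans[OF b(2)] by blast
  qed
  then have "cos n b \<in> carrier (Up n)" "\<And>k. UR n k (cos n b) (s k)"
    using UR_cos[OF _ Up_elem(1)[OF s(1) a(1)] b(2)] Up_elem(2)[OF s(1) a(1)] by (auto simp: carrier_Up)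
  then show "\<exists>X\<in>carrier (Up n). \<forall>k. UR n k X (s k)" by blast
next
  fix k
  obtain c :: "series_matrix \<Rightarrow> (2 \<times> 2 \<times> var multiset \<Rightarrow> int)"
    where c: "finite (c ` cM)" "\<And>a b. c a = c b \<Longrightarrow> agree k a b" using finite_agree_classes by meson
  define H where "H = cl (lcs n)"
  have HM: "H \<subseteq> cM" unfolding H_def using cl_cM by blast
  define r where "r v = (SOME a. a \<in> H \<and> c a = v)" for v
  have r: "r (c a) \<in> H \<and> c (r (c a)) = c a" if "a \<in> H" for a
    unfolding r_def using someI[of "\<lambda>b. b \<in> H \<and> c b = c a" a] that by simp
  define F where "F = (\<lambda>v. cos n (r v)) ` c ` H"
  have "finite (c ` H)" by (rule finite_subset[OF image_mono[OF HM] c(1)])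
  then have "finite F" by (simp add: F_def)
  moreover have "F \<subseteq> carrier (Up n)" using r unfolding F_def carrier_Up H_def[symmetric] by blast
  moreover have "\<exists>f\<in>F. UR n k X f" if X: "X \<in> carrier (Up n)" for X
  proof -
    obtain a where a: "a \<in> H" "X = cos n a" using X unfolding carrier_Up H_def by blast
    then have "UR n k X (cos n (r (c a)))"
      using r[OF a(1)] unfolding H_def by (simp add: UR_cos c(2))
    then show ?thesis using a(1) unfolding F_def by blast
  qed
  ultimately show "\<exists>F. finite F \<and> F \<subseteq> carrier (Up n) \<and> (\<forall>a\<in>carrier (Up n). \<exists>f\<in>F. UR n k a f)" by blast
qed (auto simp: UR_def dest: agree.R_sym)

lemma Upsilon_top_utop: "Upsilon_top (G_hat p) (G_hat_top p) n = utop (UR n) (carrier (Up n))"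
proof (rule topology_eq[THEN iffD2], intro allI)
  fix U
  interpret Y: filtered_group "Up n" "UR n" by (rule Upsilon_filtered)
  let ?H = "cl (lcs n)"
  have HM: "?H \<subseteq> cM" using cl_cM by blast
  have sub: "subtopology (G_hat_top p) ?H = utop agree ?H"
    unfolding G_hat_top_utop by (rule agree.subtopology_utop[OF cl_mono]) (use cl_cM in auto)
  have sp: "topspace (utop agree ?H) = ?H" by (rule agree.topspace_utop[OF HM])
  have fold: "(\<lambda>x. cl (lcs (Suc n)) #>\<^bsub>G_hat p\<^esub> x) = cos n" by (simp add: cos_def fun_eq_iff)
  have "openin (Upsilon_top (G_hat p) (G_hat_top p) n) U \<longleftrightarrow>
      U \<subseteq> carrier (Up n) \<and> (\<forall>a\<in>{x \<in> ?H. cos n x \<in> U}. \<exists>k. \<forall>b\<in>?H. agree k a b \<longrightarrow> b \<in> {x \<in> ?H. cos n x \<in> U})"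
    unfolding Upsilon_top_def closed_lcs_cl openin_quotient_topology sub sp fold agree.openin_utop[OF HM] carrier_Up
    by auto
  also have "\<dots> \<longleftrightarrow> U \<subseteq> carrier (Up n) \<and> (\<forall>X\<in>U. \<exists>k. \<forall>Y\<in>carrier (Up n). UR n k X Y \<longrightarrow> Y \<in> U)"
  proof (intro conj_cong refl iffI ballI)
    fix X assume U: "U \<subseteq> carrier (Up n)" and X: "X \<in> U"
      and *: "\<forall>a\<in>{x \<in> ?H. cos n x \<in> U}. \<exists>k. \<forall>b\<in>?H. agree k a b \<longrightarrow> b \<in> {x \<in> ?H. cos n x \<in> U}"
    have XC: "X \<in> carrier (Up n)" using U X by blast
    then obtain a where a: "a \<in> X" using Up_nonempty by blast
    note e = Up_elem[OF XC a]
    obtain k where k: "\<forall>b\<in>?H. agree k a b \<longrightarrow> b \<in> {x \<in> ?H. cos n x \<in> U}" using * e X by auto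
    have "Y \<in> U" if Y: "Y \<in> carrier (Up n)" "UR n k X Y" for Y
    proof -
      obtain b where b: "b \<in> Y" "agree k a b" using UR_shift[OF XC Y a] by blast
      then show ?thesis using k Up_elem(1,2)[OF Y(1) b(1)] by simp
    qed
    then show "\<exists>k. \<forall>Y\<in>carrier (Up n). UR n k X Y \<longrightarrow> Y \<in> U" by blast
  next
    fix a assume *: "\<forall>X\<in>U. \<exists>k. \<forall>Y\<in>carrier (Up n). UR n k X Y \<longrightarrow> Y \<in> U" and a: "a \<in> {x \<in> ?H. cos n x \<in> U}"
    then obtain k where k: "\<forall>Y\<in>carrier (Up n). UR n k (cos n a) Y \<longrightarrow> Y \<in> U" by blast
    have "b \<in> {x \<in> ?H. cos n x \<in> U}" if b: "b \<in> ?H" "agree k a b" for b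
      using k a b UR_cos[of a n b k] by (auto simp: carrier_Up)
    then show "\<exists>k. \<forall>b\<in>?H. agree k a b \<longrightarrow> b \<in> {x \<in> ?H. cos n x \<in> U}" by blast
  qed
  also have "\<dots> \<longleftrightarrow> openin (utop (UR n) (carrier (Up n))) U" by (rule Y.openin_utop[OF subset_refl, symmetric])
  finally show "openin (Upsilon_top (G_hat p) (G_hat_top p) n) U \<longleftrightarrow> openin (utop (UR n) (carrier (Up n))) U" .
qed

section \<open>The discrete group in the quotients\<close>

definition cls :: "nat \<Rightarrow> gam \<Rightarrow> series_matrix set" where
  "cls n g = cos n (jg g)"

lemma cls_closed: "g \<in> lcs n \<Longrightarrow> cls n g \<in> carrier (Up n)"
  by (simp add: cls_def carrier_Up jg_cl)

lemma cls_add: "g \<in> lcs n \<Longrightarrow> h \<in> lcs n \<Longrightarrow> cls n (g + h) = cls n g \<otimes>\<^bsub>Up n\<^esub> cls n h"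
  by (simp add: cls_def mult_Up jg_cl jg_add)

lemma cls_0: "cls n 0 = \<one>\<^bsub>Up n\<^esub>"
  by (simp add: cls_def one_Up jg_0)

lemma cls_nmul:
  assumes "g \<in> lcs n"
  shows "cls n (nmul m g) = cls n g [^]\<^bsub>Up n\<^esub> m"
proof -
  interpret Y: group "Up n" by (rule Up_group)
  show ?thesis
  proof (induction m)
    case (Suc m)
    have "cls n (nmul (Suc m) g) = cls n (nmul m g + g)" by (simp add: nmul_commute)
    also have "\<dots> = cls n (nmul m g) \<otimes>\<^bsub>Up n\<^esub> cls n g"
      by (rule cls_add[OF nmul_in[OF lcs_subgrp assms] assms])
    finally show ?case by (simp add: Suc)
  qed (simp add: cls_0)
qed

text \<open>Identifies the topological quotient as the completion of \<open>lcs n\<close> modulo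
  \<open>lcs (Suc n)\<close> for the filtration by \<open>lcsV p k\<close>; together with
  \<open>cls_dense\<close> this reduces all questions to the discrete group.\<close>

lemma UR_cls:
  assumes "g \<in> lcs n" "h \<in> lcs n"
  shows "UR n k (cls n g) (cls n h) \<longleftrightarrow> g - h \<in> lcsV p k (Suc n)"
proof
  assume R: "UR n k (cls n g) (cls n h)"
  have "jg g \<in> cls n g" unfolding cls_def by (rule cos_self[OF jg_cl[OF assms(1)]])
  then obtain b where b: "b \<in> cls n h" "agree k (jg g) b"
    using UR_shift[OF cls_closed[OF assms(1)] cls_closed[OF assms(2)] R] by blast
  then obtain t where t: "t \<in> cl (lcs (Suc n))" "b = t \<odot> jg h" unfolding cls_def cos_mem by blast
  obtain t' where t': "t' \<in> lcs (Suc n)" "agree k t (jg t')" using cl_approx[OF t(1)] by blast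
  have "agree k b (jg (t' + h))"
    unfolding t(2) jg_add by (intro agree_mult agree.R_refl t' jg_cM cl_cM[OF t(1)])
  then have "agree k (jg g) (jg (t' + h))" by (rule agree.R_trans[OF b(2)])
  then have "g - (t' + h) \<in> lcsV p k (Suc n)" unfolding agree_jg by (rule V_D)
  from D.D_group(2)[OF this lcs_D[OF t'(1)]] have "g - (t' + h) + t' \<in> lcsV p k (Suc n)" .
  moreover have "g - (t' + h) + t' = g - h" by (simp only: diff_add_eq_diff_diff_swap diff_add_cancel)
  ultimately show "g - h \<in> lcsV p k (Suc n)" by (simp only:)
next
  assume "g - h \<in> lcsV p k (Suc n)"
  then obtain t v where t: "t \<in> lcs (Suc n)" and v: "v \<in> adicV p k" and gh: "g - h = t + v"
    unfolding lcsV_def by blast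
  have "g = t + v + h" using gh by (metis diff_add_cancel)
  then have "g - (t + h) = t + v - t" by (simp only: diff_add_eq_diff_diff_swap add_diff_cancel)
  then have A: "agree k (jg g) (jg (t + h))" unfolding agree_jg using nsubgrpD(2)[OF nsubgrp_V v] by simp
  have B: "jg (t + h) \<in> cls n h" unfolding cls_def cos_mem jg_add using jg_cl[OF t] by blast
  have C: "jg g \<in> cls n g" unfolding cls_def by (rule cos_self[OF jg_cl[OF assms(1)]])
  show "UR n k (cls n g) (cls n h)"
    unfolding UR_def by (intro disjI2 conjI cls_closed assms, rule bexI[OF _ C], rule bexI[OF _ B], rule A)
qed

lemma cls_dense:
  assumes X: "X \<in> carrier (Up n)"
  shows "\<exists>g\<in>lcs n. UR n k X (cls n g)"
proof -
  obtain a where a: "a \<in> X" using Up_nonempty[OF X] by blast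
  note e = Up_elem[OF X a]
  obtain g where g: "g \<in> lcs n" "agree k a (jg g)" using cl_approx[OF e(1)] by blast
  then have "UR n k X (cls n g)" unfolding e(2) cls_def using UR_cos[OF e(1) jg_cl] by blast
  with g show ?thesis by blast
qed

end

subsection \<open>Coordinates on the lower central quotients\<close>

context prime_base
begin

text \<open>Coordinates are read off from approximations: the m-th residue of a coordinate is that
  of any combination close enough to the element. The list is first reindexed by 0, ..., d - 1 to
  match \<open>padic_power\<close>.\<close>

lemma graded_iso:
  fixes e :: "'i \<Rightarrow> gam" and n :: nat
  assumes gb: "graded_basis p n e is" and n: "1 \<le> n" and d: "length is = d"
  shows "top_group_iso (Up n) (Upsilon_top (G_hat p) (G_hat_top p) n) (padic_power p d) (padic_power_top p d)"
proof -
  interpret Y: filtered_group "Up n" "UR n" by (rule Upsilon_filtered)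
  define \<epsilon> where "\<epsilon> i = e (is ! i)" for i
  define L where "L \<mu> = lin \<epsilon> \<mu> [0..<d]" for \<mu>
  have dist: "distinct is" and mem: "\<And>i. i \<in> set is \<Longrightarrow> e i \<in> lcs n"
    and span: "\<And>k g. g \<in> lcs n \<Longrightarrow> \<exists>\<mu>. g - lin e \<mu> is \<in> lcsV p k (Suc n)"
    and indep: "\<And>m. \<exists>k. \<forall>\<mu> \<mu>'. lin e \<mu> is - lin e \<mu>' is \<in> lcsV p k (Suc n) \<longrightarrow>
        (\<forall>i\<in>set is. int p ^ m dvd int (\<mu> i) - int (\<mu>' i))"
    using gb unfolding graded_basis_def by auto
  have eL: "\<epsilon> i \<in> lcs n" if "i \<in> set [0..<d]" for i using mem that d by (simp add: \<epsilon>_def)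
  have L_lcs: "L \<mu> \<in> lcs n" for \<mu> unfolding L_def by (rule lin_in[OF lcs_subgrp eL])
  have map_is: "map ((!) is) [0..<d] = is" unfolding d[symmetric] by (rule map_nth)
  have L_lin: "lin e \<mu> is = L (\<mu> \<circ> (!) is)" for \<mu>
    using lin_map[of e \<mu> "(!) is" "[0..<d]"] unfolding map_is by (simp add: L_def \<epsilon>_def[abs_def] comp_def)
  have L_cong: "L \<mu> = L \<mu>'" if "\<And>i. i < d \<Longrightarrow> \<mu> i = \<mu>' i" for \<mu> \<mu>'
    unfolding L_def lin_def by (rule arg_cong[of _ _ sum_list], rule map_cong[OF refl]) (simp add: that)
  have "\<exists>k. \<forall>\<mu> \<mu>'. L \<mu> - L \<mu>' \<in> lcsV p k (Suc n) \<longrightarrow> (\<forall>i<d. int p ^ m dvd int (\<mu> i) - int (\<mu>' i))" for m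
  proof -
    obtain k where k: "\<And>\<mu> \<mu>' i. lin e \<mu> is - lin e \<mu>' is \<in> lcsV p k (Suc n) \<Longrightarrow> i \<in> set is \<Longrightarrow>
        int p ^ m dvd int (\<mu> i) - int (\<mu>' i)" using indep[of m] by meson
    define r where "r = inv_into {..<d} ((!) is)"
    have r: "r (is ! i) = i" if "i < d" for i
      unfolding r_def using inj_on_nth[OF dist, of "{..<d}"] that d by (intro inv_into_f_f) auto
    have "int p ^ m dvd int (\<mu> i) - int (\<mu>' i)" if D: "L \<mu> - L \<mu>' \<in> lcsV p k (Suc n)" and i: "i < d" for \<mu> \<mu>' i
    proof -
      have "lin e (\<mu> \<circ> r) is = L \<mu>" "lin e (\<mu>' \<circ> r) is = L \<mu>'"
        unfolding L_lin by (rule L_cong, simp add: r)+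
      then show ?thesis using k[of "\<mu> \<circ> r" "\<mu>' \<circ> r" "is ! i"] D r[OF i] i d by simp
    qed
    then show ?thesis by (intro exI[of _ k] allI impI)
  qed
  \<comment> \<open>\<open>\<kappa> m\<close> is a level at which the coefficients are determined
    modulo p^m.\<close>
  then obtain \<kappa> where \<kappa>: "\<And>m \<mu> \<mu>' i. L \<mu> - L \<mu>' \<in> lcsV p (\<kappa> m) (Suc n) \<Longrightarrow> i < d \<Longrightarrow>
      int p ^ m dvd int (\<mu> i) - int (\<mu>' i)" by metis
  have C: "cls n (L \<mu>) \<in> carrier (Up n)" for \<mu> by (rule cls_closed[OF L_lcs])
  have ex: "\<exists>\<mu>. UR n k X (cls n (L \<mu>))" if X: "X \<in> carrier (Up n)" for X k
  proof -
    obtain g where g: "g \<in> lcs n" "UR n k X (cls n g)" using cls_dense[OF X] by blast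
    obtain \<mu> where "g - lin e \<mu> is \<in> lcsV p k (Suc n)" using span[OF g(1)] by blast
    then have "UR n k (cls n g) (cls n (L (\<mu> \<circ> (!) is)))" unfolding UR_cls[OF g(1) L_lcs] L_lin .
    then show ?thesis using Y.R_trans[OF g(2)] by blast
  qed
  define crd where "crd X k = (SOME \<mu>. UR n k X (cls n (L \<mu>)))" for X k
  have crd: "UR n k X (cls n (L (crd X k)))" if "X \<in> carrier (Up n)" for X k
    unfolding crd_def by (rule someI_ex[OF ex[OF that]])
  define \<psi> where "\<psi> X = (\<lambda>i\<in>{..<d}. \<lambda>m. int (crd X (\<kappa> m) i) mod int p ^ m)" for X
  have key: "\<psi> X i m = int (\<mu> i) mod int p ^ m"
    if X: "X \<in> carrier (Up n)" and k: "\<kappa> m \<le> k" "UR n k X (cls n (L \<mu>))" and i: "i < d" for X i m \<mu> k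
  proof -
    have "UR n (\<kappa> m) X (cls n (L \<mu>))" by (rule Y.R_le[OF k(2,1) X C])
    then have "UR n (\<kappa> m) (cls n (L (crd X (\<kappa> m)))) (cls n (L \<mu>))"
      by (rule Y.R_trans[OF Y.R_sym[OF crd[OF X]]])
    then have "L (crd X (\<kappa> m)) - L \<mu> \<in> lcsV p (\<kappa> m) (Suc n)" unfolding UR_cls[OF L_lcs L_lcs] .
    from \<kappa>[OF this i] show ?thesis using i by (simp add: \<psi>_def mod_eq_dvd_iff)
  qed
  have \<psi>_Zc: "\<psi> X i \<in> Zc" if X: "X \<in> carrier (Up n)" and i: "i < d" for X i
  proof -
    have "\<psi> X i (Suc m) mod int p ^ m = \<psi> X i m mod int p ^ m" for m
    proof -
      define k where "k = max (\<kappa> m) (\<kappa> (Suc m))"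
      obtain \<mu> where \<mu>: "UR n k X (cls n (L \<mu>))" using ex[OF X] by blast
      have "\<psi> X i m = int (\<mu> i) mod int p ^ m" "\<psi> X i (Suc m) = int (\<mu> i) mod int p ^ Suc m"
        by (rule key[OF X _ \<mu> i], simp add: k_def)+
      then show ?thesis by (simp add: mod_mod_cancel)
    qed
    then have "coherent p (\<lambda>m. \<psi> X i m mod int p ^ m)" by (rule coherentI[OF p_pos])
    moreover have "(\<lambda>m. \<psi> X i m mod int p ^ m) = \<psi> X i" using i by (simp add: \<psi>_def)
    ultimately show ?thesis by (simp add: Zc_def)
  qed
  have \<psi>_cong: "\<psi> X i m = \<psi> X' i m"
    if X: "X \<in> carrier (Up n)" "X' \<in> carrier (Up n)" and R: "UR n (\<kappa> m) X X'" and i: "i < d" for X X' i m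
  proof -
    obtain \<mu> where \<mu>: "UR n (\<kappa> m) X' (cls n (L \<mu>))" using ex[OF X(2)] by blast
    show ?thesis using key[OF X(1) order_refl Y.R_trans[OF R \<mu>] i] key[OF X(2) order_refl \<mu> i] by simp
  qed
  have \<psi>_carrier: "\<psi> X \<in> (\<Pi>\<^sub>E i\<in>{..<d}. Zc)" if "X \<in> carrier (Up n)" for X
    using \<psi>_Zc[OF that] by (auto simp: \<psi>_def)
  have carr: "carrier (padic_power p d) = (\<Pi>\<^sub>E i\<in>{..<d}. Zc)" by (simp add: padic_power_def carrier_Zc)
  have hom: "\<psi> (X \<otimes>\<^bsub>Up n\<^esub> X') = \<psi> X \<otimes>\<^bsub>padic_power p d\<^esub> \<psi> X'"
    if X: "X \<in> carrier (Up n)" "X' \<in> carrier (Up n)" for X X'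
  proof -
    have "\<psi> (X \<otimes>\<^bsub>Up n\<^esub> X') i m = (\<psi> X i m + \<psi> X' i m) mod int p ^ m" if i: "i < d" for i m
    proof -
      let ?k = "\<kappa> m"
      obtain \<mu> \<nu> where \<mu>: "UR n ?k X (cls n (L \<mu>))" and \<nu>: "UR n ?k X' (cls n (L \<nu>))" using ex X by meson
      define \<tau> where "\<tau> i = \<mu> i + \<nu> i" for i
      have 1: "UR n ?k (X \<otimes>\<^bsub>Up n\<^esub> X') (cls n (L \<mu> + L \<nu>))"
        unfolding cls_add[OF L_lcs L_lcs] by (intro Y.R_mult X C \<mu> \<nu>)
      have "D.eqv p ?k (Suc n) (L \<tau>) (L \<mu> + L \<nu>)"
        unfolding L_def \<tau>_def by (rule D.lin_add) (use n eL lcs_D in auto)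
      then have "UR n ?k (cls n (L \<tau>)) (cls n (L \<mu> + L \<nu>))"
        unfolding D.eqv_def UR_cls[OF L_lcs subgrpD(2)[OF lcs_subgrp L_lcs L_lcs]] .
      then have "UR n ?k (cls n (L \<mu> + L \<nu>)) (cls n (L \<tau>))" by (rule Y.R_sym)
      from Y.R_trans[OF 1 this] have "\<psi> (X \<otimes>\<^bsub>Up n\<^esub> X') i m = int (\<tau> i) mod int p ^ m"
        by (rule key[OF Y.m_closed[OF X] order_refl _ i])
      then show ?thesis using key[OF X(1) order_refl \<mu> i] key[OF X(2) order_refl \<nu> i]
        by (simp add: \<tau>_def mod_add_eq)
    qed
    note sum = this
    have "\<psi> (X \<otimes>\<^bsub>Up n\<^esub> X') = (\<lambda>i\<in>{..<d}. \<lambda>m. (\<psi> X i m + \<psi> X' i m) mod int p ^ m)"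
    proof (rule extensionalityI[of _ "{..<d}"])
      show "\<psi> (X \<otimes>\<^bsub>Up n\<^esub> X') \<in> extensional {..<d}" by (simp add: \<psi>_def)
      fix i assume "i \<in> {..<d}"
      then show "\<psi> (X \<otimes>\<^bsub>Up n\<^esub> X') i = (\<lambda>i\<in>{..<d}. \<lambda>m. (\<psi> X i m + \<psi> X' i m) mod int p ^ m) i"
        using sum by (simp add: fun_eq_iff)
    qed simp
    then show ?thesis by (simp add: padic_power_def padic_int_def)
  qed
  have inj: "X = X'" if X: "X \<in> carrier (Up n)" "X' \<in> carrier (Up n)" and eq: "\<psi> X = \<psi> X'" for X X'
  proof (rule Y.separated[OF X])
    fix k
    \<comment> \<open>At level \<open>\<kappa> (k * k)\<close> equal coordinates force congruence of
      the coefficients modulo p^(k*k), which by \<open>lin_cong_V\<close> is what level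
      \<open>k\<close> requires.\<close>
    define K where "K = max k (\<kappa> (k * k))"
    obtain \<mu> \<nu> where \<mu>: "UR n K X (cls n (L \<mu>))" and \<nu>: "UR n K X' (cls n (L \<nu>))" using ex X by meson
    have "int p ^ (k * k) dvd int (\<mu> i) - int (\<nu> i)" if i: "i \<in> set [0..<d]" for i
    proof -
      have K: "\<kappa> (k * k) \<le> K" by (simp add: K_def)
      have "i < d" using i by simp
      then show ?thesis
        unfolding mod_eq_dvd_iff[symmetric] using key[OF X(1) K \<mu>, of i] key[OF X(2) K \<nu>, of i] eq by simp
    qed
    then have "L \<mu> - L \<nu> \<in> adicV p k" unfolding L_def by (rule lin_cong_V)
    then have 1: "UR n k (cls n (L \<mu>)) (cls n (L \<nu>))" unfolding UR_cls[OF L_lcs L_lcs] by (rule V_D)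
    have "UR n k X (cls n (L \<mu>))" "UR n k X' (cls n (L \<nu>))"
      using Y.R_le[OF \<mu> _ X(1) C] Y.R_le[OF \<nu> _ X(2) C] by (simp_all add: K_def)
    then show "UR n k X X'" using Y.R_trans[OF _ Y.R_trans[OF 1 Y.R_sym]] by blast
  qed
  have surj: "\<exists>X\<in>carrier (Up n). \<psi> X = c" if c: "c \<in> (\<Pi>\<^sub>E i\<in>{..<d}. Zc)" for c
  proof -
    have coh: "coherent p (c i)" if "i < d" for i using c that by (auto simp: Zc_def)
    \<comment> \<open>Residues modulo p^(k*k), so that consecutive combinations agree at level
      \<open>k\<close> and converge.\<close>
    define \<mu> where "\<mu> k i = nat (c i (k * k))" for k i
    have \<mu>: "int (\<mu> k i) = c i (k * k)" if "i < d" for k i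
      using coherent_bounds(1)[OF coh[OF that]] by (simp add: \<mu>_def)
    have step: "UR n k (cls n (L (\<mu> k))) (cls n (L (\<mu> (Suc k))))" for k
    proof -
      have "int p ^ (k * k) dvd int (\<mu> k i) - int (\<mu> (Suc k) i)" if "i \<in> set [0..<d]" for i
      proof -
        have i: "i < d" using that by simp
        have "c i (Suc k * Suc k) mod int p ^ (k * k) = c i (k * k)"
          by (rule coherent_mod[OF coh[OF i]]) (simp add: mult_le_mono)
        then have "c i (k * k) mod int p ^ (k * k) = c i (Suc k * Suc k) mod int p ^ (k * k)"
          using coherent_bounds(3)[OF coh[OF i], of "k * k"] by simp
        then show ?thesis unfolding \<mu>[OF i] by (simp only: mod_eq_dvd_iff)
      qed
      then have "L (\<mu> k) - L (\<mu> (Suc k)) \<in> adicV p k" unfolding L_def by (rule lin_cong_V)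
      then show ?thesis unfolding UR_cls[OF L_lcs L_lcs] by (rule V_D)
    qed
    obtain X where X: "X \<in> carrier (Up n)" "\<And>k. UR n k X (cls n (L (\<mu> k)))"
      using Y.complete[of "\<lambda>k. cls n (L (\<mu> k))", OF C step] by blast
    have "\<psi> X i m = c i m" if i: "i < d" for i m
    proof -
      define k where "k = max m (\<kappa> m)"
      have "m \<le> k * k" by (metis k_def max.cobounded1 le_square le_trans)
      then show ?thesis
        using key[OF X(1) _ X(2) i, of m k] coherent_mod[OF coh[OF i], of m "k * k"] by (simp add: \<mu>[OF i] k_def)
    qed
    then have "\<psi> X i = c i" if "i \<in> {..<d}" for i using that by (intro ext) simp
    moreover have "\<psi> X \<in> extensional {..<d}" by (simp add: \<psi>_def)
    moreover have "c \<in> extensional {..<d}" using c by (simp add: PiE_iff)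
    ultimately have "\<psi> X = c" by (metis extensionalityI)
    then show ?thesis using X(1) by blast
  qed
  have image: "\<psi> ` carrier (Up n) = (\<Pi>\<^sub>E i\<in>{..<d}. Zc)"
    using \<psi>_carrier surj by blast
  have inj_on: "inj_on \<psi> (carrier (Up n))" using inj by (intro inj_onI)
  have iso: "\<psi> \<in> iso (Up n) (padic_power p d)"
    unfolding iso_def hom_def bij_betw_def carr using image inj_on hom \<psi>_carrier by auto
  have sp: "topspace Y.T = carrier (Up n)" by (rule Y.topspace_utop[OF subset_refl])
  have "continuous_map Y.T (padic_power_top p d) \<psi>"
    unfolding padic_power_top_def continuous_map_componentwise sp
  proof (intro conjI ballI)
    show "\<psi> ` carrier (Up n) \<subseteq> extensional {..<d}" by (auto simp: \<psi>_def)
    fix i assume "i \<in> {..<d}"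
    then have i: "i < d" by simp
    show "continuous_map Y.T (padic_top p) (\<lambda>X. \<psi> X i)"
      unfolding continuous_map_def padic_top_utop sp zeq.topspace_utop[OF subset_refl]
    proof (intro conjI allI impI)
      fix U assume U: "openin (utop zeq Zc) U"
      show "openin Y.T {X \<in> carrier (Up n). \<psi> X i \<in> U}"
        unfolding Y.openin_utop[OF subset_refl]
      proof (intro conjI ballI)
        fix X assume "X \<in> {X \<in> carrier (Up n). \<psi> X i \<in> U}"
        then have X: "X \<in> carrier (Up n)" "\<psi> X i \<in> U" by auto
        obtain m where m: "\<forall>b\<in>Zc. zeq m (\<psi> X i) b \<longrightarrow> b \<in> U"
          using U X(2) unfolding zeq.openin_utop[OF subset_refl] by meson
        have "X' \<in> {X \<in> carrier (Up n). \<psi> X i \<in> U}" if "X' \<in> carrier (Up n)" "UR n (\<kappa> m) X X'" for X'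
          using m \<psi>_Zc[OF that(1) i] \<psi>_cong[OF X(1) that i] that(1) by simp
        then show "\<exists>k. \<forall>X'\<in>carrier (Up n). UR n k X X' \<longrightarrow> X' \<in> {X \<in> carrier (Up n). \<psi> X i \<in> U}" by blast
      qed auto
    qed (use \<psi>_Zc[OF _ i] in auto)
  qed
  moreover have "Hausdorff_space (padic_power_top p d)"
    unfolding padic_power_top_def Hausdorff_space_product_topology using Hausdorff_padic by blast
  moreover have "topspace (padic_power_top p d) = (\<Pi>\<^sub>E i\<in>{..<d}. Zc)"
    by (simp add: padic_power_top_def padic_top_utop zeq.topspace_utop)
  \<comment> \<open>A continuous bijection from a compact space onto a Hausdorff space, so that
    continuity of the inverse is free.\<close>
  ultimately have "homeomorphic_map Y.T (padic_power_top p d) \<psi>"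
    using Y.compact image inj_on by (intro continuous_imp_homeomorphic_map) (simp_all add: sp)
  then show ?thesis unfolding top_group_iso_def Upsilon_top_utop using iso by blast
qed

lemma comm_group_Up: "comm_group (Up n)"
proof -
  interpret Y: filtered_group "Up n" "UR n" by (rule Upsilon_filtered)
  show ?thesis
  proof (rule Y.group_comm_groupI)
    fix X X' assume X: "X \<in> carrier (Up n)" "X' \<in> carrier (Up n)"
    show "X \<otimes>\<^bsub>Up n\<^esub> X' = X' \<otimes>\<^bsub>Up n\<^esub> X"
    proof (rule Y.separated)
      fix k
      obtain g h where g: "g \<in> lcs n" "UR n k X (cls n g)" and h: "h \<in> lcs n" "UR n k X' (cls n h)"
        using cls_dense X by meson
      have gh: "g + h \<in> lcs n" "h + g \<in> lcs n" using subgrpD(2)[OF lcs_subgrp] g h by auto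
      have "(g + h) - (h + g) = comm g h" by (simp only: comm_def diff_add_eq_diff_diff_swap)
      then have "UR n k (cls n (g + h)) (cls n (h + g))"
        unfolding UR_cls[OF gh] using lcs_D[OF comm_lcs_right[OF g(1)]] by simp
      moreover have "UR n k (X \<otimes>\<^bsub>Up n\<^esub> X') (cls n (g + h))" "UR n k (X' \<otimes>\<^bsub>Up n\<^esub> X) (cls n (h + g))"
        unfolding cls_add[OF g(1) h(1)] cls_add[OF h(1) g(1)] by (intro Y.R_mult X cls_closed g h)+
      ultimately show "UR n k (X \<otimes>\<^bsub>Up n\<^esub> X') (X' \<otimes>\<^bsub>Up n\<^esub> X)" using Y.R_trans Y.R_sym by meson
    qed (use X in auto)
  qed
qed

lemma pro_p_Up: "pro_p_group p (Up n) (Upsilon_top (G_hat p) (G_hat_top p) n)"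
proof -
  interpret Y: filtered_group "Up n" "UR n" by (rule Upsilon_filtered)
  show ?thesis
    unfolding Upsilon_top_utop
  proof (rule Y.pro_p[OF prime_p])
    fix X k assume X: "X \<in> carrier (Up n)"
    let ?N = "p ^ (k * k)"
    obtain g where g: "g \<in> lcs n" "UR n k X (cls n g)" using cls_dense[OF X] by blast
    have "UR n k (X [^]\<^bsub>Up n\<^esub> ?N) (cls n (nmul ?N g))"
      unfolding cls_nmul[OF g(1)] by (rule Y.R_pow[OF X cls_closed[OF g(1)] g(2)])
    moreover have "nmul ?N g - 0 \<in> lcsV p k (Suc n)" using V_D[OF nmul_V] by simp
    then have "UR n k (cls n (nmul ?N g)) \<one>\<^bsub>Up n\<^esub>"
      unfolding cls_0[symmetric] UR_cls[OF nmul_in[OF lcs_subgrp g(1)] subgrpD(1)[OF lcs_subgrp]] .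
    ultimately have "UR n k \<one>\<^bsub>Up n\<^esub> (X [^]\<^bsub>Up n\<^esub> ?N)" using Y.R_trans Y.R_sym by meson
    then show "\<exists>j :: nat. UR n k \<one>\<^bsub>Up n\<^esub> (X [^]\<^bsub>Up n\<^esub> (p ^ j))" by blast
  qed
qed

end

text \<open>Modulo squares the group is a vector space over the field with two elements, in which
  the subset sums of a generating set exhaust the span.\<close>

lemma (in comm_group) generate_mod_squares:
  assumes S: "finite S" "S \<subseteq> carrier G" and z: "z \<in> generate G S"
  shows "\<exists>T\<subseteq>S. \<exists>w\<in>carrier G. z = finprod G (\<lambda>x. x) T \<otimes> (w \<otimes> w)"
  using z
proof induction
  case one
  then show ?case by (intro exI[of _ "{}"]) (auto intro!: bexI[of _ \<one>])
next
  case (incl h)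
  then show ?case using S by (intro exI[of _ "{h}"]) (auto intro!: bexI[of _ \<one>])
next
  case (inv h)
  have h: "h \<in> carrier G" using inv S by blast
  then have "inv h = h \<otimes> (inv h \<otimes> inv h)" by (simp add: m_assoc[symmetric])
  then show ?case using h inv by (intro exI[of _ "{h}"]) (auto intro!: bexI[of _ "inv h"])
next
  case (eng y z)
  then obtain A u B v where A: "A \<subseteq> S" "u \<in> carrier G" "y = finprod G (\<lambda>x. x) A \<otimes> (u \<otimes> u)"
    and B: "B \<subseteq> S" "v \<in> carrier G" "z = finprod G (\<lambda>x. x) B \<otimes> (v \<otimes> v)" by meson
  define P where "P T = finprod G (\<lambda>x. x) T" for T
  have P_closed: "P T \<in> carrier G" if "T \<subseteq> S" for T
    unfolding P_def using that S by (intro finprod_closed) auto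
  have P_Un: "P (T \<union> T') = P T \<otimes> P T'" if "T \<subseteq> S" "T' \<subseteq> S" "T \<inter> T' = {}" for T T'
    unfolding P_def using that S finite_subset[OF _ S(1)] by (intro finprod_Un_disjoint) auto
  have sub: "A - B \<subseteq> S" "B - A \<subseteq> S" "A \<inter> B \<subseteq> S" using A B by auto
  have "A = (A - B) \<union> (A \<inter> B)" "B = (B - A) \<union> (A \<inter> B)" by auto
  then have PA: "P A = P (A - B) \<otimes> P (A \<inter> B)" and PB: "P B = P (B - A) \<otimes> P (A \<inter> B)"
    using P_Un[OF sub(1,3)] P_Un[OF sub(2,3)] by (metis Diff_disjoint Int_Diff Int_commute inf_le1 Int_empty_right inf_assoc)+
  have PC: "P ((A - B) \<union> (B - A)) = P (A - B) \<otimes> P (B - A)" by (rule P_Un[OF sub(1,2)]) auto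
  \<comment> \<open>The common factors occur twice and go into the square, leaving the symmetric
    difference.\<close>
  define w where "w = P (A \<inter> B) \<otimes> u \<otimes> v"
  have "y \<otimes> z = P ((A - B) \<union> (B - A)) \<otimes> (w \<otimes> w)"
    unfolding A(3) B(3) P_def[symmetric] PA PB PC w_def
    using P_closed[OF sub(1)] P_closed[OF sub(2)] P_closed[OF sub(3)] A(2) B(2) by (simp add: m_ac)
  moreover have "w \<in> carrier G" using P_closed[OF sub(3)] A(2) B(2) by (simp add: w_def)
  ultimately show ?case unfolding P_def using sub by (intro exI[of _ "(A - B) \<union> (B - A)"]) auto
qed

context prime_base
begin

text \<open>A counting argument that needs no quotient modulo squares: each subset of the nine
  elements is matched, up to level \<open>k\<close> and a square, with a subset of \<open>S\<close>.
  If two subsets get the same partner, their product is a square at level \<open>k\<close>, so by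
  \<open>independence_mod_squares\<close> they coincide; hence 2^9 is at most 2^(card S).\<close>

lemma min_generators_6:
  assumes p2: "p = 2"
  shows "enat 9 \<le> min_generators (Up 6) (Upsilon_top (G_hat p) (G_hat_top p) 6)"
  unfolding min_generators_def
proof (rule INF_greatest)
  interpret Y: filtered_group "Up 6" "UR 6" by (rule Upsilon_filtered)
  interpret C: comm_group "Up 6" by (rule comm_group_Up)
  fix S assume "S \<in> {S. finite S \<and> topologically_generates (Up 6) (Upsilon_top (G_hat p) (G_hat_top p) 6) S}"
  then have S: "finite S" "S \<subseteq> carrier (Up 6)" and gen: "Y.T closure_of generate (Up 6) S = carrier (Up 6)"
    by (auto simp: topologically_generates_def Upsilon_top_utop)
  obtain k where k: "\<And>\<mu> s i. s \<in> lcs 6 \<Longrightarrow> lin e6 \<mu> ind6 - (s + s) \<in> lcsV p k 7 \<Longrightarrow> i \<in> set ind6 \<Longrightarrow> even (\<mu> i)"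
    using independence_mod_squares p2 by meson
  define ind :: "(bool \<times> nat \<times> nat \<times> nat) set \<Rightarrow> bool \<times> nat \<times> nat \<times> nat \<Rightarrow> nat"
    where "ind A i = (if i \<in> A then 1 else 0)" for A i
  define L where "L A = lin e6 (ind A) ind6" for A
  have lin_lcs: "lin e6 \<mu> ind6 \<in> lcs 6" for \<mu> by (rule lin_in[OF lcs_subgrp e6_lcs])
  have C: "cls 6 (L A) \<in> carrier (Up 6)" for A unfolding L_def by (rule cls_closed[OF lin_lcs])
  have "\<exists>T\<subseteq>S. \<exists>w\<in>carrier (Up 6). UR 6 k (cls 6 (L A)) (finprod (Up 6) (\<lambda>x. x) T \<otimes>\<^bsub>Up 6\<^esub> (w \<otimes>\<^bsub>Up 6\<^esub> w))" for A
  proof -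
    have "cls 6 (L A) \<in> {a \<in> carrier (Up 6). \<forall>k. \<exists>s\<in>generate (Up 6) S. UR 6 k a s}"
      using C[of A] gen unfolding Y.closure_utop[OF Y.generate_incl[OF S(2)] subset_refl] by simp
    then obtain z where "z \<in> generate (Up 6) S" "UR 6 k (cls 6 (L A)) z" by blast
    then show ?thesis using C.generate_mod_squares[OF S] by metis
  qed
  then obtain T w where T: "\<And>A. T A \<subseteq> S" and w: "\<And>A. w A \<in> carrier (Up 6)"
    and R: "\<And>A. UR 6 k (cls 6 (L A)) (finprod (Up 6) (\<lambda>x. x) (T A) \<otimes>\<^bsub>Up 6\<^esub> (w A \<otimes>\<^bsub>Up 6\<^esub> w A))"
    by metis
  have "A = B" if A: "A \<subseteq> set ind6" and B: "B \<subseteq> set ind6" and eq: "T A = T B" for A B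
  proof -
    define P where "P = finprod (Up 6) (\<lambda>x. x) (T A)"
    have P: "P \<in> carrier (Up 6)" unfolding P_def using T[of A] S(2) by (intro C.finprod_closed) auto
    define u where "u = P \<otimes>\<^bsub>Up 6\<^esub> w A \<otimes>\<^bsub>Up 6\<^esub> w B"
    have u: "u \<in> carrier (Up 6)" unfolding u_def by (intro Y.m_closed P w)
    define \<tau> where "\<tau> i = ind A i + ind B i" for i
    have sum: "L A + L B \<in> lcs 6" unfolding L_def by (rule subgrpD(2)[OF lcs_subgrp lin_lcs lin_lcs])
    have "D.eqv p k (Suc 6) (lin e6 \<tau> ind6) (L A + L B)"
      unfolding L_def \<tau>_def by (rule D.lin_add) (use e6_lcs lcs_D in auto)
    then have 1: "UR 6 k (cls 6 (lin e6 \<tau> ind6)) (cls 6 (L A + L B))"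
      unfolding UR_cls[OF lin_lcs sum] D.eqv_def .
    have "UR 6 k (cls 6 (L A) \<otimes>\<^bsub>Up 6\<^esub> cls 6 (L B)) ((P \<otimes>\<^bsub>Up 6\<^esub> (w A \<otimes>\<^bsub>Up 6\<^esub> w A)) \<otimes>\<^bsub>Up 6\<^esub> (P \<otimes>\<^bsub>Up 6\<^esub> (w B \<otimes>\<^bsub>Up 6\<^esub> w B)))"
      using R[of A] R[of B] unfolding eq[symmetric] P_def[symmetric] by (intro Y.R_mult C Y.m_closed P w)
    moreover have "(P \<otimes>\<^bsub>Up 6\<^esub> (w A \<otimes>\<^bsub>Up 6\<^esub> w A)) \<otimes>\<^bsub>Up 6\<^esub> (P \<otimes>\<^bsub>Up 6\<^esub> (w B \<otimes>\<^bsub>Up 6\<^esub> w B)) = u \<otimes>\<^bsub>Up 6\<^esub> u"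
      unfolding u_def using P w by (simp add: C.m_ac)
    moreover have "cls 6 (L A) \<otimes>\<^bsub>Up 6\<^esub> cls 6 (L B) = cls 6 (L A + L B)"
      unfolding L_def by (rule cls_add[OF lin_lcs lin_lcs, symmetric])
    ultimately have 2: "UR 6 k (cls 6 (L A + L B)) (u \<otimes>\<^bsub>Up 6\<^esub> u)" by simp
    obtain s where s: "s \<in> lcs 6" "UR 6 k u (cls 6 s)" using cls_dense[OF u] by blast
    have 3: "UR 6 k (u \<otimes>\<^bsub>Up 6\<^esub> u) (cls 6 (s + s))"
      unfolding cls_add[OF s(1) s(1)] by (intro Y.R_mult u cls_closed s)
    have "UR 6 k (cls 6 (lin e6 \<tau> ind6)) (cls 6 (s + s))" by (rule Y.R_trans[OF 1 Y.R_trans[OF 2 3]])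
    then have "lin e6 \<tau> ind6 - (s + s) \<in> lcsV p k 7"
      unfolding UR_cls[OF lin_lcs subgrpD(2)[OF lcs_subgrp s(1) s(1)]] by simp
    note even = k[OF s(1) this]
    have "i \<in> A \<longleftrightarrow> i \<in> B" if "i \<in> set ind6" for i
      using even[OF that] by (simp add: \<tau>_def ind_def split: if_splits)
    then show ?thesis using A B by blast
  qed
  then have "inj_on T (Pow (set ind6))" by (intro inj_onI) auto
  moreover have "T ` Pow (set ind6) \<subseteq> Pow S" using T by auto
  ultimately have "card (Pow (set ind6)) \<le> card (Pow S)" using S(1) by (intro card_inj_on_le) auto
  moreover have "card (set ind6) = 9" using distinct_card[OF distinct_ind6] length_ind6 by simp
  ultimately have "(2 :: nat) ^ 9 \<le> 2 ^ card S" using S(1) by (simp add: card_Pow)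
  then show "enat 9 \<le> enat (card S)" by (simp only: enat_ord_simps) (rule power_le_imp_le_exp[of 2], auto)
qed

end

subsection \<open>The ranks\<close>

lemma m_rank_even:
  assumes "2 * c = (K + 1) * (K + 2)"
  shows "m_rank (2 * K + 2) = c"
proof -
  have "(2 * K + 2) * (2 * K + 2 + 2) = 4 * ((K + 1) * (K + 2))" by (simp add: algebra_simps)
  also have "\<dots> = c * 8" unfolding assms[symmetric] by simp
  finally have "(2 * K + 2) * (2 * K + 2 + 2) div 8 = c" by simp
  then show ?thesis unfolding m_rank_def by simp
qed

lemma m_rank_odd:
  assumes "2 * c = (K + 1) * (K + 2)"
  shows "m_rank (2 * K + 3) = 2 * c"
proof -
  have "(2 * K + 3 - 1) * (2 * K + 3 + 1) = 4 * ((K + 1) * (K + 2))" by (simp add: algebra_simps)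
  also have "\<dots> = (2 * c) * 4" unfolding assms[symmetric] by simp
  finally have "(2 * K + 3 - 1) * (2 * K + 3 + 1) div 4 = 2 * c" by (metis nonzero_mult_div_cancel_right zero_neq_numeral)
  then show ?thesis unfolding m_rank_def by simp
qed

lemma moebius_1: "moebius 1 = 1"
  by (simp add: moebius_def)

lemma moebius_prime: "prime q \<Longrightarrow> moebius q = - 1"
  by (simp add: moebius_def squarefree_prime prime_factorization_prime)

lemma moebius_4: "moebius 4 = 0"
proof -
  have "\<not> squarefree (4 :: nat)"
  proof
    assume "squarefree (4 :: nat)"
    moreover have "(2 :: nat) ^ 2 dvd 4" by simp
    ultimately have "(2 :: nat) dvd 1" unfolding squarefree_def by blast
    then show False by simp
  qed
  then show ?thesis by (simp add: moebius_def)
qed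

lemma divisors: "0 < n \<Longrightarrow> {m :: nat. m dvd n} = set (filter (\<lambda>m. m dvd n) [1..<Suc n])"
  by (auto dest: dvd_imp_le intro!: Nat.gr0I)

lemma divisors_upto_6: "{m :: nat. m dvd 1} = {1}" "{m :: nat. m dvd 2} = {1, 2}" "{m :: nat. m dvd 3} = {1, 3}"
  "{m :: nat. m dvd 4} = {1, 2, 4}" "{m :: nat. m dvd 5} = {1, 5}" "{m :: nat. m dvd 6} = {1, 2, 3, 6}"
  by (subst divisors; code_simp)+

lemma moebius_6: "moebius 6 = 1"
proof -
  have "prime_factors (6 :: nat) = {q. prime q \<and> q \<in> {m. m dvd 6}}" by (simp add: prime_factors_dvd)
  also have "\<dots> = {2, 3}" unfolding divisors_upto_6 by auto
  finally have f: "prime_factors (6 :: nat) = {2, 3}" .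
  have "x = 1" if "x ^ 2 dvd 6" for x :: nat
  proof -
    have "x ^ 2 \<in> {1, 2, 3, 6}" using that divisors_upto_6(6) by blast
    moreover have "x < 3" using that dvd_imp_le[of "x ^ 2" 6] by (intro power_less_imp_less_base[of x 2 3]) auto
    then have "x = 0 \<or> x = 1 \<or> x = 2" by auto
    ultimately show ?thesis by auto
  qed
  then have "squarefree (6 :: nat)" unfolding squarefree_def by simp
  then show ?thesis by (simp add: moebius_def f)
qed

lemma l2_upto_6: "l2 1 = 2" "l2 2 = 1" "l2 3 = 2" "l2 4 = 3" "l2 5 = 6" "l2 6 = 9"
  unfolding l2_def divisors_upto_6
  using moebius_1 moebius_prime[of 2] moebius_prime[of 3] moebius_prime[of 5] moebius_4 moebius_6 by simp_all

theorem proposition4p2: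
  fixes p :: nat
  assumes "prime p"
  shows
    "(\<forall>n \<in> {1..5}.
        top_group_iso (Upsilon (G_hat p) (G_hat_top p) n) (Upsilon_top (G_hat p) (G_hat_top p) n)
          (padic_power p (l2 n)) (padic_power_top p (l2 n))) \<and>
     (p \<noteq> 2 \<longrightarrow>
        top_group_iso (Upsilon (G_hat p) (G_hat_top p) 6) (Upsilon_top (G_hat p) (G_hat_top p) 6)
          (padic_power p 6) (padic_power_top p 6) \<and>
        (\<forall>n \<ge> 2.
          top_group_iso (Upsilon (G_hat p) (G_hat_top p) n) (Upsilon_top (G_hat p) (G_hat_top p) n)
            (padic_power p (m_rank n)) (padic_power_top p (m_rank n)))) \<and>
     (p = 2 \<longrightarrow>
        comm_group (Upsilon (G_hat p) (G_hat_top p) 6) \<and>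
        pro_p_group 2 (Upsilon (G_hat p) (G_hat_top p) 6) (Upsilon_top (G_hat p) (G_hat_top p) 6) \<and>
        l2 6 = 9 \<and>
        min_generators (Upsilon (G_hat p) (G_hat_top p) 6) (Upsilon_top (G_hat p) (G_hat_top p) 6)
          \<ge> enat (l2 6))"
proof -
  interpret prime_base p using assms by unfold_locales
  let ?iso = "\<lambda>n d. top_group_iso (Up n) (Upsilon_top (G_hat p) (G_hat_top p) n) (padic_power p d) (padic_power_top p d)"
  have even: "?iso (2 * K + 2) (m_rank (2 * K + 2))" if "odd p \<or> K \<le> 1" for K
  proof (rule graded_iso[OF graded_basis_even[OF assms that]])
    show "length (triple_list K) = m_rank (2 * K + 2)"
      by (simp only: m_rank_even[OF card_triples] triple_list(3))
  qed simp
  have odd: "?iso (2 * K + 3) (m_rank (2 * K + 3))" if "odd p \<or> K \<le> 1" for K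
  proof (rule graded_iso[OF graded_basis_odd[OF assms that]])
    show "length (List.product [gen_x, gen_y] (triple_list K)) = m_rank (2 * K + 3)"
      unfolding m_rank_odd[OF card_triples] by (simp add: triple_list(3))
  qed simp
  \<comment> \<open>Without oddness the bases are available for \<open>K \<le> 1\<close>, that is,
    in weights 2 to 5.\<close>
  have rank: "?iso n (m_rank n)" if n: "2 \<le> n" and "odd p \<or> n \<le> 5" for n
  proof (cases "even n")
    case True
    then have "n = 2 * (n div 2 - 1) + 2" using n by auto
    moreover have "odd p \<or> n div 2 - 1 \<le> 1" using that(2) by auto
    ultimately show ?thesis using even[of "n div 2 - 1"] by metis
  next
    case False
    then have "n = 2 * (n div 2 - 1) + 3" using n by (auto elim!: oddE)
    moreover have "odd p \<or> n div 2 - 1 \<le> 1" using that(2) by auto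
    ultimately show ?thesis using odd[of "n div 2 - 1"] by metis
  qed
  have one: "?iso 1 (l2 1)"
    unfolding l2_upto_6(1) by (rule graded_iso[OF graded_basis_1[OF assms]]) simp_all
  \<comment> \<open>The two rank formulas coincide from 2 to 5 and separate at 6, where
    \<open>l2\<close> is 9; weight 1 has to be treated on its own, as \<open>m_rank 1\<close> is
    0.\<close>
  have m: "m_rank 2 = l2 2" "m_rank 3 = l2 3" "m_rank 4 = l2 4" "m_rank 5 = l2 5" "m_rank 6 = 6"
    unfolding l2_upto_6 by (simp_all add: m_rank_def)
  have "?iso n (l2 n)" if "n \<in> {1..5}" for n
  proof -
    have "n = 1 \<or> n = 2 \<or> n = 3 \<or> n = 4 \<or> n = 5" using that by auto
    then show ?thesis using one rank[of 2] rank[of 3] rank[of 4] rank[of 5] m by auto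
  qed
  moreover have "?iso 6 6 \<and> (\<forall>n\<ge>2. ?iso n (m_rank n))" if "p \<noteq> 2"
  proof -
    have "odd p" using assms that prime_odd_nat[of p] prime_ge_2_nat[of p] by auto
    then show ?thesis using rank rank[of 6] m(5) by simp
  qed
  moreover have "comm_group (Up 6) \<and> pro_p_group 2 (Up 6) (Upsilon_top (G_hat p) (G_hat_top p) 6) \<and> l2 6 = 9 \<and>
      enat (l2 6) \<le> min_generators (Up 6) (Upsilon_top (G_hat p) (G_hat_top p) 6)" if "p = 2"
    using comm_group_Up pro_p_Up[of 6] min_generators_6[OF that] l2_upto_6(6) that by simp
  ultimately show ?thesis by blast
qed

end
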